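(* Let $\Omega\subset\mathbb{R}^2$ be a smooth bounded simply connected domain, let $p_1,\dots,p_n\in\Omega$ and $\alpha_1,\dots,\alpha_n>0$, and let $h(x)=\exp\left(-4\pi\sum_{j=1}^n\alpha_j G_{p_j}(x)\right)$. Assume $(\Omega,\mathbf{a})$, $\mathbf{a}=\sum_j\alpha_j p_j$, is a domain of first kind. For $\lambda<8\pi$ let $\psi_\lambda$ be the unique solution of $$-\Delta\psi_\lambda=\frac{h e^{\lambda\psi_\lambda}}{\int_\Omega h e^{\lambda\psi_\lambda}\,dx}\ \text{in }\Omega,\qquad \psi_\lambda=0\ \text{on }\partial\Omega,$$ and let $E(\lambda)=\frac12\int_\Omega|\nabla\psi_\lambda|^2\,dx$. Then the function $E\colon(-\infty,8\pi)\to(0,+\infty)$ is strictly increasing and bijective. In particular $\lim_{\lambda\to-\infty}E(\lambda)=0$ and $\lim_{\lambda\to 8\pi^-}E(\lambda)=+\infty$.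
   Context: For $p\in\Omega$, $G_p$ denotes the Dirichlet Green function of $\Omega$: $-\Delta G_p=\delta_p$ in $\Omega$, $G_p=0$ on $\partial\Omega$. Thus $h>0$ away from the $p_j$ and $h(x)\approx|x-p_j|^{2\alpha_j}$ near $p_j$. For $\lambda\in\mathbb{R}$, the mean field problem $(MP_\lambda)$ is: $-\Delta\psi=\frac{he^{\lambda\psi}}{\int_\Omega he^{\lambda\psi}dx}$ in $\Omega$, $\psi=0$ on $\partial\Omega$. For $\lambda<8\pi$ and $\Omega$ simply connected, $(MP_\lambda)$ has exactly one solution (a known fact used to define $\psi_\lambda$). The pair $(\Omega,\mathbf{a})$ is called a domain of first kind if $(MP_{8\pi})$ has no solution, and of second kind otherwise. *)

theory Defs
  imports "HOL-Analysis.Analysis"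
begin

type_synonym pt = "real ^ 2"

definition pderiv :: "2 \<Rightarrow> (pt \<Rightarrow> real) \<Rightarrow> pt \<Rightarrow> real" where
  "pderiv i f x = deriv (\<lambda>s. f (x + s *\<^sub>R axis i 1)) 0"

fun Ck :: "nat \<Rightarrow> pt set \<Rightarrow> (pt \<Rightarrow> real) \<Rightarrow> bool" where
  "Ck 0 S f = continuous_on S f"
| "Ck (Suc k) S f = (continuous_on S f \<and>
     (\<forall>i. (\<forall>x\<in>S. (\<lambda>s. f (x + s *\<^sub>R axis i 1)) differentiable (at 0))
          \<and> Ck k S (pderiv i f)))"

definition smooth_on :: "pt set \<Rightarrow> (pt \<Rightarrow> real) \<Rightarrow> bool" where
  "smooth_on S f \<longleftrightarrow> (\<forall>k. Ck k S f)"

definition laplacian :: "(pt \<Rightarrow> real) \<Rightarrow> pt \<Rightarrow> real" where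
  "laplacian f x = (\<Sum>i\<in>UNIV. pderiv i (pderiv i f) x)"

definition grad_sq :: "(pt \<Rightarrow> real) \<Rightarrow> pt \<Rightarrow> real" where
  "grad_sq f x = (\<Sum>i\<in>UNIV. (pderiv i f x)\<^sup>2)"

definition smooth_boundary :: "pt set \<Rightarrow> bool" where
  "smooth_boundary \<Omega> \<longleftrightarrow> (\<forall>z\<in>frontier \<Omega>. \<exists>r>0. \<exists>\<phi>.
      smooth_on (ball z r) \<phi> \<and> (\<forall>x\<in>ball z r. grad_sq \<phi> x \<noteq> 0) \<and>
      \<Omega> \<inter> ball z r = {x\<in>ball z r. \<phi> x < 0})"

definition smooth_bounded_sc_domain :: "pt set \<Rightarrow> bool" where
  "smooth_bounded_sc_domain \<Omega> \<longleftrightarrow> open \<Omega> \<and> connected \<Omega> \<and> \<Omega> \<noteq> {} \<and> bounded \<Omega> \<and>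
     simply_connected \<Omega> \<and> smooth_boundary \<Omega>"

definition harmonic_on :: "pt set \<Rightarrow> (pt \<Rightarrow> real) \<Rightarrow> bool" where
  "harmonic_on S H \<longleftrightarrow> Ck 2 S H \<and> (\<forall>x\<in>S. laplacian H x = 0)"

text \<open>Dirichlet Green function with pole p: -Delta G = delta_p in Omega, G = 0 on the boundary,
  i.e. G = -(1/(2 pi)) log|x-p| + H with H harmonic in Omega, continuous up to the boundary.\<close>
definition green_fun :: "pt set \<Rightarrow> pt \<Rightarrow> (pt \<Rightarrow> real) \<Rightarrow> bool" where
  "green_fun \<Omega> p G \<longleftrightarrow> (\<exists>H. harmonic_on \<Omega> H \<and> continuous_on (closure \<Omega>) H \<and>
      (\<forall>x\<in>closure \<Omega> - {p}. G x = - (1 / (2 * pi)) * ln (norm (x - p)) + H x) \<and>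
      (\<forall>x\<in>frontier \<Omega>. G x = 0))"

text \<open>h(x) = exp(-4 pi sum_j alpha_j G_{p_j}(x)), extended by its limit 0 at the points p_j.\<close>
definition weight :: "(pt \<Rightarrow> pt \<Rightarrow> real) \<Rightarrow> nat \<Rightarrow> (nat \<Rightarrow> pt) \<Rightarrow> (nat \<Rightarrow> real) \<Rightarrow> pt \<Rightarrow> real" where
  "weight G n p \<alpha> x = (if x \<in> p ` {..<n} then 0
      else exp (- 4 * pi * (\<Sum>j<n. \<alpha> j * G (p j) x)))"

definition mean_field_sol :: "pt set \<Rightarrow> (pt \<Rightarrow> real) \<Rightarrow> real \<Rightarrow> (pt \<Rightarrow> real) \<Rightarrow> bool" where
  "mean_field_sol \<Omega> h lam \<psi> \<longleftrightarrow>
     Ck 2 \<Omega> \<psi> \<and> continuous_on (closure \<Omega>) \<psi> \<and> (\<forall>x\<in>frontier \<Omega>. \<psi> x = 0) \<and>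
     (\<lambda>x. h x * exp (lam * \<psi> x)) integrable_on \<Omega> \<and>
     (\<forall>x\<in>\<Omega>. - laplacian \<psi> x =
        h x * exp (lam * \<psi> x) / integral \<Omega> (\<lambda>y. h y * exp (lam * \<psi> y)))"

end

theory Submission
  imports "HOL-Complex_Analysis.Great_Picard" Defs
begin

text \<open>
  Write \<open>G \<rho>\<close> for the Green potential of a density \<open>\<rho>\<close>. Solutions of the mean field equation are the
  densities \<open>\<rho> = h e\<^sup>v\<close> of mass one that are critical for the free energy
  \<open>F\<^sub>\<lambda>(\<rho>) = \<integral> \<rho> ln (\<rho>/h) - (\<lambda>/2) \<integral> \<rho> G \<rho>\<close>, whose last integral is \<open>2 E\<close>. If the solution \<open>\<rho>\<^sub>\<lambda>\<close> minimises \<open>F\<^sub>\<lambda>\<close>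
  for each \<open>\<lambda>\<close>, adding the strict inequalities \<open>F\<^sub>\<lambda>(\<rho>\<^sub>\<lambda>) < F\<^sub>\<lambda>(\<rho>\<^sub>\<mu>)\<close> and \<open>F\<^sub>\<mu>(\<rho>\<^sub>\<mu>) < F\<^sub>\<mu>(\<rho>\<^sub>\<lambda>)\<close> yields
  \<open>(\<lambda> - \<mu>)(E(\<lambda>) - E(\<mu>)) > 0\<close>.

  For \<open>\<lambda> \<le> 0\<close> minimality holds by convexity. For \<open>0 < \<lambda> < 8\<pi>\<close> the map sending \<open>\<rho>\<close> to the normalisation of
  \<open>h exp(\<lambda> G \<rho>)\<close> lowers \<open>F\<^sub>\<lambda>\<close> by at least a relative entropy, and \<open>F\<^sub>\<lambda>\<close> is coercive: since \<open>\<bar>x - y\<bar>\<^sup>-\<^sup>\<theta>\<close> is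
  locally integrable in the plane for \<open>\<theta> < 2\<close>, Young's inequality bounds \<open>2\<pi>\<theta> sup (G \<rho>)\<close> by the entropy
  of \<open>\<rho>\<close>. So the iterates of any density accumulate at a solution, which is \<open>\<rho>\<^sub>\<lambda>\<close> by uniqueness.

  The same estimate turns a bound on the energy into compactness of solutions. This gives continuity of
  \<open>E\<close>, and divergence at \<open>8\<pi>\<close>, because a bounded energy would produce a solution there. As \<open>\<lambda> \<rightarrow> -\<infinity>\<close>,
  the set where \<open>\<psi>\<^sub>\<lambda>\<close> is small has measure bounded below, which bounds the partition function from
  below by \<open>c exp(-\<epsilon>\<bar>\<lambda>\<bar>)\<close> and forces \<open>E(\<lambda>) \<rightarrow> 0\<close>.
\<close>


subsection \<open>Partial derivatives\<close>

text \<open>The bound \<open>8 \<pi>\<close> comes from the logarithmic kernel. For every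
  \<open>\<theta> < 2\<close> the entropy plus a constant bounds
  \<open>2 \<pi> \<theta> sup (G \<rho>)\<close>, and twice the energy of a density of mass one is
  at most \<open>sup (G \<rho>)\<close>. So the entropy absorbs the quadratic term once
  \<open>\<lambda> / (4 \<pi> \<theta>) < 1\<close>. The weight vanishes at p_j only like |x - p_j|
  to the power 2 \<alpha>_j, so it may be no better than Hoelder continuous, and C2 regularity of
  potentials must be proved for Hoelder densities. Solutions are C2 inside and continuous up to the
  boundary, without control of the gradient there. Integrations by parts therefore use functions of
  the solution that vanish near the boundary, and a limit removes the cut-off. The same device gives
  the symmetry of the energy form, since symmetry of the Green function is not part of its
  definition. Densities are encoded by \<open>v = ln (\<rho> / h)\<close>, so the zeros of h do not
  disturb entropies. Strictness of the inequalities holds because a solution is positive inside and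
  zero on the boundary, so it cannot solve the equation for two parameters.\<close>

definition has_pd :: "2 \<Rightarrow> (pt \<Rightarrow> real) \<Rightarrow> pt \<Rightarrow> real \<Rightarrow> bool" where
  "has_pd i f x d \<longleftrightarrow> ((\<lambda>s. f (x + s *\<^sub>R axis i 1)) has_real_derivative d) (at 0)"

abbreviation pd :: "2 \<Rightarrow> (pt \<Rightarrow> real) \<Rightarrow> pt \<Rightarrow> real" where
  "pd \<equiv> Defs.pderiv"

lemma has_pd_imp_pderiv: "has_pd i f x d \<Longrightarrow> pd i f x = d"
  unfolding has_pd_def Defs.pderiv_def by (rule DERIV_imp_deriv)

lemma differentiable_iff_has_pd:
  "(\<lambda>s. f (x + s *\<^sub>R axis i 1)) differentiable (at 0) \<longleftrightarrow> has_pd i f x (pd i f x)"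
  unfolding has_pd_def Defs.pderiv_def using DERIV_deriv_iff_real_differentiable by blast

text \<open>Moves the base point along the line: mean value arguments use the derivative at every
  parameter, while \<open>pderiv\<close> looks only at 0.\<close>

lemma has_pd_line:
  assumes "has_pd i f (x + t *\<^sub>R axis i 1) d"
  shows "((\<lambda>s. f (x + s *\<^sub>R axis i 1)) has_real_derivative d) (at t)"
proof -
  have "((\<lambda>s. f (x + (s + t) *\<^sub>R axis i 1)) has_real_derivative d) (at 0)"
    using assms unfolding has_pd_def by (simp add: algebra_simps)
  then show ?thesis
    using DERIV_shift[of "\<lambda>s. f (x + s *\<^sub>R axis i 1)" d 0 t] by simp
qed

lemma has_pd_add: "has_pd i f x a \<Longrightarrow> has_pd i g x b \<Longrightarrow> has_pd i (\<lambda>x. f x + g x) x (a + b)"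
  unfolding has_pd_def by (rule DERIV_add)

lemma has_pd_diff: "has_pd i f x a \<Longrightarrow> has_pd i g x b \<Longrightarrow> has_pd i (\<lambda>x. f x - g x) x (a - b)"
  unfolding has_pd_def by (rule DERIV_diff)

lemma has_pd_cmult: "has_pd i f x a \<Longrightarrow> has_pd i (\<lambda>x. c * f x) x (c * a)"
  unfolding has_pd_def by (rule DERIV_cmult)

lemma has_pd_const: "has_pd i (\<lambda>x. c) x 0"
  unfolding has_pd_def by simp

lemma has_pd_mult:
  "has_pd i f x a \<Longrightarrow> has_pd i g x b \<Longrightarrow> has_pd i (\<lambda>x. f x * g x) x (a * g x + f x * b)"
  unfolding has_pd_def by (drule (1) DERIV_mult) (simp add: mult.commute)

lemma has_pd_chain:
  assumes "(g has_real_derivative c) (at (f x))" "has_pd i f x a"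
  shows "has_pd i (\<lambda>x. g (f x)) x (c * a)"
  using assms unfolding has_pd_def
  by (intro DERIV_chain2[where f=g and g="\<lambda>s. f (x + s *\<^sub>R axis i 1)"]) simp_all

lemma has_pd_cong_open:
  assumes "has_pd i f x a" "open S" "x \<in> S" "\<And>y. y \<in> S \<Longrightarrow> f y = g y"
  shows "has_pd i g x a"
proof -
  let ?l = "\<lambda>s::real. x + s *\<^sub>R axis i 1"
  have "open (?l -` S)"
    by (rule open_vimage[OF \<open>open S\<close>]) (intro continuous_intros)
  then show ?thesis unfolding has_pd_def
    by (rule has_field_derivative_transform_within_open[OF assms(1)[unfolded has_pd_def]])
      (use assms in simp_all)
qed

lemma pd_cong_open:
  assumes "open S" "x \<in> S" "\<And>y. y \<in> S \<Longrightarrow> f y = g y"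
  shows "pd i f x = pd i g x"
proof -
  let ?l = "\<lambda>s::real. x + s *\<^sub>R axis i 1"
  have "open (?l -` S)"
    by (rule open_vimage[OF \<open>open S\<close>]) (intro continuous_intros)
  then have "eventually (\<lambda>s. s \<in> ?l -` S) (nhds 0)"
    using assms(2) by (intro eventually_nhds_in_open) auto
  then have "eventually (\<lambda>s. f (?l s) = g (?l s)) (nhds 0)"
    by eventually_elim (use assms(3) in auto)
  then show ?thesis unfolding Defs.pderiv_def by (intro deriv_cong_ev) auto
qed

lemma has_pd_translate: "has_pd i f (x - q) d \<Longrightarrow> has_pd i (\<lambda>x. f (x - q)) x d"
  unfolding has_pd_def by (simp add: algebra_simps)

lemma has_pd_reflect:
  assumes "has_pd i f (x - q) d" shows "has_pd i (\<lambda>q. f (x - q)) q (- d)"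
proof -
  have "((\<lambda>s. f ((x - q) + s *\<^sub>R axis i 1)) has_real_derivative d) (at (- 0))"
    using assms unfolding has_pd_def by simp
  from DERIV_mirror[THEN iffD1, OF this]
  show ?thesis unfolding has_pd_def by (simp add: algebra_simps)
qed

lemma has_pd_component: "has_pd i (\<lambda>x. x $ j) x (if i = j then 1 else 0)"
  unfolding has_pd_def by (auto simp: axis_def intro!: derivative_eq_intros)

lemma has_pd_norm_sq: "has_pd i (\<lambda>z::pt. (norm z)\<^sup>2) z (2 * z $ i)"
proof -
  have eq: "(\<lambda>s. (norm (z + s *\<^sub>R axis i 1))\<^sup>2) = (\<lambda>s. (norm z)\<^sup>2 + 2 * s * z $ i + s\<^sup>2)"
  proof
    fix s :: real
    have "(norm (z + s *\<^sub>R axis i 1))\<^sup>2 = z \<bullet> z + 2 * (s * (z \<bullet> axis i 1)) + s * (s * (axis i 1 \<bullet> (axis i 1 :: pt)))"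
      unfolding power2_norm_eq_inner by (simp add: inner_add_left inner_add_right inner_commute algebra_simps)
    then show "(norm (z + s *\<^sub>R axis i 1))\<^sup>2 = (norm z)\<^sup>2 + 2 * s * z $ i + s\<^sup>2"
      by (simp add: inner_axis inner_axis_axis dot_square_norm power2_eq_square[of s])
  qed
  show ?thesis unfolding has_pd_def eq by (auto intro!: derivative_eq_intros)
qed

text \<open>A partial derivative at a point sees the function only near that point, so agreement on
  an open set survives every order of differentiation.\<close>

lemma Ck_cong_open:
  assumes "open S"
  shows "(\<And>y. y \<in> S \<Longrightarrow> f y = g y) \<Longrightarrow> Ck k S f \<Longrightarrow> Ck k S g"
proof (induction k arbitrary: f g)
  case 0
  then show ?case using continuous_on_cong[of S S f g] by simp
next
  case (Suc k)
  have "continuous_on S g" using Suc.prems continuous_on_cong[of S S f g] by simp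
  moreover have "(\<lambda>s. g (x + s *\<^sub>R axis i 1)) differentiable (at 0)" if "x \<in> S" for x i
  proof -
    have "has_pd i f x (pd i f x)" using Suc.prems(2) that by (simp add: differentiable_iff_has_pd)
    from has_pd_cong_open[OF this assms that Suc.prems(1)] show ?thesis
      by (simp add: differentiable_iff_has_pd has_pd_imp_pderiv)
  qed
  moreover have "Ck k S (pd i g)" for i
    using Suc.IH[of "pd i f" "pd i g"] pd_cong_open[OF assms _ Suc.prems(1)] Suc.prems(2) by auto
  ultimately show ?case by simp
qed

lemma Ck2_iff: "Ck 2 S f \<longleftrightarrow> continuous_on S f \<and> (\<forall>i. (\<forall>x\<in>S. has_pd i f x (pd i f x)) \<and> continuous_on S (pd i f)
    \<and> (\<forall>j. (\<forall>x\<in>S. has_pd j (pd i f) x (pd j (pd i f) x)) \<and> continuous_on S (pd j (pd i f))))"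
  by (simp add: numeral_2_eq_2 differentiable_iff_has_pd)

lemma Ck2D:
  assumes "Ck 2 S f"
  shows "continuous_on S f" "x \<in> S \<Longrightarrow> has_pd i f x (pd i f x)" "continuous_on S (pd i f)"
    "x \<in> S \<Longrightarrow> has_pd j (pd i f) x (pd j (pd i f) x)" "continuous_on S (pd j (pd i f))"
  using assms unfolding Ck2_iff by auto

text \<open>Explicit candidates are easier to verify than \<open>pderiv\<close> itself. The second
  order needs a transfer: \<open>f1 i\<close> and \<open>pderiv i f\<close> agree on the open set
  \<open>S\<close>, hence so do their derivatives.\<close>

lemma Ck2I:
  assumes "open S" "continuous_on S f"
    and 1: "\<And>i x. x \<in> S \<Longrightarrow> has_pd i f x (f1 i x)" "\<And>i. continuous_on S (f1 i)"
    and 2: "\<And>i j x. x \<in> S \<Longrightarrow> has_pd j (f1 i) x (f2 i j x)" "\<And>i j. continuous_on S (f2 i j)"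
  shows "Ck 2 S f" "x \<in> S \<Longrightarrow> pd i f x = f1 i x" "x \<in> S \<Longrightarrow> pd j (pd i f) x = f2 i j x"
    "x \<in> S \<Longrightarrow> laplacian f x = (\<Sum>i\<in>UNIV. f2 i i x)"
proof -
  have e1: "pd i f x = f1 i x" if "x \<in> S" for i x
    using has_pd_imp_pderiv[OF 1(1)[OF that]] .
  have h2: "has_pd j (pd i f) x (f2 i j x)" if "x \<in> S" for i j x
    by (rule has_pd_cong_open[OF 2(1)[OF that] \<open>open S\<close> that]) (simp add: e1)
  have e2: "pd j (pd i f) x = f2 i j x" if "x \<in> S" for i j x
    using has_pd_imp_pderiv[OF h2[OF that]] .
  have "continuous_on S (pd i f)" for i
    using 1(2)[of i] continuous_on_cong[of S S "pd i f" "f1 i"] e1 by simp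
  moreover have "continuous_on S (pd j (pd i f))" for i j
    using 2(2)[of i j] continuous_on_cong[of S S "pd j (pd i f)" "f2 i j"] e2 by simp
  moreover have "has_pd i f x (pd i f x)" if "x \<in> S" for i x using 1(1) e1 that by simp
  moreover have "has_pd j (pd i f) x (pd j (pd i f) x)" if "x \<in> S" for i j x using h2 e2 that by simp
  ultimately show "Ck 2 S f" unfolding Ck2_iff using assms(2) by blast
  show "x \<in> S \<Longrightarrow> pd i f x = f1 i x" "x \<in> S \<Longrightarrow> pd j (pd i f) x = f2 i j x"
    "x \<in> S \<Longrightarrow> laplacian f x = (\<Sum>i\<in>UNIV. f2 i i x)"
    by (auto simp: e1 e2 laplacian_def)
qed

text \<open>Every clause of \<open>Ck 2\<close> is pointwise or is continuity on an open set, hence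
  local. C2 regularity proved on small balls is assembled this way.\<close>

lemma Ck2_local:
  assumes "open S" and loc: "\<And>x. x \<in> S \<Longrightarrow> \<exists>U. open U \<and> x \<in> U \<and> Ck 2 U f"
  shows "Ck 2 S f"
proof -
  have c: "continuous_on S g" if cg: "\<And>U. Ck 2 U f \<Longrightarrow> continuous_on U g" for g :: "pt \<Rightarrow> real"
  proof -
    have "isCont g x" if x: "x \<in> S" for x
    proof -
      obtain U where "open U" "x \<in> U" "Ck 2 U f" using loc[OF x] by blast
      then show ?thesis using cg[of U] by (simp add: continuous_on_eq_continuous_at)
    qed
    then show ?thesis by (simp add: continuous_at_imp_continuous_on)
  qed
  show ?thesis unfolding Ck2_iff
  proof (intro conjI allI ballI)
    show "has_pd i f x (pd i f x)" "has_pd j (pd i f) x (pd j (pd i f) x)" if "x \<in> S" for i j x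
      using loc[OF that] Ck2D(2,4) by blast+
  qed (rule c, erule Ck2D)+
qed

lemma Ck2_lin:
  assumes "open S" "Ck 2 S f" "Ck 2 S g"
  shows "Ck 2 S (\<lambda>x. a * f x + b * g x)"
    "x \<in> S \<Longrightarrow> pd i (\<lambda>x. a * f x + b * g x) x = a * pd i f x + b * pd i g x"
    "x \<in> S \<Longrightarrow> laplacian (\<lambda>x. a * f x + b * g x) x = a * laplacian f x + b * laplacian g x"
proof -
  note I = Ck2I[OF assms(1), of "\<lambda>x. a * f x + b * g x" "\<lambda>i x. a * pd i f x + b * pd i g x"
      "\<lambda>i j x. a * pd j (pd i f) x + b * pd j (pd i g) x"]
  show "Ck 2 S (\<lambda>x. a * f x + b * g x)"
    by (rule I) (intro continuous_intros has_pd_add has_pd_cmult Ck2D[OF assms(2)] Ck2D[OF assms(3)]; simp)+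
  show "x \<in> S \<Longrightarrow> pd i (\<lambda>x. a * f x + b * g x) x = a * pd i f x + b * pd i g x"
    by (rule I(2)) (intro continuous_intros has_pd_add has_pd_cmult Ck2D[OF assms(2)] Ck2D[OF assms(3)]; simp)+
  assume x: "x \<in> S"
  have "laplacian (\<lambda>x. a * f x + b * g x) x = (\<Sum>i\<in>UNIV. a * pd i (pd i f) x + b * pd i (pd i g) x)"
    by (rule I(4)) ((intro continuous_intros has_pd_add has_pd_cmult Ck2D[OF assms(2)] Ck2D[OF assms(3)] x; assumption)+)
  then show "laplacian (\<lambda>x. a * f x + b * g x) x = a * laplacian f x + b * laplacian g x"
    by (simp add: laplacian_def sum.distrib sum_distrib_left)
qed

subsection \<open>Differentiation under the integral sign and integration by parts\<close>

text \<open>Dominated convergence of the difference quotients along an arbitrary null sequence; the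
  mean value theorem turns the bound on \<open>f'\<close> into the same bound on the quotients.
  Integrability of \<open>f' 0\<close> is a by-product, because it is a pointwise limit of
  measurable quotients.\<close>

lemma DERIV_integral:
  fixes f f' :: "real \<Rightarrow> 'a \<Rightarrow> real"
  assumes "0 < \<delta>" and int: "\<And>t. \<bar>t\<bar> < \<delta> \<Longrightarrow> integrable M (f t)"
    and der: "\<And>t q. \<bar>t\<bar> < \<delta> \<Longrightarrow> q \<in> space M \<Longrightarrow> ((\<lambda>t. f t q) has_real_derivative f' t q) (at t)"
    and bd: "\<And>t q. \<bar>t\<bar> < \<delta> \<Longrightarrow> q \<in> space M \<Longrightarrow> \<bar>f' t q\<bar> \<le> g q" and g: "integrable M g"
  shows "((\<lambda>t. \<integral>q. f t q \<partial>M) has_real_derivative (\<integral>q. f' 0 q \<partial>M)) (at 0)" "integrable M (f' 0)"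
proof -
  have quot: "(\<lambda>n. ((\<integral>q. f (X n) q \<partial>M) - (\<integral>q. f 0 q \<partial>M)) / X n) \<longlonglongrightarrow> (\<integral>q. f' 0 q \<partial>M)
      \<and> integrable M (f' 0)"
    if X: "\<And>n. X n \<noteq> 0" "X \<longlonglongrightarrow> 0" for X :: "nat \<Rightarrow> real"
  proof -
    obtain N where N: "\<And>n. n \<ge> N \<Longrightarrow> \<bar>X n\<bar> < \<delta>"
      using LIMSEQ_D[OF X(2) \<open>0 < \<delta>\<close>] by auto
    define s where "s n q = (f (X (n + N)) q - f 0 q) / X (n + N)" for n q
    have i0: "integrable M (f 0)" using int \<open>0 < \<delta>\<close> by simp
    have iX: "integrable M (f (X (n + N)))" for n using int N by simp
    have lim: "(\<lambda>n. s n q) \<longlonglongrightarrow> f' 0 q" if "q \<in> space M" for q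
    proof -
      have "((\<lambda>h. (f (0 + h) q - f 0 q) / h) \<longlongrightarrow> f' 0 q) (at 0)"
        using der[of 0 q] \<open>0 < \<delta>\<close> that unfolding DERIV_def by simp
      moreover have "filterlim (\<lambda>n. X (n + N)) (at 0) sequentially"
        using X by (intro filterlim_atI LIMSEQ_ignore_initial_segment) auto
      ultimately show ?thesis unfolding s_def by (auto dest: filterlim_compose)
    qed
    have sb: "\<bar>s n q\<bar> \<le> g q" if q: "q \<in> space M" for n q
    proof -
      have "\<exists>z. \<bar>z\<bar> < \<delta> \<and> f (X (n + N)) q - f 0 q = X (n + N) * f' z q"
      proof (cases "X (n + N) > 0")
        case True
        then obtain z where "0 < z" "z < X (n + N)" "f (X (n + N)) q - f 0 q = (X (n + N) - 0) * f' z q"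
          using MVT2[of 0 "X (n + N)" "\<lambda>t. f t q" "\<lambda>t. f' t q"] der q N[of "n + N"] by fastforce
        then show ?thesis using N[of "n + N"] by (intro exI[of _ z]) auto
      next
        case False
        then have neg: "X (n + N) < 0" using X(1)[of "n + N"] by linarith
        then obtain z where "X (n + N) < z" "z < 0" "f 0 q - f (X (n + N)) q = (0 - X (n + N)) * f' z q"
          using MVT2[of "X (n + N)" 0 "\<lambda>t. f t q" "\<lambda>t. f' t q"] der q N[of "n + N"] by fastforce
        then show ?thesis using N[of "n + N"] by (intro exI[of _ z]) (auto simp: algebra_simps)
      qed
      then obtain z where z: "\<bar>z\<bar> < \<delta>" "f (X (n + N)) q - f 0 q = X (n + N) * f' z q" by blast
      then have "s n q = f' z q" unfolding s_def using X(1) by simp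
      then show ?thesis using bd z(1) q by simp
    qed
    have ms: "s n \<in> borel_measurable M" for n
      unfolding s_def using i0 iX by (intro borel_measurable_divide borel_measurable_diff) auto
    have mf: "f' 0 \<in> borel_measurable M"
      by (rule borel_measurable_LIMSEQ_real[OF lim ms])
    have "(\<lambda>n. \<integral>q. s n q \<partial>M) \<longlonglongrightarrow> (\<integral>q. f' 0 q \<partial>M)"
      by (rule integral_dominated_convergence[OF mf ms g AE_I2 AE_I2]) (use lim sb in auto)
    moreover have "(\<integral>q. s n q \<partial>M) = ((\<integral>q. f (X (n + N)) q \<partial>M) - (\<integral>q. f 0 q \<partial>M)) / X (n + N)" for n
      unfolding s_def using i0 iX by simp
    ultimately have "(\<lambda>n. ((\<integral>q. f (X (n + N)) q \<partial>M) - (\<integral>q. f 0 q \<partial>M)) / X (n + N)) \<longlonglongrightarrow> (\<integral>q. f' 0 q \<partial>M)"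
      by simp
    then have "(\<lambda>n. ((\<integral>q. f (X n) q \<partial>M) - (\<integral>q. f 0 q \<partial>M)) / X n) \<longlonglongrightarrow> (\<integral>q. f' 0 q \<partial>M)"
      by (rule LIMSEQ_offset)
    moreover have "integrable M (f' 0)"
      by (rule Bochner_Integration.integrable_bound[OF g mf]) (use bd[of 0] \<open>0 < \<delta>\<close> in \<open>auto intro!: AE_I2 order_trans[OF _ abs_ge_self]\<close>)
    ultimately show ?thesis by blast
  qed
  have "((\<lambda>h. ((\<integral>q. f (0 + h) q \<partial>M) - (\<integral>q. f 0 q \<partial>M)) / h) \<longlongrightarrow> (\<integral>q. f' 0 q \<partial>M)) (at 0)"
    unfolding tendsto_at_iff_sequentially o_def using quot by auto
  then show "((\<lambda>t. \<integral>q. f t q \<partial>M) has_real_derivative (\<integral>q. f' 0 q \<partial>M)) (at 0)"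
    unfolding DERIV_def .
  have "(\<lambda>n. inverse (real (Suc n))) \<longlonglongrightarrow> 0" by (rule LIMSEQ_inverse_real_of_nat)
  from quot[OF _ this] show "integrable M (f' 0)" by simp
qed

lemma integral_lborel_shift:
  fixes f :: "pt \<Rightarrow> real"
  assumes "f \<in> borel_measurable borel"
  shows "(\<integral>x. f (x + c) \<partial>lborel) = (\<integral>x. f x \<partial>lborel)"
proof -
  have "(\<integral>x. f x \<partial>lborel) = (\<integral>x. f x \<partial>(distr lborel borel ((+) c)))"
    by (simp add: lborel_distr_plus)
  also have "\<dots> = (\<integral>x. f (c + x) \<partial>lborel)"
    using assms by (subst integral_distr) auto
  finally show ?thesis by (simp add: add.commute)
qed

lemma integrable_lborel_shift:
  fixes f :: "pt \<Rightarrow> real"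
  assumes "integrable lborel f"
  shows "integrable lborel (\<lambda>x. f (x + c))"
proof -
  have "integrable (distr lborel borel ((+) c)) f" using assms by (simp add: lborel_distr_plus)
  then show ?thesis by (subst (asm) integrable_distr_eq) (use assms in \<open>auto simp: add.commute\<close>)
qed

lemma integrable_compact_support:
  fixes F :: "pt \<Rightarrow> real"
  assumes "continuous_on UNIV F" "\<And>x. norm x > R \<Longrightarrow> F x = 0"
  shows "integrable lborel F"
proof -
  have "integrable lborel (\<lambda>x. indicator (cball 0 R) x *\<^sub>R F x)"
    by (rule borel_integrable_compact) (auto intro: continuous_on_subset[OF assms(1)])
  moreover have "(\<lambda>x. indicator (cball 0 R) x *\<^sub>R F x) = F"
    using assms(2) by (intro ext) (force simp: indicator_def)
  ultimately show ?thesis by simp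
qed

text \<open>By translation invariance the integral of F(x + t e) does not depend on t, and its
  derivative at t = 0 is the integral of \<open>F'\<close>.\<close>

lemma integral_pd_zero_lborel:
  assumes F: "continuous_on UNIV F" and F': "continuous_on UNIV F'"
    and der: "\<And>x. has_pd i F x (F' x)"
    and supp: "\<And>x. norm x > R \<Longrightarrow> F x = 0" "\<And>x. norm x > R \<Longrightarrow> F' x = 0"
  shows "(\<integral>x. F' x \<partial>lborel) = 0"
proof -
  let ?e = "axis i 1 :: pt"
  have "compact (F' ` cball 0 R)" by (intro compact_continuous_image continuous_on_subset[OF F']) auto
  then obtain B0 where B0: "\<And>x. x \<in> cball 0 R \<Longrightarrow> \<bar>F' x\<bar> \<le> B0"
    using compact_imp_bounded[of "F' ` cball 0 R"] unfolding bounded_iff by force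
  define B where "B = max B0 0"
  have B: "\<bar>F' x\<bar> \<le> B" for x using B0[of x] supp(2)[of x] unfolding B_def by fastforce
  have iF: "integrable lborel F" by (rule integrable_compact_support[OF F supp(1)])
  have "((\<lambda>t. \<integral>x. F (x + t *\<^sub>R ?e) \<partial>lborel) has_real_derivative (\<integral>x. F' (x + 0 *\<^sub>R ?e) \<partial>lborel)) (at 0)"
  \<comment> \<open>A translate by less than 1 of a function supported in radius \<open>R\<close> is
    supported in radius \<open>R + 1\<close>, which supplies the integrable majorant.\<close>
  proof (rule DERIV_integral(1)[where \<delta>=1 and g="\<lambda>x. B * indicator (cball 0 (R + 1)) x"])
    show "integrable lborel (\<lambda>x. F (x + t *\<^sub>R ?e))" for t
      by (rule integrable_lborel_shift[OF iF])
    show "((\<lambda>t. F (q + t *\<^sub>R ?e)) has_real_derivative F' (q + t *\<^sub>R ?e)) (at t)" for t q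
      by (rule has_pd_line[OF der])
    show "\<bar>F' (q + t *\<^sub>R ?e)\<bar> \<le> B * indicator (cball 0 (R + 1)) q" if "\<bar>t\<bar> < 1" for t q
    proof (cases "norm q \<le> R + 1")
      case False
      have "norm (t *\<^sub>R ?e) \<le> 1" using that by (simp add: norm_axis_1)
      then have "norm (q + t *\<^sub>R ?e) > R" using False norm_diff_ineq[of q "t *\<^sub>R ?e"] by linarith
      then show ?thesis using supp(2) False by simp
    qed (use B in auto)
    have "emeasure lborel (cball (0::pt) (R + 1)) < \<infinity>"
      by (rule emeasure_bounded_finite) simp
    then show "integrable lborel (\<lambda>x. B * indicator (cball (0::pt) (R + 1)) x)"
      by (intro integrable_mult_right integrable_real_indicator) auto
  qed simp
  moreover have "(\<integral>x. F (x + t *\<^sub>R ?e) \<partial>lborel) = (\<integral>x. F x \<partial>lborel)" for t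
    by (rule integral_lborel_shift) (use F borel_measurable_continuous_onI in auto)
  ultimately have "((\<lambda>t::real. \<integral>x. F x \<partial>lborel) has_real_derivative (\<integral>x. F' x \<partial>lborel)) (at 0)" by simp
  then show ?thesis using DERIV_const DERIV_unique by blast
qed

abbreviation leb :: "pt set \<Rightarrow> pt measure" where "leb \<Omega> \<equiv> restrict_space lborel \<Omega>"

lemma borel_measurable_leb: "continuous_on \<Omega> f \<Longrightarrow> f \<in> borel_measurable (leb \<Omega>)"
  using borel_measurable_continuous_on_restrict measurable_cong_sets
  by (metis (no_types) sets_lborel sets_restrict_space_cong)

text \<open>Extension by zero reduces the claim to the whole plane: \<open>\<Omega>\<close> and the
  complement of \<open>C\<close> are open, cover the plane, and the two definitions agree on the
  overlap.\<close>

lemma integral_pd_zero: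
  assumes "open \<Omega>" "compact C" "C \<subseteq> \<Omega>" and F: "continuous_on \<Omega> F" and F': "continuous_on \<Omega> F'"
    and der: "\<And>x. x \<in> \<Omega> \<Longrightarrow> has_pd i F x (F' x)"
    and supp: "\<And>x. x \<in> \<Omega> - C \<Longrightarrow> F x = 0"
  shows "integrable (leb \<Omega>) F'" "(\<integral>x. F' x \<partial>leb \<Omega>) = 0"
proof -
  have oC: "open (- C)" using compact_imp_closed[OF assms(2)] by (simp add: open_Compl)
  \<comment> \<open>On the open set \<open>\<Omega> - C\<close> the function is constant, so its
    derivative vanishes there as well.\<close>
  have supp': "F' x = 0" if "x \<in> \<Omega> - C" for x
  proof -
    have "has_pd i F x 0"
      by (rule has_pd_cong_open[OF has_pd_const[of _ 0], of "\<Omega> \<inter> - C"]) (use assms(1) oC that supp in auto)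
    then show ?thesis using has_pd_imp_pderiv[OF der[of x]] that by (simp add: has_pd_imp_pderiv)
  qed
  define G where "G x = (if x \<in> \<Omega> then F x else 0)" for x
  define G' where "G' x = (if x \<in> \<Omega> then F' x else 0)" for x
  obtain R where R: "\<And>x. x \<in> C \<Longrightarrow> norm x \<le> R"
    using compact_imp_bounded[OF assms(2)] unfolding bounded_iff by blast
  have cont: "continuous_on UNIV (\<lambda>x. if x \<in> \<Omega> then f x else 0)"
    if "continuous_on \<Omega> f" "\<And>x. x \<in> \<Omega> - C \<Longrightarrow> f x = 0" for f :: "pt \<Rightarrow> real"
  proof -
    have "continuous_on \<Omega> (\<lambda>x. if x \<in> \<Omega> then f x else 0)"
      using that(1) by (rule continuous_on_cong[THEN iffD1, OF refl, rotated]) simp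
    moreover have "continuous_on (- C) (\<lambda>x. if x \<in> \<Omega> then f x else 0)"
      using continuous_on_const[of "- C" "0::real"]
      by (rule continuous_on_cong[THEN iffD1, OF refl, rotated]) (use that(2) in auto)
    ultimately have "continuous_on (\<Omega> \<union> - C) (\<lambda>x. if x \<in> \<Omega> then f x else 0)"
      by (rule continuous_on_open_Un[OF assms(1) oC])
    moreover have "\<Omega> \<union> - C = UNIV" using assms(3) by blast
    ultimately show ?thesis by simp
  qed
  have dG: "has_pd i G x (G' x)" for x
  proof (cases "x \<in> \<Omega>")
    case True
    then show ?thesis unfolding G'_def
      using has_pd_cong_open[OF der[OF True] assms(1) True, of G] by (simp add: G_def)
  next
    case False
    have "has_pd i G x 0"
      by (rule has_pd_cong_open[OF has_pd_const oC]) (use False assms(3) supp in \<open>auto simp: G_def\<close>)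
    then show ?thesis unfolding G'_def using False by simp
  qed
  have cG: "continuous_on UNIV G" "continuous_on UNIV G'"
    unfolding G_def G'_def by (intro cont F F' supp supp'; assumption)+
  have z: "G x = 0" "G' x = 0" if "norm x > R" for x
    using that R[of x] supp[of x] supp'[of x] unfolding G_def G'_def by (auto split: if_splits)
  have G'eq: "(\<lambda>x. indicator \<Omega> x *\<^sub>R F' x) = G'" unfolding G'_def by (auto simp: indicator_def)
  have meas: "\<Omega> \<inter> space lborel \<in> sets lborel" using assms(1) by simp
  show "integrable (leb \<Omega>) F'"
    unfolding integrable_restrict_space[OF meas] G'eq by (rule integrable_compact_support[OF cG(2) z(2)])
  show "(\<integral>x. F' x \<partial>leb \<Omega>) = 0"
    unfolding integral_restrict_space[OF meas] G'eq by (rule integral_pd_zero_lborel[OF cG dG z])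
qed

subsection \<open>Riesz kernels\<close>

text \<open>Dyadic shells: for \<open>R (Suc k) \<le> norm z < R k\<close> the integrand is at most
  \<open>c k\<close>, and the shell lies in a disc of area \<open>pi * (R k)\<^sup>2\<close>. The
  sum is geometric with ratio \<open>p\<close>, which is below 1 exactly because
  \<open>\<theta> < 2\<close>.\<close>

lemma nn_integral_norm_powr_ball:
  assumes "0 \<le> \<theta>" "\<theta> < 2"
  shows "\<exists>C\<ge>0. \<forall>r>0. (\<integral>\<^sup>+z. ennreal (norm (z::pt) powr - \<theta>) * indicator (ball 0 r) z \<partial>lborel)
           \<le> ennreal (C * r powr (2 - \<theta>))"
proof -
  define p where "p = 2 powr (\<theta> - 2)"
  have p: "0 < p" "p < 1" using assms unfolding p_def by (auto simp: powr_less_one)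
  define C where "C = pi * 2 powr \<theta> * (1 / (1 - p))"
  have "(\<integral>\<^sup>+z. ennreal (norm (z::pt) powr - \<theta>) * indicator (ball 0 r) z \<partial>lborel) \<le> ennreal (C * r powr (2 - \<theta>))"
    if "r > 0" for r :: real
  proof -
    define R where "R k = r * (1/2) ^ k" for k :: nat
    have R0: "R k > 0" for k using that unfolding R_def by simp
    have Rlim: "R \<longlonglongrightarrow> 0"
      unfolding R_def by (rule tendsto_mult_right_zero) (rule LIMSEQ_realpow_zero, auto)
    define c where "c k = R (Suc k) powr - \<theta>" for k
    have c0: "c k \<ge> 0" for k unfolding c_def by simp
    have ptw: "ennreal (norm z powr - \<theta>) * indicator (ball 0 r) z
        \<le> (\<Sum>k. ennreal (c k) * indicator (ball 0 (R k)) z)" for z :: pt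
    proof (cases "z \<noteq> 0 \<and> norm z < r")
      case True
      \<comment> \<open>The index of the shell that contains \<open>z\<close>; its single term
        already dominates the integrand.\<close>
      define k where "k = (LEAST k. R (Suc k) \<le> norm z)"
      have "\<exists>k. R (Suc k) \<le> norm z"
      proof -
        have "eventually (\<lambda>k. R k < norm z) sequentially"
          using Rlim True by (intro order_tendstoD(2)) auto
        then obtain N where "\<And>k. k \<ge> N \<Longrightarrow> R k < norm z" unfolding eventually_sequentially by blast
        then show ?thesis by (intro exI[of _ N]) (simp add: less_imp_le)
      qed
      then have k1: "R (Suc k) \<le> norm z" unfolding k_def by (rule LeastI_ex)
      have k2: "norm z < R k"
      proof (cases k)
        case 0
        then show ?thesis using True by (simp add: R_def)
      next
        case (Suc m)
        then show ?thesis using not_less_Least[of m "\<lambda>k. R (Suc k) \<le> norm z"] unfolding k_def by fastforce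
      qed
      have "norm z powr - \<theta> \<le> c k"
        unfolding c_def using k1 R0 assms by (intro powr_mono2') auto
      then have "ennreal (norm z powr - \<theta>) * indicator (ball 0 r) z \<le> ennreal (c k) * indicator (ball 0 (R k)) z"
        using k2 True by (auto intro: ennreal_leI)
      also have "\<dots> = (\<Sum>j\<in>{k}. ennreal (c j) * indicator (ball 0 (R j)) z)"
        by (subst sum.insert) (simp_all del: sum_mult_indicator)
      also have "\<dots> \<le> (\<Sum>j. ennreal (c j) * indicator (ball 0 (R j)) z)"
        by (rule sum_le_suminf) auto
      finally show ?thesis .
    qed auto
    have trm: "c k * (pi * (R k)\<^sup>2) = (pi * 2 powr \<theta> * r powr (2 - \<theta>)) * p ^ k" for k
    proof -
      have "c k = 2 powr \<theta> * (R k) powr - \<theta>"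
      proof -
        have "R (Suc k) = R k / 2" by (simp add: R_def)
        then have "c k = (R k / 2) powr - \<theta>" unfolding c_def by (rule arg_cong)
        also have "\<dots> = R k powr - \<theta> / 2 powr - \<theta>" by (rule powr_divide)
        also have "\<dots> = 2 powr \<theta> * R k powr - \<theta>"
          unfolding powr_minus[of 2 \<theta>] by (simp only: divide_inverse inverse_inverse_eq mult.commute)
        finally show ?thesis .
      qed
      moreover have "(R k)\<^sup>2 = R k powr 2" using R0[of k] by simp
      moreover have "R k powr (2 - \<theta>) = R k powr 2 * R k powr - \<theta>" unfolding powr_add[symmetric] by simp
      ultimately have "c k * (pi * (R k)\<^sup>2) = pi * 2 powr \<theta> * R k powr (2 - \<theta>)"
        by (simp only: mult_ac)
      also have "R k powr (2 - \<theta>) = r powr (2 - \<theta>) * p ^ k"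
      proof -
        have "((1/2)^k) powr (2 - \<theta>) = ((1/2) powr (2 - \<theta>)) ^ k"
          by (simp add: powr_powr powr_realpow[symmetric] mult.commute)
        also have "(1/2::real) powr (2 - \<theta>) = p" unfolding p_def
          by (simp add: powr_divide powr_diff)
        finally show ?thesis unfolding R_def using that by (simp add: powr_mult)
      qed
      finally show ?thesis by simp
    qed
    have "(\<integral>\<^sup>+z. ennreal (norm (z::pt) powr - \<theta>) * indicator (ball 0 r) z \<partial>lborel)
        \<le> (\<integral>\<^sup>+z. (\<Sum>k. ennreal (c k) * indicator (ball 0 (R k)) (z::pt)) \<partial>lborel)"
      by (intro nn_integral_mono ptw)
    also have "\<dots> = (\<Sum>k. \<integral>\<^sup>+z. ennreal (c k) * indicator (ball 0 (R k)) (z::pt) \<partial>lborel)"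
      by (rule nn_integral_suminf) (intro borel_measurable_times_ennreal borel_measurable_indicator, auto)
    also have "\<dots> = (\<Sum>k. ennreal (c k * (pi * (R k)\<^sup>2)))"
    proof (rule suminf_cong)
      fix k
      show "(\<integral>\<^sup>+z. ennreal (c k) * indicator (ball 0 (R k)) (z::pt) \<partial>lborel) = ennreal (c k * (pi * (R k)\<^sup>2))"
        using R0[of k] c0[of k] by (simp add: nn_integral_cmult_indicator emeasure_ball unit_ball_vol_2 ennreal_mult)
    qed
    also have "\<dots> = ennreal (\<Sum>k. (pi * 2 powr \<theta> * r powr (2 - \<theta>)) * p ^ k)"
      unfolding trm using p by (intro suminf_ennreal2 summable_mult summable_geometric) auto
    also have "(\<Sum>k. (pi * 2 powr \<theta> * r powr (2 - \<theta>)) * p ^ k) = C * r powr (2 - \<theta>)"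
      using p by (subst suminf_mult) (auto simp: suminf_geometric C_def intro: summable_geometric)
    finally show ?thesis .
  qed
  moreover have "C \<ge> 0" unfolding C_def using p by simp
  ultimately show ?thesis by blast
qed

text \<open>The constant is chosen before the set, the pole and the radius. This uniformity is what
  later makes estimates on potentials independent of the point.\<close>

lemma riesz_potential_bound:
  assumes "0 \<le> \<theta>" "\<theta> < 2"
  shows "\<exists>C\<ge>0. \<forall>A x r. A \<in> sets borel \<longrightarrow> 0 < r \<longrightarrow> A \<subseteq> ball x r \<longrightarrow>
     integrable (leb A) (\<lambda>q. norm (x - q) powr - \<theta>) \<and> (\<integral>q. norm (x - q) powr - \<theta> \<partial>leb A) \<le> C * r powr (2 - \<theta>)"
proof -
  obtain C where C: "C \<ge> 0" "\<And>r. r > 0 \<Longrightarrow> (\<integral>\<^sup>+z. ennreal (norm (z::pt) powr - \<theta>) * indicator (ball 0 r) z \<partial>lborel)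
           \<le> ennreal (C * r powr (2 - \<theta>))" using nn_integral_norm_powr_ball[OF assms] by blast
  have "integrable (leb A) (\<lambda>q. norm (x - q) powr - \<theta>) \<and> (\<integral>q. norm (x - q) powr - \<theta> \<partial>leb A) \<le> C * r powr (2 - \<theta>)"
    if A: "A \<in> sets borel" and "0 < r" and sub: "A \<subseteq> ball x r" for A x r
  proof -
    have [measurable]: "A \<in> sets lborel" using A by simp
    have mA: "A \<inter> space lborel \<in> sets lborel" using A by simp
    have "(\<integral>\<^sup>+q. ennreal (norm (x - q) powr - \<theta>) \<partial>leb A)
        = (\<integral>\<^sup>+q. ennreal (norm (x - q) powr - \<theta>) * indicator A q \<partial>lborel)"
      by (rule nn_integral_restrict_space[OF mA])
    also have "\<dots> \<le> (\<integral>\<^sup>+q. ennreal (norm (x - q) powr - \<theta>) * indicator (ball x r) q \<partial>lborel)"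
      using sub by (intro nn_integral_mono) (auto simp: indicator_def)
    also have "\<dots> = (\<integral>\<^sup>+q. ennreal (norm (x - q) powr - \<theta>) * indicator (ball x r) q \<partial>distr lborel borel ((+) x))"
      by (simp add: lborel_distr_plus)
    also have "\<dots> = (\<integral>\<^sup>+z. ennreal (norm (z::pt) powr - \<theta>) * indicator (ball 0 r) z \<partial>lborel)"
      by (subst nn_integral_distr) (auto simp: indicator_def dist_norm intro!: nn_integral_cong)
    also have "\<dots> \<le> ennreal (C * r powr (2 - \<theta>))" using C(2) \<open>0 < r\<close> .
    finally have le: "(\<integral>\<^sup>+q. ennreal (norm (x - q) powr - \<theta>) \<partial>leb A) \<le> ennreal (C * r powr (2 - \<theta>))" .
    have m: "(\<lambda>q. norm (x - q) powr - \<theta>) \<in> borel_measurable (leb A)"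
      by (rule measurable_restrict_space1) measurable
    have int: "integrable (leb A) (\<lambda>q. norm (x - q) powr - \<theta>)"
      unfolding integrable_iff_bounded using m le by (auto simp: less_top[symmetric] top_unique)
    moreover have "ennreal (\<integral>q. norm (x - q) powr - \<theta> \<partial>leb A) = (\<integral>\<^sup>+q. ennreal (norm (x - q) powr - \<theta>) \<partial>leb A)"
      using int by (intro nn_integral_eq_integral[symmetric]) auto
    ultimately show ?thesis using le C(1) by (metis ennreal_le_iff mult_nonneg_nonneg powr_ge_zero)
  qed
  with C(1) show ?thesis by blast
qed

subsection \<open>Regularised logarithmic kernels\<close>

text \<open>Each branch alone is differentiable at \<open>a\<close>, so both one-sided difference
  quotients of the glued function converge, and to the same limit.\<close>

lemma DERIV_piecewise:
  fixes f g :: "real \<Rightarrow> real"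
  assumes "t \<ge> a \<Longrightarrow> (f has_real_derivative f' t) (at t)"
    and "t \<le> a \<Longrightarrow> (g has_real_derivative g' t) (at t)"
    and "f a = g a" "f' a = g' a"
  shows "((\<lambda>s. if s \<ge> a then f s else g s) has_real_derivative (if t \<ge> a then f' t else g' t)) (at t)"
proof -
  consider "t > a" | "t < a" | "t = a" by linarith
  then show ?thesis
  proof cases
    case 1
    then show ?thesis using assms(1)
      by (auto intro!: has_field_derivative_transform_within_open[where f=f and S="{a<..}"])
  next
    case 2
    then show ?thesis using assms(2)
      by (auto intro!: has_field_derivative_transform_within_open[where f=g and S="{..<a}"])
  next
    case 3
    let ?k = "\<lambda>s. if s \<ge> a then f s else g s"
    have "((\<lambda>y. (f y - f a) / (y - a)) \<longlongrightarrow> f' a) (at a)"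
      using assms(1) 3 by (simp add: has_field_derivative_iff)
    then have "((\<lambda>y. (?k y - ?k a) / (y - a)) \<longlongrightarrow> f' a) (at_right a)"
      by (intro Lim_transform_eventually[OF filterlim_mono[OF _ order_refl at_le[of "{a<..}" UNIV]]])
         (auto simp: eventually_at_filter)
    moreover have "((\<lambda>y. (g y - g a) / (y - a)) \<longlongrightarrow> f' a) (at a)"
      using assms(2,4) 3 by (simp add: has_field_derivative_iff)
    then have "((\<lambda>y. (?k y - ?k a) / (y - a)) \<longlongrightarrow> f' a) (at_left a)"
      by (intro Lim_transform_eventually[OF filterlim_mono[OF _ order_refl at_le[of "{..<a}" UNIV]]])
         (auto simp: eventually_at_filter assms(3))
    ultimately show ?thesis using 3 by (simp add: has_field_derivative_iff filterlim_split_at)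
  qed
qed

text \<open>The logarithm continued to the left of 1 by its Taylor polynomial of order 4 at 1; the order
  makes the regularised kernel below four times continuously differentiable.\<close>

definition rlog :: "real \<Rightarrow> real" where
  "rlog t = (if t \<ge> 1 then ln t else - ((1 - t) + (1 - t)^2 / 2 + (1 - t)^3 / 3 + (1 - t)^4 / 4))"
definition rlog1 :: "real \<Rightarrow> real" where
  "rlog1 t = (if t \<ge> 1 then 1 / t else 1 + (1 - t) + (1 - t)^2 + (1 - t)^3)"
definition rlog2 :: "real \<Rightarrow> real" where
  "rlog2 t = (if t \<ge> 1 then - 1 / t^2 else - (1 + 2 * (1 - t) + 3 * (1 - t)^2))"

lemma DERIV_rlog: "(rlog has_real_derivative rlog1 t) (at t)"
  unfolding rlog_def[abs_def] rlog1_def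
  by (rule DERIV_piecewise) (auto intro!: derivative_eq_intros simp: field_simps power2_eq_square power3_eq_cube)

lemma DERIV_rlog1: "(rlog1 has_real_derivative rlog2 t) (at t)"
  unfolding rlog1_def[abs_def] rlog2_def
  by (rule DERIV_piecewise) (auto intro!: derivative_eq_intros simp: field_simps power2_eq_square power3_eq_cube)

lemma continuous_rlog: "continuous_on UNIV rlog" "continuous_on UNIV rlog1" "continuous_on UNIV rlog2"
proof -
  show "continuous_on UNIV rlog" "continuous_on UNIV rlog1"
    using DERIV_rlog DERIV_rlog1 by (meson DERIV_continuous_on DERIV_isCont continuous_at_imp_continuous_on)+
  show "continuous_on UNIV rlog2" unfolding rlog2_def[abs_def]
  proof -
    have "continuous_on ({1..} \<union> {..1}) (\<lambda>t::real. if t \<ge> 1 then - 1 / t^2 else - (1 + 2 * (1 - t) + 3 * (1 - t)^2))"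
      by (rule continuous_on_cases) (auto intro!: continuous_intros)
    moreover have "{1..} \<union> {..1::real} = UNIV" by auto
    ultimately show "continuous_on UNIV (\<lambda>t::real. if t \<ge> 1 then - 1 / t^2 else - (1 + 2 * (1 - t) + 3 * (1 - t)^2))"
      by simp
  qed
qed

text \<open>The bounds on \<open>rlog1\<close> and \<open>rlog2\<close> have the homogeneity of the
  derivatives of \<open>ln\<close>, so that after rescaling the kernel bounds do not depend on
  \<open>r\<close>.\<close>

lemma rlog1_bound: assumes "t > 0" shows "\<bar>rlog1 t\<bar> \<le> 4 / t"
proof (cases "t \<ge> 1")
  case False
  have "(1 - t)^2 \<le> 1" "(1 - t)^3 \<le> 1" using False assms by (auto intro!: power_le_one)
  moreover have "(1 - t)^2 \<ge> 0" "(1 - t)^3 \<ge> 0" using False assms by auto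
  ultimately have "\<bar>rlog1 t\<bar> \<le> 4" using False assms unfolding rlog1_def by auto
  also have "4 \<le> 4 / t" using False assms by (simp add: field_simps)
  finally show ?thesis .
qed (auto simp: rlog1_def divide_simps)

lemma rlog2_bound: assumes "t > 0" shows "\<bar>rlog2 t\<bar> \<le> 6 / t^2"
proof (cases "t \<ge> 1")
  case False
  have "(1 - t)^2 \<le> 1" using False assms by (auto intro!: power_le_one)
  moreover have "(1 - t)^2 \<ge> 0" by simp
  ultimately have "\<bar>- (1 + 2 * (1 - t) + 3 * (1 - t)^2)\<bar> \<le> 6"
    using False assms by (smt (verit))
  then have "\<bar>rlog2 t\<bar> \<le> 6" using False unfolding rlog2_def by simp
  also have "6 \<le> 6 / t^2" using False assms power_le_one[of t 2] by (simp add: field_simps)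
  finally show ?thesis .
qed (auto simp: rlog2_def divide_simps)

lemma rlog_bounds: assumes "0 < t" "t < 1" shows "ln t \<le> rlog t" "rlog t \<le> 0"
proof -
  have "rlog 1 - ln 1 \<le> rlog t - ln t"
  proof (rule DERIV_nonpos_imp_nonincreasing[of t 1])
    fix x assume x: "t \<le> x" "x \<le> 1"
    have "rlog1 x - 1 / x \<le> 0"
    proof (cases "x = 1")
      case False
      \<comment> \<open>\<open>rlog1\<close> is a truncated geometric series for
        \<open>1 / x\<close>, so multiplication by \<open>x\<close> telescopes.\<close>
      then have "x * rlog1 x = 1 - (1 - x)^4" using x unfolding rlog1_def by simp algebra
      then have "x * rlog1 x \<le> 1" by simp
      then show ?thesis using x assms by (simp add: field_simps)
    qed (simp add: rlog1_def)
    moreover have "((\<lambda>x. rlog x - ln x) has_real_derivative rlog1 x - 1 / x) (at x)"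
      using x assms by (intro DERIV_diff DERIV_rlog) (auto intro!: derivative_eq_intros)
    ultimately show "\<exists>y. ((\<lambda>x. rlog x - ln x) has_real_derivative y) (at x) \<and> y \<le> 0" by blast
  qed (use assms in auto)
  then show "ln t \<le> rlog t" by (simp add: rlog_def)
  have "(1 - t)^2 \<ge> 0" "(1 - t)^3 \<ge> 0" "(1 - t)^4 \<ge> 0" using assms by auto
  then have "- ((1 - t) + (1 - t)^2 / 2 + (1 - t)^3 / 3 + (1 - t)^4 / 4) \<le> 0" using assms by linarith
  then show "rlog t \<le> 0" using assms unfolding rlog_def by simp
qed

text \<open>\<open>gk r\<close> is the kernel \<open>- ln \<bar>z\<bar> / (2 \<pi>)\<close> regularised inside the disc of radius \<open>r\<close>, and
  \<open>mollifier r = - \<Delta> (gk r)\<close>. The suffixes 1 and 2 mark first and second partial derivatives.\<close>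

definition gk :: "real \<Rightarrow> pt \<Rightarrow> real" where
  "gk r z = - (1 / (4 * pi)) * (ln (r\<^sup>2) + rlog ((norm z)\<^sup>2 / r\<^sup>2))"
definition gk1 :: "real \<Rightarrow> 2 \<Rightarrow> pt \<Rightarrow> real" where
  "gk1 r i z = - (1 / (4 * pi)) * (rlog1 ((norm z)\<^sup>2 / r\<^sup>2) * (2 / r\<^sup>2 * z $ i))"
definition gk2 :: "real \<Rightarrow> 2 \<Rightarrow> 2 \<Rightarrow> pt \<Rightarrow> real" where
  "gk2 r i j z = - (1 / (4 * pi)) * ((rlog2 ((norm z)\<^sup>2 / r\<^sup>2) * (2 / r\<^sup>2 * z $ j)) * (2 / r\<^sup>2 * z $ i)
     + rlog1 ((norm z)\<^sup>2 / r\<^sup>2) * (2 / r\<^sup>2 * (if j = i then 1 else 0)))"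
text \<open>This function arises as a quarter of \<open>t * rlog2 t + rlog1 t\<close>. Its cubic
  contact with 0 at \<open>t = 1\<close> makes it twice continuously differentiable.\<close>

definition bump :: "real \<Rightarrow> real" where
  "bump t = (if t \<ge> 1 then 0 else (1 - t) ^ 3)"
definition bump1 :: "real \<Rightarrow> real" where
  "bump1 t = (if t \<ge> 1 then 0 else - 3 * (1 - t)\<^sup>2)"
definition bump2 :: "real \<Rightarrow> real" where
  "bump2 t = (if t \<ge> 1 then 0 else 6 * (1 - t))"

lemma DERIV_bump: "(bump has_real_derivative bump1 t) (at t)"
  unfolding bump_def[abs_def] bump1_def
  by (rule DERIV_piecewise) (auto intro!: derivative_eq_intros simp: power2_eq_square)

lemma DERIV_bump1: "(bump1 has_real_derivative bump2 t) (at t)"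
  unfolding bump1_def[abs_def] bump2_def
  by (rule DERIV_piecewise) (auto intro!: derivative_eq_intros simp: power2_eq_square)

lemma continuous_bump: "continuous_on UNIV bump" "continuous_on UNIV bump1" "continuous_on UNIV bump2"
proof -
  show "continuous_on UNIV bump" "continuous_on UNIV bump1"
    using DERIV_bump DERIV_bump1 by (meson DERIV_isCont continuous_at_imp_continuous_on)+
  have "bump2 = (\<lambda>t. 6 * max 0 (1 - t))" by (auto simp: bump2_def max_def)
  moreover have "continuous_on UNIV (\<lambda>t::real. 6 * max 0 (1 - t))" by (intro continuous_intros)
  ultimately show "continuous_on UNIV bump2" by metis
qed

definition mollifier :: "real \<Rightarrow> pt \<Rightarrow> real" where
  "mollifier r z = 4 / (pi * r\<^sup>2) * bump ((norm z)\<^sup>2 / r\<^sup>2)"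
definition mollifier1 :: "real \<Rightarrow> 2 \<Rightarrow> pt \<Rightarrow> real" where
  "mollifier1 r i z = 4 / (pi * r\<^sup>2) * (bump1 ((norm z)\<^sup>2 / r\<^sup>2) * (2 / r\<^sup>2 * z $ i))"
definition mollifier2 :: "real \<Rightarrow> 2 \<Rightarrow> 2 \<Rightarrow> pt \<Rightarrow> real" where
  "mollifier2 r i j z = 4 / (pi * r\<^sup>2) * ((bump2 ((norm z)\<^sup>2 / r\<^sup>2) * (2 / r\<^sup>2 * z $ j)) * (2 / r\<^sup>2 * z $ i)
     + bump1 ((norm z)\<^sup>2 / r\<^sup>2) * (2 / r\<^sup>2 * (if j = i then 1 else 0)))"

text \<open>In the plane the Laplacian of f(|z|^2) is 4 (t f''(t) + f'(t)) at t = |z|^2. For the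
  logarithm this is zero, which is the case \<open>t \<ge> 1\<close>; below 1 only the cubic term of
  the truncated series survives.\<close>

lemma rlog_laplace: "t * rlog2 t + rlog1 t = 4 * bump t" 
proof (cases "t \<ge> 1")
  case True
  then show ?thesis by (simp add: rlog1_def rlog2_def bump_def power2_eq_square)
next
  case False
  then show ?thesis by (simp add: rlog1_def rlog2_def bump_def) algebra
qed

lemma has_pd_scaled_norm_sq: "has_pd i (\<lambda>z::pt. (norm z)\<^sup>2 / r\<^sup>2) z (2 / r\<^sup>2 * z $ i)"
  using has_pd_cmult[OF has_pd_norm_sq[of i z], of "1 / r\<^sup>2"] by simp

lemma has_pd_gk: "has_pd i (gk r) z (gk1 r i z)"
proof -
  have "has_pd i (\<lambda>z. - (1 / (4 * pi)) * (ln (r\<^sup>2) + rlog ((norm z)\<^sup>2 / r\<^sup>2))) z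
     (- (1 / (4 * pi)) * (0 + rlog1 ((norm z)\<^sup>2 / r\<^sup>2) * (2 / r\<^sup>2 * z $ i)))"
    by (intro has_pd_cmult has_pd_add has_pd_const has_pd_chain[OF DERIV_rlog] has_pd_scaled_norm_sq)
  then show ?thesis by (simp add: gk_def[abs_def] gk1_def)
qed

lemma has_pd_gk1: "has_pd j (gk1 r i) z (gk2 r i j z)"
  unfolding gk1_def[abs_def] gk2_def
  by (intro has_pd_cmult has_pd_mult has_pd_chain[OF DERIV_rlog1] has_pd_scaled_norm_sq has_pd_component)

lemma continuous_gk: "continuous_on S (gk r)" "continuous_on S (gk1 r i)" "continuous_on S (gk2 r i j)"
  unfolding gk_def[abs_def] gk1_def[abs_def] gk2_def[abs_def] divide_inverse
  by (intro continuous_intros continuous_on_compose2[OF continuous_rlog(1)] continuous_on_compose2[OF continuous_rlog(2)]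
      continuous_on_compose2[OF continuous_rlog(3)] subset_UNIV)+

lemma norm_sq_pt: "(norm (z::pt))\<^sup>2 = (\<Sum>i\<in>UNIV. (z $ i)\<^sup>2)"
  unfolding power2_norm_eq_inner inner_vec_def by (simp add: power2_eq_square)

lemma sum_gk2: assumes "r > 0" shows "(\<Sum>i\<in>UNIV. gk2 r i i z) = - mollifier r z"
proof -
  let ?t = "(norm z)\<^sup>2 / r\<^sup>2"
  have "(\<Sum>i\<in>UNIV. gk2 r i i z) = - (1 / (4 * pi)) * (\<Sum>i\<in>UNIV. rlog2 ?t * (4 / r^4) * (z $ i)\<^sup>2 + rlog1 ?t * (2 / r\<^sup>2))"
    unfolding gk2_def by (simp add: sum_distrib_left power2_eq_square power4_eq_xxxx algebra_simps)
  also have "\<dots> = - (1 / (4 * pi)) * (rlog2 ?t * (4 / r^4) * (norm z)\<^sup>2 + 2 * (rlog1 ?t * (2 / r\<^sup>2)))"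
    by (simp add: sum.distrib norm_sq_pt sum_distrib_left)
  also have "\<dots> = - (1 / (pi * r\<^sup>2)) * (?t * rlog2 ?t + rlog1 ?t)"
    using assms by (simp add: field_simps power2_eq_square power4_eq_xxxx)
  also have "\<dots> = - mollifier r z" unfolding rlog_laplace mollifier_def by simp
  finally show ?thesis .
qed

lemma gk_far: assumes "0 < r" "r \<le> norm z" shows "gk r z = - (1 / (2 * pi)) * ln (norm z)"
proof -
  have "(norm z)\<^sup>2 / r\<^sup>2 \<ge> 1" using assms by (simp add: power_mono)
  moreover have "norm z > 0" using assms by linarith
  ultimately have "rlog ((norm z)\<^sup>2 / r\<^sup>2) = 2 * ln (norm z) - 2 * ln r"
    using assms by (simp add: rlog_def ln_div ln_realpow)
  then show ?thesis using assms by (simp add: gk_def ln_realpow)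
qed

lemma gk1_far: assumes "0 < r" "r \<le> norm z" shows "gk1 r i z = - (1 / (2 * pi)) * (z $ i / (norm z)\<^sup>2)"
proof -
  have "(norm z)\<^sup>2 / r\<^sup>2 \<ge> 1" using assms by (simp add: power_mono)
  then show ?thesis using assms by (simp add: gk1_def rlog1_def)
qed

lemma gk2_far: assumes "0 < r" "r \<le> norm z"
  shows "gk2 r i j z = - (1 / (4 * pi)) * (- 4 * z $ j * z $ i / (norm z) ^ 4 + 2 * (if j = i then 1 else 0) / (norm z)\<^sup>2)"
proof -
  have "(norm z)\<^sup>2 / r\<^sup>2 \<ge> 1" using assms by (simp add: power_mono)
  moreover have "norm z > 0" using assms by linarith
  ultimately show ?thesis using assms by (simp add: gk2_def rlog1_def rlog2_def power2_eq_square power4_eq_xxxx)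
qed

text \<open>Bounds free of \<open>r\<close> with the singularity of the unregularised kernel. The
  power -1 is integrable in the plane, whereas the power -2 met at second order is not; that is the
  difficulty of the C2 theory below.\<close>

lemma gk1_bound: assumes "0 < r" "z \<noteq> 0" shows "\<bar>gk1 r i z\<bar> \<le> norm z powr - 1"
proof -
  let ?t = "(norm z)\<^sup>2 / r\<^sup>2"
  have "\<bar>gk1 r i z\<bar> = 1 / (4 * pi) * (\<bar>rlog1 ?t\<bar> * (2 / r\<^sup>2 * \<bar>z $ i\<bar>))"
    unfolding gk1_def by (simp add: abs_mult)
  also have "\<dots> \<le> 1 / (4 * pi) * (4 / ?t * (2 / r\<^sup>2 * norm z))"
    using assms by (intro mult_left_mono mult_mono rlog1_bound component_le_norm_cart) auto
  also have "\<dots> = 2 / pi * (1 / norm z)" using assms by (simp add: field_simps power2_eq_square)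
  also have "\<dots> \<le> 1 * (1 / norm z)" using pi_gt3 by (intro mult_right_mono) auto
  finally show ?thesis by (simp add: powr_minus_divide)
qed

lemma gk2_bound: assumes "0 < r" "z \<noteq> 0" shows "\<bar>gk2 r i j z\<bar> \<le> 3 * norm z powr - 2"
proof -
  let ?t = "(norm z)\<^sup>2 / r\<^sup>2"
  have t: "?t > 0" using assms by simp
  have "\<bar>(rlog2 ?t * (2 / r\<^sup>2 * z $ j)) * (2 / r\<^sup>2 * z $ i)\<bar> = \<bar>rlog2 ?t\<bar> * (2 / r\<^sup>2 * \<bar>z $ j\<bar>) * (2 / r\<^sup>2 * \<bar>z $ i\<bar>)"
    by (simp add: abs_mult)
  also have "\<dots> \<le> (6 / ?t^2) * (2 / r\<^sup>2 * norm z) * (2 / r\<^sup>2 * norm z)"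
    using assms by (intro mult_left_mono mult_mono rlog2_bound t component_le_norm_cart) auto
  also have "\<dots> = 24 / (norm z)\<^sup>2" using assms by (simp add: field_simps power2_eq_square)
  finally have 1: "\<bar>(rlog2 ?t * (2 / r\<^sup>2 * z $ j)) * (2 / r\<^sup>2 * z $ i)\<bar> \<le> 24 / (norm z)\<^sup>2" .
  have "\<bar>rlog1 ?t * (2 / r\<^sup>2 * (if j = i then 1 else 0))\<bar> \<le> \<bar>rlog1 ?t\<bar> * (2 / r\<^sup>2)"
    by (auto simp: abs_mult)
  also have "\<dots> \<le> (4 / ?t) * (2 / r\<^sup>2)" using rlog1_bound[OF t] by (intro mult_right_mono) auto
  also have "\<dots> = 8 / (norm z)\<^sup>2" using assms by (simp add: field_simps power2_eq_square)
  finally have 2: "\<bar>rlog1 ?t * (2 / r\<^sup>2 * (if j = i then 1 else 0))\<bar> \<le> 8 / (norm z)\<^sup>2" .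
  have "\<bar>gk2 r i j z\<bar> \<le> 1 / (4 * pi) * (24 / (norm z)\<^sup>2 + 8 / (norm z)\<^sup>2)"
  proof -
    have "\<bar>(rlog2 ?t * (2 / r\<^sup>2 * z $ j)) * (2 / r\<^sup>2 * z $ i) + rlog1 ?t * (2 / r\<^sup>2 * (if j = i then 1 else 0))\<bar>
        \<le> 24 / (norm z)\<^sup>2 + 8 / (norm z)\<^sup>2"
      by (rule order_trans[OF abs_triangle_ineq add_mono[OF 1 2]])
    from mult_left_mono[OF this, of "1 / (4 * pi)"] show ?thesis
      unfolding gk2_def by (simp only: abs_mult[of "- (1 / (4 * pi))"] abs_minus_cancel) (simp del: mult_if_delta)
  qed
  also have "\<dots> = 8 / pi * (1 / (norm z)\<^sup>2)" by (simp add: field_simps)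
  also have "\<dots> \<le> 3 * (1 / (norm z)\<^sup>2)" using pi_gt3 by (intro mult_right_mono) (auto simp: field_simps)
  also have "1 / (norm z)\<^sup>2 = norm z powr - 2" using assms by (simp add: powr_minus_divide)
  finally show ?thesis .
qed

text \<open>Inside the disc \<open>rlog\<close> lies between \<open>ln\<close> and 0, and
  \<open>r \<le> 1\<close> prevents \<open>ln (r\<^sup>2)\<close> from being positive.\<close>

lemma gk_near: assumes "0 < r" "r \<le> 1" "z \<noteq> 0" "norm z < r"
  shows "0 \<le> gk r z" "gk r z \<le> - (1 / (2 * pi)) * ln (norm z)"
proof -
  let ?t = "(norm z)\<^sup>2 / r\<^sup>2"
  have t: "0 < ?t" "?t < 1" using assms by (auto simp: power_strict_mono)
  have "ln (r\<^sup>2) \<le> 0" using assms by (simp add: power_le_one)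
  then show "0 \<le> gk r z" unfolding gk_def using rlog_bounds(2)[OF t] by (simp add: divide_nonpos_pos)
  have "ln ?t = 2 * ln (norm z) - ln (r\<^sup>2)" using assms by (simp add: ln_div ln_realpow)
  then have "2 * ln (norm z) \<le> ln (r\<^sup>2) + rlog ?t" using rlog_bounds(1)[OF t] by linarith
  then have "(1 / (4 * pi)) * (2 * ln (norm z)) \<le> (1 / (4 * pi)) * (ln (r\<^sup>2) + rlog ?t)"
    by (intro mult_left_mono) auto
  then show "gk r z \<le> - (1 / (2 * pi)) * ln (norm z)" unfolding gk_def by simp
qed

lemma has_pd_mollifier: "has_pd i (mollifier r) z (mollifier1 r i z)" "has_pd j (mollifier1 r i) z (mollifier2 r i j z)"
  unfolding mollifier_def[abs_def] mollifier1_def[abs_def] mollifier2_def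
  by (intro has_pd_cmult has_pd_mult has_pd_chain[OF DERIV_bump] has_pd_chain[OF DERIV_bump1]
      has_pd_scaled_norm_sq has_pd_component)+

lemma continuous_mollifier:
  "continuous_on S (mollifier r)" "continuous_on S (mollifier1 r i)" "continuous_on S (mollifier2 r i j)"
  unfolding mollifier_def[abs_def] mollifier1_def[abs_def] mollifier2_def[abs_def] divide_inverse
  by (intro continuous_intros continuous_on_compose2[OF continuous_bump(1)] continuous_on_compose2[OF continuous_bump(2)]
      continuous_on_compose2[OF continuous_bump(3)] subset_UNIV)+

lemma mollifier_supp:
  assumes "0 < r" "r \<le> norm z"
  shows "mollifier r z = 0" "mollifier1 r i z = 0" "mollifier2 r i j z = 0"
proof -
  have "(norm z)\<^sup>2 / r\<^sup>2 \<ge> 1" using assms by (simp add: power_mono)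
  then show "mollifier r z = 0" "mollifier1 r i z = 0" "mollifier2 r i j z = 0"
    by (simp_all add: mollifier_def mollifier1_def mollifier2_def bump_def bump1_def bump2_def)
qed

lemma mollifier_nonneg: "mollifier r z \<ge> 0"
  unfolding mollifier_def bump_def by auto

text \<open>Layer cake: write \<open>u ^ 3\<close> as the integral of \<open>3 * s\<^sup>2\<close>
  over \<open>{0..u}\<close> and exchange the integrals. The set where \<open>u\<close> is at least
  \<open>s\<close> is a disc of area \<open>pi * r\<^sup>2 * (1 - s)\<close>, and the remaining
  integral of \<open>3 * s\<^sup>2 * (1 - s)\<close> over the unit interval is 1/4; hence the factor
  4 in \<open>mollifier\<close>.\<close>

lemma integral_mollifier:
  assumes "0 < r"
  shows "integrable lborel (mollifier r)" "(\<integral>z. mollifier r z \<partial>lborel) = 1"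
proof -
  define u where "u z = max 0 (1 - (norm z)\<^sup>2 / r\<^sup>2)" for z :: pt
  have u0: "0 \<le> u z" for z unfolding u_def by simp
  have [measurable]: "u \<in> borel_measurable borel" unfolding u_def by measurable
  have bu: "bump ((norm z)\<^sup>2 / r\<^sup>2) = u z ^ 3" for z unfolding u_def bump_def by (auto simp: max_def)
  have cube: "ennreal (u z ^ 3) = (\<integral>\<^sup>+s. ennreal (3 * s\<^sup>2) * indicator {0..u z} s \<partial>lborel)" for z
  proof -
    have "(\<integral>\<^sup>+s. ennreal (3 * s\<^sup>2) * indicator {0..u z} s \<partial>lborel) = ennreal (u z ^ 3 - 0 ^ 3)"
      by (rule nn_integral_FTC_Icc) (auto intro!: derivative_eq_intros u0 simp: power2_eq_square)
    then show ?thesis by simp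
  qed
  have meas: "(\<lambda>(z, s). ennreal (3 * s\<^sup>2) * indicator {0..u z} s) \<in> borel_measurable (lborel \<Otimes>\<^sub>M lborel)"
  proof -
    have "(\<lambda>(z, s). ennreal (3 * s\<^sup>2) * indicator {0..u z} s)
        = (\<lambda>x. ennreal (3 * (snd x)\<^sup>2) * indicator {x. 0 \<le> snd x \<and> snd x \<le> u (fst x)} x)"
      by (auto simp: indicator_def)
    moreover have "\<dots> \<in> borel_measurable (lborel \<Otimes>\<^sub>M lborel)" by measurable
    ultimately show ?thesis by simp
  qed
  \<comment> \<open>The level \<open>s = 0\<close>, whose superlevel set is the whole plane, is left
    out; it is a null set for the outer integral.\<close>
  have inner: "(\<integral>\<^sup>+z. ennreal (3 * s\<^sup>2) * indicator {0..u z} s \<partial>lborel)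
      = ennreal (pi * r\<^sup>2 * (3 * s\<^sup>2 * (1 - s))) * indicator {0..1} s" if "s \<noteq> 0" for s
  proof (cases "0 < s \<and> s \<le> 1")
    case True
    have set: "{z. s \<le> u z} = cball 0 (r * sqrt (1 - s))"
    proof (intro set_eqI)
      fix z :: pt
      have "s \<le> u z \<longleftrightarrow> s \<le> 1 - (norm z)\<^sup>2 / r\<^sup>2" using True unfolding u_def by linarith
      also have "\<dots> \<longleftrightarrow> (norm z)\<^sup>2 \<le> (r * sqrt (1 - s))\<^sup>2"
        using True assms by (auto simp: power_mult_distrib field_simps)
      also have "\<dots> \<longleftrightarrow> norm z \<le> r * sqrt (1 - s)"
        using True assms by (subst abs_le_square_iff[symmetric]) auto
      finally show "z \<in> {z. s \<le> u z} \<longleftrightarrow> z \<in> cball 0 (r * sqrt (1 - s))" by simp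
    qed
    have "(\<integral>\<^sup>+z. ennreal (3 * s\<^sup>2) * indicator {0..u z} s \<partial>lborel)
       = (\<integral>\<^sup>+z. ennreal (3 * s\<^sup>2) * indicator (cball 0 (r * sqrt (1 - s))) (z::pt) \<partial>lborel)"
      unfolding set[symmetric] using True by (intro nn_integral_cong) (auto simp: indicator_def)
    also have "\<dots> = ennreal (3 * s\<^sup>2) * emeasure lborel (cball (0::pt) (r * sqrt (1 - s)))"
      by (rule nn_integral_cmult_indicator) simp
    also have "emeasure lborel (cball (0::pt) (r * sqrt (1 - s))) = ennreal (pi * (r\<^sup>2 * (1 - s)))"
      using True assms by (subst emeasure_cball) (auto simp: unit_ball_vol_2 power_mult_distrib)
    also have "ennreal (3 * s\<^sup>2) * ennreal (pi * (r\<^sup>2 * (1 - s))) = ennreal (pi * r\<^sup>2 * (3 * s\<^sup>2 * (1 - s)))"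
      using True by (subst ennreal_mult[symmetric]) (auto simp: mult_ac)
    finally show ?thesis using True by simp
  next
    case False
    have "u z \<le> 1" for z unfolding u_def by simp
    then have "(\<lambda>z. ennreal (3 * s\<^sup>2) * indicator {0..u z} s) = (\<lambda>z. 0)"
      using False that by (intro ext) (smt (verit) atLeastAtMost_iff indicator_simps(2) mult_zero_right)
    moreover have "s \<notin> {0..1}" using False that by auto
    ultimately show ?thesis by simp
  qed
  have "(\<integral>\<^sup>+z. ennreal (u z ^ 3) \<partial>lborel) = (\<integral>\<^sup>+z. \<integral>\<^sup>+s. ennreal (3 * s\<^sup>2) * indicator {0..u z} s \<partial>lborel \<partial>lborel)"
    unfolding cube ..
  also have "\<dots> = (\<integral>\<^sup>+s. \<integral>\<^sup>+z. ennreal (3 * s\<^sup>2) * indicator {0..u z} s \<partial>lborel \<partial>lborel)"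
    by (rule lborel_pair.Fubini'[OF meas, symmetric])
  also have "\<dots> = (\<integral>\<^sup>+s. ennreal (pi * r\<^sup>2 * (3 * s\<^sup>2 * (1 - s))) * indicator {0..1} s \<partial>lborel)"
    by (rule nn_integral_cong_AE) (rule AE_mp[OF AE_lborel_singleton[of 0]], auto intro!: AE_I2 inner)
  also have "\<dots> = ennreal (pi * r\<^sup>2 * (1 ^ 3 - 3 / 4 * 1 ^ 4) - pi * r\<^sup>2 * (0 ^ 3 - 3 / 4 * 0 ^ 4))"
  proof (rule nn_integral_FTC_Icc[where F="\<lambda>s. pi * r\<^sup>2 * (s ^ 3 - 3 / 4 * s ^ 4)"])
    show "((\<lambda>s. pi * r\<^sup>2 * (s ^ 3 - 3 / 4 * s ^ 4)) has_real_derivative pi * r\<^sup>2 * (3 * s\<^sup>2 * (1 - s))) (at s)" for s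
      by (auto intro!: derivative_eq_intros simp: algebra_simps power2_eq_square power3_eq_cube)
  qed auto
  finally have int: "(\<integral>\<^sup>+z. ennreal (u z ^ 3) \<partial>lborel) = ennreal (pi * r\<^sup>2 / 4)" by simp
  have "(\<integral>\<^sup>+z. ennreal (mollifier r z) \<partial>lborel) = (\<integral>\<^sup>+z. ennreal (4 / (pi * r\<^sup>2)) * ennreal (u z ^ 3) \<partial>lborel)"
    unfolding mollifier_def bu using u0 by (intro nn_integral_cong ennreal_mult) auto
  also have "\<dots> = ennreal (4 / (pi * r\<^sup>2)) * ennreal (pi * r\<^sup>2 / 4)"
    unfolding int[symmetric] by (rule nn_integral_cmult) measurable
  also have "\<dots> = 1" using assms by (subst ennreal_mult[symmetric]) auto
  finally have nn: "(\<integral>\<^sup>+z. ennreal (mollifier r z) \<partial>lborel) = ennreal 1" by simp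
  have m: "mollifier r \<in> borel_measurable lborel"
    using borel_measurable_continuous_onI[OF continuous_mollifier(1)] by simp
  show "integrable lborel (mollifier r)"
    using nn m mollifier_nonneg by (intro integrableI_nonneg) auto
  show "(\<integral>z. mollifier r z \<partial>lborel) = 1"
    using nn m mollifier_nonneg by (subst integral_eq_nn_integral) auto
qed

subsection \<open>Green's identity, mean values and the maximum principle\<close>

lemma AE_leb_neq: assumes "open \<Omega>" shows "AE q in leb \<Omega>. q \<noteq> x"
proof -
  have "\<Omega> \<inter> space lborel \<in> sets lborel" using assms by simp
  then show ?thesis using AE_lborel_singleton[of x]
    by (subst AE_restrict_space_iff) (auto elim!: eventually_mono)
qed

lemma integrable_compact_leb:
  fixes f :: "pt \<Rightarrow> real"
  assumes "open \<Omega>" "compact C" "C \<subseteq> \<Omega>" "continuous_on \<Omega> f" "\<And>x. x \<in> \<Omega> - C \<Longrightarrow> f x = 0"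
  shows "integrable (leb \<Omega>) f"
proof -
  have m: "\<Omega> \<inter> space lborel \<in> sets lborel" using assms(1) by simp
  have "integrable lborel (\<lambda>x. indicator C x *\<^sub>R f x)"
    by (rule borel_integrable_compact) (use assms continuous_on_subset in auto)
  moreover have "(\<lambda>x. indicator C x *\<^sub>R f x) = (\<lambda>x. indicator \<Omega> x *\<^sub>R f x)"
    using assms(3,5) by (intro ext) (fastforce simp: indicator_def)
  ultimately show ?thesis unfolding integrable_restrict_space[OF m] by simp
qed

text \<open>The difference of the two integrands is the divergence of w grad f - f grad w, a field
  supported in \<open>C\<close>.\<close>

lemma green_second:
  assumes "open \<Omega>" "compact C" "C \<subseteq> \<Omega>" and w: "Ck 2 \<Omega> w" and f: "Ck 2 \<Omega> f"
    and supp: "\<And>x. x \<in> \<Omega> - C \<Longrightarrow> f x = 0"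
  shows "(\<integral>x. w x * laplacian f x \<partial>leb \<Omega>) = (\<integral>x. f x * laplacian w x \<partial>leb \<Omega>)"
proof -
  have oC: "open (\<Omega> - C)" using assms(1) compact_imp_closed[OF assms(2)] by (rule open_Diff)
  have s1: "pd i f x = 0" if "x \<in> \<Omega> - C" for i x
    using has_pd_imp_pderiv[OF has_pd_cong_open[OF has_pd_const[of i 0 x] oC that, of f]] supp by simp
  have s2: "pd j (pd i f) x = 0" if "x \<in> \<Omega> - C" for i j x
    using has_pd_imp_pderiv[OF has_pd_cong_open[OF has_pd_const[of j 0 x] oC that, of "pd i f"]] s1 by simp
  define F' where "F' i x = (pd i w x * pd i f x + w x * pd i (pd i f) x) - (pd i f x * pd i w x + f x * pd i (pd i w) x)" for i x
  have I: "integrable (leb \<Omega>) (F' i)" "(\<integral>x. F' i x \<partial>leb \<Omega>) = 0" for i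
  proof -
    have "continuous_on \<Omega> (F' i)" "continuous_on \<Omega> (\<lambda>x. w x * pd i f x - f x * pd i w x)"
      unfolding F'_def by (intro continuous_intros Ck2D(1,3,5)[OF w] Ck2D(1,3,5)[OF f])+
    note c = this
    have d: "has_pd i (\<lambda>x. w x * pd i f x - f x * pd i w x) x (F' i x)" if "x \<in> \<Omega>" for x
      unfolding F'_def by (intro has_pd_diff has_pd_mult Ck2D[OF w] Ck2D[OF f] that)
    have z: "w x * pd i f x - f x * pd i w x = 0" if "x \<in> \<Omega> - C" for x using s1 supp that by simp
    show "integrable (leb \<Omega>) (F' i)" "(\<integral>x. F' i x \<partial>leb \<Omega>) = 0"
      using integral_pd_zero[OF assms(1-3) c(2,1) d z] by blast+
  qed
  have i1: "integrable (leb \<Omega>) (\<lambda>x. w x * laplacian f x)"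
    by (rule integrable_compact_leb[OF assms(1-3)])
      (auto simp: laplacian_def s2 intro!: continuous_intros Ck2D[OF w] Ck2D[OF f])
  have i2: "integrable (leb \<Omega>) (\<lambda>x. f x * laplacian w x)"
    by (rule integrable_compact_leb[OF assms(1-3)])
      (auto simp: laplacian_def supp intro!: continuous_intros Ck2D[OF w] Ck2D[OF f])
  have "(\<integral>x. w x * laplacian f x \<partial>leb \<Omega>) - (\<integral>x. f x * laplacian w x \<partial>leb \<Omega>)
      = (\<integral>x. w x * laplacian f x - f x * laplacian w x \<partial>leb \<Omega>)" using i1 i2 by simp
  also have "\<dots> = (\<integral>x. (\<Sum>i\<in>UNIV. F' i x) \<partial>leb \<Omega>)"
    by (rule Bochner_Integration.integral_cong)
      (auto simp: F'_def laplacian_def sum_distrib_left sum_subtractf[symmetric] intro!: sum.cong)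
  also have "\<dots> = 0" using I by (subst Bochner_Integration.integral_sum) auto
  finally show ?thesis by simp
qed

lemma mollifier_even: "mollifier r (x - y) = mollifier r (y - x)"
  unfolding mollifier_def by (simp add: norm_minus_commute)

lemma integral_mollifier_leb:
  assumes "open \<Omega>" "0 < r" "ball x r \<subseteq> \<Omega>"
  shows "integrable (leb \<Omega>) (\<lambda>y. mollifier r (x - y))" "(\<integral>y. mollifier r (x - y) \<partial>leb \<Omega>) = 1"
proof -
  have m: "\<Omega> \<inter> space lborel \<in> sets lborel" using assms(1) by simp
  have eq: "(\<lambda>y. indicator \<Omega> y *\<^sub>R mollifier r (x - y)) = (\<lambda>y. mollifier r (y + - x))"
  proof
    fix y
    show "indicator \<Omega> y *\<^sub>R mollifier r (x - y) = mollifier r (y + - x)"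
    proof (cases "y \<in> \<Omega>")
      case False
      then have "r \<le> norm (y - x)" using assms(3) by (force simp: dist_norm norm_minus_commute)
      then show ?thesis using mollifier_supp(1)[OF assms(2), of "y - x"] False by simp
    qed (simp add: mollifier_even[of r x])
  qed
  show "integrable (leb \<Omega>) (\<lambda>y. mollifier r (x - y))"
    unfolding integrable_restrict_space[OF m] eq
    by (rule integrable_lborel_shift[OF integral_mollifier(1)[OF assms(2)]])
  show "(\<integral>y. mollifier r (x - y) \<partial>leb \<Omega>) = 1"
    unfolding integral_restrict_space[OF m] eq
    using integral_lborel_shift[of "mollifier r" "- x"] integral_mollifier(2)[OF assms(2)]
      borel_measurable_continuous_onI[OF continuous_mollifier(1)] by simp
qed

lemma mollifier_approx:
  assumes "open \<Omega>" "0 < r" "ball x r \<subseteq> \<Omega>" and int: "integrable (leb \<Omega>) (\<lambda>y. f y * mollifier r (x - y))"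
    and close: "\<And>y. y \<in> ball x r \<Longrightarrow> \<bar>f y - f x\<bar> \<le> e" and "e \<ge> 0"
  shows "\<bar>(\<integral>y. f y * mollifier r (x - y) \<partial>leb \<Omega>) - f x\<bar> \<le> e"
proof -
  note M = integral_mollifier_leb[OF assms(1-3)]
  have "(\<integral>y. f y * mollifier r (x - y) \<partial>leb \<Omega>) - f x = (\<integral>y. f y * mollifier r (x - y) - f x * mollifier r (x - y) \<partial>leb \<Omega>)"
    using M int by simp
  also have "\<bar>\<dots>\<bar> \<le> (\<integral>y. e * mollifier r (x - y) \<partial>leb \<Omega>)"
    unfolding real_norm_def[symmetric]
  proof (rule Bochner_Integration.integral_norm_bound_integral)
    show "norm (f y * mollifier r (x - y) - f x * mollifier r (x - y)) \<le> e * mollifier r (x - y)" for y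
    proof (cases "y \<in> ball x r")
      case True
      have "\<bar>(f y - f x) * mollifier r (x - y)\<bar> \<le> e * mollifier r (x - y)"
        unfolding abs_mult using close[OF True] mollifier_nonneg by (intro mult_mono) auto
      then show ?thesis by (simp add: algebra_simps)
    next
      case False
      then have "r \<le> norm (x - y)" by (simp add: dist_norm)
      from mollifier_supp(1)[OF assms(2) this] show ?thesis by simp
    qed
  qed (use M int in auto)
  also have "\<dots> = e" using M by simp
  finally show ?thesis .
qed

text \<open>Reflection changes the sign of first derivatives only, so both orientations of the
  kernel have the same form of Laplacian.\<close>

lemma kernel_C2:
  fixes k :: "pt \<Rightarrow> real"
  assumes "\<And>i z. has_pd i k z (k1 i z)" "\<And>i j z. has_pd j (k1 i) z (k2 i j z)"
    and "continuous_on UNIV k" "\<And>i. continuous_on UNIV (k1 i)" "\<And>i j. continuous_on UNIV (k2 i j)" "open \<Omega>"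
  shows "Ck 2 \<Omega> (\<lambda>q. k (x - q))" "q \<in> \<Omega> \<Longrightarrow> laplacian (\<lambda>q. k (x - q)) q = (\<Sum>i\<in>UNIV. k2 i i (x - q))"
    "Ck 2 \<Omega> (\<lambda>q. k (q - x))" "q \<in> \<Omega> \<Longrightarrow> laplacian (\<lambda>q. k (q - x)) q = (\<Sum>i\<in>UNIV. k2 i i (q - x))"
proof -
  have c: "continuous_on \<Omega> (\<lambda>q. g (x - q))" "continuous_on \<Omega> (\<lambda>q. g (q - x))"
    if "continuous_on UNIV g" for g :: "pt \<Rightarrow> real"
    by (rule continuous_on_compose2[OF that]; (intro continuous_intros)?; simp)+
  have 2: "has_pd j (\<lambda>q. - k1 i (x - q)) q (k2 i j (x - q))" for i j q
    using has_pd_cmult[OF has_pd_reflect[OF assms(2)[of j i "x - q"]], of "-1"] by simp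
  note I = Ck2I[OF assms(6) c(1)[OF assms(3)] has_pd_reflect[OF assms(1)] _ 2 c(1)[OF assms(5)]]
  have c1: "continuous_on \<Omega> (\<lambda>q. - k1 i (x - q))" for i by (intro continuous_intros c assms)
  show "Ck 2 \<Omega> (\<lambda>q. k (x - q))" by (rule I(1)) (rule c1)
  show "q \<in> \<Omega> \<Longrightarrow> laplacian (\<lambda>q. k (x - q)) q = (\<Sum>i\<in>UNIV. k2 i i (x - q))" by (rule I(4)) (rule c1)
  note J = Ck2I[OF assms(6) c(2)[OF assms(3)] has_pd_translate[OF assms(1)] c(2)[OF assms(4)]
      has_pd_translate[OF assms(2)] c(2)[OF assms(5)]]
  show "Ck 2 \<Omega> (\<lambda>q. k (q - x))" "q \<in> \<Omega> \<Longrightarrow> laplacian (\<lambda>q. k (q - x)) q = (\<Sum>i\<in>UNIV. k2 i i (q - x))"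
    using J(1,4) by blast+
qed

lemmas gk_C2 = kernel_C2[OF has_pd_gk has_pd_gk1 continuous_gk(1,2,3)]
lemmas mollifier_C2 = kernel_C2[OF has_pd_mollifier continuous_mollifier(1,2,3)]

text \<open>The mean does not depend on the scale: \<open>gk r - gk s\<close> has compact support,
  since both kernels equal the logarithm far out, and its Laplacian is
  \<open>mollifier s - mollifier r\<close>. Letting \<open>s\<close> tend to 0 gives the value at
  the centre. The second claim tests with \<open>mollifier r\<close> itself.\<close>

lemma harmonic_mean_value:
  assumes "open \<Omega>" "harmonic_on \<Omega> w" "0 < r" "cball x r \<subseteq> \<Omega>"
  shows "(\<integral>y. w y * mollifier r (x - y) \<partial>leb \<Omega>) = w x"
    "(\<integral>y. w y * (\<Sum>i\<in>UNIV. mollifier2 r i i (x - y)) \<partial>leb \<Omega>) = 0"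
proof -
  have w: "Ck 2 \<Omega> w" and lw: "\<And>x. x \<in> \<Omega> \<Longrightarrow> laplacian w x = 0"
    using assms(2) unfolding harmonic_on_def by auto
  have int: "integrable (leb \<Omega>) (\<lambda>y. w y * mollifier s (x - y))" if "0 < s" "s \<le> r" for s
    by (rule integrable_compact_leb[OF assms(1) compact_cball assms(4)])
      (use that mollifier_supp(1)[of s] in \<open>auto intro!: continuous_intros Ck2D[OF w] Ck2D[OF mollifier_C2(1)] assms(1) simp: dist_norm\<close>)
  have z: "(\<integral>y. w y * laplacian f y \<partial>leb \<Omega>) = 0" if "Ck 2 \<Omega> f" "\<And>y. y \<in> \<Omega> - cball x r \<Longrightarrow> f y = 0" for f
  proof -
    have "(\<integral>y. w y * laplacian f y \<partial>leb \<Omega>) = (\<integral>y. f y * laplacian w y \<partial>leb \<Omega>)"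
      by (rule green_second[OF assms(1) compact_cball assms(4) w that])
    also have "\<dots> = (\<integral>y. 0 \<partial>leb \<Omega>)"
      by (rule Bochner_Integration.integral_cong) (auto simp: lw space_restrict_space)
    finally show ?thesis by simp
  qed
  have eq: "(\<integral>y. w y * mollifier s (x - y) \<partial>leb \<Omega>) = (\<integral>y. w y * mollifier r (x - y) \<partial>leb \<Omega>)" if "0 < s" "s \<le> r" for s
  proof -
    \<comment> \<open>The coefficients 1 and -1 are written out to match the linear combinations of
      \<open>Ck2_lin\<close>.\<close>
    let ?f = "\<lambda>q. 1 * gk r (x - q) + (- 1) * gk s (x - q)"
    have "(\<integral>y. w y * laplacian ?f y \<partial>leb \<Omega>) = 0"
    proof (rule z)
      show "Ck 2 \<Omega> ?f" by (intro Ck2_lin gk_C2 assms(1))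
      show "?f y = 0" if "y \<in> \<Omega> - cball x r" for y
        using that \<open>0 < s\<close> \<open>s \<le> r\<close> assms(3) by (simp add: gk_far dist_norm)
    qed
    moreover have "(\<integral>y. w y * laplacian ?f y \<partial>leb \<Omega>) = (\<integral>y. w y * mollifier s (x - y) - w y * mollifier r (x - y) \<partial>leb \<Omega>)"
    proof (rule Bochner_Integration.integral_cong)
      fix y assume "y \<in> space (leb \<Omega>)"
      then have y: "y \<in> \<Omega>" by (simp add: space_restrict_space)
      have "laplacian ?f y = 1 * laplacian (\<lambda>q. gk r (x - q)) y + (-1) * laplacian (\<lambda>q. gk s (x - q)) y"
        by (rule Ck2_lin(3)[OF assms(1) _ _ y]) (intro gk_C2 assms(1))+
      also have "\<dots> = mollifier s (x - y) - mollifier r (x - y)"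
        using that assms(3) y by (simp add: gk_C2(2)[OF assms(1)] sum_gk2)
      finally show "w y * laplacian ?f y = w y * mollifier s (x - y) - w y * mollifier r (x - y)"
        by (simp only: right_diff_distrib)
    qed simp
    ultimately show ?thesis using int[OF that] int[of r] assms(3) by simp
  qed
  have small: "\<bar>(\<integral>y. w y * mollifier r (x - y) \<partial>leb \<Omega>) - w x\<bar> \<le> e" if "e > 0" for e
  proof -
    have x: "x \<in> \<Omega>" using assms(3,4) by auto
    then have "isCont w x" using Ck2D(1)[OF w] assms(1) continuous_on_eq_continuous_at by blast
    then obtain d where d: "d > 0" "\<And>y. dist y x < d \<Longrightarrow> \<bar>w y - w x\<bar> < e"
      using \<open>e > 0\<close> unfolding continuous_at_eps_delta dist_real_def by blast
    define s where "s = min d r"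
    have s: "0 < s" "s \<le> r" using d assms(3) by (auto simp: s_def)
    have "\<bar>(\<integral>y. w y * mollifier s (x - y) \<partial>leb \<Omega>) - w x\<bar> \<le> e"
    proof (rule mollifier_approx[OF assms(1) s(1) _ int[OF s]])
      show "ball x s \<subseteq> \<Omega>" using assms(4) s(2) by (meson ball_subset_cball dual_order.trans subset_ball)
      show "\<bar>w y - w x\<bar> \<le> e" if "y \<in> ball x s" for y
        using d(2)[of y] that by (auto simp: s_def dist_commute)
    qed (use that in auto)
    then show ?thesis using eq[OF s] by simp
  qed
  have "\<bar>(\<integral>y. w y * mollifier r (x - y) \<partial>leb \<Omega>) - w x\<bar> \<le> 0"
    by (rule dense_ge) (rule small)
  then show "(\<integral>y. w y * mollifier r (x - y) \<partial>leb \<Omega>) = w x" by simp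
  have "(\<integral>y. w y * laplacian (\<lambda>q. mollifier r (x - q)) y \<partial>leb \<Omega>) = 0"
    by (rule z) (use mollifier_supp(1)[OF assms(3)] in \<open>auto simp: dist_norm intro!: mollifier_C2 assms(1)\<close>)
  moreover have "(\<integral>y. w y * laplacian (\<lambda>q. mollifier r (x - q)) y \<partial>leb \<Omega>) = (\<integral>y. w y * (\<Sum>i\<in>UNIV. mollifier2 r i i (x - y)) \<partial>leb \<Omega>)"
    by (rule Bochner_Integration.integral_cong) (auto simp: mollifier_C2(2)[OF assms(1)] space_restrict_space)
  ultimately show "(\<integral>y. w y * (\<Sum>i\<in>UNIV. mollifier2 r i i (x - y)) \<partial>leb \<Omega>) = 0" by simp
qed

lemma second_derivative_local_max:
  fixes g g1 :: "real \<Rightarrow> real"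
  assumes "e > 0" and g: "\<And>t. \<bar>t\<bar> < e \<Longrightarrow> (g has_real_derivative g1 t) (at t)"
    and g1: "(g1 has_real_derivative d) (at 0)" and mx: "\<And>t. \<bar>t\<bar> < e \<Longrightarrow> g t \<le> g 0"
  shows "d \<le> 0"
proof (rule ccontr)
  assume "\<not> d \<le> 0"
  then have "d > 0" by simp
  have "g1 0 = 0"
    by (rule DERIV_local_max[OF g[of 0] \<open>e > 0\<close>]) (use mx \<open>e > 0\<close> in auto)
  then obtain \<delta> where \<delta>: "\<delta> > 0" "\<And>h. 0 < h \<Longrightarrow> h < \<delta> \<Longrightarrow> g1 h > 0"
    using DERIV_pos_inc_right[OF g1 \<open>d > 0\<close>] by auto
  define h where "h = min \<delta> e / 2"
  have h: "0 < h" "h < \<delta>" "h < e" using \<delta> \<open>e > 0\<close> by (auto simp: h_def)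
  obtain z where "0 < z" "z < h" "g h - g 0 = (h - 0) * g1 z"
    using MVT2[of 0 h g g1] g h by force
  moreover have "h * g1 z > 0" using \<open>0 < z\<close> \<open>z < h\<close> \<delta>(2)[of z] h by simp
  ultimately have "g h > g 0" by simp
  then show False using mx[of h] h by simp
qed

text \<open>Adding a small multiple of |x|^2 makes the Laplacian strictly positive, which is
  impossible at an interior maximum, where both pure second derivatives are at most 0.\<close>

lemma maximum_principle:
  assumes "open \<Omega>" "bounded \<Omega>" and w: "Ck 2 \<Omega> w" and cw: "continuous_on (closure \<Omega>) w"
    and sub: "\<And>x. x \<in> \<Omega> \<Longrightarrow> laplacian w x \<ge> 0" and bd: "\<And>x. x \<in> frontier \<Omega> \<Longrightarrow> w x \<le> c"
    and x0: "x0 \<in> closure \<Omega>"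
  shows "w x0 \<le> c"
proof (rule ccontr)
  assume "\<not> w x0 \<le> c"
  then have gt: "w x0 - c > 0" by simp
  have cpt: "compact (closure \<Omega>)" using assms(2) by (simp add: compact_closure)
  obtain B0 where B0: "\<And>x. x \<in> closure \<Omega> \<Longrightarrow> norm x \<le> B0"
    using compact_imp_bounded[OF cpt] unfolding bounded_iff by blast
  define B where "B = B0\<^sup>2 + 1"
  have B: "(norm x)\<^sup>2 \<le> B" if "x \<in> closure \<Omega>" for x
    using power_mono[OF B0[OF that] norm_ge_zero, of 2] by (simp add: B_def)
  have "B > 0" unfolding B_def by (simp add: add_nonneg_pos)
  \<comment> \<open>Small enough that the perturbation, at most \<open>\<epsilon> * B\<close>,
    cannot close the gap \<open>w x0 - c\<close>; the maximum of \<open>v\<close> is then not on the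
    boundary.\<close>
  define \<epsilon> where "\<epsilon> = (w x0 - c) / (2 * B)"
  have eps: "\<epsilon> > 0" "\<epsilon> * B < w x0 - c" using gt \<open>B > 0\<close> by (auto simp: \<epsilon>_def field_simps)
  define v where "v x = w x + \<epsilon> * (norm x)\<^sup>2" for x
  have "continuous_on (closure \<Omega>) v" unfolding v_def by (intro continuous_intros cw)
  then obtain x1 where x1: "x1 \<in> closure \<Omega>" "\<And>y. y \<in> closure \<Omega> \<Longrightarrow> v y \<le> v x1"
    using continuous_attains_sup[OF cpt _ \<open>continuous_on (closure \<Omega>) v\<close>] x0 by (metis empty_iff)
  have "v x1 > c + \<epsilon> * B"
  proof -
    have "v x1 \<ge> v x0" using x1 x0 by blast
    moreover have "v x0 \<ge> w x0" using eps by (simp add: v_def)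
    ultimately show ?thesis using eps by linarith
  qed
  moreover have "v x1 \<le> c + \<epsilon> * B" if "x1 \<in> frontier \<Omega>"
    unfolding v_def using bd[OF that] B[OF x1(1)] eps by (intro add_mono mult_left_mono) auto
  ultimately have "x1 \<notin> frontier \<Omega>" by linarith
  then have x1O: "x1 \<in> \<Omega>" using x1(1) assms(1) by (simp add: frontier_def interior_open)
  obtain e where e: "e > 0" "ball x1 e \<subseteq> \<Omega>" using assms(1) x1O openE by blast
  have "pd i (pd i w) x1 + 2 * \<epsilon> \<le> 0" for i
  proof -
    let ?l = "\<lambda>t::real. x1 + t *\<^sub>R axis i 1"
    have l: "?l t \<in> \<Omega>" if "\<bar>t\<bar> < e" for t
      using e(2) that by (auto intro!: subsetD[OF e(2)] simp: dist_norm norm_axis_1)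
    show ?thesis
    proof (rule second_derivative_local_max[OF e(1), where g="\<lambda>t. v (?l t)" and ?g1.0="\<lambda>t. pd i w (?l t) + \<epsilon> * (2 * ?l t $ i)"])
      show "((\<lambda>t. v (?l t)) has_real_derivative pd i w (?l t) + \<epsilon> * (2 * ?l t $ i)) (at t)" if "\<bar>t\<bar> < e" for t
        unfolding v_def
        by (rule has_pd_line[of i "\<lambda>x. w x + \<epsilon> * (norm x)\<^sup>2"]) (intro has_pd_add has_pd_cmult has_pd_norm_sq Ck2D[OF w] l that)
      have "has_pd i (\<lambda>x. pd i w x + \<epsilon> * (2 * x $ i)) x1 (pd i (pd i w) x1 + \<epsilon> * (2 * (if i = i then 1 else 0)))"
        by (intro has_pd_add has_pd_cmult has_pd_component Ck2D[OF w] x1O)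
      then show "((\<lambda>t. pd i w (?l t) + \<epsilon> * (2 * ?l t $ i)) has_real_derivative pd i (pd i w) x1 + 2 * \<epsilon>) (at 0)"
        unfolding has_pd_def by (simp add: mult.commute)
      show "v (?l t) \<le> v (?l 0)" if "\<bar>t\<bar> < e" for t
        using x1(2)[of "?l t"] l[OF that] closure_subset by auto
    qed
  qed
  then have "(\<Sum>i\<in>(UNIV::2 set). pd i (pd i w) x1 + 2 * \<epsilon>) \<le> 0" by (rule sum_nonpos)
  then have "laplacian w x1 + 4 * \<epsilon> \<le> 0" by (simp add: laplacian_def sum.distrib)
  then show False using sub[OF x1O] eps by linarith
qed

subsection \<open>Potentials of smooth kernels\<close>

text \<open>Continuity and derivatives at \<open>x\<close> involve only nearby points, so a bound
  over the unit ball around \<open>x\<close> serves as dominating constant.\<close>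

lemma conv_kernel_bound:
  fixes k :: "pt \<Rightarrow> real"
  assumes "bounded A" "continuous_on UNIV k"
  shows "\<exists>B. \<forall>y\<in>cball x 1. \<forall>q\<in>A. \<bar>k (y - q)\<bar> \<le> B"
proof -
  obtain a where a: "\<And>q. q \<in> A \<Longrightarrow> norm q \<le> a" using assms(1) unfolding bounded_iff by blast
  have "compact (k ` cball 0 (norm x + 1 + a))"
    by (intro compact_continuous_image continuous_on_subset[OF assms(2)]) auto
  then obtain B where B: "\<And>z. z \<in> cball 0 (norm x + 1 + a) \<Longrightarrow> \<bar>k z\<bar> \<le> B"
    using compact_imp_bounded[of "k ` cball 0 (norm x + 1 + a)"] unfolding bounded_iff by (metis imageI real_norm_def)
  have "\<bar>k (y - q)\<bar> \<le> B" if "y \<in> cball x 1" "q \<in> A" for y q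
  proof (rule B)
    have "norm (y - q) \<le> norm (y - x) + norm x + norm q" by norm
    then show "y - q \<in> cball 0 (norm x + 1 + a)" using that a[of q] by (simp add: dist_norm norm_minus_commute)
  qed
  then show ?thesis by blast
qed

context
  fixes A :: "pt set" and \<rho> :: "pt \<Rightarrow> real"
  assumes A: "open A" "bounded A" and rho: "integrable (leb A) \<rho>"
begin

lemma conv_integrable:
  fixes k :: "pt \<Rightarrow> real"
  assumes "continuous_on UNIV k"
  shows "integrable (leb A) (\<lambda>q. k (x - q) * \<rho> q)"
proof -
  obtain B where B: "\<forall>y\<in>cball x 1. \<forall>q\<in>A. \<bar>k (y - q)\<bar> \<le> B" using conv_kernel_bound[OF A(2) assms] by blast
  have m: "(\<lambda>q. k (x - q)) \<in> borel_measurable (leb A)"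
    by (rule borel_measurable_leb, rule continuous_on_compose2[OF assms]) (auto intro!: continuous_intros)
  show ?thesis
  proof (rule Bochner_Integration.integrable_bound)
    show "integrable (leb A) (\<lambda>q. B * \<rho> q)" using rho by simp
    show "(\<lambda>q. k (x - q) * \<rho> q) \<in> borel_measurable (leb A)" using m rho by simp
    show "AE q in leb A. norm (k (x - q) * \<rho> q) \<le> norm (B * \<rho> q)"
    proof (rule AE_I2)
      fix q assume "q \<in> space (leb A)"
      then have "\<bar>k (x - q)\<bar> \<le> B" using B by (auto simp: space_restrict_space)
      then show "norm (k (x - q) * \<rho> q) \<le> norm (B * \<rho> q)" by (auto simp: abs_mult intro!: mult_mono)
    qed
  qed
qed

lemma conv_continuous:
  fixes k :: "pt \<Rightarrow> real"
  assumes "continuous_on UNIV k"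
  shows "continuous_on S (\<lambda>x. \<integral>q. k (x - q) * \<rho> q \<partial>leb A)"
proof -
  have "isCont (\<lambda>x. \<integral>q. k (x - q) * \<rho> q \<partial>leb A) x" for x
    unfolding continuous_at_sequentially o_def
  proof (intro allI impI)
    fix X assume X: "X \<longlonglongrightarrow> x"
    obtain B where B: "\<forall>y\<in>cball x 1. \<forall>q\<in>A. \<bar>k (y - q)\<bar> \<le> B" using conv_kernel_bound[OF A(2) assms] by blast
    obtain N where N: "\<And>n. n \<ge> N \<Longrightarrow> dist (X n) x < 1" using metric_LIMSEQ_D[OF X, of 1] by auto
    have "(\<lambda>n. \<integral>q. k (X (n + N) - q) * \<rho> q \<partial>leb A) \<longlonglongrightarrow> (\<integral>q. k (x - q) * \<rho> q \<partial>leb A)"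
    proof (rule integral_dominated_convergence[where w="\<lambda>q. B * \<bar>\<rho> q\<bar>"])
      show "(\<lambda>q. k (x - q) * \<rho> q) \<in> borel_measurable (leb A)" "\<And>n. (\<lambda>q. k (X (n + N) - q) * \<rho> q) \<in> borel_measurable (leb A)"
        using conv_integrable[OF assms] by auto
      show "integrable (leb A) (\<lambda>q. B * \<bar>\<rho> q\<bar>)" using rho by simp
      show "AE q in leb A. (\<lambda>n. k (X (n + N) - q) * \<rho> q) \<longlonglongrightarrow> k (x - q) * \<rho> q"
      proof (rule AE_I2)
        fix q
        have "(\<lambda>n. X (n + N) - q) \<longlonglongrightarrow> x - q" by (intro tendsto_intros LIMSEQ_ignore_initial_segment X)
        then have "(\<lambda>n. k (X (n + N) - q)) \<longlonglongrightarrow> k (x - q)"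
          using assms by (intro continuous_on_tendsto_compose[OF assms]) auto
        then show "(\<lambda>n. k (X (n + N) - q) * \<rho> q) \<longlonglongrightarrow> k (x - q) * \<rho> q" by (intro tendsto_intros)
      qed
      show "AE q in leb A. norm (k (X (n + N) - q) * \<rho> q) \<le> B * \<bar>\<rho> q\<bar>" for n
      proof (rule AE_I2)
        fix q assume "q \<in> space (leb A)"
        then have "\<bar>k (X (n + N) - q)\<bar> \<le> B" using B N[of "n + N"]
          by (auto simp: space_restrict_space dist_commute less_imp_le)
        then show "norm (k (X (n + N) - q) * \<rho> q) \<le> B * \<bar>\<rho> q\<bar>" by (auto simp: abs_mult intro!: mult_mono)
      qed
    qed
    then show "(\<lambda>n. \<integral>q. k (X n - q) * \<rho> q \<partial>leb A) \<longlonglongrightarrow> (\<integral>q. k (x - q) * \<rho> q \<partial>leb A)" by (rule LIMSEQ_offset)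
  qed
  then show ?thesis by (simp add: continuous_at_imp_continuous_on)
qed

lemma conv_pd:
  assumes "continuous_on UNIV k" "continuous_on UNIV k'" "\<And>z. has_pd i k z (k' z)"
  shows "has_pd i (\<lambda>x. \<integral>q. k (x - q) * \<rho> q \<partial>leb A) x (\<integral>q. k' (x - q) * \<rho> q \<partial>leb A)"
proof -
  let ?e = "axis i 1 :: pt"
  obtain B where B: "\<forall>y\<in>cball x 1. \<forall>q\<in>A. \<bar>k' (y - q)\<bar> \<le> B" using conv_kernel_bound[OF A(2) assms(2)] by blast
  have "((\<lambda>t. \<integral>q. k (x + t *\<^sub>R ?e - q) * \<rho> q \<partial>leb A) has_real_derivative (\<integral>q. k' (x + 0 *\<^sub>R ?e - q) * \<rho> q \<partial>leb A)) (at 0)"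
  proof (rule DERIV_integral(1)[where \<delta>=1 and g="\<lambda>q. B * \<bar>\<rho> q\<bar>"])
    show "integrable (leb A) (\<lambda>q. k (x + t *\<^sub>R ?e - q) * \<rho> q)" for t by (rule conv_integrable[OF assms(1)])
    show "((\<lambda>t. k (x + t *\<^sub>R ?e - q) * \<rho> q) has_real_derivative k' (x + t *\<^sub>R ?e - q) * \<rho> q) (at t)" for t q
    proof -
      have "has_pd i (\<lambda>x. k (x - q)) (x + t *\<^sub>R ?e) (k' (x + t *\<^sub>R ?e - q))" by (rule has_pd_translate[OF assms(3)])
      from DERIV_cmult_right[OF has_pd_line[OF this], of "\<rho> q"] show ?thesis .
    qed
    show "\<bar>k' (x + t *\<^sub>R ?e - q) * \<rho> q\<bar> \<le> B * \<bar>\<rho> q\<bar>" if "\<bar>t\<bar> < 1" "q \<in> space (leb A)" for t q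
    proof -
      have "x + t *\<^sub>R ?e \<in> cball x 1" using that by (simp add: dist_norm norm_axis_1)
      then have "\<bar>k' (x + t *\<^sub>R ?e - q)\<bar> \<le> B" using B that by (auto simp: space_restrict_space)
      then show ?thesis by (auto simp: abs_mult intro!: mult_mono)
    qed
    show "integrable (leb A) (\<lambda>q. B * \<bar>\<rho> q\<bar>)" using rho by simp
  qed simp
  then show ?thesis unfolding has_pd_def by simp
qed

end

text \<open>Along a short segment in direction \<open>i\<close> this is the one-variable theorem on
  limits of derivatives; uniform convergence is needed for the derivatives only.\<close>

lemma has_pd_uniform_limit:
  assumes "open S" "x \<in> S" and f: "\<And>n y. y \<in> S \<Longrightarrow> has_pd i (f n) y (f1 n y)"
    and lim: "\<And>y. y \<in> S \<Longrightarrow> (\<lambda>n. f n y) \<longlonglongrightarrow> g y" and ul: "uniform_limit S f1 g1 sequentially"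
  shows "has_pd i g x (g1 x)"
proof -
  let ?l = "\<lambda>t::real. x + t *\<^sub>R axis i 1"
  obtain e where e: "e > 0" "ball x e \<subseteq> S" using assms(1,2) openE by blast
  define T where "T = {-e<..<e}"
  have l: "?l t \<in> S" if "t \<in> T" for t
    by (rule subsetD[OF e(2)]) (use that in \<open>auto simp: T_def dist_norm norm_axis_1\<close>)
  have oT: "open T" and T0: "0 \<in> T" using e(1) by (auto simp: T_def)
  have "\<exists>h. \<forall>t\<in>T. (\<lambda>n. f n (?l t)) \<longlonglongrightarrow> h t \<and> (h has_derivative (\<lambda>s. g1 (?l t) * s)) (at t within T)"
  proof (rule has_derivative_sequence[where f'="\<lambda>n t s. f1 n (?l t) * s"])
    show "convex T" by (simp add: T_def)
    show "((\<lambda>t. f n (?l t)) has_derivative (\<lambda>s. f1 n (?l t) * s)) (at t within T)" if "t \<in> T" for n t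
      using has_pd_line[OF f[OF l[OF that]]] by (simp add: has_field_derivative_def has_derivative_at_withinI)
    show "\<forall>\<^sub>F n in sequentially. \<forall>t\<in>T. \<forall>h. norm (f1 n (?l t) * h - g1 (?l t) * h) \<le> \<epsilon> * norm h" if "\<epsilon> > 0" for \<epsilon>
    proof -
      have "\<forall>\<^sub>F n in sequentially. \<forall>y\<in>S. dist (f1 n y) (g1 y) < \<epsilon>" using uniform_limitD[OF ul that] .
      then show ?thesis
      proof eventually_elim
        case (elim n)
        show ?case
        proof (intro ballI allI)
          fix t h assume "t \<in> T"
          then have "\<bar>f1 n (?l t) - g1 (?l t)\<bar> \<le> \<epsilon>" using elim l by (simp add: dist_real_def less_imp_le)
          then show "norm (f1 n (?l t) * h - g1 (?l t) * h) \<le> \<epsilon> * norm h"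
            unfolding left_diff_distrib[symmetric] norm_mult by (intro mult_right_mono) auto
        qed
      qed
    qed
    show "(\<lambda>n. f n (?l 0)) \<longlonglongrightarrow> g (?l 0)" by (rule lim[OF l[OF T0]])
  qed (rule T0)
  then obtain h where h: "\<And>t. t \<in> T \<Longrightarrow> (\<lambda>n. f n (?l t)) \<longlonglongrightarrow> h t"
    "\<And>t. t \<in> T \<Longrightarrow> (h has_derivative (\<lambda>s. g1 (?l t) * s)) (at t within T)" by blast
  have eq: "h t = g (?l t)" if "t \<in> T" for t using LIMSEQ_unique[OF h(1)[OF that] lim[OF l[OF that]]] .
  have "(h has_real_derivative g1 (?l 0)) (at 0)"
    using h(2)[OF T0] unfolding has_field_derivative_def at_within_open[OF T0 oT] .
  then have "((\<lambda>t. g (?l t)) has_real_derivative g1 (?l 0)) (at 0)"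
    by (rule has_field_derivative_transform_within_open[OF _ oT T0]) (rule eq)
  then show ?thesis unfolding has_pd_def by simp
qed

subsection \<open>The Newtonian potential\<close>

text \<open>Radius, exponent and constant may all depend on the point: near a zero p_j the weight
  has its own exponent, determined by \<alpha>_j.\<close>

definition loc_holder :: "pt set \<Rightarrow> (pt \<Rightarrow> real) \<Rightarrow> bool" where
  "loc_holder S f \<longleftrightarrow> (\<forall>x\<in>S. \<exists>r \<gamma> C. 0 < r \<and> 0 < \<gamma> \<and> \<gamma> \<le> 1 \<and> 0 \<le> C \<and> ball x r \<subseteq> S \<and>
     (\<forall>y\<in>ball x r. \<forall>z\<in>ball x r. \<bar>f y - f z\<bar> \<le> C * norm (y - z) powr \<gamma>))"

definition newton :: "pt \<Rightarrow> real" where "newton z = - (1 / (2 * pi)) * ln (norm z)"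
definition newton1 :: "2 \<Rightarrow> pt \<Rightarrow> real" where "newton1 i z = - (1 / (2 * pi)) * (z $ i / (norm z)\<^sup>2)"

lemma newton_bound: assumes "0 < norm z" "norm z < 1" shows "0 \<le> newton z" "newton z \<le> norm z powr - 1"
proof -
  show "0 \<le> newton z" unfolding newton_def using assms by (simp add: divide_nonpos_pos mult_nonneg_nonpos)
  have "- ln (norm z) = ln (1 / norm z)" using assms by (simp add: ln_div)
  also have "\<dots> \<le> 1 / norm z - 1" using assms by (intro ln_le_minus_one) auto
  finally have "- ln (norm z) \<le> 1 / norm z" by linarith
  moreover have "newton z = 1 / (2 * pi) * (- ln (norm z))" by (simp add: newton_def)
  moreover have "1 / (2 * pi) * (- ln (norm z)) \<le> 1 * (- ln (norm z))"
    using assms pi_gt3 by (intro mult_right_mono) (auto simp: field_simps)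
  ultimately show "newton z \<le> norm z powr - 1" by (simp add: powr_minus_divide)
qed

text \<open>Regularised and singular kernel differ only inside the small disc, and there by an
  integrable singularity independent of \<open>r\<close>. Integration against a bounded density thus
  gives an error of order \<open>r\<close>, uniformly in the point.\<close>

lemma gk_newton: assumes "0 < r" "r \<le> 1" "z \<noteq> 0"
  shows "\<bar>gk r z - newton z\<bar> \<le> norm z powr - 1 * indicator (ball 0 r) z"
proof (cases "r \<le> norm z")
  case True
  then show ?thesis using gk_far[OF assms(1) True] by (simp add: newton_def)
next
  case False
  then show ?thesis using gk_near[OF assms] newton_bound[of z] assms by (auto simp: newton_def)
qed

lemma gk1_newton: assumes "0 < r" "z \<noteq> 0"
  shows "\<bar>gk1 r i z - newton1 i z\<bar> \<le> 2 * norm z powr - 1 * indicator (ball 0 r) z"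
proof (cases "r \<le> norm z")
  case True
  then show ?thesis using gk1_far[OF assms(1) True] by (simp add: newton1_def)
next
  case False
  have "newton1 i z = gk1 (norm z) i z" using gk1_far[of "norm z" z i] assms by (simp add: newton1_def)
  then show ?thesis using gk1_bound[OF assms, of i] gk1_bound[of "norm z" z i] assms False by auto
qed

lemma gk2_diff: assumes "0 < s" "s \<le> r" "z \<noteq> 0"
  shows "\<bar>gk2 r i j z - gk2 s i j z\<bar> \<le> 6 * norm z powr - 2 * indicator (ball 0 r) z"
proof (cases "r \<le> norm z")
  case True
  then show ?thesis using gk2_far[of r z i j] gk2_far[of s z i j] assms by simp
next
  case False
  then show ?thesis using gk2_bound[of r z i j] gk2_bound[of s z i j] assms by auto
qed

text \<open>Turns a pointwise singularity confined to a small disc into a power of its radius. The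
  pole itself may be ignored, being a null set.\<close>

lemma integral_near_bound:
  assumes \<theta>: "0 \<le> \<theta>" "\<theta> < 2"
  shows "\<exists>K\<ge>0. \<forall>\<Omega> x r c g. open \<Omega> \<longrightarrow> 0 < r \<longrightarrow> 0 \<le> c \<longrightarrow> g \<in> borel_measurable (leb \<Omega>) \<longrightarrow>
     (\<forall>q\<in>\<Omega>. q \<noteq> x \<longrightarrow> \<bar>g q\<bar> \<le> c * norm (x - q) powr - \<theta> * indicator (ball x r) q) \<longrightarrow>
     integrable (leb \<Omega>) g \<and> \<bar>\<integral>q. g q \<partial>leb \<Omega>\<bar> \<le> c * (K * r powr (2 - \<theta>))"
proof -
  obtain K where K: "K \<ge> 0" "\<forall>A x r. A \<in> sets borel \<longrightarrow> 0 < r \<longrightarrow> A \<subseteq> ball x r \<longrightarrow>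
     integrable (leb A) (\<lambda>q. norm (x - q) powr - \<theta>) \<and> (\<integral>q. norm (x - q) powr - \<theta> \<partial>leb A) \<le> K * r powr (2 - \<theta>)"
    using riesz_potential_bound[OF \<theta>] by blast
  have "integrable (leb \<Omega>) g \<and> \<bar>\<integral>q. g q \<partial>leb \<Omega>\<bar> \<le> c * (K * r powr (2 - \<theta>))"
    if "open \<Omega>" "0 < r" "0 \<le> c" and g: "g \<in> borel_measurable (leb \<Omega>)"
      and b: "\<forall>q\<in>\<Omega>. q \<noteq> x \<longrightarrow> \<bar>g q\<bar> \<le> c * norm (x - q) powr - \<theta> * indicator (ball x r) q" for \<Omega> x r c g
  proof -
    let ?w = "\<lambda>q. norm (x - q) powr - \<theta>"
    let ?A = "\<Omega> \<inter> ball x r"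
    have A: "?A \<in> sets borel" using that(1) by auto
    have mA: "?A \<inter> space lborel \<in> sets lborel" "\<Omega> \<inter> space lborel \<in> sets lborel" using that(1) by auto
    have e: "(\<lambda>q. indicator \<Omega> q *\<^sub>R (c * ?w q * indicator (ball x r) q)) = (\<lambda>q. c * (indicator ?A q *\<^sub>R ?w q))"
      by (auto simp: indicator_def)
    have KA: "integrable (leb ?A) ?w" "(\<integral>q. ?w q \<partial>leb ?A) \<le> K * r powr (2 - \<theta>)"
      using K(2) A \<open>0 < r\<close> by (meson inf_le2)+
    have iW: "integrable (leb \<Omega>) (\<lambda>q. c * ?w q * indicator (ball x r) q)"
      unfolding integrable_restrict_space[OF mA(2)] e
      using KA(1) unfolding integrable_restrict_space[OF mA(1)] by simp
    have bW: "(\<integral>q. c * ?w q * indicator (ball x r) q \<partial>leb \<Omega>) = c * (\<integral>q. ?w q \<partial>leb ?A)"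
      unfolding integral_restrict_space[OF mA(2)] integral_restrict_space[OF mA(1)] e by simp
    have ae: "AE q in leb \<Omega>. norm (g q) \<le> c * ?w q * indicator (ball x r) q"
      using AE_leb_neq[OF that(1), of x] AE_space
      by eventually_elim (use b in \<open>auto simp: space_restrict_space\<close>)
    have ig: "integrable (leb \<Omega>) g"
      by (rule Bochner_Integration.integrable_bound[OF iW g])
        (use ae in \<open>eventually_elim, simp\<close>)
    have "\<bar>\<integral>q. g q \<partial>leb \<Omega>\<bar> \<le> (\<integral>q. \<bar>g q\<bar> \<partial>leb \<Omega>)" by (rule integral_abs_bound)
    also have "\<dots> \<le> (\<integral>q. c * ?w q * indicator (ball x r) q \<partial>leb \<Omega>)"
      by (rule integral_mono_AE) (use ig iW ae in auto)
    also have "\<dots> \<le> c * (K * r powr (2 - \<theta>))" unfolding bW using KA(2) that(3) by (rule mult_left_mono)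
    finally show ?thesis using ig by blast
  qed
  with K(1) show ?thesis by blast
qed

lemma finite_leb: assumes "bounded \<Omega>" "open \<Omega>" shows "finite_measure (leb \<Omega>)"
proof (rule finite_measureI)
  have "emeasure (leb \<Omega>) (space (leb \<Omega>)) = emeasure lborel \<Omega>"
    using assms(2) by (simp add: emeasure_restrict_space space_restrict_space)
  then show "emeasure (leb \<Omega>) (space (leb \<Omega>)) \<noteq> \<infinity>" using emeasure_bounded_finite[OF assms(1)] by simp
qed

lemma integrable_bounded_leb:
  fixes f :: "pt \<Rightarrow> real"
  assumes "bounded \<Omega>" "open \<Omega>" "f \<in> borel_measurable (leb \<Omega>)" "\<And>x. x \<in> \<Omega> \<Longrightarrow> \<bar>f x\<bar> \<le> B"
  shows "integrable (leb \<Omega>) f"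
proof (rule finite_measure.integrable_const_bound[OF finite_leb[OF assms(1,2)] _ assms(3)])
  show "AE x in leb \<Omega>. norm (f x) \<le> B" using assms(4) by (intro AE_I2) (simp add: space_restrict_space)
qed

text \<open>With only partial derivatives at hand, the increment from \<open>z\<close> to
  \<open>y\<close> is split at the corner \<open>w\<close> that shares one coordinate with
  each.\<close>

lemma C1_loc_holder:
  assumes "open S" and f: "\<And>i x. x \<in> S \<Longrightarrow> has_pd i f x (f1 i x)" and c: "\<And>i. continuous_on S (f1 i)"
  shows "loc_holder S f"
  unfolding loc_holder_def
proof
  fix x assume "x \<in> S"
  then obtain e where e: "e > 0" "cball x e \<subseteq> S" using assms(1) open_contains_cball by blast
  have "\<exists>M. \<forall>y\<in>cball x e. \<bar>f1 i y\<bar> \<le> M" for i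
  proof -
    have "compact (f1 i ` cball x e)"
      by (intro compact_continuous_image continuous_on_subset[OF c] e) auto
    then show ?thesis using compact_imp_bounded[of "f1 i ` cball x e"] unfolding bounded_iff by force
  qed
  then obtain Mi where Mi: "\<And>i y. y \<in> cball x e \<Longrightarrow> \<bar>f1 i y\<bar> \<le> Mi i" by metis
  define M where "M = max 0 (max (Mi 1) (Mi 2))"
  have M: "\<bar>f1 i y\<bar> \<le> M" if "y \<in> cball x e" for i y
  proof -
    have "i = 1 \<or> i = 2" by (rule exhaust_2)
    then show ?thesis using Mi[OF that, of i] unfolding M_def by auto
  qed
  have M0: "M \<ge> 0" by (simp add: M_def)
  have step: "\<bar>f (z + a *\<^sub>R axis i 1) - f z\<bar> \<le> M * \<bar>a\<bar>" if "z \<in> cball x e" "z + a *\<^sub>R axis i 1 \<in> cball x e" for z a i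
  proof -
    let ?l = "\<lambda>t. z + t *\<^sub>R axis i 1 :: pt"
    have l: "?l t \<in> cball x e" if t: "t \<in> closed_segment 0 a" for t
    proof -
      obtain u where u: "0 \<le> u" "u \<le> 1" "t = u * a" using t by (auto simp: in_segment)
      have "?l t = (1 - u) *\<^sub>R z + u *\<^sub>R ?l a" unfolding u by (simp add: algebra_simps)
      also have "\<dots> \<in> cball x e"
        using convexD[OF convex_cball, of z x e "?l a" "1 - u" u] \<open>z \<in> _\<close> \<open>?l a \<in> _\<close> u by simp
      finally show ?thesis .
    qed
    have "norm (f (?l a) - f (?l 0)) \<le> M * norm (a - 0)"
    proof (rule field_differentiable_bound[where S="closed_segment 0 a" and f'="\<lambda>t. f1 i (?l t)"])
      show "((\<lambda>t. f (?l t)) has_field_derivative f1 i (?l t)) (at t within closed_segment 0 a)"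
        if "t \<in> closed_segment 0 a" for t
        using has_pd_line[OF f[of "?l t"]] l[OF that] e(2) has_field_derivative_at_within by blast
      show "norm (f1 i (?l t)) \<le> M" if "t \<in> closed_segment 0 a" for t using M l[OF that] by simp
    qed auto
    then show ?thesis by simp
  qed
  \<comment> \<open>The radius \<open>e/3\<close> keeps the corner in the large ball: |x - w| is at
    most |x - z| + |z - y| < e/3 + 2e/3.\<close>
  have "\<bar>f y - f z\<bar> \<le> (2 * M) * norm (y - z) powr 1" if y: "y \<in> ball x (e/3)" and z: "z \<in> ball x (e/3)" for y z
  proof -
    define w where "w = z + (y $ 1 - z $ 1) *\<^sub>R axis 1 1"
    have yw: "y = w + (y $ 2 - z $ 2) *\<^sub>R axis 2 1"
      unfolding w_def by (simp add: vec_eq_iff forall_2 axis_def)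
    have c1: "\<bar>y $ 1 - z $ 1\<bar> \<le> norm (y - z)" "\<bar>y $ 2 - z $ 2\<bar> \<le> norm (y - z)"
      using component_le_norm_cart[of "y - z"] by (metis vector_minus_component)+
    have nyz: "norm (y - z) < 2 * e / 3"
      using y z dist_triangle_lt[of y x z] dist_triangle2[of y z x] by (simp add: dist_norm norm_minus_commute)
    have "norm (w - z) \<le> norm (y - z)" using c1 by (simp add: w_def norm_axis_1)
    then have "norm (x - w) < e" using nyz z norm_triangle_ineq4[of "x - z" "w - z"] by (simp add: dist_norm)
    then have w: "w \<in> cball x e" by (simp add: dist_norm)
    have yz: "y \<in> cball x e" "z \<in> cball x e" using y z e(1) by auto
    have "\<bar>f w - f z\<bar> \<le> M * \<bar>y $ 1 - z $ 1\<bar>" using step[OF yz(2), of "y $ 1 - z $ 1" 1] w by (simp add: w_def)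
    moreover have "\<bar>f y - f w\<bar> \<le> M * \<bar>y $ 2 - z $ 2\<bar>"
      using step[OF w, of "y $ 2 - z $ 2" 2] yz(1) unfolding yw[symmetric] by simp
    moreover have "M * \<bar>y $ 1 - z $ 1\<bar> \<le> M * norm (y - z)" "M * \<bar>y $ 2 - z $ 2\<bar> \<le> M * norm (y - z)"
      using c1 M0 by (auto intro!: mult_left_mono)
    ultimately have "\<bar>f y - f z\<bar> \<le> 2 * M * norm (y - z)" by linarith
    then show ?thesis by (cases "y = z") auto
  qed
  moreover have "ball x (e/3) \<subseteq> S" using e by (auto simp: subset_iff)
  ultimately show "\<exists>r \<gamma> C. 0 < r \<and> 0 < \<gamma> \<and> \<gamma> \<le> 1 \<and> 0 \<le> C \<and> ball x r \<subseteq> S \<and>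
     (\<forall>y\<in>ball x r. \<forall>z\<in>ball x r. \<bar>f y - f z\<bar> \<le> C * norm (y - z) powr \<gamma>)"
    using e(1) M0 by (intro exI[of _ "e/3"] exI[of _ 1] exI[of _ "2 * M"]) auto
qed

context
  fixes \<Omega> :: "pt set" and \<rho> :: "pt \<Rightarrow> real" and B :: real
  assumes om: "open \<Omega>" "bounded \<Omega>" and rm: "\<rho> \<in> borel_measurable (leb \<Omega>)"
    and B: "\<And>q. q \<in> \<Omega> \<Longrightarrow> \<bar>\<rho> q\<bar> \<le> B" and B0: "0 \<le> B"
begin

definition newt where "newt x = (\<integral>q. newton (x - q) * \<rho> q \<partial>leb \<Omega>)"
definition newt1 where "newt1 i x = (\<integral>q. newton1 i (x - q) * \<rho> q \<partial>leb \<Omega>)"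

lemma rho_integrable: "integrable (leb \<Omega>) \<rho>"
  by (rule integrable_bounded_leb[OF om(2,1) rm B])

lemma newton_measurable [measurable]:
  "(\<lambda>q. newton (x - q)) \<in> borel_measurable (leb \<Omega>)" "(\<lambda>q. newton1 i (x - q)) \<in> borel_measurable (leb \<Omega>)"
proof -
  show "(\<lambda>q. newton (x - q)) \<in> borel_measurable (leb \<Omega>)"
    unfolding newton_def by (rule measurable_restrict_space1) measurable
  have [measurable]: "(\<lambda>q. (x - q) $ i) \<in> borel_measurable borel" "(\<lambda>q. (norm (x - q))\<^sup>2) \<in> borel_measurable borel"
    by (intro borel_measurable_continuous_onI continuous_intros)+
  show "(\<lambda>q. newton1 i (x - q)) \<in> borel_measurable (leb \<Omega>)"
    unfolding newton1_def by (rule measurable_restrict_space1) measurable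
qed

lemma gk_measurable [measurable]:
  "(\<lambda>q. gk r (x - q)) \<in> borel_measurable (leb \<Omega>)" "(\<lambda>q. gk1 r i (x - q)) \<in> borel_measurable (leb \<Omega>)"
  "(\<lambda>q. gk2 r i j (x - q)) \<in> borel_measurable (leb \<Omega>)"
  by (rule borel_measurable_leb, rule continuous_on_compose2[OF continuous_gk(1)], auto intro!: continuous_intros)
     (rule borel_measurable_leb, rule continuous_on_compose2[OF continuous_gk(2)], auto intro!: continuous_intros,
      rule borel_measurable_leb, rule continuous_on_compose2[OF continuous_gk(3)], auto intro!: continuous_intros)

text \<open>The rate \<open>K * r\<close> is uniform in the point, for the kernel and for its
  gradient, so the potential is C1 as a uniform limit of smooth ones.\<close>

lemma newton_approx:
  "\<exists>K\<ge>0. \<forall>r x i. 0 < r \<and> r \<le> 1 \<longrightarrow>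
     \<bar>(\<integral>q. gk r (x - q) * \<rho> q \<partial>leb \<Omega>) - newt x\<bar> \<le> K * r \<and> \<bar>(\<integral>q. gk1 r i (x - q) * \<rho> q \<partial>leb \<Omega>) - newt1 i x\<bar> \<le> K * r
     \<and> integrable (leb \<Omega>) (\<lambda>q. newton (x - q) * \<rho> q)"
proof -
  obtain K where K: "K \<ge> 0" "\<And>\<Omega> x r c g. open \<Omega> \<Longrightarrow> 0 < r \<Longrightarrow> 0 \<le> c \<Longrightarrow> g \<in> borel_measurable (leb \<Omega>) \<Longrightarrow>
     (\<forall>q\<in>\<Omega>. q \<noteq> x \<longrightarrow> \<bar>g q\<bar> \<le> c * norm (x - q) powr - 1 * indicator (ball x r) q) \<Longrightarrow>
     integrable (leb \<Omega>) g \<and> \<bar>\<integral>q. g q \<partial>leb \<Omega>\<bar> \<le> c * (K * r powr (2 - 1))"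
    using integral_near_bound[of 1] by auto
  have ind: "indicator (ball 0 r) (x - q) = (indicator (ball x r) q :: real)" for r and x q :: pt
    by (auto simp: indicator_def dist_norm norm_minus_commute)
  have est: "integrable (leb \<Omega>) (\<lambda>q. (k (x - q) - k' (x - q)) * \<rho> q) \<and>
      \<bar>\<integral>q. (k (x - q) - k' (x - q)) * \<rho> q \<partial>leb \<Omega>\<bar> \<le> (c * B) * (K * r powr (2 - 1))"
    if "0 < r" "0 \<le> c" and [measurable]: "(\<lambda>q. k (x - q)) \<in> borel_measurable (leb \<Omega>)" "(\<lambda>q. k' (x - q)) \<in> borel_measurable (leb \<Omega>)"
      and b: "\<And>z. z \<noteq> 0 \<Longrightarrow> \<bar>k z - k' z\<bar> \<le> c * norm z powr - 1 * indicator (ball 0 r) z"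
    for k k' :: "pt \<Rightarrow> real" and c r x
  proof (rule K(2)[OF om(1) that(1)])
    show "(\<lambda>q. (k (x - q) - k' (x - q)) * \<rho> q) \<in> borel_measurable (leb \<Omega>)" using rm by measurable
    show "\<forall>q\<in>\<Omega>. q \<noteq> x \<longrightarrow> \<bar>(k (x - q) - k' (x - q)) * \<rho> q\<bar> \<le> c * B * norm (x - q) powr - 1 * indicator (ball x r) q"
    proof (intro ballI impI)
      fix q assume q: "q \<in> \<Omega>" "q \<noteq> x"
      have "\<bar>(k (x - q) - k' (x - q)) * \<rho> q\<bar> \<le> (c * norm (x - q) powr - 1 * indicator (ball x r) q) * B"
        unfolding abs_mult using b[of "x - q"] B[OF q(1)] q \<open>0 \<le> c\<close> by (intro mult_mono) (auto simp: ind)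
      then show "\<bar>(k (x - q) - k' (x - q)) * \<rho> q\<bar> \<le> c * B * norm (x - q) powr - 1 * indicator (ball x r) q"
        by (simp add: mult_ac)
    qed
  qed (use that B0 in auto)
  have "\<bar>(\<integral>q. gk r (x - q) * \<rho> q \<partial>leb \<Omega>) - newt x\<bar> \<le> (2 * B * K) * r \<and> \<bar>(\<integral>q. gk1 r i (x - q) * \<rho> q \<partial>leb \<Omega>) - newt1 i x\<bar> \<le> (2 * B * K) * r
     \<and> integrable (leb \<Omega>) (\<lambda>q. newton (x - q) * \<rho> q)"
    if r: "0 < r" "r \<le> 1" for r x i
  proof -
    have e0: "integrable (leb \<Omega>) (\<lambda>q. (gk r (x - q) - newton (x - q)) * \<rho> q) \<and>
      \<bar>\<integral>q. (gk r (x - q) - newton (x - q)) * \<rho> q \<partial>leb \<Omega>\<bar> \<le> (1 * B) * (K * r powr (2 - 1))"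
      by (rule est) (use r gk_newton[OF r] in auto)
    have e1: "integrable (leb \<Omega>) (\<lambda>q. (gk1 r i (x - q) - newton1 i (x - q)) * \<rho> q) \<and>
      \<bar>\<integral>q. (gk1 r i (x - q) - newton1 i (x - q)) * \<rho> q \<partial>leb \<Omega>\<bar> \<le> (2 * B) * (K * r powr (2 - 1))"
      by (rule est) (use r gk1_newton[OF r(1)] in auto)
    note g0 = conv_integrable[OF om rho_integrable continuous_gk(1)[of UNIV r], of x]
    note g1 = conv_integrable[OF om rho_integrable continuous_gk(2)[of UNIV r i], of x]
    have n0: "integrable (leb \<Omega>) (\<lambda>q. newton (x - q) * \<rho> q)"
      using Bochner_Integration.integrable_diff[OF g0 conjunct1[OF e0]] by (simp add: algebra_simps)
    have n1: "integrable (leb \<Omega>) (\<lambda>q. newton1 i (x - q) * \<rho> q)"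
      using Bochner_Integration.integrable_diff[OF g1 conjunct1[OF e1]] by (simp add: algebra_simps)
    have "(\<integral>q. (gk r (x - q) - newton (x - q)) * \<rho> q \<partial>leb \<Omega>) = (\<integral>q. gk r (x - q) * \<rho> q \<partial>leb \<Omega>) - newt x"
      unfolding newt_def left_diff_distrib by (rule Bochner_Integration.integral_diff[OF g0 n0])
    moreover have "(\<integral>q. (gk1 r i (x - q) - newton1 i (x - q)) * \<rho> q \<partial>leb \<Omega>) = (\<integral>q. gk1 r i (x - q) * \<rho> q \<partial>leb \<Omega>) - newt1 i x"
      unfolding newt1_def left_diff_distrib by (rule Bochner_Integration.integral_diff[OF g1 n1])
    moreover have "(1 * B) * (K * r powr (2 - 1)) \<le> (2 * B * K) * r" "(2 * B) * (K * r powr (2 - 1)) = (2 * B * K) * r"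
      using r B0 K(1) by auto
    ultimately show ?thesis using e0 e1 n0 by linarith
  qed
  moreover have "2 * B * K \<ge> 0" using B0 K(1) by simp
  ultimately show ?thesis by blast
qed

lemma newt_C1:
  "has_pd i newt x (newt1 i x)" "continuous_on S newt" "continuous_on S (newt1 i)"
  "integrable (leb \<Omega>) (\<lambda>q. newton (x - q) * \<rho> q)"
proof -
  obtain K where K: "K \<ge> 0" "\<And>r x i. 0 < r \<Longrightarrow> r \<le> 1 \<Longrightarrow>
     \<bar>(\<integral>q. gk r (x - q) * \<rho> q \<partial>leb \<Omega>) - newt x\<bar> \<le> K * r \<and> \<bar>(\<integral>q. gk1 r i (x - q) * \<rho> q \<partial>leb \<Omega>) - newt1 i x\<bar> \<le> K * r
     \<and> integrable (leb \<Omega>) (\<lambda>q. newton (x - q) * \<rho> q)"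
    using newton_approx by blast
  define r where "r n = inverse (real (Suc n))" for n
  have r: "0 < r n" "r n \<le> 1" for n unfolding r_def by (auto simp: field_simps)
  have rl: "(\<lambda>n. K * r n) \<longlonglongrightarrow> 0"
    unfolding r_def by (rule tendsto_mult_right_zero) (rule LIMSEQ_inverse_real_of_nat)
  have ul: "uniform_limit UNIV f g sequentially" if "\<And>n x. \<bar>f n x - g x\<bar> \<le> K * r n" for f :: "nat \<Rightarrow> pt \<Rightarrow> real" and g
  proof (rule uniform_limitI)
    fix e :: real assume "e > 0"
    have "\<forall>\<^sub>F n in sequentially. K * r n < e" using order_tendstoD(2)[OF rl \<open>e > 0\<close>] .
    then show "\<forall>\<^sub>F n in sequentially. \<forall>x\<in>UNIV. dist (f n x) (g x) < e"
      by eventually_elim (use that in \<open>auto simp: dist_real_def intro: le_less_trans\<close>)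
  qed
  have u0: "uniform_limit UNIV (\<lambda>n x. \<integral>q. gk (r n) (x - q) * \<rho> q \<partial>leb \<Omega>) newt sequentially"
    by (rule ul) (use K(2)[OF r] in blast)
  have u1: "uniform_limit UNIV (\<lambda>n x. \<integral>q. gk1 (r n) i (x - q) * \<rho> q \<partial>leb \<Omega>) (newt1 i) sequentially" for i
    by (rule ul) (use K(2)[OF r] in blast)
  show "integrable (leb \<Omega>) (\<lambda>q. newton (x - q) * \<rho> q)" using K(2)[of 1] by auto
  have "continuous_on UNIV newt"
    by (rule uniform_limit_theorem[OF _ u0]) (auto intro!: always_eventually conv_continuous[OF om rho_integrable] continuous_gk)
  then show "continuous_on S newt" by (rule continuous_on_subset) auto
  have "continuous_on UNIV (newt1 i)"
    by (rule uniform_limit_theorem[OF _ u1]) (auto intro!: always_eventually conv_continuous[OF om rho_integrable] continuous_gk)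
  then show "continuous_on S (newt1 i)" by (rule continuous_on_subset) auto
  show "has_pd i newt x (newt1 i x)"
    by (rule has_pd_uniform_limit[OF open_UNIV UNIV_I _ _ u1])
      (auto intro!: conv_pd[OF om rho_integrable] continuous_gk has_pd_gk tendsto_uniform_limitI[OF u0])
qed

text \<open>The second derivatives of the kernel are not integrable. The second derivatives of the
  regularised potentials still form a uniform Cauchy sequence: the difference of two kernels
  integrates to 0, so \<open>\<rho> q\<close> may be replaced by \<open>\<rho> q - \<rho> x\<close>,
  and Hoelder continuity makes the singularity integrable.\<close>

lemma newt_C2_local:
  assumes "loc_holder \<Omega> \<rho>" "x0 \<in> \<Omega>"
  shows "\<exists>U. open U \<and> x0 \<in> U \<and> Ck 2 U newt \<and> (\<forall>x\<in>U. laplacian newt x = - \<rho> x)"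
proof -
  obtain R \<gamma> H where R: "0 < R" "0 < \<gamma>" "\<gamma> \<le> 1" "0 \<le> H" "ball x0 R \<subseteq> \<Omega>"
    and H: "\<And>y z. y \<in> ball x0 R \<Longrightarrow> z \<in> ball x0 R \<Longrightarrow> \<bar>\<rho> y - \<rho> z\<bar> \<le> H * norm (y - z) powr \<gamma>"
    using assms unfolding loc_holder_def by metis
  define U where "U = ball x0 (R / 2)"
  \<comment> \<open>The bound 1 is required by \<open>newton_approx\<close>; \<open>R / 4\<close>
    keeps discs around points of the half-size ball \<open>U\<close> inside the ball where the
    Hoelder estimate holds.\<close>
  define r where "r n = min 1 (R / 4) * inverse (real (Suc n))" for n
  have r0: "0 < r n" for n using R by (simp add: r_def)
  have r1: "r n \<le> min 1 (R/4)" for n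
    unfolding r_def using R by (intro mult_left_le) (auto simp: field_simps)
  have rdec: "r m \<le> r n" if "n \<le> m" for m n
    unfolding r_def using R that by (intro mult_left_mono le_imp_inverse_le) auto
  have rl: "r \<longlonglongrightarrow> 0" unfolding r_def by (rule tendsto_mult_right_zero) (rule LIMSEQ_inverse_real_of_nat)
  have rpl: "(\<lambda>n. c * r n powr \<gamma>) \<longlonglongrightarrow> 0" for c
    using tendsto_zero_powrI[OF rl tendsto_const[of \<gamma>]] R(2) r0 by (intro tendsto_mult_right_zero) (auto simp: less_imp_le)
  have sub: "cball x (r n) \<subseteq> ball x0 R" if "x \<in> U" for x n
  proof
    fix y assume "y \<in> cball x (r n)"
    then have "dist x y \<le> R / 4" using r1[of n] by simp
    moreover have "dist x0 x < R / 2" using that by (simp add: U_def)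
    ultimately show "y \<in> ball x0 R" using dist_triangle[of x0 y x] R(1) unfolding mem_ball by linarith
  qed
  obtain K where K: "K \<ge> 0" "\<And>\<Omega> x r c g. open \<Omega> \<Longrightarrow> 0 < r \<Longrightarrow> 0 \<le> c \<Longrightarrow> g \<in> borel_measurable (leb \<Omega>) \<Longrightarrow>
     (\<forall>q\<in>\<Omega>. q \<noteq> x \<longrightarrow> \<bar>g q\<bar> \<le> c * norm (x - q) powr - (2 - \<gamma>) * indicator (ball x r) q) \<Longrightarrow>
     integrable (leb \<Omega>) g \<and> \<bar>\<integral>q. g q \<partial>leb \<Omega>\<bar> \<le> c * (K * r powr (2 - (2 - \<gamma>)))"
    using integral_near_bound[of "2 - \<gamma>"] R by auto
  define N2 where "N2 i j n x = (\<integral>q. gk2 (r n) i j (x - q) * \<rho> q \<partial>leb \<Omega>)" for i j n x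
  have cauchy: "\<bar>N2 i j n x - N2 i j m x\<bar> \<le> (6 * H * K) * r n powr \<gamma>" if x: "x \<in> U" and nm: "n \<le> m" for i j n m x
  proof -
    define d where "d q = gk2 (r n) i j (x - q) - gk2 (r m) i j (x - q)" for q
    define g where "g q = d q * (\<rho> q - \<rho> x)" for q
    have cs: "cball x (r n) \<subseteq> \<Omega>" using sub[OF x] R(5) by blast
    have c: "continuous_on \<Omega> (\<lambda>q. k (x - q))" if "continuous_on UNIV k" for k :: "pt \<Rightarrow> real"
      by (rule continuous_on_compose2[OF that]) (auto intro!: continuous_intros)
    let ?F = "\<lambda>q. gk1 (r m) i (x - q) - gk1 (r n) i (x - q)"
    \<comment> \<open>\<open>d\<close> is a partial derivative of a function that vanishes outside
      the disc of radius \<open>r n\<close>, because the two gradients coincide there.\<close>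
    have D: "integrable (leb \<Omega>) d" "(\<integral>q. d q \<partial>leb \<Omega>) = 0"
    proof -
      have 1: "continuous_on \<Omega> ?F" "continuous_on \<Omega> d"
        unfolding d_def by (intro continuous_intros c continuous_gk)+
      have 2: "has_pd j ?F q (d q)" for q
        using has_pd_diff[OF has_pd_reflect[OF has_pd_gk1[of j "r m" i "x - q"]] has_pd_reflect[OF has_pd_gk1[of j "r n" i "x - q"]]]
        by (simp add: d_def)
      have 3: "?F q = 0" if "q \<in> \<Omega> - cball x (r n)" for q
        using that gk1_far[OF r0[of m], of "x - q" i] gk1_far[OF r0[of n], of "x - q" i] rdec[OF nm] by (simp add: dist_norm)
      show "integrable (leb \<Omega>) d" "(\<integral>q. d q \<partial>leb \<Omega>) = 0"
        using integral_pd_zero[OF om(1) compact_cball cs 1 2 3] by blast+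
    qed
    have dr: "integrable (leb \<Omega>) (\<lambda>q. d q * \<rho> q)" and "(\<integral>q. d q * \<rho> q \<partial>leb \<Omega>) = N2 i j n x - N2 i j m x"
      unfolding d_def N2_def left_diff_distrib
      using conv_integrable[OF om rho_integrable continuous_gk(3)] by auto
    then have eq: "N2 i j n x - N2 i j m x = (\<integral>q. g q \<partial>leb \<Omega>)"
      unfolding g_def right_diff_distrib using D by simp
    have "integrable (leb \<Omega>) g \<and> \<bar>\<integral>q. g q \<partial>leb \<Omega>\<bar> \<le> (6 * H) * (K * r n powr (2 - (2 - \<gamma>)))"
    proof (rule K(2)[OF om(1) r0])
      show "g \<in> borel_measurable (leb \<Omega>)" unfolding g_def d_def using rm by measurable
      show "\<forall>q\<in>\<Omega>. q \<noteq> x \<longrightarrow> \<bar>g q\<bar> \<le> 6 * H * norm (x - q) powr - (2 - \<gamma>) * indicator (ball x (r n)) q"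
      proof (intro ballI impI)
        fix q assume q: "q \<in> \<Omega>" "q \<noteq> x"
        have "\<bar>d q\<bar> \<le> 6 * norm (x - q) powr - 2 * indicator (ball 0 (r n)) (x - q)"
          unfolding d_def by (rule gk2_diff[OF r0 rdec[OF nm]]) (use q in simp)
        moreover have "indicator (ball 0 (r n)) (x - q) = (indicator (ball x (r n)) q :: real)"
          by (auto simp: indicator_def dist_norm norm_minus_commute)
        ultimately have db: "\<bar>d q\<bar> \<le> 6 * norm (x - q) powr - 2 * indicator (ball x (r n)) q" by simp
        show "\<bar>g q\<bar> \<le> 6 * H * norm (x - q) powr - (2 - \<gamma>) * indicator (ball x (r n)) q"
        proof (cases "q \<in> ball x (r n)")
          case True
          then have "q \<in> ball x0 R" "x \<in> ball x0 R" using sub[OF x, of n] r0[of n] by (auto simp: subset_iff less_imp_le)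
          then have "\<bar>\<rho> q - \<rho> x\<bar> \<le> H * norm (x - q) powr \<gamma>" using H[of q x] by (simp add: norm_minus_commute)
          then have "\<bar>g q\<bar> \<le> (6 * norm (x - q) powr - 2) * (H * norm (x - q) powr \<gamma>)"
            unfolding g_def abs_mult using db True by (intro mult_mono) auto
          also have "\<dots> = 6 * H * (norm (x - q) powr - 2 * norm (x - q) powr \<gamma>)" by simp
          also have "norm (x - q) powr - 2 * norm (x - q) powr \<gamma> = norm (x - q) powr - (2 - \<gamma>)"
            unfolding powr_add[symmetric] by simp
          finally show ?thesis using True by simp
        next
          case False
          then show ?thesis using db by (simp add: g_def)
        qed
      qed
    qed (use R in auto)
    then show ?thesis unfolding eq by (simp add: mult_ac)
  qed
  have "\<exists>D. uniform_limit U (N2 i j) D sequentially" for i j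
  proof -
    have "uniformly_Cauchy_on U (N2 i j)"
      unfolding uniformly_Cauchy_on_def
    proof (intro allI impI)
      fix e :: real assume "e > 0"
      then have "\<forall>\<^sub>F n in sequentially. (6 * H * K) * r n powr \<gamma> < e / 2" by (intro order_tendstoD(2)[OF rpl]) simp
      then obtain M where M: "(6 * H * K) * r M powr \<gamma> < e / 2" unfolding eventually_sequentially by blast
      have "dist (N2 i j m x) (N2 i j n x) < e" if "x \<in> U" "m \<ge> M" "n \<ge> M" for x m n
        using cauchy[OF that(1,2), of i j] cauchy[OF that(1,3), of i j] M unfolding dist_real_def by linarith
      then show "\<exists>M. \<forall>x\<in>U. \<forall>m\<ge>M. \<forall>n\<ge>M. dist (N2 i j m x) (N2 i j n x) < e" by blast
    qed
    then have "uniformly_convergent_on U (N2 i j)" by (rule Cauchy_uniformly_convergent)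
    then show ?thesis unfolding uniformly_convergent_on_def .
  qed
  then obtain D where D: "\<And>i j. uniform_limit U (N2 i j) (D i j) sequentially" by metis
  have oU: "open U" "x0 \<in> U" "U \<subseteq> \<Omega>" using R by (auto simp: U_def subset_iff)
  have cD: "continuous_on U (D i j)" for i j
    by (rule uniform_limit_theorem[OF _ D]) (auto simp: N2_def[abs_def] intro!: always_eventually conv_continuous[OF om rho_integrable] continuous_gk)
  obtain K' where K': "K' \<ge> 0" "\<And>r x i. 0 < r \<Longrightarrow> r \<le> 1 \<Longrightarrow>
     \<bar>(\<integral>q. gk r (x - q) * \<rho> q \<partial>leb \<Omega>) - newt x\<bar> \<le> K' * r \<and> \<bar>(\<integral>q. gk1 r i (x - q) * \<rho> q \<partial>leb \<Omega>) - newt1 i x\<bar> \<le> K' * r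
     \<and> integrable (leb \<Omega>) (\<lambda>q. newton (x - q) * \<rho> q)"
    using newton_approx by blast
  have d2: "has_pd j (newt1 i) x (D i j x)" if "x \<in> U" for i j x
  proof (rule has_pd_uniform_limit[OF oU(1) that _ _ D])
    show "has_pd j (\<lambda>x. \<integral>q. gk1 (r n) i (x - q) * \<rho> q \<partial>leb \<Omega>) y (N2 i j n y)" for n y
      unfolding N2_def by (rule conv_pd[OF om rho_integrable]) (rule continuous_gk has_pd_gk1)+
    show "(\<lambda>n. \<integral>q. gk1 (r n) i (y - q) * \<rho> q \<partial>leb \<Omega>) \<longlonglongrightarrow> newt1 i y" for y
    proof (rule LIMSEQ_I)
      fix e :: real assume "e > 0"
      have "(\<lambda>n. K' * r n) \<longlonglongrightarrow> 0" using rl by (rule tendsto_mult_right_zero)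
      then have "\<forall>\<^sub>F n in sequentially. K' * r n < e" using \<open>e > 0\<close> by (rule order_tendstoD(2))
      then obtain M where M: "\<And>n. n \<ge> M \<Longrightarrow> K' * r n < e" unfolding eventually_sequentially by blast
      have "norm ((\<integral>q. gk1 (r n) i (y - q) * \<rho> q \<partial>leb \<Omega>) - newt1 i y) < e" if "n \<ge> M" for n
        using K'(2)[OF r0[of n], of y i] r1[of n] M[OF that] by auto
      then show "\<exists>no. \<forall>n\<ge>no. norm ((\<integral>q. gk1 (r n) i (y - q) * \<rho> q \<partial>leb \<Omega>) - newt1 i y) < e" by blast
    qed
  qed
  note C2 = Ck2I[OF oU(1) newt_C1(2) newt_C1(1) newt_C1(3) d2 cD]
  have "laplacian newt x = - \<rho> x" if x: "x \<in> U" for x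
  proof -
    have "(\<lambda>n. \<Sum>i\<in>UNIV. N2 i i n x) \<longlonglongrightarrow> (\<Sum>i\<in>UNIV. D i i x)"
      by (intro tendsto_sum tendsto_uniform_limitI[OF D] x)
    moreover have "(\<lambda>n. \<Sum>i\<in>UNIV. N2 i i n x) \<longlonglongrightarrow> - \<rho> x"
    proof -
      \<comment> \<open>The trace of the second derivatives of the kernel is minus a mollifier, so
        the Laplacians are mollifications of \<open>- \<rho>\<close> and converge at the Hoelder
        rate.\<close>
      have "\<bar>(\<Sum>i\<in>UNIV. N2 i i n x) - (- \<rho> x)\<bar> \<le> H * r n powr \<gamma>" for n
      proof -
        have "(\<Sum>i\<in>UNIV. N2 i i n x) = (\<integral>q. (\<Sum>i\<in>UNIV. gk2 (r n) i i (x - q) * \<rho> q) \<partial>leb \<Omega>)"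
          unfolding N2_def using conv_integrable[OF om rho_integrable continuous_gk(3)] by (intro Bochner_Integration.integral_sum[symmetric]) auto
        also have "\<dots> = (\<integral>q. - (\<rho> q * mollifier (r n) (x - q)) \<partial>leb \<Omega>)"
          unfolding sum_distrib_right[symmetric] sum_gk2[OF r0] by (simp add: mult.commute)
        also have "\<dots> = - (\<integral>q. \<rho> q * mollifier (r n) (x - q) \<partial>leb \<Omega>)" by simp
        finally have e: "(\<Sum>i\<in>UNIV. N2 i i n x) = - (\<integral>q. \<rho> q * mollifier (r n) (x - q) \<partial>leb \<Omega>)" .
        have "\<bar>(\<integral>q. \<rho> q * mollifier (r n) (x - q) \<partial>leb \<Omega>) - \<rho> x\<bar> \<le> H * r n powr \<gamma>"
        proof (rule mollifier_approx[OF om(1) r0])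
          show "ball x (r n) \<subseteq> \<Omega>" using sub[OF x, of n] R(5) ball_subset_cball by blast
          show "integrable (leb \<Omega>) (\<lambda>y. \<rho> y * mollifier (r n) (x - y))"
            using conv_integrable[OF om rho_integrable continuous_mollifier(1)[of UNIV "r n"], of x] by (simp add: mult.commute)
          show "\<bar>\<rho> y - \<rho> x\<bar> \<le> H * r n powr \<gamma>" if y: "y \<in> ball x (r n)" for y
          proof -
            have "y \<in> ball x0 R" "x \<in> ball x0 R" using y sub[OF x, of n] r0[of n] by (auto simp: subset_iff less_imp_le)
            then have "\<bar>\<rho> y - \<rho> x\<bar> \<le> H * norm (y - x) powr \<gamma>" by (rule H)
            also have "\<dots> \<le> H * r n powr \<gamma>"
              using y R by (intro mult_left_mono powr_mono2) (auto simp: dist_norm norm_minus_commute)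
            finally show ?thesis .
          qed
        qed (use R in auto)
        then show ?thesis unfolding e by linarith
      qed
      then have "(\<lambda>n. (\<Sum>i\<in>UNIV. N2 i i n x) - (- \<rho> x)) \<longlonglongrightarrow> 0"
        by (intro Lim_null_comparison[OF always_eventually rpl[of H]]) auto
      then show ?thesis by (simp only: LIM_zero_iff)
    qed
    ultimately have "(\<Sum>i\<in>UNIV. D i i x) = - \<rho> x" by (rule LIMSEQ_unique)
    then show ?thesis using C2(4)[OF _ x] by simp
  qed
  then show ?thesis using C2(1) oU by blast
qed

lemma newt_C2:
  assumes "loc_holder \<Omega> \<rho>"
  shows "Ck 2 \<Omega> newt" "x \<in> \<Omega> \<Longrightarrow> laplacian newt x = - \<rho> x"
proof -
  show "Ck 2 \<Omega> newt" by (rule Ck2_local[OF om(1)]) (use newt_C2_local[OF assms] in blast)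
  show "x \<in> \<Omega> \<Longrightarrow> laplacian newt x = - \<rho> x" using newt_C2_local[OF assms] by blast
qed

end

subsection \<open>The Green operator\<close>

text \<open>Bounded second moments give uniform integrability: below a level \<open>A\<close>
  dominated convergence applies, and above it |f - g| is at most |f - g|^2 / A.\<close>

lemma L1_convergence_of_L2_bounded:
  fixes f :: "nat \<Rightarrow> 'a \<Rightarrow> real"
  assumes "finite_measure M" and m: "\<And>n. f n \<in> borel_measurable M" "g \<in> borel_measurable M"
    and lim: "AE x in M. (\<lambda>n. f n x) \<longlonglongrightarrow> g x"
    and sq: "\<And>n. integrable M (\<lambda>x. (f n x)\<^sup>2)" "\<And>n. (\<integral>x. (f n x)\<^sup>2 \<partial>M) \<le> C"
      "integrable M (\<lambda>x. (g x)\<^sup>2)" "(\<integral>x. (g x)\<^sup>2 \<partial>M) \<le> C"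
  shows "(\<lambda>n. \<integral>x. \<bar>f n x - g x\<bar> \<partial>M) \<longlonglongrightarrow> 0"
proof (rule LIMSEQ_I)
  interpret finite_measure M by fact
  fix e :: real assume "e > 0"
  have C0: "C \<ge> 0" by (rule order_trans[OF _ sq(4)]) simp
  \<comment> \<open>Makes the tail \<open>4 * C / A\<close> smaller than \<open>e / 2\<close>; the 1
    covers \<open>C = 0\<close>.\<close>
  define A where "A = (8 * C + 1) / e"
  have A: "A > 0" "4 * C / A < e / 2" using \<open>e > 0\<close> C0 by (auto simp: A_def field_simps)
  have "(\<lambda>n. \<integral>x. min \<bar>f n x - g x\<bar> A \<partial>M) \<longlonglongrightarrow> (\<integral>x. 0 \<partial>M)"
  proof (rule integral_dominated_convergence[where w="\<lambda>x. A"])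
    show "AE x in M. (\<lambda>n. min \<bar>f n x - g x\<bar> A) \<longlonglongrightarrow> 0"
      using lim
    proof eventually_elim
      case (elim x)
      have "(\<lambda>n. min \<bar>f n x - g x\<bar> A) \<longlonglongrightarrow> min \<bar>g x - g x\<bar> A" by (intro tendsto_intros elim)
      then show ?case using A by simp
    qed
  qed (use m A in auto)
  then have "(\<lambda>n. \<integral>x. min \<bar>f n x - g x\<bar> A \<partial>M) \<longlonglongrightarrow> 0" by simp
  from LIMSEQ_D[OF this, of "e/2"] obtain N where N: "\<And>n. n \<ge> N \<Longrightarrow> \<bar>\<integral>x. min \<bar>f n x - g x\<bar> A \<partial>M\<bar> < e / 2"
    using \<open>e > 0\<close> by auto
  have "\<bar>\<integral>x. \<bar>f n x - g x\<bar> \<partial>M\<bar> < e" if n: "n \<ge> N" for n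
  proof -
    have imin: "integrable M (\<lambda>x. min \<bar>f n x - g x\<bar> A)"
      by (rule integrable_const_bound[of _ A]) (use m A in auto)
    have isq: "integrable M (\<lambda>x. 2 / A * ((f n x)\<^sup>2 + (g x)\<^sup>2))" using sq by simp
    have pw: "\<bar>f n x - g x\<bar> \<le> min \<bar>f n x - g x\<bar> A + 2 / A * ((f n x)\<^sup>2 + (g x)\<^sup>2)" for x
    proof (cases "\<bar>f n x - g x\<bar> \<le> A")
      case False
      have "A * \<bar>f n x - g x\<bar> \<le> \<bar>f n x - g x\<bar> * \<bar>f n x - g x\<bar>" using False by (intro mult_right_mono) auto
      also have "\<dots> = (f n x - g x)\<^sup>2" by (simp add: power2_eq_square)
      also have "\<dots> \<le> 2 * ((f n x)\<^sup>2 + (g x)\<^sup>2)"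
        using sum_squares_bound[of "f n x" "- g x"] by (simp add: power2_eq_square algebra_simps)
      finally have "\<bar>f n x - g x\<bar> \<le> 2 / A * ((f n x)\<^sup>2 + (g x)\<^sup>2)" using A by (simp add: field_simps)
      then show ?thesis using A by (simp add: min_def)
    qed (use A in \<open>auto intro!: mult_nonneg_nonneg\<close>)
    have "integrable M (\<lambda>x. \<bar>f n x - g x\<bar>)"
      by (rule Bochner_Integration.integrable_bound[OF Bochner_Integration.integrable_add[OF imin isq]])
        (use m pw in \<open>auto intro!: AE_I2 order_trans[OF pw]\<close>)
    then have "(\<integral>x. \<bar>f n x - g x\<bar> \<partial>M) \<le> (\<integral>x. min \<bar>f n x - g x\<bar> A + 2 / A * ((f n x)\<^sup>2 + (g x)\<^sup>2) \<partial>M)"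
      using imin isq pw by (intro integral_mono) auto
    also have "\<dots> = (\<integral>x. min \<bar>f n x - g x\<bar> A \<partial>M) + 2 / A * ((\<integral>x. (f n x)\<^sup>2 \<partial>M) + (\<integral>x. (g x)\<^sup>2 \<partial>M))"
      using imin isq sq by simp
    also have "\<dots> \<le> (\<integral>x. min \<bar>f n x - g x\<bar> A \<partial>M) + 2 / A * (C + C)"
      using sq A by (intro add_left_mono mult_left_mono add_mono) auto
    also have "\<dots> < e / 2 + e / 2" using N[OF n] A by (intro add_strict_mono) auto
    finally show ?thesis by simp
  qed
  then show "\<exists>no. \<forall>n\<ge>no. norm ((\<integral>x. \<bar>f n x - g x\<bar> \<partial>M) - 0) < e" by auto
qed

section \<open>Pointwise estimates for the Green function and its regular part\<close>

locale green_domain =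
  fixes \<Omega> :: "pt set" and H :: "pt \<Rightarrow> pt \<Rightarrow> real"
  assumes om: "open \<Omega>" "bounded \<Omega>" "\<Omega> \<noteq> {}"
    and H_harm: "\<And>q. q \<in> \<Omega> \<Longrightarrow> harmonic_on \<Omega> (H q)"
    and H_cont: "\<And>q. q \<in> \<Omega> \<Longrightarrow> continuous_on (closure \<Omega>) (H q)"
    and H_bdry: "\<And>q z. q \<in> \<Omega> \<Longrightarrow> z \<in> frontier \<Omega> \<Longrightarrow> H q z = - newton (z - q)"
begin

text \<open>The Green function with pole \<open>q\<close>. Its value at \<open>x = q\<close> is an
  artefact of \<open>ln 0\<close>, so the estimates exclude the pole, which is a null set under the
  integrals.\<close>

definition K :: "pt \<Rightarrow> pt \<Rightarrow> real" where "K q x = newton (x - q) + H q x"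
text \<open>The added 1 makes \<open>D\<close> positive and \<open>ln D\<close> nonnegative.\<close>

definition D :: real where "D = 1 + diameter (closure \<Omega>)"

lemma D_ge1: "D \<ge> 1"
  unfolding D_def using diameter_ge_0[OF bounded_closure[OF om(2)]] by simp

lemma norm_le_D: "x \<in> closure \<Omega> \<Longrightarrow> y \<in> closure \<Omega> \<Longrightarrow> norm (x - y) \<le> D"
  unfolding D_def using diameter_bounded_bound[of "closure \<Omega>" x y] bounded_closure[OF om(2)] by (simp add: dist_norm)

lemma in_closure: "x \<in> \<Omega> \<Longrightarrow> x \<in> closure \<Omega>"
  using closure_subset by blast

lemma om_borel: "\<Omega> \<in> sets borel" using om(1) by auto

lemma finite_leb_om: "finite_measure (leb \<Omega>)" using finite_leb[OF om(2,1)] .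

lemma H_C2: "q \<in> \<Omega> \<Longrightarrow> Ck 2 \<Omega> (H q)" "q \<in> \<Omega> \<Longrightarrow> x \<in> \<Omega> \<Longrightarrow> laplacian (H q) x = 0"
  using H_harm unfolding harmonic_on_def by auto

lemma frontier_not_in: "z \<in> frontier \<Omega> \<Longrightarrow> z \<notin> \<Omega>"
  using om(1) by (simp add: frontier_def interior_open)

lemma frontier_in_closure: "z \<in> frontier \<Omega> \<Longrightarrow> z \<in> closure \<Omega>"
  by (simp add: frontier_def)

text \<open>On the boundary \<open>H q\<close> equals ln |z - q| / (2 \<pi>), and the maximum
  principle carries the bound inside.\<close>

lemma H_upper: assumes "q \<in> \<Omega>" "x \<in> closure \<Omega>" shows "H q x \<le> ln D / (2 * pi)"
proof (rule maximum_principle[OF om(1,2) H_C2(1)[OF assms(1)] H_cont[OF assms(1)] _ _ assms(2)])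
  show "laplacian (H q) x \<ge> 0" if "x \<in> \<Omega>" for x using H_C2(2)[OF assms(1) that] by simp
  fix z assume z: "z \<in> frontier \<Omega>"
  have "z \<noteq> q" using z frontier_not_in assms(1) by blast
  then have "ln (norm (z - q)) \<le> ln D"
    using norm_le_D[OF frontier_in_closure[OF z] in_closure[OF assms(1)]] D_ge1 by (subst ln_le_cancel_iff) auto
  then show "H q z \<le> ln D / (2 * pi)" unfolding H_bdry[OF assms(1) z] newton_def by (simp add: divide_right_mono)
qed

text \<open>The pole prevents a direct use of the maximum principle. It is removed by
  \<open>gk r\<close>, which is superharmonic, agrees with the singular kernel beyond distance
  \<open>r\<close>, and hence also at \<open>x\<close> and on the boundary.\<close>

lemma K_nonneg: assumes "q \<in> \<Omega>" "x \<in> closure \<Omega>" "x \<noteq> q" shows "K q x \<ge> 0"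
proof -
  obtain e where e: "e > 0" "cball q e \<subseteq> \<Omega>" using assms(1) om(1) open_contains_cball by blast
  define r where "r = min e (norm (x - q))"
  have r: "0 < r" "r \<le> norm (x - q)" "cball q r \<subseteq> \<Omega>" using e assms(3) by (auto simp: r_def subset_iff)
  let ?w = "\<lambda>y. (- 1) * H q y + (- 1) * gk r (y - q)"
  have "?w x \<le> 0"
  proof (rule maximum_principle[OF om(1,2) _ _ _ _ assms(2)])
    show "Ck 2 \<Omega> ?w" by (intro Ck2_lin om(1) H_C2 assms gk_C2)
    show "continuous_on (closure \<Omega>) ?w"
      by (intro continuous_intros H_cont assms continuous_on_compose2[OF continuous_gk(1)[of UNIV]]) auto
    show "laplacian ?w y \<ge> 0" if "y \<in> \<Omega>" for y
    proof -
      have "laplacian ?w y = (-1) * laplacian (H q) y + (-1) * laplacian (\<lambda>y. gk r (y - q)) y"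
        by (rule Ck2_lin(3)[OF om(1) _ _ that]) (intro H_C2 assms gk_C2 om(1))+
      also have "\<dots> = mollifier r (y - q)"
        using that H_C2(2)[OF assms(1) that] r(1) by (simp add: gk_C2(4)[OF om(1)] sum_gk2)
      finally show ?thesis using mollifier_nonneg by simp
    qed
    show "?w z \<le> 0" if "z \<in> frontier \<Omega>" for z
    proof -
      have "z \<notin> cball q r" using r(3) frontier_not_in[OF that] by blast
      then have "r \<le> norm (z - q)" by (simp add: dist_norm norm_minus_commute)
      then show ?thesis using gk_far[OF r(1)] H_bdry[OF assms(1) that] by (simp add: newton_def)
    qed
  qed
  then show ?thesis unfolding K_def newton_def using gk_far[OF r(1,2)] by simp
qed

text \<open>The Green function of the disc of radius \<open>D\<close> with pole at its centre; it
  dominates \<open>K\<close>.\<close>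

definition LD :: "pt \<Rightarrow> real" where "LD z = ln (D / norm z) / (2 * pi)"

lemma newton_LD: assumes "z \<noteq> 0" shows "newton z = LD z - ln D / (2 * pi)"
  using assms D_ge1 unfolding newton_def LD_def by (simp add: ln_div field_simps)

lemma K_upper: assumes "q \<in> \<Omega>" "x \<in> closure \<Omega>" "x \<noteq> q" shows "K q x \<le> LD (x - q)"
  unfolding K_def using newton_LD[of "x - q"] H_upper[OF assms(1,2)] assms(3) by simp

text \<open>From ln t = 2 ln (sqrt t) < 2 sqrt t: the square of the logarithm has at most the
  integrable singularity of power -1.\<close>

lemma LD_bounds: assumes "z \<noteq> 0" "norm z \<le> D" shows "0 \<le> LD z" "(LD z)\<^sup>2 \<le> D * norm z powr - 1"
proof -
  have t: "D / norm z \<ge> 1" using assms by simp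
  show "0 \<le> LD z" unfolding LD_def using t by simp
  have "ln (D / norm z) = 2 * ln (sqrt (D / norm z))" using t by (simp add: ln_sqrt)
  also have "\<dots> \<le> 2 * (sqrt (D / norm z) - 1)" using t by (intro mult_left_mono ln_le_minus_one) auto
  finally have "ln (D / norm z) \<le> 2 * sqrt (D / norm z)" by simp
  then have "LD z \<le> (2 * sqrt (D / norm z)) / (2 * pi)" unfolding LD_def by (rule divide_right_mono) simp
  also have "\<dots> \<le> sqrt (D / norm z)" using t pi_gt3 by (simp add: field_simps mult_left_le)
  finally have "(LD z)\<^sup>2 \<le> (sqrt (D / norm z))\<^sup>2" using \<open>0 \<le> LD z\<close> by (rule power_mono)
  then show "(LD z)\<^sup>2 \<le> D * norm z powr - 1" using t D_ge1 by (simp add: powr_minus_divide)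
qed

text \<open>\<open>H q x\<close> has no uniform lower bound as pole and point approach the same
  boundary point. This majorant, integrable uniformly in the pole, is what Fubini needs
  later.\<close>

lemma H_bound: assumes "q \<in> \<Omega>" "x \<in> closure \<Omega>" "x \<noteq> q"
  shows "\<bar>H q x\<bar> \<le> (ln D + 1) + D * norm (x - q) powr - 1"
proof -
  have n: "norm (x - q) \<le> D" using norm_le_D in_closure assms by blast
  have L: "0 \<le> LD (x - q)" "(LD (x - q))\<^sup>2 \<le> D * norm (x - q) powr - 1" using LD_bounds[OF _ n] assms(3) by auto
  have "LD (x - q) \<le> 1 + (LD (x - q))\<^sup>2"
    using zero_le_power2[of "LD (x - q) - 1"] L(1) by (simp add: power2_eq_square algebra_simps)
  moreover have "ln D / (2 * pi) - LD (x - q) \<le> H q x"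
    using K_nonneg[OF assms] newton_LD[of "x - q"] assms(3) unfolding K_def by simp
  moreover have "H q x \<le> ln D / (2 * pi)" by (rule H_upper[OF assms(1,2)])
  moreover have "0 \<le> ln D / (2 * pi)" using D_ge1 by simp
  moreover have "ln D / (2 * pi) \<le> ln D / 1" using D_ge1 pi_gt3 by (intro divide_left_mono) auto
  ultimately show ?thesis using L by linarith
qed

text \<open>For poles near \<open>q0\<close> the boundary values are close, since \<open>ln\<close>
  is Lipschitz away from 0; the maximum principle extends this to the closed domain. This is how
  continuity in the pole is obtained from conditions on each single pole.\<close>

lemma H_close:
  assumes "q0 \<in> \<Omega>" "e > 0"
  shows "\<exists>d>0. \<forall>q\<in>ball q0 d. q \<in> \<Omega> \<and> (\<forall>x\<in>closure \<Omega>. \<bar>H q x - H q0 x\<bar> \<le> e)"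
proof -
  obtain a where a: "a > 0" "cball q0 (2 * a) \<subseteq> \<Omega>"
  proof -
    obtain b where "b > 0" "cball q0 b \<subseteq> \<Omega>" using assms(1) om(1) open_contains_cball by blast
    then show ?thesis using that[of "b / 2"] by simp
  qed
  \<comment> \<open>Boundary points stay farther than \<open>a\<close> from both poles, where
    \<open>ln\<close> has Lipschitz constant \<open>1 / a\<close>; moving the pole by
    \<open>a * e\<close> costs at most \<open>e\<close>.\<close>
  define d where "d = min a (a * e)"
  have "q \<in> \<Omega> \<and> (\<forall>x\<in>closure \<Omega>. \<bar>H q x - H q0 x\<bar> \<le> e)" if q: "q \<in> ball q0 d" for q
  proof
    have qd: "norm (q - q0) < a" "norm (q - q0) < a * e" using q by (auto simp: d_def dist_norm norm_minus_commute)
    then show qO: "q \<in> \<Omega>" using a by (intro subsetD[OF a(2)]) (auto simp: dist_norm norm_minus_commute)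
    have bd: "\<bar>H q z - H q0 z\<bar> \<le> e" if z: "z \<in> frontier \<Omega>" for z
    proof -
      have "z \<notin> cball q0 (2 * a)" using a frontier_not_in[OF z] by blast
      then have z0: "norm (z - q0) > 2 * a" by (simp add: dist_norm norm_minus_commute)
      have z1: "norm (z - q) > a" using z0 qd(1) norm_triangle_ineq[of "z - q" "q - q0"] by simp
      have nd: "\<bar>norm (z - q) - norm (z - q0)\<bar> \<le> norm (q - q0)"
        using norm_triangle_ineq3[of "z - q" "z - q0"] by (simp add: norm_minus_commute)
      have l: "ln s - ln t \<le> e" if "s > a" "t > a" "\<bar>s - t\<bar> \<le> norm (q - q0)" for s t
      proof -
        have "ln s - ln t \<le> (s - t) / t" using that a by (intro ln_diff_le) auto
        also have "\<dots> \<le> (a * e) / t" using that qd a by (intro divide_right_mono) auto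
        also have "\<dots> \<le> (a * e) / a" using that a assms(2) by (intro divide_left_mono) auto
        finally show ?thesis using a by simp
      qed
      have "\<bar>ln (norm (z - q)) - ln (norm (z - q0))\<bar> \<le> e"
        using l[of "norm (z - q)" "norm (z - q0)"] l[of "norm (z - q0)" "norm (z - q)"] z0 z1 a nd by (auto simp: abs_le_iff)
      moreover have "H q z - H q0 z = (1 / (2 * pi)) * (ln (norm (z - q)) - ln (norm (z - q0)))"
        unfolding H_bdry[OF qO z] H_bdry[OF assms(1) z] newton_def by (simp add: algebra_simps)
      ultimately have "\<bar>H q z - H q0 z\<bar> \<le> (1 / (2 * pi)) * e"
        by (simp only: abs_mult) (simp add: divide_right_mono)
      also have "\<dots> \<le> 1 * e" using pi_gt3 assms(2) by (intro mult_right_mono) auto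
      finally show ?thesis by simp
    qed
    have one: "H u x - H v x \<le> e" if uv: "u \<in> \<Omega>" "v \<in> \<Omega>" and b: "\<And>z. z \<in> frontier \<Omega> \<Longrightarrow> H u z - H v z \<le> e"
      and x: "x \<in> closure \<Omega>" for u v x
    proof -
      have "1 * H u x + (- 1) * H v x \<le> e"
      proof (rule maximum_principle[OF om(1,2) _ _ _ _ x])
        show "Ck 2 \<Omega> (\<lambda>x. 1 * H u x + (- 1) * H v x)" by (intro Ck2_lin om(1) H_C2 uv)
        show "continuous_on (closure \<Omega>) (\<lambda>x. 1 * H u x + (- 1) * H v x)" by (intro continuous_intros H_cont uv)
        show "laplacian (\<lambda>x. 1 * H u x + (- 1) * H v x) y \<ge> 0" if "y \<in> \<Omega>" for y
          using Ck2_lin(3)[OF om(1) H_C2(1)[OF uv(1)] H_C2(1)[OF uv(2)] that, of 1 "-1"] H_C2(2) uv that by simp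
      qed (use b in auto)
      then show ?thesis by simp
    qed
    show "\<forall>x\<in>closure \<Omega>. \<bar>H q x - H q0 x\<bar> \<le> e"
    proof
      fix x assume x: "x \<in> closure \<Omega>"
      have "H q x - H q0 x \<le> e" by (rule one[OF qO assms(1) _ x]) (use bd in \<open>auto simp: abs_le_iff\<close>)
      moreover have "H q0 x - H q x \<le> e" by (rule one[OF assms(1) qO _ x]) (use bd in \<open>auto simp: abs_le_iff\<close>)
      ultimately show "\<bar>H q x - H q0 x\<bar> \<le> e" by linarith
    qed
  qed
  moreover have "d > 0" using a assms(2) by (simp add: d_def)
  ultimately show ?thesis by blast
qed

text \<open>Continuity in the pole is uniform in the point, so separate continuity becomes joint.
  The gain is measurability in the pole and on the product.\<close>

lemma H_joint: "continuous_on (\<Omega> \<times> closure \<Omega>) (\<lambda>p. H (fst p) (snd p))"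
  unfolding continuous_on_iff
proof (intro ballI allI impI)
  fix p :: "pt \<times> pt" and e :: real assume p: "p \<in> \<Omega> \<times> closure \<Omega>" and "e > 0"
  obtain q x where px: "p = (q, x)" "q \<in> \<Omega>" "x \<in> closure \<Omega>" using p by auto
  obtain d1 where d1: "d1 > 0" "\<And>q' y. q' \<in> ball q d1 \<Longrightarrow> y \<in> closure \<Omega> \<Longrightarrow> \<bar>H q' y - H q y\<bar> \<le> e / 3"
    using H_close[OF px(2), of "e/3"] \<open>e > 0\<close> by force
  obtain d2 where d2: "d2 > 0" "\<And>y. y \<in> closure \<Omega> \<Longrightarrow> dist y x < d2 \<Longrightarrow> dist (H q y) (H q x) < e / 3"
    using H_cont[OF px(2)] px(3) \<open>e > 0\<close> unfolding continuous_on_iff by (metis divide_pos_pos zero_less_numeral)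
  show "\<exists>d>0. \<forall>p'\<in>\<Omega> \<times> closure \<Omega>. dist p' p < d \<longrightarrow> dist (H (fst p') (snd p')) (H (fst p) (snd p)) < e"
  proof (intro exI[of _ "min d1 d2"] conjI ballI impI)
    fix p' assume p': "p' \<in> \<Omega> \<times> closure \<Omega>" "dist p' p < min d1 d2"
    obtain q' y where e': "p' = (q', y)" by (cases p')
    have "dist q' q < d1" "dist y x < d2"
      using p'(2) dist_fst_le[of p' p] dist_snd_le[of p' p] unfolding e' px by auto
    then have "\<bar>H q' y - H q y\<bar> \<le> e / 3" "\<bar>H q y - H q x\<bar> < e / 3"
      using d1(2)[of q' y] d2(2)[of y] p' unfolding e' by (auto simp: dist_commute[of q] dist_real_def)
    then show "dist (H (fst p') (snd p')) (H (fst p) (snd p)) < e"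
      unfolding e' px dist_real_def fst_conv snd_conv using \<open>e > 0\<close> by linarith
  qed (use d1 d2 in auto)
qed

lemma H_measurable: assumes "x \<in> closure \<Omega>" shows "(\<lambda>q. H q x) \<in> borel_measurable (leb \<Omega>)"
proof (rule borel_measurable_leb)
  have "continuous_on \<Omega> (\<lambda>q. (\<lambda>p. H (fst p) (snd p)) (q, x))"
    by (rule continuous_on_compose2[OF H_joint]) (use assms in \<open>auto intro!: continuous_intros\<close>)
  then show "continuous_on \<Omega> (\<lambda>q. H q x)" by simp
qed

lemma H_measurable_pair: "(\<lambda>p. H (fst p) (snd p)) \<in> borel_measurable (leb \<Omega> \<Otimes>\<^sub>M leb \<Omega>)"
proof -
  let ?h = "\<lambda>p::pt \<times> pt. indicator (\<Omega> \<times> \<Omega>) p *\<^sub>R H (fst p) (snd p)"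
  have "continuous_on (\<Omega> \<times> \<Omega>) (\<lambda>p. H (fst p) (snd p))"
    by (rule continuous_on_subset[OF H_joint]) (use closure_subset in auto)
  then have "?h \<in> borel_measurable borel"
    using om(1) by (intro borel_measurable_continuous_on_indicator) (auto intro!: borel_open open_Times)
  then have h: "?h \<in> borel_measurable (borel \<Otimes>\<^sub>M borel)" by (simp add: borel_prod)
  have id: "(\<lambda>p. (fst p, snd p)) \<in> measurable (leb \<Omega> \<Otimes>\<^sub>M leb \<Omega>) (borel \<Otimes>\<^sub>M borel)"
  proof (rule measurable_Pair)
    have i: "(\<lambda>x. x) \<in> measurable (leb \<Omega>) borel" by (rule measurable_restrict_space1) simp
    show "fst \<in> measurable (leb \<Omega> \<Otimes>\<^sub>M leb \<Omega>) borel" by (rule measurable_compose[OF measurable_fst i])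
    show "snd \<in> measurable (leb \<Omega> \<Otimes>\<^sub>M leb \<Omega>) borel" by (rule measurable_compose[OF measurable_snd i])
  qed
  have "?h \<in> borel_measurable (leb \<Omega> \<Otimes>\<^sub>M leb \<Omega>)" using measurable_compose[OF id h] by simp
  then show ?thesis
    by (rule measurable_cong[THEN iffD1, rotated]) (auto simp: space_pair_measure space_restrict_space)
qed

lemma newton_measurable_om: "(\<lambda>q. newton (x - q)) \<in> borel_measurable (leb \<Omega>)"
  unfolding newton_def by (rule measurable_restrict_space1) measurable

lemma K_measurable: "x \<in> closure \<Omega> \<Longrightarrow> (\<lambda>q. K q x) \<in> borel_measurable (leb \<Omega>)"
  unfolding K_def by (intro borel_measurable_add newton_measurable_om H_measurable)

lemma om_ball: assumes "x \<in> closure \<Omega>" shows "\<Omega> \<subseteq> ball x (D + 1)"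
proof
  fix y assume "y \<in> \<Omega>"
  from norm_le_D[OF assms in_closure[OF this]] show "y \<in> ball x (D + 1)" by (simp add: dist_norm)
qed

text \<open>The square of the logarithmic majorant is controlled by the power -1, whose integral
  over the domain is bounded uniformly in the pole.\<close>

lemma K_sq_bound:
  "\<exists>C\<ge>0. \<forall>x\<in>closure \<Omega>. integrable (leb \<Omega>) (\<lambda>q. (K q x)\<^sup>2) \<and> (\<integral>q. (K q x)\<^sup>2 \<partial>leb \<Omega>) \<le> C"
proof -
  obtain C where C: "C \<ge> 0" "\<forall>A x r. A \<in> sets borel \<longrightarrow> 0 < r \<longrightarrow> A \<subseteq> ball x r \<longrightarrow>
     integrable (leb A) (\<lambda>q. norm (x - q) powr - 1) \<and> (\<integral>q. norm (x - q) powr - 1 \<partial>leb A) \<le> C * r powr (2 - 1)"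
    using riesz_potential_bound[of 1] by auto
  have "integrable (leb \<Omega>) (\<lambda>q. (K q x)\<^sup>2) \<and> (\<integral>q. (K q x)\<^sup>2 \<partial>leb \<Omega>) \<le> D * (C * (D + 1) powr (2 - 1))"
    if x: "x \<in> closure \<Omega>" for x
  proof -
    have R: "integrable (leb \<Omega>) (\<lambda>q. norm (x - q) powr - 1)" "(\<integral>q. norm (x - q) powr - 1 \<partial>leb \<Omega>) \<le> C * (D + 1) powr (2 - 1)"
      using C(2)[rule_format, OF om_borel _ om_ball[OF x]] D_ge1 by auto
    have ae: "AE q in leb \<Omega>. (K q x)\<^sup>2 \<le> D * norm (x - q) powr - 1"
      using AE_leb_neq[OF om(1), of x] AE_space
    proof eventually_elim
      case (elim q)
      then have q: "q \<in> \<Omega>" "x \<noteq> q" by (auto simp: space_restrict_space)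
      have "(K q x)\<^sup>2 \<le> (LD (x - q))\<^sup>2" using K_nonneg[OF q(1) x q(2)] K_upper[OF q(1) x q(2)] by (intro power_mono)
      also have "\<dots> \<le> D * norm (x - q) powr - 1" using LD_bounds(2)[of "x - q"] norm_le_D[OF x in_closure[OF q(1)]] q by simp
      finally show ?case .
    qed
    have i: "integrable (leb \<Omega>) (\<lambda>q. (K q x)\<^sup>2)"
    proof (rule Bochner_Integration.integrable_bound)
      show "integrable (leb \<Omega>) (\<lambda>q. D * norm (x - q) powr - 1)" by (intro integrable_mult_right R(1))
      show "(\<lambda>q. (K q x)\<^sup>2) \<in> borel_measurable (leb \<Omega>)" using K_measurable[OF x] by measurable
      show "AE q in leb \<Omega>. norm ((K q x)\<^sup>2) \<le> norm (D * norm (x - q) powr - 1)"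
        using ae
      proof eventually_elim
        case (elim q)
        have "norm ((K q x)\<^sup>2) = (K q x)\<^sup>2" by simp
        also note elim
        also have "D * norm (x - q) powr - 1 \<le> norm (D * norm (x - q) powr - 1)"
          unfolding real_norm_def by (rule abs_ge_self)
        finally show ?case .
      qed
    qed
    have "(\<integral>q. (K q x)\<^sup>2 \<partial>leb \<Omega>) \<le> (\<integral>q. D * norm (x - q) powr - 1 \<partial>leb \<Omega>)"
      by (intro integral_mono_AE i integrable_mult_right R(1) ae)
    also have "\<dots> \<le> D * (C * (D + 1) powr (2 - 1))"
      unfolding integral_mult_right_zero using R(2) D_ge1 by (intro mult_left_mono) auto
    finally show ?thesis using i by blast
  qed
  moreover have "D * (C * (D + 1) powr (2 - 1)) \<ge> 0" using C(1) D_ge1 by simp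
  ultimately show ?thesis by blast
qed

lemma K_sq_integrable: assumes "x \<in> closure \<Omega>" shows "integrable (leb \<Omega>) (\<lambda>q. (K q x)\<^sup>2)"
proof -
  obtain C where "\<forall>x\<in>closure \<Omega>. integrable (leb \<Omega>) (\<lambda>q. (K q x)\<^sup>2) \<and> (\<integral>q. (K q x)\<^sup>2 \<partial>leb \<Omega>) \<le> C"
    using K_sq_bound by blast
  from bspec[OF this assms] show ?thesis by (rule conjunct1)
qed

lemma K_integrable: assumes "x \<in> closure \<Omega>" shows "integrable (leb \<Omega>) (\<lambda>q. K q x)"
  by (rule finite_measure.square_integrable_imp_integrable[OF finite_leb_om K_measurable[OF assms] K_sq_integrable[OF assms]])

lemma K_tendsto:
  assumes X: "X \<longlonglongrightarrow> x" "\<And>n. X n \<in> closure \<Omega>" and x: "x \<in> closure \<Omega>" and q: "q \<in> \<Omega>" "q \<noteq> x"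
  shows "(\<lambda>n. K q (X n)) \<longlonglongrightarrow> K q x"
proof -
  have "(\<lambda>n. H q (X n)) \<longlonglongrightarrow> H q x"
    using H_cont[OF q(1)] X x by (intro continuous_on_tendsto_compose[OF H_cont[OF q(1)]]) auto
  moreover have "(\<lambda>n. newton (X n - q)) \<longlonglongrightarrow> newton (x - q)"
    unfolding newton_def by (intro tendsto_intros X) (use q(2) in auto)
  ultimately show ?thesis unfolding K_def by (intro tendsto_intros)
qed

text \<open>Along a sequence the kernels converge pointwise off the limit point and have bounded
  second moments, hence converge in L1.\<close>

lemma K_L1_continuous:
  assumes x: "x \<in> closure \<Omega>" and "e > 0"
  shows "\<exists>d>0. \<forall>y\<in>closure \<Omega>. norm (x - y) < d \<longrightarrow> (\<integral>q. \<bar>K q x - K q y\<bar> \<partial>leb \<Omega>) < e"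
proof (rule ccontr)
  assume "\<not> ?thesis"
  then have no: "\<And>d. d > 0 \<Longrightarrow> \<exists>y\<in>closure \<Omega>. norm (x - y) < d \<and> \<not> (\<integral>q. \<bar>K q x - K q y\<bar> \<partial>leb \<Omega>) < e"
    by blast
  have "\<forall>n. \<exists>y. y \<in> closure \<Omega> \<and> norm (x - y) < inverse (real (Suc n)) \<and> \<not> (\<integral>q. \<bar>K q x - K q y\<bar> \<partial>leb \<Omega>) < e"
    by (intro allI no[unfolded Bex_def]) simp
  from choice[OF this] obtain X where X': "\<forall>n. X n \<in> closure \<Omega> \<and> norm (x - X n) < inverse (real (Suc n))
     \<and> \<not> (\<integral>q. \<bar>K q x - K q (X n)\<bar> \<partial>leb \<Omega>) < e" by blast
  have X: "X n \<in> closure \<Omega>" "norm (x - X n) < inverse (real (Suc n))"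
     "\<not> (\<integral>q. \<bar>K q x - K q (X n)\<bar> \<partial>leb \<Omega>) < e" for n using X' by blast+
  have "(\<lambda>n. norm (x - X n)) \<longlonglongrightarrow> 0"
    by (rule real_tendsto_sandwich[OF _ _ tendsto_const LIMSEQ_inverse_real_of_nat]) (intro always_eventually allI norm_ge_zero less_imp_le[OF X(2)])+
  then have lim: "X \<longlonglongrightarrow> x" by (simp add: tendsto_norm_zero_iff LIM_zero_iff norm_minus_commute[of x])
  obtain C where C: "\<forall>x\<in>closure \<Omega>. integrable (leb \<Omega>) (\<lambda>q. (K q x)\<^sup>2) \<and> (\<integral>q. (K q x)\<^sup>2 \<partial>leb \<Omega>) \<le> C"
    using K_sq_bound by blast
  have "(\<lambda>n. \<integral>q. \<bar>K q (X n) - K q x\<bar> \<partial>leb \<Omega>) \<longlonglongrightarrow> 0"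
  proof (rule L1_convergence_of_L2_bounded[OF finite_leb_om])
    show "AE q in leb \<Omega>. (\<lambda>n. K q (X n)) \<longlonglongrightarrow> K q x"
      using AE_leb_neq[OF om(1), of x] AE_space
      by eventually_elim (rule K_tendsto[OF lim X(1) x], auto simp: space_restrict_space)
  qed (use C X(1) x K_measurable in auto)
  from LIMSEQ_D[OF this \<open>e > 0\<close>] obtain N where "\<bar>\<integral>q. \<bar>K q (X N) - K q x\<bar> \<partial>leb \<Omega>\<bar> < e" by auto
  then show False using X(3)[of N] by (simp add: abs_minus_commute)
qed

section \<open>Potentials of bounded densities: continuity, boundary values, regularity\<close>

definition pot :: "(pt \<Rightarrow> real) \<Rightarrow> pt \<Rightarrow> real" where "pot \<rho> x = (\<integral>q. K q x * \<rho> q \<partial>leb \<Omega>)"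

definition bdd :: "(pt \<Rightarrow> real) \<Rightarrow> real \<Rightarrow> bool" where
  "bdd \<rho> B \<longleftrightarrow> \<rho> \<in> borel_measurable (leb \<Omega>) \<and> (\<forall>q\<in>\<Omega>. \<bar>\<rho> q\<bar> \<le> B)"

lemma bdd_nonneg: assumes "bdd \<rho> B" shows "0 \<le> B"
proof -
  obtain q where "q \<in> \<Omega>" using om(3) by blast
  then have "\<bar>\<rho> q\<bar> \<le> B" using assms by (simp add: bdd_def)
  then show ?thesis by linarith
qed

lemma bdd_integrable: assumes "bdd \<rho> B" shows "integrable (leb \<Omega>) \<rho>"
  by (rule integrable_bounded_leb[OF om(2,1), of _ B]) (use assms in \<open>simp_all add: bdd_def\<close>)

lemma K_rho_integrable:
  assumes "bdd \<rho> B" "integrable (leb \<Omega>) f" shows "integrable (leb \<Omega>) (\<lambda>q. f q * \<rho> q)"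
proof (rule Bochner_Integration.integrable_bound[of _ "\<lambda>q. B * f q"])
  show "integrable (leb \<Omega>) (\<lambda>q. B * f q)" using assms(2) by simp
  show "(\<lambda>q. f q * \<rho> q) \<in> borel_measurable (leb \<Omega>)" using assms unfolding bdd_def by auto
  show "AE q in leb \<Omega>. norm (f q * \<rho> q) \<le> norm (B * f q)"
  proof (rule AE_I2)
    fix q assume "q \<in> space (leb \<Omega>)"
    then have "\<bar>\<rho> q\<bar> \<le> B" using assms(1) by (simp add: bdd_def space_restrict_space)
    then show "norm (f q * \<rho> q) \<le> norm (B * f q)" by (auto simp: abs_mult mult.commute intro!: mult_right_mono)
  qed
qed

lemma pot_diff_bound:
  assumes "bdd \<rho> B" "x \<in> closure \<Omega>" "y \<in> closure \<Omega>"
  shows "\<bar>pot \<rho> x - pot \<rho> y\<bar> \<le> B * (\<integral>q. \<bar>K q x - K q y\<bar> \<partial>leb \<Omega>)"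
proof -
  have i: "integrable (leb \<Omega>) (\<lambda>q. K q x - K q y)" using K_integrable assms by auto
  have "pot \<rho> x - pot \<rho> y = (\<integral>q. (K q x - K q y) * \<rho> q \<partial>leb \<Omega>)"
    unfolding pot_def left_diff_distrib
    by (rule Bochner_Integration.integral_diff[symmetric]) (intro K_rho_integrable[OF assms(1)] K_integrable assms)+
  also have "\<bar>\<dots>\<bar> \<le> (\<integral>q. \<bar>(K q x - K q y) * \<rho> q\<bar> \<partial>leb \<Omega>)" by (rule integral_abs_bound)
  also have "\<dots> \<le> (\<integral>q. B * \<bar>K q x - K q y\<bar> \<partial>leb \<Omega>)"
  proof (rule integral_mono)
    show "\<bar>(K q x - K q y) * \<rho> q\<bar> \<le> B * \<bar>K q x - K q y\<bar>" if "q \<in> space (leb \<Omega>)" for q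
      using assms(1) that by (auto simp: abs_mult mult.commute bdd_def space_restrict_space intro!: mult_right_mono)
  qed (use K_rho_integrable[OF assms(1) i] i in auto)
  finally show ?thesis by simp
qed

text \<open>The modulus comes from the kernel alone and depends on the density only through
  \<open>B\<close>; this is the equicontinuity behind the compactness of potentials.\<close>

lemma pot_equicontinuous:
  assumes "x \<in> closure \<Omega>" "e > 0" "0 \<le> B"
  obtains d where "d > 0"
    "\<And>\<rho> y. bdd \<rho> B \<Longrightarrow> y \<in> closure \<Omega> \<Longrightarrow> norm (x - y) < d \<Longrightarrow> \<bar>pot \<rho> x - pot \<rho> y\<bar> < e"
proof -
  have pos: "e / (B + 1) > 0" using assms by simp
  obtain d where d: "d > 0" "\<forall>y\<in>closure \<Omega>. norm (x - y) < d \<longrightarrow> (\<integral>q. \<bar>K q x - K q y\<bar> \<partial>leb \<Omega>) < e / (B + 1)"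
    using K_L1_continuous[OF assms(1) pos] by blast
  have "\<bar>pot \<rho> x - pot \<rho> y\<bar> < e" if y: "bdd \<rho> B" "y \<in> closure \<Omega>" "norm (x - y) < d" for \<rho> y
  proof -
    have "\<bar>pot \<rho> x - pot \<rho> y\<bar> \<le> B * (\<integral>q. \<bar>K q x - K q y\<bar> \<partial>leb \<Omega>)" by (rule pot_diff_bound[OF y(1) assms(1) y(2)])
    also have "\<dots> \<le> B * (e / (B + 1))"
      using d(2)[rule_format, OF y(2,3)] assms(3) by (intro mult_left_mono) auto
    also have "\<dots> < e" using assms by (simp add: field_simps)
    finally show ?thesis .
  qed
  then show ?thesis by (rule that[OF d(1)])
qed


lemma pot_continuous: assumes "bdd \<rho> B" shows "continuous_on (closure \<Omega>) (pot \<rho>)"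
  unfolding continuous_on_iff
proof (intro ballI allI impI)
  fix x and e :: real assume xe: "x \<in> closure \<Omega>" "e > 0"
  obtain d where d: "d > 0"
    "\<And>\<rho> y. bdd \<rho> B \<Longrightarrow> y \<in> closure \<Omega> \<Longrightarrow> norm (x - y) < d \<Longrightarrow> \<bar>pot \<rho> x - pot \<rho> y\<bar> < e"
    using pot_equicontinuous[OF xe bdd_nonneg[OF assms]] by blast
  show "\<exists>d>0. \<forall>x'\<in>closure \<Omega>. dist x' x < d \<longrightarrow> dist (pot \<rho> x') (pot \<rho> x) < e"
  proof (intro exI[of _ d] conjI ballI impI d(1))
    fix y assume "y \<in> closure \<Omega>" "dist y x < d"
    then show "dist (pot \<rho> y) (pot \<rho> x) < e"
      using d(2)[OF assms, of y] by (simp add: dist_norm norm_minus_commute abs_minus_commute)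
  qed
qed

text \<open>The Green function vanishes on the boundary for every pole, so the integrand is
  identically 0.\<close>

lemma pot_frontier: assumes "z \<in> frontier \<Omega>" shows "pot \<rho> z = 0"
proof -
  have "pot \<rho> z = (\<integral>q. 0 \<partial>leb \<Omega>)" unfolding pot_def
    by (rule Bochner_Integration.integral_cong) (auto simp: K_def H_bdry[OF _ assms] space_restrict_space)
  then show ?thesis by simp
qed

definition hpart :: "(pt \<Rightarrow> real) \<Rightarrow> pt \<Rightarrow> real" where "hpart \<rho> x = (\<integral>q. H q x * \<rho> q \<partial>leb \<Omega>)"

lemma newton_rho: assumes "bdd \<rho> B"
  shows "integrable (leb \<Omega>) (\<lambda>q. newton (x - q) * \<rho> q)" "continuous_on S (newt \<Omega> \<rho>)"
    "has_pd i (newt \<Omega> \<rho>) x (newt1 \<Omega> \<rho> i x)" "continuous_on S (newt1 \<Omega> \<rho> i)"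
proof -
  have "\<rho> \<in> borel_measurable (leb \<Omega>)" "\<And>q. q \<in> \<Omega> \<Longrightarrow> \<bar>\<rho> q\<bar> \<le> B" using assms by (auto simp: bdd_def)
  note N = newt_C1[OF om(1,2) this bdd_nonneg[OF assms]]
  show "integrable (leb \<Omega>) (\<lambda>q. newton (x - q) * \<rho> q)" by (rule N(4))
  show "continuous_on S (newt \<Omega> \<rho>)" by (rule N(2))
  show "has_pd i (newt \<Omega> \<rho>) x (newt1 \<Omega> \<rho> i x)" by (rule N(1))
  show "continuous_on S (newt1 \<Omega> \<rho> i)" by (rule N(3))
qed

lemma pot_split: assumes "bdd \<rho> B" "x \<in> closure \<Omega>" 
  shows "pot \<rho> x = newt \<Omega> \<rho> x + hpart \<rho> x" "integrable (leb \<Omega>) (\<lambda>q. H q x * \<rho> q)"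
proof -
  note iK = K_rho_integrable[OF assms(1) K_integrable[OF assms(2)]]
  have "integrable (leb \<Omega>) (\<lambda>q. K q x * \<rho> q - newton (x - q) * \<rho> q)" using iK newton_rho(1)[OF assms(1)] by auto
  moreover have "(\<lambda>q. K q x * \<rho> q - newton (x - q) * \<rho> q) = (\<lambda>q. H q x * \<rho> q)"
    by (auto simp: K_def algebra_simps)
  ultimately show i: "integrable (leb \<Omega>) (\<lambda>q. H q x * \<rho> q)" by simp
  show "pot \<rho> x = newt \<Omega> \<rho> x + hpart \<rho> x"
  proof -
    have "newt \<Omega> \<rho> x = (\<integral>q. newton (x - q) * \<rho> q \<partial>leb \<Omega>)"
      by (rule newt_def[OF om(1,2)]) (use assms(1) bdd_nonneg[OF assms(1)] in \<open>auto simp: bdd_def\<close>)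
    then show ?thesis unfolding pot_def K_def distrib_right hpart_def
      using Bochner_Integration.integral_add[OF newton_rho(1)[OF assms(1)] i] by simp
  qed
qed

lemma hpart_continuous: assumes "bdd \<rho> B" shows "continuous_on (closure \<Omega>) (hpart \<rho>)"
proof -
  have "continuous_on (closure \<Omega>) (\<lambda>x. pot \<rho> x - newt \<Omega> \<rho> x)"
    by (intro continuous_intros pot_continuous[OF assms] newton_rho(2)[OF assms])
  then show ?thesis by (rule continuous_on_cong[THEN iffD1, OF refl, rotated]) (use pot_split(1)[OF assms] in simp)
qed

lemma hpart_integrable: assumes "bdd \<rho> B" shows "integrable (leb \<Omega>) (hpart \<rho>)"
proof -
  have "compact (hpart \<rho> ` closure \<Omega>)" by (intro compact_continuous_image hpart_continuous[OF assms]) (use om in simp)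
  then obtain M where M: "\<And>x. x \<in> closure \<Omega> \<Longrightarrow> \<bar>hpart \<rho> x\<bar> \<le> M"
    using compact_imp_bounded[of "hpart \<rho> ` closure \<Omega>"] unfolding bounded_iff by (metis imageI real_norm_def)
  show ?thesis
    by (rule integrable_bounded_leb[OF om(2,1) borel_measurable_leb[OF continuous_on_subset[OF hpart_continuous[OF assms]]]])
      (use closure_subset M in auto)
qed

text \<open>Lets properties of each harmonic function \<open>H q\<close> under averaging pass to
  their superposition. Joint integrability rests on \<open>H_bound\<close>, whose integral over the
  point is at most \<open>T\<close> for every pole.\<close>

lemma hpart_fubini:
  fixes g :: "pt \<Rightarrow> real"
  assumes "bdd \<rho> B" and g: "continuous_on UNIV g"
  shows "(\<integral>y. g (x - y) * hpart \<rho> y \<partial>leb \<Omega>) = (\<integral>q. (\<integral>y. H q y * g (x - y) \<partial>leb \<Omega>) * \<rho> q \<partial>leb \<Omega>)"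
proof -
  interpret finite_measure "leb \<Omega>" by (rule finite_leb_om)
  interpret P: pair_sigma_finite "leb \<Omega>" "leb \<Omega>" ..
  obtain G where "\<forall>y\<in>cball x 1. \<forall>q\<in>\<Omega>. \<bar>g (y - q)\<bar> \<le> G"
    using conv_kernel_bound[OF om(2) g, of x] by blast
  then have G: "\<bar>g (x - y)\<bar> \<le> G" if "y \<in> \<Omega>" for y using that by simp
  obtain q0 where "q0 \<in> \<Omega>" using om(3) by blast
  from order_trans[OF abs_ge_zero G[OF this]] have G0: "G \<ge> 0" .
  have mg: "(\<lambda>y. g (x - y)) \<in> borel_measurable (leb \<Omega>)"
    by (rule borel_measurable_leb, rule continuous_on_compose2[OF g]) (auto intro!: continuous_intros)
  have mr: "\<rho> \<in> borel_measurable (leb \<Omega>)" using assms(1) by (simp add: bdd_def)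
  let ?f = "\<lambda>p. H (fst p) (snd p) * g (x - snd p) * \<rho> (fst p)"
  have mf: "?f \<in> borel_measurable (leb \<Omega> \<Otimes>\<^sub>M leb \<Omega>)"
    by (intro borel_measurable_times H_measurable_pair measurable_compose[OF measurable_snd mg] measurable_compose[OF measurable_fst mr])
  obtain C where C: "C \<ge> 0" "\<forall>A x r. A \<in> sets borel \<longrightarrow> 0 < r \<longrightarrow> A \<subseteq> ball x r \<longrightarrow>
     integrable (leb A) (\<lambda>q. norm (x - q) powr - 1) \<and> (\<integral>q. norm (x - q) powr - 1 \<partial>leb A) \<le> C * r powr (2 - 1)"
    using riesz_potential_bound[of 1] by auto
  define c where "c = ln D + 1"
  have c0: "c \<ge> 0" using D_ge1 by (simp add: c_def)
  have gen: "(\<integral>y. G * B * (c + D * f y) \<partial>leb \<Omega>) = G * B * (c * measure (leb \<Omega>) \<Omega> + D * (\<integral>y. f y \<partial>leb \<Omega>))"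
    if "integrable (leb \<Omega>) f" for f :: "pt \<Rightarrow> real"
    using that by (simp add: space_restrict_space)
  define T where "T = G * B * (c * measure (leb \<Omega>) \<Omega> + D * (C * (D + 1) powr (2 - 1)))"
  have inner: "integrable (leb \<Omega>) (\<lambda>y. ?f (q, y)) \<and> (\<integral>y. norm (?f (q, y)) \<partial>leb \<Omega>) \<le> T" if q: "q \<in> \<Omega>" for q
  proof -
    have R: "integrable (leb \<Omega>) (\<lambda>y. norm (q - y) powr - 1)" "(\<integral>y. norm (q - y) powr - 1 \<partial>leb \<Omega>) \<le> C * (D + 1) powr (2 - 1)"
      using C(2)[rule_format, OF om_borel _ om_ball[OF in_closure[OF q]]] D_ge1 by auto
    let ?w = "\<lambda>y. G * B * (c + D * norm (q - y) powr - 1)"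
    have iw: "integrable (leb \<Omega>) ?w"
      by (intro integrable_mult_right Bochner_Integration.integrable_add integrable_const R(1))
    have ae: "AE y in leb \<Omega>. norm (?f (q, y)) \<le> ?w y"
      using AE_leb_neq[OF om(1), of q] AE_space
    proof eventually_elim
      case (elim y)
      then have y: "y \<in> \<Omega>" "y \<noteq> q" by (auto simp: space_restrict_space)
      have h: "\<bar>H q y\<bar> \<le> c + D * norm (q - y) powr - 1"
        using H_bound[OF q in_closure[OF y(1)] y(2)] by (simp add: c_def norm_minus_commute)
      have "\<bar>H q y\<bar> * \<bar>g (x - y)\<bar> * \<bar>\<rho> q\<bar> \<le> (c + D * norm (q - y) powr - 1) * G * B"
        using h G[OF y(1)] G0 assms(1) q c0 D_ge1 unfolding bdd_def by (intro mult_mono) auto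
      then show ?case by (simp add: abs_mult mult_ac)
    qed
    have m: "(\<lambda>y. ?f (q, y)) \<in> borel_measurable (leb \<Omega>)"
    proof -
      have "(\<lambda>y. H q y) \<in> borel_measurable (leb \<Omega>)"
        by (rule borel_measurable_leb[OF continuous_on_subset[OF H_cont[OF q] closure_subset]])
      then show ?thesis using mg by simp
    qed
    have i: "integrable (leb \<Omega>) (\<lambda>y. ?f (q, y))"
      by (rule Bochner_Integration.integrable_bound[OF iw m]) (use ae in \<open>eventually_elim, auto intro: order_trans\<close>)
    have "(\<integral>y. norm (?f (q, y)) \<partial>leb \<Omega>) \<le> (\<integral>y. ?w y \<partial>leb \<Omega>)"
      by (rule integral_mono_AE[OF integrable_norm[OF i] iw ae])
    also have "\<dots> = G * B * (c * measure (leb \<Omega>) \<Omega> + D * (\<integral>y. norm (q - y) powr - 1 \<partial>leb \<Omega>))"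
      by (rule gen[OF R(1)])
    also have "\<dots> \<le> T" unfolding T_def using R(2) G0 bdd_nonneg[OF assms(1)] D_ge1 by (intro mult_left_mono add_left_mono) auto
    finally show ?thesis using i by blast
  qed
  have int: "integrable (leb \<Omega> \<Otimes>\<^sub>M leb \<Omega>) ?f"
  proof (rule P.Fubini_integrable[OF mf])
    have [measurable]: "(\<lambda>p. norm (?f p)) \<in> borel_measurable (leb \<Omega> \<Otimes>\<^sub>M leb \<Omega>)" using mf by simp
    have "(\<lambda>q. \<integral>y. norm (?f (q, y)) \<partial>leb \<Omega>) \<in> borel_measurable (leb \<Omega>)"
      by (rule borel_measurable_lebesgue_integral) measurable
    moreover have "\<bar>\<integral>y. norm (?f (q, y)) \<partial>leb \<Omega>\<bar> \<le> T" if "q \<in> \<Omega>" for q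
      using inner[OF that] by simp
    ultimately show "integrable (leb \<Omega>) (\<lambda>q. \<integral>y. norm (?f (q, y)) \<partial>leb \<Omega>)"
      by (rule integrable_bounded_leb[OF om(2,1)])
    show "AE q in leb \<Omega>. integrable (leb \<Omega>) (\<lambda>y. ?f (q, y))"
      using inner by (intro AE_I2) (auto simp: space_restrict_space)
  qed
  have "(\<integral>y. \<integral>q. H q y * g (x - y) * \<rho> q \<partial>leb \<Omega> \<partial>leb \<Omega>) = (\<integral>q. \<integral>y. H q y * g (x - y) * \<rho> q \<partial>leb \<Omega> \<partial>leb \<Omega>)"
    by (rule P.Fubini_integral) (use int in \<open>simp add: case_prod_beta'\<close>)
  moreover have "(\<integral>y. \<integral>q. H q y * g (x - y) * \<rho> q \<partial>leb \<Omega> \<partial>leb \<Omega>) = (\<integral>y. g (x - y) * hpart \<rho> y \<partial>leb \<Omega>)"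
  proof (rule Bochner_Integration.integral_cong)
    fix y
    have "(\<integral>q. H q y * g (x - y) * \<rho> q \<partial>leb \<Omega>) = (\<integral>q. g (x - y) * (H q y * \<rho> q) \<partial>leb \<Omega>)" by (simp add: mult_ac)
    then show "(\<integral>q. H q y * g (x - y) * \<rho> q \<partial>leb \<Omega>) = g (x - y) * hpart \<rho> y" by (simp add: hpart_def)
  qed simp
  ultimately show ?thesis by simp
qed

text \<open>By the mean value property \<open>hpart\<close> coincides locally with its own
  mollification \<open>V\<close>. Derivatives of \<open>V\<close> fall on the mollifier, whose
  Laplacian is orthogonal to every \<open>H q\<close>.\<close>

lemma hpart_harmonic:
  assumes "bdd \<rho> B"
  shows "Ck 2 \<Omega> (hpart \<rho>)" "x \<in> \<Omega> \<Longrightarrow> laplacian (hpart \<rho>) x = 0"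
proof -
  have loc: "\<exists>U. open U \<and> x0 \<in> U \<and> Ck 2 U (hpart \<rho>) \<and> (\<forall>x\<in>U. laplacian (hpart \<rho>) x = 0)" if x0: "x0 \<in> \<Omega>" for x0
  proof -
    obtain R where R: "R > 0" "ball x0 (2 * R) \<subseteq> \<Omega>"
    proof -
      obtain b where "b > 0" "ball x0 b \<subseteq> \<Omega>" using x0 om(1) openE by blast
      then show ?thesis using that[of "b / 2"] by simp
    qed
    define U where "U = ball x0 R"
    define V where "V x = (\<integral>y. mollifier R (x - y) * hpart \<rho> y \<partial>leb \<Omega>)" for x
    have sub: "cball x R \<subseteq> \<Omega>" if "x \<in> U" for x
    proof
      fix y assume "y \<in> cball x R"
      then show "y \<in> \<Omega>" using that dist_triangle[of x0 y x] by (intro subsetD[OF R(2)]) (auto simp: U_def)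
    qed
    have eq: "V x = hpart \<rho> x" if "x \<in> U" for x
    proof -
      have "V x = (\<integral>q. (\<integral>y. H q y * mollifier R (x - y) \<partial>leb \<Omega>) * \<rho> q \<partial>leb \<Omega>)"
        unfolding V_def by (rule hpart_fubini[OF assms continuous_mollifier(1)])
      also have "\<dots> = hpart \<rho> x" unfolding hpart_def
        by (rule Bochner_Integration.integral_cong)
          (auto simp: space_restrict_space harmonic_mean_value(1)[OF om(1) H_harm R(1) sub[OF that]])
      finally show ?thesis .
    qed
    note hi = hpart_integrable[OF assms]
    have oU: "open U" "x0 \<in> U" using R by (auto simp: U_def)
    note C2 = Ck2I[OF oU(1), of V "\<lambda>i x. \<integral>y. mollifier1 R i (x - y) * hpart \<rho> y \<partial>leb \<Omega>"
        "\<lambda>i j x. \<integral>y. mollifier2 R i j (x - y) * hpart \<rho> y \<partial>leb \<Omega>"]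
    have pre: "continuous_on U V" "\<And>i x. has_pd i V x (\<integral>y. mollifier1 R i (x - y) * hpart \<rho> y \<partial>leb \<Omega>)"
      "\<And>i. continuous_on U (\<lambda>x. \<integral>y. mollifier1 R i (x - y) * hpart \<rho> y \<partial>leb \<Omega>)"
      "\<And>i j x. has_pd j (\<lambda>x. \<integral>y. mollifier1 R i (x - y) * hpart \<rho> y \<partial>leb \<Omega>) x (\<integral>y. mollifier2 R i j (x - y) * hpart \<rho> y \<partial>leb \<Omega>)"
      "\<And>i j. continuous_on U (\<lambda>x. \<integral>y. mollifier2 R i j (x - y) * hpart \<rho> y \<partial>leb \<Omega>)"
      unfolding V_def by (rule conv_continuous[OF om(1,2) hi] conv_pd[OF om(1,2) hi] continuous_mollifier has_pd_mollifier)+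
    have CV: "Ck 2 U V" by (rule C2(1)[OF pre])
    have lap: "laplacian V x = 0" if x: "x \<in> U" for x
    proof -
      have "laplacian V x = (\<Sum>i\<in>UNIV. \<integral>y. mollifier2 R i i (x - y) * hpart \<rho> y \<partial>leb \<Omega>)" by (rule C2(4)[OF pre x])
      also have "\<dots> = (\<integral>y. (\<Sum>i\<in>UNIV. mollifier2 R i i (x - y)) * hpart \<rho> y \<partial>leb \<Omega>)"
        unfolding sum_distrib_right
        by (rule Bochner_Integration.integral_sum[symmetric]) (rule conv_integrable[OF om(1,2) hi continuous_mollifier(3)])
      also have "\<dots> = (\<integral>q. (\<integral>y. H q y * (\<Sum>i\<in>UNIV. mollifier2 R i i (x - y)) \<partial>leb \<Omega>) * \<rho> q \<partial>leb \<Omega>)"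
        by (rule hpart_fubini[OF assms, of "\<lambda>z. \<Sum>i\<in>UNIV. mollifier2 R i i z"]) (intro continuous_intros continuous_mollifier)
      also have "\<dots> = (\<integral>q. 0 \<partial>leb \<Omega>)"
        by (rule Bochner_Integration.integral_cong)
          (auto simp: space_restrict_space harmonic_mean_value(2)[OF om(1) H_harm R(1) sub[OF x]])
      finally show ?thesis by simp
    qed
    have "Ck 2 U (hpart \<rho>)" by (rule Ck_cong_open[OF oU(1) eq CV])
    moreover have "laplacian (hpart \<rho>) x = 0" if "x \<in> U" for x
    proof -
      have "pd i (hpart \<rho>) y = pd i V y" if "y \<in> U" for i y using pd_cong_open[OF oU(1) that, of V "hpart \<rho>" i] eq by simp
      then have "pd i (pd i (hpart \<rho>)) x = pd i (pd i V) x" for i by (intro pd_cong_open[OF oU(1) that]) simp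
      then show ?thesis using lap[OF that] by (simp add: laplacian_def)
    qed
    ultimately show ?thesis using oU by blast
  qed
  show "Ck 2 \<Omega> (hpart \<rho>)" by (rule Ck2_local[OF om(1)]) (use loc in blast)
  show "x \<in> \<Omega> \<Longrightarrow> laplacian (hpart \<rho>) x = 0" using loc by blast
qed

lemma loc_holder_cong: assumes "loc_holder S f" "\<And>x. x \<in> S \<Longrightarrow> f x = g x" shows "loc_holder S g"
  unfolding loc_holder_def
proof
  fix x assume "x \<in> S"
  then obtain r \<gamma> C where r: "0 < r" "0 < \<gamma>" "\<gamma> \<le> 1" "0 \<le> C" "ball x r \<subseteq> S"
    "\<forall>y\<in>ball x r. \<forall>z\<in>ball x r. \<bar>f y - f z\<bar> \<le> C * norm (y - z) powr \<gamma>"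
    using assms(1) unfolding loc_holder_def by metis
  moreover have "\<forall>y\<in>ball x r. f y = g y" using assms(2) r(5) by blast
  ultimately show "\<exists>r \<gamma> C. 0 < r \<and> 0 < \<gamma> \<and> \<gamma> \<le> 1 \<and> 0 \<le> C \<and> ball x r \<subseteq> S \<and>
     (\<forall>y\<in>ball x r. \<forall>z\<in>ball x r. \<bar>g y - g z\<bar> \<le> C * norm (y - z) powr \<gamma>)"
    by (intro exI[of _ r] exI[of _ \<gamma>] exI[of _ C]) auto
qed

text \<open>The Newtonian part is C1 for any bounded density and the other part is harmonic.
  Regularity of the density is not involved, which starts the bootstrap.\<close>

lemma pot_loc_holder: assumes "bdd \<rho> B" shows "loc_holder \<Omega> (pot \<rho>)"
proof (rule loc_holder_cong)
  show "loc_holder \<Omega> (\<lambda>x. newt \<Omega> \<rho> x + hpart \<rho> x)"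
    by (rule C1_loc_holder[OF om(1), where ?f1.0="\<lambda>i x. newt1 \<Omega> \<rho> i x + pd i (hpart \<rho>) x"])
      (intro continuous_intros has_pd_add newton_rho[OF assms] Ck2D[OF hpart_harmonic(1)[OF assms]]; assumption)+
qed (use pot_split(1)[OF assms in_closure] in simp)

lemma pot_C2:
  assumes "bdd \<rho> B" "loc_holder \<Omega> \<rho>"
  shows "Ck 2 \<Omega> (pot \<rho>)" "x \<in> \<Omega> \<Longrightarrow> laplacian (pot \<rho>) x = - \<rho> x"
proof -
  have "\<rho> \<in> borel_measurable (leb \<Omega>)" "\<And>q. q \<in> \<Omega> \<Longrightarrow> \<bar>\<rho> q\<bar> \<le> B" using assms(1) by (auto simp: bdd_def)
  note N0 = newt_C2[OF om(1,2) this bdd_nonneg[OF assms(1)] assms(2)]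
  have N: "Ck 2 \<Omega> (newt \<Omega> \<rho>)" "\<And>x. x \<in> \<Omega> \<Longrightarrow> laplacian (newt \<Omega> \<rho>) x = - \<rho> x"
    by (rule N0(1), assumption) (rule N0(2), assumption+)
  note HC = hpart_harmonic[OF assms(1)]
  have eq: "1 * newt \<Omega> \<rho> x + 1 * hpart \<rho> x = pot \<rho> x" if "x \<in> \<Omega>" for x
    using pot_split(1)[OF assms(1) in_closure[OF that]] by simp
  show "Ck 2 \<Omega> (pot \<rho>)" by (rule Ck_cong_open[OF om(1) eq Ck2_lin(1)[OF om(1) N(1) HC(1)]])
  assume x: "x \<in> \<Omega>"
  let ?V = "\<lambda>x. 1 * newt \<Omega> \<rho> x + 1 * hpart \<rho> x"
  have "pd i (pot \<rho>) y = pd i ?V y" if "y \<in> \<Omega>" for i y using pd_cong_open[OF om(1) that, of ?V "pot \<rho>" i] eq by simp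
  then have "pd i (pd i (pot \<rho>)) x = pd i (pd i ?V) x" for i by (intro pd_cong_open[OF om(1) x]) simp
  then have "laplacian (pot \<rho>) x = laplacian ?V x" by (simp add: laplacian_def)
  also have "\<dots> = - \<rho> x" using Ck2_lin(3)[OF om(1) N(1) HC(1) x, of 1 1] N(2)[OF x] HC(2)[OF x] by simp
  finally show "laplacian (pot \<rho>) x = - \<rho> x" .
qed

text \<open>The difference of the two functions is harmonic and zero on the boundary; the maximum
  principle is applied to it with both signs.\<close>

lemma pot_unique:
  assumes "bdd \<rho> B" "loc_holder \<Omega> \<rho>" and u: "Ck 2 \<Omega> u" "continuous_on (closure \<Omega>) u" "\<And>z. z \<in> frontier \<Omega> \<Longrightarrow> u z = 0"
    "\<And>x. x \<in> \<Omega> \<Longrightarrow> - laplacian u x = \<rho> x" and x: "x \<in> closure \<Omega>"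
  shows "u x = pot \<rho> x"
proof -
  note P = pot_C2[OF assms(1,2)]
  have one: "a * u x + b * pot \<rho> x \<le> 0" if "a + b = 0" for a b
  proof (rule maximum_principle[OF om(1,2) Ck2_lin(1)[OF om(1) u(1) P(1)] _ _ _ x])
    show "continuous_on (closure \<Omega>) (\<lambda>x. a * u x + b * pot \<rho> x)" by (intro continuous_intros u pot_continuous[OF assms(1)])
    show "laplacian (\<lambda>x. a * u x + b * pot \<rho> x) y \<ge> 0" if "y \<in> \<Omega>" for y
    proof -
      have l: "laplacian u y = - \<rho> y" "laplacian (pot \<rho>) y = - \<rho> y" using u(4)[OF that] P(2)[OF that] by linarith+
      have "laplacian (\<lambda>x. a * u x + b * pot \<rho> x) y = (a + b) * - \<rho> y"
        unfolding Ck2_lin(3)[OF om(1) u(1) P(1) that] l by (simp add: algebra_simps)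
      then show ?thesis using \<open>a + b = 0\<close> by simp
    qed
    show "a * u z + b * pot \<rho> z \<le> 0" if "z \<in> frontier \<Omega>" for z using u(3) pot_frontier that by simp
  qed
  show ?thesis using one[of 1 "-1"] one[of "-1" 1] by simp
qed

end

subsection \<open>Hoelder continuous functions\<close>

text \<open>The radius at most 1/2 keeps mutual distances at most 1, so that the smaller exponent
  gives the weaker bound and can serve both functions.\<close>

lemma loc_holder_common:
  assumes "loc_holder S f" "loc_holder S g" "x \<in> S"
  obtains r \<gamma> C where "0 < r" "r \<le> 1/2" "0 < \<gamma>" "\<gamma> \<le> 1" "0 \<le> C" "ball x r \<subseteq> S"
    "\<And>y z. y \<in> ball x r \<Longrightarrow> z \<in> ball x r \<Longrightarrow> \<bar>f y - f z\<bar> \<le> C * norm (y - z) powr \<gamma>"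
    "\<And>y z. y \<in> ball x r \<Longrightarrow> z \<in> ball x r \<Longrightarrow> \<bar>g y - g z\<bar> \<le> C * norm (y - z) powr \<gamma>"
    "\<And>y. y \<in> ball x r \<Longrightarrow> \<bar>f y - f x\<bar> \<le> C" "\<And>y. y \<in> ball x r \<Longrightarrow> \<bar>g y - g x\<bar> \<le> C"
proof -
  obtain r1 \<gamma>1 C1 where 1: "0 < r1" "0 < \<gamma>1" "\<gamma>1 \<le> 1" "0 \<le> C1" "ball x r1 \<subseteq> S"
    "\<forall>y\<in>ball x r1. \<forall>z\<in>ball x r1. \<bar>f y - f z\<bar> \<le> C1 * norm (y - z) powr \<gamma>1"
    using assms(1,3) unfolding loc_holder_def by metis
  obtain r2 \<gamma>2 C2 where 2: "0 < r2" "0 < \<gamma>2" "\<gamma>2 \<le> 1" "0 \<le> C2" "ball x r2 \<subseteq> S"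
    "\<forall>y\<in>ball x r2. \<forall>z\<in>ball x r2. \<bar>g y - g z\<bar> \<le> C2 * norm (y - z) powr \<gamma>2"
    using assms(2,3) unfolding loc_holder_def by metis
  define r where "r = min (1/2) (min r1 r2)"
  define \<gamma> where "\<gamma> = min \<gamma>1 \<gamma>2"
  define C where "C = max C1 C2"
  have r: "0 < r" "r \<le> 1/2" "r \<le> r1" "r \<le> r2" using 1 2 by (auto simp: r_def)
  have g: "0 < \<gamma>" "\<gamma> \<le> 1" "\<gamma> \<le> \<gamma>1" "\<gamma> \<le> \<gamma>2" using 1 2 by (auto simp: \<gamma>_def)
  have C: "0 \<le> C" "C1 \<le> C" "C2 \<le> C" using 1 2 by (auto simp: C_def)
  have near: "norm (y - z) \<le> 1" if "y \<in> ball x r" "z \<in> ball x r" for y z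
    using that r(2) dist_triangle2[of y z x] by (simp add: dist_norm norm_minus_commute)
  have gen: "\<bar>k y - k z\<bar> \<le> C * norm (y - z) powr \<gamma>"
    if "\<forall>y\<in>ball x s. \<forall>z\<in>ball x s. \<bar>k y - k z\<bar> \<le> A * norm (y - z) powr \<beta>" "r \<le> s" "0 \<le> A" "A \<le> C" "\<gamma> \<le> \<beta>"
      "y \<in> ball x r" "z \<in> ball x r" for k :: "pt \<Rightarrow> real" and s A \<beta> y z
  proof -
    have "\<bar>k y - k z\<bar> \<le> A * norm (y - z) powr \<beta>" using that by auto
    also have "\<dots> \<le> C * norm (y - z) powr \<gamma>"
      using that near[OF that(6,7)] by (intro mult_mono powr_mono') auto
    finally show ?thesis .
  qed
  have small: "C * norm (y - x) powr \<gamma> \<le> C" if "y \<in> ball x r" for y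
    using near[OF that, of x] r(1) C(1) g(1) by (intro mult_left_le) (auto intro!: powr_le1)
  have f: "\<bar>f y - f z\<bar> \<le> C * norm (y - z) powr \<gamma>" if "y \<in> ball x r" "z \<in> ball x r" for y z
    by (rule gen[OF 1(6) r(3) 1(4) C(2) g(3) that])
  have gg: "\<bar>g y - g z\<bar> \<le> C * norm (y - z) powr \<gamma>" if "y \<in> ball x r" "z \<in> ball x r" for y z
    by (rule gen[OF 2(6) r(4) 2(4) C(3) g(4) that])
  show ?thesis
    by (rule that[of r \<gamma> C]; (intro f gg order_trans[OF f small] order_trans[OF gg small])?)
      (use r g C 1(5) in auto)
qed

lemma loc_holderI:
  assumes "\<And>x. x \<in> S \<Longrightarrow> \<exists>r \<gamma> C. 0 < r \<and> 0 < \<gamma> \<and> \<gamma> \<le> 1 \<and> 0 \<le> C \<and> ball x r \<subseteq> S \<and>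
     (\<forall>y\<in>ball x r. \<forall>z\<in>ball x r. \<bar>f y - f z\<bar> \<le> C * norm (y - z) powr \<gamma>)"
  shows "loc_holder S f"
  using assms unfolding loc_holder_def by blast

lemma loc_holder_mult:
  assumes "loc_holder S f" "loc_holder S g" shows "loc_holder S (\<lambda>x. f x * g x)"
proof (rule loc_holderI)
  fix x assume "x \<in> S"
  obtain r \<gamma> C where r: "0 < r" "r \<le> 1/2" "0 < \<gamma>" "\<gamma> \<le> 1" "0 \<le> C" "ball x r \<subseteq> S"
    and f: "\<And>y z. y \<in> ball x r \<Longrightarrow> z \<in> ball x r \<Longrightarrow> \<bar>f y - f z\<bar> \<le> C * norm (y - z) powr \<gamma>"
    and g: "\<And>y z. y \<in> ball x r \<Longrightarrow> z \<in> ball x r \<Longrightarrow> \<bar>g y - g z\<bar> \<le> C * norm (y - z) powr \<gamma>"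
    and b: "\<And>y. y \<in> ball x r \<Longrightarrow> \<bar>f y - f x\<bar> \<le> C" "\<And>y. y \<in> ball x r \<Longrightarrow> \<bar>g y - g x\<bar> \<le> C"
    by (rule loc_holder_common[OF assms \<open>x \<in> S\<close>]) (rule that; assumption)
  define M where "M = \<bar>f x\<bar> + \<bar>g x\<bar> + C"
  have M: "\<bar>f y\<bar> \<le> M" "\<bar>g y\<bar> \<le> M" if "y \<in> ball x r" for y using b[OF that] unfolding M_def by linarith+
  have M0: "0 \<le> M" using r(5) by (simp add: M_def)
  have "\<bar>f y * g y - f z * g z\<bar> \<le> (2 * M * C) * norm (y - z) powr \<gamma>" if "y \<in> ball x r" "z \<in> ball x r" for y z
  proof -
    have "f y * g y - f z * g z = f y * (g y - g z) + (f y - f z) * g z" by (simp add: algebra_simps)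
    then have "\<bar>f y * g y - f z * g z\<bar> \<le> \<bar>f y\<bar> * \<bar>g y - g z\<bar> + \<bar>f y - f z\<bar> * \<bar>g z\<bar>"
      using abs_triangle_ineq[of "f y * (g y - g z)" "(f y - f z) * g z"] by (simp add: abs_mult)
    also have "\<dots> \<le> M * (C * norm (y - z) powr \<gamma>) + (C * norm (y - z) powr \<gamma>) * M"
      using M that f[OF that] g[OF that] r(5) M0 by (intro add_mono mult_mono) auto
    finally show ?thesis by (simp add: algebra_simps)
  qed
  then show "\<exists>r \<gamma> C. 0 < r \<and> 0 < \<gamma> \<and> \<gamma> \<le> 1 \<and> 0 \<le> C \<and> ball x r \<subseteq> S \<and>
     (\<forall>y\<in>ball x r. \<forall>z\<in>ball x r. \<bar>f y * g y - f z * g z\<bar> \<le> C * norm (y - z) powr \<gamma>)"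
    using r M0 by (intro exI[of _ r] exI[of _ \<gamma>] exI[of _ "2 * M * C"]) auto
qed

lemma loc_holder_compose:
  fixes g g' :: "real \<Rightarrow> real"
  assumes "loc_holder S f" and g: "\<And>s. (g has_real_derivative g' s) (at s)" and c: "continuous_on UNIV g'"
  shows "loc_holder S (\<lambda>x. g (f x))"
proof (rule loc_holderI)
  fix x assume "x \<in> S"
  obtain r \<gamma> C where r: "0 < r" "r \<le> 1/2" "0 < \<gamma>" "\<gamma> \<le> 1" "0 \<le> C" "ball x r \<subseteq> S"
    and f: "\<And>y z. y \<in> ball x r \<Longrightarrow> z \<in> ball x r \<Longrightarrow> \<bar>f y - f z\<bar> \<le> C * norm (y - z) powr \<gamma>"
    and b: "\<And>y. y \<in> ball x r \<Longrightarrow> \<bar>f y - f x\<bar> \<le> C"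
    by (rule loc_holder_common[OF assms(1) assms(1) \<open>x \<in> S\<close>]) (rule that; assumption)
  define I where "I = {f x - C..f x + C}"
  have "compact (g' ` I)" unfolding I_def by (intro compact_continuous_image continuous_on_subset[OF c]) auto
  then obtain M0 where "\<forall>v\<in>g' ` I. norm v \<le> M0" using compact_imp_bounded[of "g' ` I"] unfolding bounded_iff by blast
  then have M: "\<bar>g' s\<bar> \<le> max M0 0" if "s \<in> I" for s using that by fastforce
  have "\<bar>g (f y) - g (f z)\<bar> \<le> (max M0 0 * C) * norm (y - z) powr \<gamma>" if "y \<in> ball x r" "z \<in> ball x r" for y z
  proof -
    have I: "f y \<in> I" "f z \<in> I" using b[OF that(1)] b[OF that(2)] by (auto simp: I_def abs_le_iff)
    have "norm (g (f y) - g (f z)) \<le> max M0 0 * norm (f y - f z)"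
      by (rule field_differentiable_bound[of I g g']) (use I M in \<open>auto simp: I_def intro: has_field_derivative_at_within[OF g]\<close>)
    also have "\<dots> \<le> max M0 0 * (C * norm (y - z) powr \<gamma>)" using f[OF that] by (intro mult_left_mono) auto
    finally show ?thesis by simp
  qed
  then show "\<exists>r \<gamma> C. 0 < r \<and> 0 < \<gamma> \<and> \<gamma> \<le> 1 \<and> 0 \<le> C \<and> ball x r \<subseteq> S \<and>
     (\<forall>y\<in>ball x r. \<forall>z\<in>ball x r. \<bar>g (f y) - g (f z)\<bar> \<le> C * norm (y - z) powr \<gamma>)"
    using r by (intro exI[of _ r] exI[of _ \<gamma>] exI[of _ "max M0 0 * C"]) auto
qed

lemma loc_holder_const: "open S \<Longrightarrow> loc_holder S (\<lambda>x. c)"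
  by (rule C1_loc_holder[of _ _ "\<lambda>i x. 0"]) (auto intro: has_pd_const)

lemma loc_holder_power: "open S \<Longrightarrow> loc_holder S f \<Longrightarrow> loc_holder S (\<lambda>x. f x ^ k)"
  by (induction k) (auto intro: loc_holder_const loc_holder_mult)

lemma loc_holder_prod:
  "finite J \<Longrightarrow> open S \<Longrightarrow> (\<And>j. j \<in> J \<Longrightarrow> loc_holder S (f j)) \<Longrightarrow> loc_holder S (\<lambda>x. \<Prod>j\<in>J. f j x)"
  by (induction J rule: finite_induct) (auto intro: loc_holder_const loc_holder_mult)

text \<open>Subadditivity of the power, after scaling by \<open>a\<close>: numbers \<open>t\<close>
  and \<open>1 - t\<close> of the unit interval do not exceed their powers with exponent at most
  1.\<close>

lemma powr_diff_le:
  fixes a b :: real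
  assumes "0 \<le> b" "b \<le> a" "0 < \<beta>" "\<beta> \<le> 1"
  shows "a powr \<beta> - b powr \<beta> \<le> (a - b) powr \<beta>"
proof (cases "a = 0")
  case False
  then have a: "a > 0" using assms by linarith
  define t where "t = b / a"
  have t: "0 \<le> t" "t \<le> 1" using a assms by (auto simp: t_def)
  have le: "s \<le> s powr \<beta>" if "0 \<le> s" "s \<le> 1" for s :: real
    using powr_mono'[of \<beta> 1 s] that assms by (cases "s = 0") auto
  have "a powr \<beta> * 1 \<le> a powr \<beta> * (t powr \<beta> + (1 - t) powr \<beta>)"
    using le[of t] le[of "1 - t"] t by (intro mult_left_mono) auto
  also have "\<dots> = (a * t) powr \<beta> + (a * (1 - t)) powr \<beta>"
    using a t by (simp add: powr_mult distrib_left)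
  also have "\<dots> = b powr \<beta> + (a - b) powr \<beta>" using a by (simp add: t_def right_diff_distrib)
  finally show ?thesis by simp
qed (use assms in auto)

text \<open>The exponent may exceed 1. The function is then a \<open>k\<close>-th power of one with
  exponent \<open>\<beta> / k \<le> 1\<close>, which is globally Hoelder.\<close>

lemma loc_holder_norm_powr:
  assumes "open S" "0 < \<beta>" shows "loc_holder S (\<lambda>x. norm (x - p) powr \<beta>)"
proof -
  define k where "k = Suc (nat \<lceil>\<beta>\<rceil>)"
  define \<delta> where "\<delta> = \<beta> / real k"
  have k: "real k \<ge> \<beta>" "k > 0" unfolding k_def by linarith+
  have d: "0 < \<delta>" "\<delta> \<le> 1" using k assms(2) by (auto simp: \<delta>_def)
  have "loc_holder S (\<lambda>x. norm (x - p) powr \<delta>)"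
  proof (rule loc_holderI)
    fix x assume "x \<in> S"
    then obtain r where r: "r > 0" "ball x r \<subseteq> S" using assms(1) openE by blast
    have "\<bar>norm (y - p) powr \<delta> - norm (z - p) powr \<delta>\<bar> \<le> 1 * norm (y - z) powr \<delta>" for y z
    proof -
      have one: "norm (u - p) powr \<delta> - norm (v - p) powr \<delta> \<le> norm (u - v) powr \<delta>" for u v
      proof (cases "norm (v - p) \<le> norm (u - p)")
        case True
        have "norm (u - p) powr \<delta> - norm (v - p) powr \<delta> \<le> (norm (u - p) - norm (v - p)) powr \<delta>"
          by (rule powr_diff_le) (use True d in auto)
        also have "\<dots> \<le> norm (u - v) powr \<delta>"
          using True d norm_triangle_ineq2[of "u - p" "v - p"] by (intro powr_mono2) auto
        finally show ?thesis .
      next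
        case False
        then have "norm (u - p) powr \<delta> \<le> norm (v - p) powr \<delta>" using d by (intro powr_mono2) auto
        then show ?thesis using powr_ge_zero[of "norm (u - v)" \<delta>] by linarith
      qed
      show ?thesis using one[of y z] one[of z y] by (simp add: norm_minus_commute abs_le_iff)
    qed
    then show "\<exists>r \<gamma> C. 0 < r \<and> 0 < \<gamma> \<and> \<gamma> \<le> 1 \<and> 0 \<le> C \<and> ball x r \<subseteq> S \<and>
     (\<forall>y\<in>ball x r. \<forall>z\<in>ball x r. \<bar>norm (y - p) powr \<delta> - norm (z - p) powr \<delta>\<bar> \<le> C * norm (y - z) powr \<gamma>)"
      using r d by (intro exI[of _ r] exI[of _ \<delta>] exI[of _ 1]) auto
  qed
  then have "loc_holder S (\<lambda>x. (norm (x - p) powr \<delta>) ^ k)" by (rule loc_holder_power[OF assms(1)])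
  moreover have "(norm (x - p) powr \<delta>) ^ k = norm (x - p) powr \<beta>" for x
    using k by (cases "x = p") (auto simp: powr_powr powr_realpow[symmetric] \<delta>_def)
  ultimately show ?thesis by simp
qed

subsection \<open>Energy identities\<close>

text \<open>Cut-offs of the identity vanishing near 0: composed with a function that vanishes on the
  boundary they yield compactly supported test functions.\<close>

definition cut0 :: "real \<Rightarrow> real \<Rightarrow> real" where "cut0 e s = (if s \<ge> e then s - 2 * e + e\<^sup>2 / s else 0)"
definition cut1 :: "real \<Rightarrow> real \<Rightarrow> real" where "cut1 e s = (if s \<ge> e then 1 - e\<^sup>2 / s\<^sup>2 else 0)"
definition cut :: "real \<Rightarrow> real \<Rightarrow> real" where "cut e s = cut0 e s - cut0 e (- s)"
definition cut' :: "real \<Rightarrow> real \<Rightarrow> real" where "cut' e s = cut1 e s + cut1 e (- s)"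

text \<open>For \<open>s \<ge> e\<close> the formula is (s - e)^2 / s; the double zero at
  \<open>e\<close> makes the gluing with 0 continuously differentiable.\<close>

lemma DERIV_cut0: assumes "e > 0" shows "(cut0 e has_real_derivative cut1 e s) (at s)"
  unfolding cut0_def[abs_def] cut1_def
  by (rule DERIV_piecewise) (use assms in \<open>auto intro!: derivative_eq_intros simp: power2_eq_square\<close>)

lemma DERIV_cut: assumes "e > 0" shows "(cut e has_real_derivative cut' e s) (at s)"
proof -
  have "((\<lambda>s. cut0 e (- s)) has_real_derivative cut1 e (- s) * (- 1)) (at s)"
    by (rule DERIV_chain2[OF DERIV_cut0[OF assms]]) (auto intro!: derivative_eq_intros)
  from DERIV_diff[OF DERIV_cut0[OF assms, of s] this] show ?thesis unfolding cut_def[abs_def] cut'_def by simp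
qed

lemma continuous_cut': assumes "e > 0" shows "continuous_on UNIV (cut' e)"
proof -
  have "continuous_on ({e..} \<union> {..e}) (\<lambda>s::real. if s \<ge> e then 1 - e\<^sup>2 / s\<^sup>2 else 0)"
    by (rule continuous_on_cases) (use assms in \<open>auto intro!: continuous_intros\<close>)
  moreover have "{e..} \<union> {..e} = (UNIV :: real set)" by auto
  ultimately have c: "continuous_on UNIV (cut1 e)" unfolding cut1_def[abs_def] by metis
  show ?thesis unfolding cut'_def[abs_def]
    by (intro continuous_intros c continuous_on_compose2[OF c]) auto
qed

lemma cut_zero: "e > 0 \<Longrightarrow> \<bar>s\<bar> \<le> e \<Longrightarrow> cut e s = 0"
  by (auto simp: cut_def cut0_def power2_eq_square abs_le_iff)

lemma cut0_bounds: assumes "e > 0" shows "0 \<le> cut0 e s" "cut0 e s \<le> max 0 s" "0 \<le> cut1 e s" "cut1 e s \<le> 1"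
proof -
  show "0 \<le> cut0 e s"
  proof (cases "s \<ge> e")
    case True
    then have "s - 2 * e + e\<^sup>2 / s = (s - e)\<^sup>2 / s" using assms by (simp add: field_simps power2_eq_square)
    then show ?thesis using True assms by (simp add: cut0_def)
  qed (simp add: cut0_def)
  show "cut0 e s \<le> max 0 s"
  proof (cases "s \<ge> e")
    case True
    then have "e\<^sup>2 / s \<le> e" using assms by (simp add: field_simps power2_eq_square)
    then show ?thesis using True assms by (simp add: cut0_def)
  qed (simp add: cut0_def)
  show "0 \<le> cut1 e s" "cut1 e s \<le> 1" using assms by (auto simp: cut1_def power_mono)
qed

lemma cut_bounds: assumes "e > 0" shows "\<bar>cut e s\<bar> \<le> \<bar>s\<bar>" "0 \<le> cut' e s" "cut' e s \<le> 1"
proof -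
  show "\<bar>cut e s\<bar> \<le> \<bar>s\<bar>" using cut0_bounds(1,2)[OF assms, of s] cut0_bounds(1,2)[OF assms, of "- s"] unfolding cut_def by linarith
  show "0 \<le> cut' e s" using cut0_bounds(3)[OF assms, of s] cut0_bounds(3)[OF assms, of "- s"] unfolding cut'_def by linarith
  have "cut1 e s = 0 \<or> cut1 e (- s) = 0" using assms by (auto simp: cut1_def)
  then show "cut' e s \<le> 1" using cut0_bounds(4)[OF assms, of s] cut0_bounds(4)[OF assms, of "- s"] unfolding cut'_def by auto
qed

lemma cut_approx: assumes "e > 0" shows "\<bar>cut e s - s\<bar> \<le> 2 * e"
proof -
  have one: "\<bar>cut0 e s - max 0 s\<bar> \<le> 2 * e" for s
  proof (cases "s \<ge> e")
    case True
    then have "0 \<le> e\<^sup>2 / s" "e\<^sup>2 / s \<le> e" using assms by (auto simp: field_simps power2_eq_square)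
    then show ?thesis using True assms by (auto simp: cut0_def)
  qed (use assms in \<open>auto simp: cut0_def\<close>)
  show ?thesis
  proof (cases "s \<ge> 0")
    case True
    then have "cut0 e (- s) = 0" using assms by (auto simp: cut0_def)
    then show ?thesis using one[of s] True by (simp add: cut_def)
  next
    case False
    then have "cut0 e s = 0" using assms by (auto simp: cut0_def)
    then show ?thesis using one[of "- s"] False by (simp add: cut_def)
  qed
qed

text \<open>As \<open>e\<close> decreases the derivative increases, so the cut-off can be removed by
  monotone convergence before integrability of the gradient is known.\<close>

lemma cut'_mono: assumes "0 < d" "d \<le> e" shows "cut' e s \<le> cut' d s"
proof -
  have "cut1 e s \<le> cut1 d s" for s
  proof (cases "s \<ge> e")
    case True
    then have "d\<^sup>2 / s\<^sup>2 \<le> e\<^sup>2 / s\<^sup>2" using assms by (intro divide_right_mono power_mono) auto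
    then show ?thesis using True assms by (simp add: cut1_def)
  next
    case False
    then show ?thesis using cut0_bounds(3)[OF assms(1), of s] by (simp add: cut1_def)
  qed
  then show ?thesis unfolding cut'_def by (intro add_mono)
qed

lemma cut'_tendsto: assumes "s > 0" shows "(\<lambda>n. cut' (inverse (real (Suc n))) s) \<longlonglongrightarrow> 1"
proof -
  have lim: "(\<lambda>n. inverse (real (Suc n))) \<longlonglongrightarrow> 0" by (rule LIMSEQ_inverse_real_of_nat)
  have "(\<lambda>n. 1 - (inverse (real (Suc n)))\<^sup>2 / s\<^sup>2) \<longlonglongrightarrow> 1 - 0\<^sup>2 / s\<^sup>2"
    by (intro tendsto_intros lim) (use assms in auto)
  moreover have "\<forall>\<^sub>F n in sequentially. inverse (real (Suc n)) < s" by (rule order_tendstoD(2)[OF lim assms])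
  then have "\<forall>\<^sub>F n in sequentially. 1 - (inverse (real (Suc n)))\<^sup>2 / s\<^sup>2 = cut' (inverse (real (Suc n))) s"
  proof eventually_elim
    case (elim n)
    have "inverse (real (Suc n)) > 0" by simp
    then have "\<not> inverse (real (Suc n)) \<le> - s" using assms by linarith
    then show ?case using elim by (simp add: cut'_def cut1_def less_imp_le)
  qed
  ultimately show ?thesis using Lim_transform_eventually by fastforce
qed

context green_domain
begin

text \<open>The bounded Laplacian makes products with it integrable; nothing is required of the
  gradient near the boundary.\<close>

definition admissible :: "(pt \<Rightarrow> real) \<Rightarrow> bool" where
  "admissible u \<longleftrightarrow> Ck 2 \<Omega> u \<and> continuous_on (closure \<Omega>) u \<and> (\<forall>z\<in>frontier \<Omega>. u z = 0) \<and> (\<exists>B. \<forall>x\<in>\<Omega>. \<bar>laplacian u x\<bar> \<le> B)"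

definition grad_dot :: "(pt \<Rightarrow> real) \<Rightarrow> (pt \<Rightarrow> real) \<Rightarrow> pt \<Rightarrow> real" where
  "grad_dot u v x = (\<Sum>i\<in>UNIV. pd i u x * pd i v x)"

lemma grad_dot_self: "grad_dot u u x = grad_sq u x"
  by (simp add: grad_dot_def grad_sq_def power2_eq_square)

lemma grad_dot_bound: "\<bar>grad_dot u v x\<bar> \<le> grad_sq u x + grad_sq v x"
proof -
  have "\<bar>grad_dot u v x\<bar> \<le> (\<Sum>i\<in>UNIV. \<bar>pd i u x * pd i v x\<bar>)" unfolding grad_dot_def by (rule sum_abs)
  also have "\<dots> \<le> (\<Sum>i\<in>UNIV. (pd i u x)\<^sup>2 + (pd i v x)\<^sup>2)"
  proof (rule sum_mono)
    fix i
    have "2 * (\<bar>pd i u x\<bar> * \<bar>pd i v x\<bar>) \<le> \<bar>pd i u x\<bar>\<^sup>2 + \<bar>pd i v x\<bar>\<^sup>2"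
      using sum_squares_bound[of "\<bar>pd i u x\<bar>" "\<bar>pd i v x\<bar>"] by simp
    moreover have "0 \<le> \<bar>pd i u x\<bar> * \<bar>pd i v x\<bar>" by simp
    ultimately show "\<bar>pd i u x * pd i v x\<bar> \<le> (pd i u x)\<^sup>2 + (pd i v x)\<^sup>2" unfolding abs_mult power2_abs by linarith
  qed
  finally show ?thesis by (simp add: grad_sq_def sum.distrib)
qed

lemma grad_sq_nonneg: "0 \<le> grad_sq u x" unfolding grad_sq_def by (simp add: sum_nonneg)

lemma continuous_grad_dot: "Ck 2 \<Omega> u \<Longrightarrow> Ck 2 \<Omega> v \<Longrightarrow> continuous_on \<Omega> (grad_dot u v)"
  unfolding grad_dot_def[abs_def] by (intro continuous_intros Ck2D; assumption)

lemma continuous_laplacian: "Ck 2 \<Omega> u \<Longrightarrow> continuous_on \<Omega> (laplacian u)"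
  unfolding laplacian_def[abs_def] by (intro continuous_intros Ck2D; assumption)

lemma compact_superlevel:
  fixes v :: "pt \<Rightarrow> real"
  assumes "continuous_on (closure \<Omega>) v" "\<And>z. z \<in> frontier \<Omega> \<Longrightarrow> v z = 0" "e > 0"
  shows "compact {x\<in>closure \<Omega>. \<bar>v x\<bar> \<ge> e}" "{x\<in>closure \<Omega>. \<bar>v x\<bar> \<ge> e} \<subseteq> \<Omega>"
proof -
  have "closedin (top_of_set (closure \<Omega>)) (closure \<Omega> \<inter> (\<lambda>x. \<bar>v x\<bar>) -` {e..})"
    by (rule continuous_closedin_preimage) (intro continuous_intros assms closed_atLeast)+
  then have "closed (closure \<Omega> \<inter> (\<lambda>x. \<bar>v x\<bar>) -` {e..})" by (rule closedin_closed_trans) simp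
  moreover have "{x\<in>closure \<Omega>. \<bar>v x\<bar> \<ge> e} = closure \<Omega> \<inter> (\<lambda>x. \<bar>v x\<bar>) -` {e..}" by auto
  ultimately show "compact {x\<in>closure \<Omega>. \<bar>v x\<bar> \<ge> e}"
    using bounded_subset[OF bounded_closure[OF om(2)]] by (simp add: compact_eq_bounded_closed)
  show "{x\<in>closure \<Omega>. \<bar>v x\<bar> \<ge> e} \<subseteq> \<Omega>"
    using assms(2,3) om(1) by (force simp: frontier_def interior_open)
qed

text \<open>Since \<open>v\<close> vanishes on the boundary, \<open>g (v x)\<close> has compact
  support in \<open>\<Omega>\<close>, and the field g(v) grad u has a divergence of integral
  zero.\<close>

lemma integration_by_parts_cutoff:
  assumes u: "Ck 2 \<Omega> u" and v: "Ck 2 \<Omega> v" "continuous_on (closure \<Omega>) v" "\<And>z. z \<in> frontier \<Omega> \<Longrightarrow> v z = 0"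
    and g: "\<And>s. (g has_real_derivative g' s) (at s)" "continuous_on UNIV g'" and "e > 0" "\<And>s. \<bar>s\<bar> \<le> e \<Longrightarrow> g s = 0"
  shows "integrable (leb \<Omega>) (\<lambda>x. g (v x) * - laplacian u x)" "integrable (leb \<Omega>) (\<lambda>x. g' (v x) * grad_dot v u x)"
    "(\<integral>x. g (v x) * - laplacian u x \<partial>leb \<Omega>) = (\<integral>x. g' (v x) * grad_dot v u x \<partial>leb \<Omega>)"
proof -
  let ?C = "{x\<in>closure \<Omega>. \<bar>v x\<bar> \<ge> e}"
  note C = compact_superlevel[OF v(2,3) assms(7)]
  have g0: "g (v x) = 0" if "x \<in> \<Omega> - ?C" for x using that assms(8) in_closure by force
  have cg: "continuous_on UNIV g" using g(1) by (meson DERIV_isCont continuous_at_imp_continuous_on)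
  have cgv: "continuous_on \<Omega> (\<lambda>x. g (v x))" "continuous_on \<Omega> (\<lambda>x. g' (v x))"
    by (rule continuous_on_compose2[OF cg] continuous_on_compose2[OF g(2)], auto intro: Ck2D(1)[OF v(1)])+
  define F' where "F' i x = (g' (v x) * pd i v x) * pd i u x + g (v x) * pd i (pd i u) x" for i x
  have I: "integrable (leb \<Omega>) (F' i)" "(\<integral>x. F' i x \<partial>leb \<Omega>) = 0" for i
  proof -
    have c: "continuous_on \<Omega> (\<lambda>x. g (v x) * pd i u x)" "continuous_on \<Omega> (F' i)"
      unfolding F'_def by (intro continuous_intros cgv Ck2D[OF u] Ck2D[OF v(1)])+
    have d: "has_pd i (\<lambda>x. g (v x) * pd i u x) x (F' i x)" if "x \<in> \<Omega>" for x
      unfolding F'_def by (intro has_pd_mult has_pd_chain[OF g(1)] Ck2D[OF u] Ck2D[OF v(1)] that)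
    have z: "g (v x) * pd i u x = 0" if "x \<in> \<Omega> - ?C" for x using g0[OF that] by simp
    show "integrable (leb \<Omega>) (F' i)" "(\<integral>x. F' i x \<partial>leb \<Omega>) = 0"
      by (rule integral_pd_zero[OF om(1) C c d z]; assumption)+
  qed
  show i1: "integrable (leb \<Omega>) (\<lambda>x. g (v x) * - laplacian u x)"
    by (rule integrable_compact_leb[OF om(1) C]) (auto intro!: continuous_intros cgv continuous_laplacian[OF u] g0)
  have sum: "integrable (leb \<Omega>) (\<lambda>x. \<Sum>i\<in>UNIV. F' i x)" "(\<integral>x. (\<Sum>i\<in>UNIV. F' i x) \<partial>leb \<Omega>) = 0"
    using I by (auto simp: Bochner_Integration.integral_sum)
  have eq: "g' (v x) * grad_dot v u x = (\<Sum>i\<in>UNIV. F' i x) + g (v x) * - laplacian u x" for x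
    unfolding F'_def grad_dot_def laplacian_def sum.distrib by (simp add: sum_distrib_left mult.assoc)
  show "integrable (leb \<Omega>) (\<lambda>x. g' (v x) * grad_dot v u x)"
    unfolding eq by (intro Bochner_Integration.integrable_add sum i1)
  show "(\<integral>x. g (v x) * - laplacian u x \<partial>leb \<Omega>) = (\<integral>x. g' (v x) * grad_dot v u x \<partial>leb \<Omega>)"
    unfolding eq using sum i1 by simp
qed

lemma continuous_closure_bounded:
  assumes "continuous_on (closure \<Omega>) (u :: pt \<Rightarrow> real)" obtains B where "\<And>x. x \<in> closure \<Omega> \<Longrightarrow> \<bar>u x\<bar> \<le> B"
proof -
  have "compact (u ` closure \<Omega>)" by (intro compact_continuous_image assms) (use om in simp)
  then obtain B where "\<forall>v\<in>u ` closure \<Omega>. norm v \<le> B" using compact_imp_bounded[of "u ` closure \<Omega>"] unfolding bounded_iff by blast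
  then show ?thesis by (intro that[of B]) auto
qed

lemma admissible_lim:
  assumes u: "admissible u" and v: "admissible v"
  shows "(\<lambda>n. \<integral>x. cut (inverse (real (Suc n))) (v x) * - laplacian u x \<partial>leb \<Omega>) \<longlonglongrightarrow> (\<integral>x. v x * - laplacian u x \<partial>leb \<Omega>)"
    "integrable (leb \<Omega>) (\<lambda>x. v x * - laplacian u x)"
proof -
  have u': "Ck 2 \<Omega> u" and v': "continuous_on (closure \<Omega>) v" "Ck 2 \<Omega> v" using u v by (auto simp: admissible_def)
  obtain B where B: "\<forall>x\<in>\<Omega>. \<bar>laplacian u x\<bar> \<le> B" using u by (auto simp: admissible_def)
  obtain A where A: "\<And>x. x \<in> closure \<Omega> \<Longrightarrow> \<bar>v x\<bar> \<le> A" using continuous_closure_bounded[OF v'(1)] by blast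
  have mv: "v \<in> borel_measurable (leb \<Omega>)" by (rule borel_measurable_leb[OF Ck2D(1)[OF v'(2)]])
  have ml: "laplacian u \<in> borel_measurable (leb \<Omega>)" by (rule borel_measurable_leb[OF continuous_laplacian[OF u']])
  have mc: "(\<lambda>x. cut (inverse (real (Suc n))) (v x)) \<in> borel_measurable (leb \<Omega>)" for n
  proof -
    have "continuous_on UNIV (cut (inverse (real (Suc n))))"
      by (intro continuous_at_imp_continuous_on ballI DERIV_isCont[OF DERIV_cut]) simp
    then show ?thesis by (rule borel_measurable_continuous_on[OF _ mv])
  qed
  have bd: "\<bar>s * - laplacian u x\<bar> \<le> A * B" if "x \<in> \<Omega>" "\<bar>s\<bar> \<le> \<bar>v x\<bar>" for s x
    unfolding abs_mult abs_minus_cancel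
    using B that A[OF in_closure[OF that(1)]] by (intro mult_mono) auto
  show "integrable (leb \<Omega>) (\<lambda>x. v x * - laplacian u x)"
    by (rule integrable_bounded_leb[OF om(2,1)]) (use mv ml bd in auto)
  show "(\<lambda>n. \<integral>x. cut (inverse (real (Suc n))) (v x) * - laplacian u x \<partial>leb \<Omega>) \<longlonglongrightarrow> (\<integral>x. v x * - laplacian u x \<partial>leb \<Omega>)"
  proof (rule integral_dominated_convergence[where w="\<lambda>x. A * B"])
    show "integrable (leb \<Omega>) (\<lambda>x. A * B)" using finite_measure.integrable_const[OF finite_leb_om] .
    show "AE x in leb \<Omega>. (\<lambda>n. cut (inverse (real (Suc n))) (v x) * - laplacian u x) \<longlonglongrightarrow> v x * - laplacian u x"
    proof (rule AE_I2, rule tendsto_mult[OF _ tendsto_const])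
      fix x
      have "(\<lambda>n. cut (inverse (real (Suc n))) (v x) - v x) \<longlonglongrightarrow> 0"
        by (rule Lim_null_comparison[of _ "\<lambda>n. 2 * inverse (real (Suc n))"])
          (auto intro!: always_eventually cut_approx tendsto_mult_right_zero LIMSEQ_inverse_real_of_nat simp del: of_nat_Suc)
      then show "(\<lambda>n. cut (inverse (real (Suc n))) (v x)) \<longlonglongrightarrow> v x" by (simp only: LIM_zero_iff)
    qed
    show "AE x in leb \<Omega>. norm (cut (inverse (real (Suc n))) (v x) * - laplacian u x) \<le> A * B" for n
      unfolding real_norm_def by (intro AE_I2 bd cut_bounds) (auto simp: space_restrict_space)
  qed (use mv ml mc in auto)
qed

lemma admissible_parts:
  assumes u: "admissible u" and v: "admissible v" and "e > 0"
  shows "integrable (leb \<Omega>) (\<lambda>x. cut' e (v x) * grad_dot v u x)"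
    "(\<integral>x. cut e (v x) * - laplacian u x \<partial>leb \<Omega>) = (\<integral>x. cut' e (v x) * grad_dot v u x \<partial>leb \<Omega>)"
proof -
  have uv: "Ck 2 \<Omega> u" "Ck 2 \<Omega> v" "continuous_on (closure \<Omega>) v" "\<And>z. z \<in> frontier \<Omega> \<Longrightarrow> v z = 0"
    using u v by (simp_all add: admissible_def)
  note P = integration_by_parts_cutoff[OF uv DERIV_cut[OF assms(3)] continuous_cut'[OF assms(3)] assms(3) cut_zero[OF assms(3)]]
  show "integrable (leb \<Omega>) (\<lambda>x. cut' e (v x) * grad_dot v u x)" by (rule P(2))
  show "(\<integral>x. cut e (v x) * - laplacian u x \<partial>leb \<Omega>) = (\<integral>x. cut' e (v x) * grad_dot v u x \<partial>leb \<Omega>)" by (rule P(3))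
qed

text \<open>Unlike the identity below this does not ask for a sign of \<open>u\<close>, and it will
  be applied to differences of potentials.\<close>

lemma energy_nonneg: assumes "admissible u" shows "0 \<le> (\<integral>x. u x * - laplacian u x \<partial>leb \<Omega>)"
proof (rule LIMSEQ_le_const[OF admissible_lim(1)[OF assms assms]], intro exI allI impI)
  fix n :: nat
  have "(\<integral>x. cut (inverse (real (Suc n))) (u x) * - laplacian u x \<partial>leb \<Omega>) = (\<integral>x. cut' (inverse (real (Suc n))) (u x) * grad_dot u u x \<partial>leb \<Omega>)"
    by (rule admissible_parts(2)[OF assms assms]) simp
  also have "\<dots> \<ge> 0"
    unfolding grad_dot_self by (intro Bochner_Integration.integral_nonneg mult_nonneg_nonneg cut_bounds grad_sq_nonneg) simp
  finally show "0 \<le> (\<integral>x. cut (inverse (real (Suc n))) (u x) * - laplacian u x \<partial>leb \<Omega>)" .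
qed

text \<open>Where \<open>u\<close> is positive the factor \<open>cut'\<close> increases to 1.
  Monotone convergence then yields square integrability of the gradient together with the
  identity.\<close>

lemma energy_identity:
  assumes u: "admissible u" and pos: "\<And>x. x \<in> \<Omega> \<Longrightarrow> u x > 0"
  shows "integrable (leb \<Omega>) (grad_sq u)" "(\<integral>x. grad_sq u x \<partial>leb \<Omega>) = (\<integral>x. u x * - laplacian u x \<partial>leb \<Omega>)"
proof -
  let ?e = "\<lambda>n. inverse (real (Suc n))"
  let ?f = "\<lambda>n x. cut' (?e n) (u x) * grad_sq u x"
  have i: "integrable (leb \<Omega>) (?f n)" for n using admissible_parts(1)[OF u u, of "?e n"] by (simp add: grad_dot_self)
  have eq: "(\<integral>x. ?f n x \<partial>leb \<Omega>) = (\<integral>x. cut (?e n) (u x) * - laplacian u x \<partial>leb \<Omega>)" for n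
    using admissible_parts(2)[OF u u, of "?e n"] by (simp add: grad_dot_self)
  have mono: "AE x in leb \<Omega>. mono (\<lambda>n. ?f n x)"
    by (intro AE_I2 monoI mult_right_mono cut'_mono grad_sq_nonneg le_imp_inverse_le) auto
  have lim: "AE x in leb \<Omega>. (\<lambda>n. ?f n x) \<longlonglongrightarrow> grad_sq u x"
  proof (rule AE_I2)
    fix x assume "x \<in> space (leb \<Omega>)"
    then have "u x > 0" using pos by (simp add: space_restrict_space)
    from tendsto_mult[OF cut'_tendsto[OF this] tendsto_const[of "grad_sq u x"]]
    show "(\<lambda>n. ?f n x) \<longlonglongrightarrow> grad_sq u x" by simp
  qed
  have conv: "(\<lambda>n. \<integral>x. ?f n x \<partial>leb \<Omega>) \<longlonglongrightarrow> (\<integral>x. u x * - laplacian u x \<partial>leb \<Omega>)"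
    unfolding eq by (rule admissible_lim(1)[OF u u])
  have m: "grad_sq u \<in> borel_measurable (leb \<Omega>)"
  proof -
    have "grad_dot u u = grad_sq u" by (simp add: fun_eq_iff grad_dot_self)
    then show ?thesis using borel_measurable_leb[OF continuous_grad_dot, of u u] u by (simp add: admissible_def)
  qed
  show "integrable (leb \<Omega>) (grad_sq u)" by (rule integrable_monotone_convergence[OF i mono lim conv m])
  show "(\<integral>x. grad_sq u x \<partial>leb \<Omega>) = (\<integral>x. u x * - laplacian u x \<partial>leb \<Omega>)"
    by (rule integral_monotone_convergence[OF i mono lim conv m])
qed

text \<open>Both sides equal the integral of grad u . grad v. The gradients are square integrable by
  the energy identity, so the limit of the cut-offs is dominated.\<close>

lemma energy_symmetric:
  assumes u: "admissible u" "\<And>x. x \<in> \<Omega> \<Longrightarrow> u x > 0" and v: "admissible v" "\<And>x. x \<in> \<Omega> \<Longrightarrow> v x > 0"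
  shows "(\<integral>x. v x * - laplacian u x \<partial>leb \<Omega>) = (\<integral>x. u x * - laplacian v x \<partial>leb \<Omega>)"
proof -
  let ?e = "\<lambda>n. inverse (real (Suc n))"
  have gd: "(\<integral>x. b x * - laplacian a x \<partial>leb \<Omega>) = (\<integral>x. grad_dot b a x \<partial>leb \<Omega>)"
    if a: "admissible a" "\<And>x. x \<in> \<Omega> \<Longrightarrow> a x > 0" and b: "admissible b" "\<And>x. x \<in> \<Omega> \<Longrightarrow> b x > 0" for a b
  proof -
    let ?f = "\<lambda>n x. cut' (?e n) (b x) * grad_dot b a x"
    have "(\<lambda>n. \<integral>x. ?f n x \<partial>leb \<Omega>) \<longlonglongrightarrow> (\<integral>x. grad_dot b a x \<partial>leb \<Omega>)"
    proof (rule integral_dominated_convergence[where w="\<lambda>x. grad_sq b x + grad_sq a x"])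
      show "integrable (leb \<Omega>) (\<lambda>x. grad_sq b x + grad_sq a x)"
        using energy_identity(1)[OF a] energy_identity(1)[OF b] by simp
      show "grad_dot b a \<in> borel_measurable (leb \<Omega>)"
        using a(1) b(1) by (intro borel_measurable_leb continuous_grad_dot) (auto simp: admissible_def)
      show "?f n \<in> borel_measurable (leb \<Omega>)" for n using admissible_parts(1)[OF a(1) b(1), of "?e n"] by auto
      show "AE x in leb \<Omega>. (\<lambda>n. ?f n x) \<longlonglongrightarrow> grad_dot b a x"
      proof (rule AE_I2)
        fix x assume "x \<in> space (leb \<Omega>)"
        then have "b x > 0" using b(2) by (simp add: space_restrict_space)
        from tendsto_mult[OF cut'_tendsto[OF this] tendsto_const[of "grad_dot b a x"]]
        show "(\<lambda>n. ?f n x) \<longlonglongrightarrow> grad_dot b a x" by simp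
      qed
      show "AE x in leb \<Omega>. norm (?f n x) \<le> grad_sq b x + grad_sq a x" for n
      proof (rule AE_I2)
        fix x
        have "\<bar>cut' (?e n) (b x)\<bar> * \<bar>grad_dot b a x\<bar> \<le> 1 * (grad_sq b x + grad_sq a x)"
          using cut_bounds(2,3)[of "?e n" "b x"] grad_dot_bound[of b a x] by (intro mult_mono) auto
        then show "norm (?f n x) \<le> grad_sq b x + grad_sq a x" by (simp add: abs_mult)
      qed
    qed
    moreover have "(\<integral>x. ?f n x \<partial>leb \<Omega>) = (\<integral>x. cut (?e n) (b x) * - laplacian a x \<partial>leb \<Omega>)" for n
      using admissible_parts(2)[OF a(1) b(1), of "?e n"] by simp
    ultimately show ?thesis using LIMSEQ_unique[OF admissible_lim(1)[OF a(1) b(1)]] by simp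
  qed
  have "grad_dot v u = grad_dot u v" by (auto simp: grad_dot_def mult.commute)
  then show ?thesis using gd[OF u v] gd[OF v u] by simp
qed

lemma pot_admissible:
  assumes "bdd \<rho> B" "loc_holder \<Omega> \<rho>" shows "admissible (pot \<rho>)"
  unfolding admissible_def using pot_C2[OF assms] pot_continuous[OF assms(1)] pot_frontier assms(1) by (auto simp: bdd_def)

lemma pot_nonneg: assumes "\<And>q. q \<in> \<Omega> \<Longrightarrow> \<rho> q \<ge> 0" "x \<in> closure \<Omega>" shows "pot \<rho> x \<ge> 0"
  unfolding pot_def
proof (rule integral_nonneg_AE)
  show "AE q in leb \<Omega>. 0 \<le> K q x * \<rho> q"
    using AE_leb_neq[OF om(1), of x] AE_space
    by eventually_elim (use assms K_nonneg in \<open>auto simp: space_restrict_space\<close>)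
qed

text \<open>As the pole approaches \<open>x\<close> the logarithm tends to infinity while
  \<open>H q x\<close> stays bounded, so the kernel is positive on a small disc around
  \<open>x\<close>, a set of positive measure.\<close>

lemma pot_pos:
  assumes "bdd \<rho> B" "\<And>q. q \<in> \<Omega> \<Longrightarrow> \<rho> q \<ge> 0" "finite P" "\<And>q. q \<in> \<Omega> - P \<Longrightarrow> \<rho> q > 0" "x \<in> \<Omega>"
  shows "pot \<rho> x > 0"
proof (rule ccontr)
  assume "\<not> pot \<rho> x > 0"
  then have z: "pot \<rho> x = 0" using pot_nonneg[OF assms(2) in_closure[OF assms(5)]] by force
  obtain d where d: "d > 0" "\<forall>q\<in>ball x d. q \<in> \<Omega> \<and> (\<forall>y\<in>closure \<Omega>. \<bar>H q y - H x y\<bar> \<le> 1)"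
    using H_close[OF assms(5), of 1] by auto
  define M where "M = \<bar>H x x\<bar> + 1"
  \<comment> \<open>The singular kernel exceeds \<open>M\<close> exactly when the distance is below
    \<open>exp (- 2 * pi * M)\<close>, and \<open>- M\<close> is a lower bound for
    \<open>H q x\<close>.\<close>
  define s where "s = min d (exp (- 2 * pi * M) / 2)"
  have s: "0 < s" "s \<le> d" "s < exp (- 2 * pi * M)" using d(1) by (auto simp: s_def min_less_iff_disj)
  have Kp: "K q x > 0" if q: "q \<in> ball x s" "q \<noteq> x" for q
  proof -
    have "q \<in> ball x d" using q s by auto
    then have "H q x \<ge> - M" using d(2) in_closure[OF assms(5)] unfolding M_def by fastforce
    moreover have "norm (x - q) < exp (- 2 * pi * M)" using q s by (simp add: dist_norm)
    then have "ln (norm (x - q)) < - 2 * pi * M" using q by (metis exp_less_cancel_iff exp_ln right_minus_eq zero_less_norm_iff)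
    then have "newton (x - q) > M" unfolding newton_def by (simp add: field_simps)
    ultimately show ?thesis unfolding K_def by linarith
  qed
  have nn: "AE q in leb \<Omega>. 0 \<le> K q x * \<rho> q"
    using AE_leb_neq[OF om(1), of x] AE_space
    by eventually_elim (use assms(2) K_nonneg in_closure[OF assms(5)] in \<open>auto simp: space_restrict_space\<close>)
  have "AE q in leb \<Omega>. K q x * \<rho> q = 0"
    using integral_nonneg_eq_0_iff_AE[OF K_rho_integrable[OF assms(1) K_integrable[OF in_closure[OF assms(5)]]] nn] z
    by (simp add: pot_def)
  then have "AE q in leb \<Omega>. q \<notin> ball x s - insert x P"
    using AE_space
  proof eventually_elim
    case (elim q)
    show ?case
    proof
      assume q: "q \<in> ball x s - insert x P"
      then have "q \<in> \<Omega>" using d(2) s by auto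
      then have "\<rho> q > 0" "K q x > 0" using assms(4) Kp q by auto
      then show False using elim by simp
    qed
  qed
  then have "AE q in lborel. q \<in> \<Omega> \<longrightarrow> q \<notin> ball x s - insert x P"
    using om(1) by (subst (asm) AE_restrict_space_iff) auto
  then have "AE q in lborel. q \<notin> ball x s"
  proof -
    have "finite (insert x P)" using assms(3) by simp
    then have "AE q in lborel. q \<notin> insert x P"
      by (intro AE_not_in finite_imp_null_set_lborel)
    with \<open>AE q in lborel. q \<in> \<Omega> \<longrightarrow> _ q\<close> show ?thesis
      by eventually_elim (use d(2) s in auto)
  qed
  then have "ball x s \<in> null_sets lborel" using AE_iff_null_sets[of "ball x s" lborel] by simp
  then have "emeasure lborel (ball x s) = 0" by (rule null_setsD1)
  then show False using s(1) by (simp add: emeasure_ball unit_ball_vol_2)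
qed

end

subsection \<open>The free energy\<close>

locale mean_field = green_domain +
  fixes h :: "pt \<Rightarrow> real" and P :: "pt set"
  assumes P: "finite P" and h_holder: "loc_holder \<Omega> h" and h_cont: "continuous_on (closure \<Omega>) h"
    and h_nonneg: "\<And>x. x \<in> \<Omega> \<Longrightarrow> h x \<ge> 0" and h_pos: "\<And>x. x \<in> \<Omega> - P \<Longrightarrow> h x > 0"
begin

definition bmeas :: "(pt \<Rightarrow> real) \<Rightarrow> bool" where "bmeas f \<longleftrightarrow> (\<exists>B. bdd f B)"

lemma bmeas_integrable: "bmeas f \<Longrightarrow> integrable (leb \<Omega>) f"
  unfolding bmeas_def using bdd_integrable by blast

lemma bmeas_measurable: "bmeas f \<Longrightarrow> f \<in> borel_measurable (leb \<Omega>)"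
  unfolding bmeas_def bdd_def by blast

lemma bdd_bmeas: "bdd f B \<Longrightarrow> bmeas f" unfolding bmeas_def by blast

lemma bmeas_cont: assumes "continuous_on (closure \<Omega>) f" shows "bmeas f"
proof -
  obtain B where B: "\<And>x. x \<in> closure \<Omega> \<Longrightarrow> \<bar>f x\<bar> \<le> B" using continuous_closure_bounded[OF assms] by blast
  have "bdd f B" unfolding bdd_def
    using borel_measurable_leb[OF continuous_on_subset[OF assms closure_subset]] B in_closure by blast
  then show ?thesis by (rule bdd_bmeas)
qed

lemma bmeas_add: assumes "bmeas f" "bmeas g" shows "bmeas (\<lambda>x. f x + g x)"
proof -
  obtain A B where AB: "bdd f A" "bdd g B" using assms bmeas_def by blast
  have "bdd (\<lambda>x. f x + g x) (A + B)" unfolding bdd_def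
  proof (intro conjI ballI)
    show "(\<lambda>x. f x + g x) \<in> borel_measurable (leb \<Omega>)" by (intro borel_measurable_add bmeas_measurable assms)
    show "\<bar>f q + g q\<bar> \<le> A + B" if "q \<in> \<Omega>" for q using AB that abs_triangle_ineq[of "f q" "g q"] by (fastforce simp: bdd_def)
  qed
  then show ?thesis by (rule bdd_bmeas)
qed

lemma bmeas_mult: assumes "bmeas f" "bmeas g" shows "bmeas (\<lambda>x. f x * g x)"
proof -
  obtain A B where AB: "bdd f A" "bdd g B" using assms bmeas_def by blast
  have "bdd (\<lambda>x. f x * g x) (A * B)" unfolding bdd_def
  proof (intro conjI ballI)
    show "(\<lambda>x. f x * g x) \<in> borel_measurable (leb \<Omega>)" by (intro borel_measurable_times bmeas_measurable assms)
    show "\<bar>f q * g q\<bar> \<le> A * B" if "q \<in> \<Omega>" for q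
      unfolding abs_mult using AB that bdd_nonneg[OF AB(1)] by (intro mult_mono) (auto simp: bdd_def)
  qed
  then show ?thesis by (rule bdd_bmeas)
qed

lemma bmeas_const: "bmeas (\<lambda>x. c)" by (rule bmeas_cont) simp

lemma bmeas_diff: "bmeas f \<Longrightarrow> bmeas g \<Longrightarrow> bmeas (\<lambda>x. f x - g x)"
  using bmeas_add[of f "\<lambda>x. (-1) * g x"] bmeas_mult[OF bmeas_const[of "-1"]] by simp

text \<open>Regular exponents give Hoelder densities, bounded up to the boundary, so their
  potentials are C2; the class is stable under \<open>gibbs\<close> and \<open>gpot\<close>.\<close>

definition regular :: "(pt \<Rightarrow> real) \<Rightarrow> bool" where "regular v \<longleftrightarrow> loc_holder \<Omega> v \<and> continuous_on (closure \<Omega>) v"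

definition dens :: "(pt \<Rightarrow> real) \<Rightarrow> pt \<Rightarrow> real" where "dens v x = h x * exp (v x)"

lemma regular_bmeas: "regular v \<Longrightarrow> bmeas v" unfolding regular_def by (blast intro: bmeas_cont)

lemma dens_cont: "continuous_on (closure \<Omega>) v \<Longrightarrow> continuous_on (closure \<Omega>) (dens v)"
  unfolding dens_def[abs_def] by (intro continuous_intros h_cont)

lemma dens_bmeas: "continuous_on (closure \<Omega>) v \<Longrightarrow> bmeas (dens v)"
  by (intro bmeas_cont dens_cont)

lemma dens_holder: assumes "regular v" shows "loc_holder \<Omega> (dens v)"
  unfolding dens_def[abs_def]
  by (intro loc_holder_mult h_holder loc_holder_compose[of _ v exp exp]) (use assms in \<open>auto simp: regular_def intro: continuous_on_exp[OF continuous_on_id, simplified]\<close>)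

lemma dens_nonneg: "x \<in> \<Omega> \<Longrightarrow> dens v x \<ge> 0" unfolding dens_def using h_nonneg by simp

lemma dens_pos: "x \<in> \<Omega> - P \<Longrightarrow> dens v x > 0" unfolding dens_def using h_pos by simp

text \<open>A null set contains no nonempty open set, so an almost sure property holds arbitrarily
  close to every point of the closure.\<close>

lemma AE_leb_dense:
  assumes "AE q in leb \<Omega>. Q q" "x \<in> closure \<Omega>" "s > 0" shows "\<exists>q\<in>\<Omega>. dist q x < s \<and> Q q"
proof (rule ccontr)
  assume no: "\<not> ?thesis"
  obtain y where y: "y \<in> \<Omega>" "dist y x < s" using assms(2,3) closure_approachable by blast
  define A where "A = \<Omega> \<inter> ball x s"
  have A: "open A" "A \<noteq> {}" using om(1) y by (auto simp: A_def dist_commute)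
  have "AE q in leb \<Omega>. q \<notin> A" using assms(1) by eventually_elim (use no in \<open>auto simp: A_def dist_commute\<close>)
  then have "AE q in lborel. q \<notin> A"
    using om(1) by (subst (asm) AE_restrict_space_iff) (auto simp: A_def)
  then have "A \<in> null_sets lborel" using AE_iff_null_sets[of A lborel] A(1) by simp
  then have "A \<in> null_sets lebesgue" using null_sets_completionI by blast
  then have "negligible A" using negligible_iff_null_sets by blast
  then show False using open_not_negligible[OF A] by blast
qed

lemma eq_closure:
  assumes "continuous_on (closure \<Omega>) u" "continuous_on (closure \<Omega>) v" "AE q in leb \<Omega>. u q = (v q :: real)" "x \<in> closure \<Omega>"
  shows "u x = v x"
proof (rule ccontr)
  assume ne: "u x \<noteq> v x"
  have "continuous_on (closure \<Omega>) (\<lambda>x. u x - v x)" by (intro continuous_intros assms)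
  then obtain d where d: "d > 0" "\<And>y. y \<in> closure \<Omega> \<Longrightarrow> dist y x < d \<Longrightarrow> dist (u y - v y) (u x - v x) < \<bar>u x - v x\<bar>"
    using assms(4) ne unfolding continuous_on_iff by (metis abs_eq_0 diff_self eq_iff_diff_eq_0 zero_less_abs_iff)
  obtain q where "q \<in> \<Omega>" "dist q x < d" "u q = v q" using AE_leb_dense[OF assms(3,4) d(1)] by blast
  then show False using d(2)[of q] in_closure by (simp add: dist_real_def)
qed

lemma AE_notin_P: "AE q in leb \<Omega>. q \<notin> P"
proof -
  have "AE q in lborel. q \<notin> P" using P by (intro AE_not_in finite_imp_null_set_lborel)
  then show ?thesis using om(1) by (subst AE_restrict_space_iff) (auto elim!: eventually_mono)
qed

definition Z :: "real \<Rightarrow> (pt \<Rightarrow> real) \<Rightarrow> real" where "Z lam \<phi> = (\<integral>x. dens (\<lambda>x. lam * \<phi> x) x \<partial>leb \<Omega>)"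

text \<open>The exponent of the normalised density proportional to
  \<open>h * exp (lam * \<phi>)\<close>, that is, its logarithm relative to
  \<open>h\<close>.\<close>

definition gibbs :: "real \<Rightarrow> (pt \<Rightarrow> real) \<Rightarrow> pt \<Rightarrow> real" where "gibbs lam \<phi> x = lam * \<phi> x - ln (Z lam \<phi>)"

lemma integral_pos:
  assumes "bmeas f" "\<And>x. x \<in> \<Omega> \<Longrightarrow> f x \<ge> 0" "\<And>x. x \<in> \<Omega> - P \<Longrightarrow> f x > 0"
  shows "(\<integral>x. f x \<partial>leb \<Omega>) > 0"
proof (rule ccontr)
  assume neg: "\<not> ?thesis"
  have nn: "AE x in leb \<Omega>. 0 \<le> f x" using assms(2) by (intro AE_I2) (simp add: space_restrict_space)
  have "(\<integral>x. f x \<partial>leb \<Omega>) \<ge> 0" by (rule integral_nonneg_AE[OF nn])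
  then have "(\<integral>x. f x \<partial>leb \<Omega>) = 0" using neg by linarith
  then have "AE x in leb \<Omega>. f x = 0" using integral_nonneg_eq_0_iff_AE[OF bmeas_integrable[OF assms(1)] nn] by simp
  then have ae: "AE x in leb \<Omega>. f x = 0 \<and> x \<notin> P" using AE_notin_P by eventually_elim auto
  obtain y where "y \<in> \<Omega>" using om(3) by blast
  then obtain q where "q \<in> \<Omega>" "f q = 0" "q \<notin> P" using AE_leb_dense[OF ae in_closure, of y 1] by auto
  then show False using assms(3)[of q] by simp
qed

lemma Z_pos: assumes "continuous_on (closure \<Omega>) \<phi>" shows "Z lam \<phi> > 0"
  unfolding Z_def by (rule integral_pos[OF dens_bmeas dens_nonneg dens_pos]) (intro continuous_intros assms)

lemma dens_gibbs: assumes "continuous_on (closure \<Omega>) \<phi>"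
  shows "dens (gibbs lam \<phi>) x = dens (\<lambda>x. lam * \<phi> x) x / Z lam \<phi>" "(\<integral>x. dens (gibbs lam \<phi>) x \<partial>leb \<Omega>) = 1"
proof -
  show e: "dens (gibbs lam \<phi>) x = dens (\<lambda>x. lam * \<phi> x) x / Z lam \<phi>" for x
    using Z_pos[OF assms, of lam] by (simp add: dens_def gibbs_def exp_diff)
  show "(\<integral>x. dens (gibbs lam \<phi>) x \<partial>leb \<Omega>) = 1"
    unfolding e using Z_pos[OF assms, of lam] by (simp add: Z_def)
qed

lemma gibbs_cont: "continuous_on (closure \<Omega>) \<phi> \<Longrightarrow> continuous_on (closure \<Omega>) (gibbs lam \<phi>)"
  unfolding gibbs_def[abs_def] by (intro continuous_intros)

lemma gibbs_regular: assumes "regular \<phi>" shows "regular (gibbs lam \<phi>)"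
proof -
  have "loc_holder \<Omega> (\<lambda>x. (\<lambda>s. lam * s - ln (Z lam \<phi>)) (\<phi> x))"
    by (rule loc_holder_compose[where g'="\<lambda>s. lam"]) (use assms in \<open>auto simp: regular_def intro!: derivative_eq_intros\<close>)
  then show ?thesis using assms gibbs_cont unfolding regular_def gibbs_def[abs_def] by auto
qed

lemma pot_regular: assumes "bmeas \<rho>" shows "regular (pot \<rho>)"
  using assms pot_loc_holder pot_continuous unfolding regular_def bmeas_def by blast

definition gpot :: "(pt \<Rightarrow> real) \<Rightarrow> pt \<Rightarrow> real" where "gpot v = pot (dens v)"

lemma gpot_facts:
  assumes "regular v"
  shows "admissible (gpot v)" "\<And>x. x \<in> \<Omega> \<Longrightarrow> - laplacian (gpot v) x = dens v x" "\<And>x. x \<in> \<Omega> \<Longrightarrow> gpot v x > 0"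
    "regular (gpot v)" "bmeas (gpot v)" "bmeas (dens v)" "continuous_on (closure \<Omega>) (gpot v)"
    "\<And>x. x \<in> closure \<Omega> \<Longrightarrow> gpot v x \<ge> 0" "\<And>x. x \<in> frontier \<Omega> \<Longrightarrow> gpot v x = 0"
proof -
  show k: "bmeas (dens v)" using assms by (intro dens_bmeas) (simp add: regular_def)
  then obtain B where B: "bdd (dens v) B" unfolding bmeas_def by blast
  note dh = dens_holder[OF assms]
  show "admissible (gpot v)" unfolding gpot_def by (rule pot_admissible[OF B dh])
  show "\<And>x. x \<in> \<Omega> \<Longrightarrow> - laplacian (gpot v) x = dens v x" unfolding gpot_def using pot_C2(2)[OF B dh] by simp
  show "\<And>x. x \<in> \<Omega> \<Longrightarrow> gpot v x > 0" unfolding gpot_def by (rule pot_pos[OF B dens_nonneg P dens_pos])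
  show s: "regular (gpot v)" unfolding gpot_def by (rule pot_regular[OF k])
  show "bmeas (gpot v)" by (rule regular_bmeas[OF s])
  show "continuous_on (closure \<Omega>) (gpot v)" using s by (simp add: regular_def)
  show "\<And>x. x \<in> closure \<Omega> \<Longrightarrow> gpot v x \<ge> 0" unfolding gpot_def by (rule pot_nonneg[OF dens_nonneg])
  show "\<And>x. x \<in> frontier \<Omega> \<Longrightarrow> gpot v x = 0" unfolding gpot_def by (rule pot_frontier)
qed

section \<open>The energy form, the entropy and the free energy\<close>

definition ip :: "(pt \<Rightarrow> real) \<Rightarrow> (pt \<Rightarrow> real) \<Rightarrow> real" where "ip v w = (\<integral>x. gpot v x * dens w x \<partial>leb \<Omega>)"

lemma ip_laplacian: assumes "regular w" shows "(\<integral>x. f x * - laplacian (gpot w) x \<partial>leb \<Omega>) = (\<integral>x. f x * dens w x \<partial>leb \<Omega>)"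
  by (rule Bochner_Integration.integral_cong) (auto simp: space_restrict_space gpot_facts(2)[OF assms, symmetric])

lemma ip_sym: assumes "regular v" "regular w" shows "ip v w = ip w v"
  using energy_symmetric[OF gpot_facts(1,3)[OF assms(2)] gpot_facts(1,3)[OF assms(1)]]
  unfolding ip_def ip_laplacian[OF assms(1)] ip_laplacian[OF assms(2)] by simp

lemma grad_energy: assumes "regular v"
  shows "integrable (leb \<Omega>) (grad_sq (gpot v))" "(\<integral>x. grad_sq (gpot v) x \<partial>leb \<Omega>) = ip v v"
  using energy_identity[OF gpot_facts(1,3)[OF assms]] unfolding ip_def ip_laplacian[OF assms] by auto

lemma ip_integrable: "regular v \<Longrightarrow> regular w \<Longrightarrow> integrable (leb \<Omega>) (\<lambda>x. gpot v x * dens w x)"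
  by (intro bmeas_integrable bmeas_mult gpot_facts)

text \<open>The expression is the energy of the difference of two densities. That difference is not
  of the form \<open>dens\<close> and its potential may change sign, hence the detour over
  \<open>energy_nonneg\<close>.\<close>

lemma ip_diff_nonneg: assumes v: "regular v" and w: "regular w" shows "ip v v - 2 * ip v w + ip w w \<ge> 0"
proof -
  let ?u = "\<lambda>x. 1 * gpot v x + (- 1) * gpot w x"
  have C: "Ck 2 \<Omega> (gpot v)" "Ck 2 \<Omega> (gpot w)" using gpot_facts(1)[OF v] gpot_facts(1)[OF w] by (auto simp: admissible_def)
  have lap: "- laplacian ?u x = dens v x - dens w x" if "x \<in> \<Omega>" for x
    using Ck2_lin(3)[OF om(1) C that, of 1 "-1"] gpot_facts(2)[OF v that] gpot_facts(2)[OF w that] by simp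
  have "admissible ?u" unfolding admissible_def
  proof (intro conjI)
    show "Ck 2 \<Omega> ?u" by (rule Ck2_lin(1)[OF om(1) C])
    show "continuous_on (closure \<Omega>) ?u" by (intro continuous_intros gpot_facts v w)
    show "\<forall>z\<in>frontier \<Omega>. ?u z = 0" using gpot_facts(9)[OF v] gpot_facts(9)[OF w] by simp
    obtain B where "bdd (\<lambda>x. dens v x - dens w x) B" using bmeas_diff[OF gpot_facts(6)[OF v] gpot_facts(6)[OF w]] bmeas_def by blast
    then have "\<bar>laplacian ?u x\<bar> \<le> B" if "x \<in> \<Omega>" for x using lap[OF that] that unfolding bdd_def
      by (metis abs_minus_cancel)
    then show "\<exists>B. \<forall>x\<in>\<Omega>. \<bar>laplacian ?u x\<bar> \<le> B" by blast
  qed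
  from energy_nonneg[OF this] have "0 \<le> (\<integral>x. ?u x * - laplacian ?u x \<partial>leb \<Omega>)" .
  also have "\<dots> = (\<integral>x. (gpot v x * dens v x - gpot v x * dens w x) - (gpot w x * dens v x - gpot w x * dens w x) \<partial>leb \<Omega>)"
  proof (rule Bochner_Integration.integral_cong)
    fix x assume "x \<in> space (leb \<Omega>)"
    then have "x \<in> \<Omega>" by (simp add: space_restrict_space)
    from lap[OF this] show "?u x * - laplacian ?u x = (gpot v x * dens v x - gpot v x * dens w x) - (gpot w x * dens v x - gpot w x * dens w x)"
      by (simp only: ) (simp add: algebra_simps)
  qed simp
  also have "\<dots> = (ip v v - ip v w) - (ip w v - ip w w)"
    unfolding ip_def using ip_integrable[OF v v] ip_integrable[OF v w] ip_integrable[OF w v] ip_integrable[OF w w] by simp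
  finally show ?thesis using ip_sym[OF v w] by simp
qed

definition Ent :: "(pt \<Rightarrow> real) \<Rightarrow> real" where "Ent v = (\<integral>x. dens v x * v x \<partial>leb \<Omega>)"
definition KL :: "(pt \<Rightarrow> real) \<Rightarrow> (pt \<Rightarrow> real) \<Rightarrow> real" where "KL v w = (\<integral>x. dens v x * (v x - w x) \<partial>leb \<Omega>)"
definition F :: "real \<Rightarrow> (pt \<Rightarrow> real) \<Rightarrow> real" where "F lam v = Ent v - lam / 2 * ip v v"
definition unit_mass :: "(pt \<Rightarrow> real) \<Rightarrow> bool" where "unit_mass v \<longleftrightarrow> regular v \<and> (\<integral>x. dens v x \<partial>leb \<Omega>) = 1"

text \<open>Equal masses allow adding \<open>dens w - dens v\<close>, and the integrand becomes
  \<open>dens v\<close> times e^t - 1 - t with t = w - v. It vanishes only for t = 0, at first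
  almost everywhere and then by continuity on the closure.\<close>

lemma KL_nonneg:
  assumes "unit_mass v" "unit_mass w"
  shows "KL v w \<ge> 0" "KL v w = 0 \<Longrightarrow> x \<in> closure \<Omega> \<Longrightarrow> v x = w x"
proof -
  have s: "regular v" "regular w" and n: "(\<integral>x. dens v x \<partial>leb \<Omega>) = 1" "(\<integral>x. dens w x \<partial>leb \<Omega>) = 1" using assms by (auto simp: unit_mass_def)
  let ?f = "\<lambda>x. dens v x * (v x - w x) - dens v x + dens w x"
  note dv = gpot_facts(6)[OF s(1)] note dw = gpot_facts(6)[OF s(2)]
  have ik: "bmeas (\<lambda>x. dens v x * (v x - w x))" by (intro bmeas_mult bmeas_diff dv regular_bmeas s)
  have i: "integrable (leb \<Omega>) ?f" by (intro bmeas_integrable bmeas_add bmeas_diff ik dv dw)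
  have eq: "(\<integral>x. ?f x \<partial>leb \<Omega>) = KL v w"
    unfolding KL_def using bmeas_integrable[OF ik] bmeas_integrable[OF dv] bmeas_integrable[OF dw] n by simp
  have f: "?f x = h x * exp (v x) * (exp (w x - v x) - 1 - (w x - v x))" for x
    unfolding dens_def by (simp add: exp_diff algebra_simps)
  have pw: "0 \<le> exp t - 1 - t" for t :: real using exp_ge_add_one_self[of t] by linarith
  have nn: "AE x in leb \<Omega>. 0 \<le> ?f x" unfolding f using h_nonneg pw by (intro AE_I2) (simp add: space_restrict_space)
  show "KL v w \<ge> 0" unfolding eq[symmetric] by (rule integral_nonneg_AE[OF nn])
  assume "KL v w = 0" and x: "x \<in> closure \<Omega>"
  then have "AE x in leb \<Omega>. ?f x = 0" using integral_nonneg_eq_0_iff_AE[OF i nn] eq by simp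
  then have "AE x in leb \<Omega>. v x = w x" using AE_notin_P AE_space
  proof eventually_elim
    case (elim y)
    then have "y \<in> \<Omega> - P" by (simp add: space_restrict_space)
    then have "h y * exp (v y) \<noteq> 0" using h_pos[of y] by simp
    then have "exp (w y - v y) = 1 + (w y - v y)" using elim(1) unfolding f by simp
    then have "ln (exp (w y - v y)) = exp (w y - v y) - 1" unfolding ln_exp by linarith
    then have "exp (w y - v y) = 1" by (intro ln_eq_minus_one) auto
    then show "v y = w y" by simp
  qed
  then show "v x = w x" using s by (intro eq_closure[OF _ _ _ x]) (auto simp: regular_def)
qed

text \<open>Both equations evaluate the integral of \<open>w\<close> against a density of mass one.
  The potential of a further exponent \<open>u\<close> leaves room for the choices
  \<open>u = v\<close> and \<open>u = w\<close> below.\<close>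

lemma Ent_split:
  assumes "unit_mass v" "unit_mass w" and w: "\<And>x. x \<in> \<Omega> \<Longrightarrow> w x = lam * gpot u x - c" and u: "regular u"
  shows "Ent v = KL v w + lam * ip u v - c" "Ent w = lam * ip u w - c"
proof -
  have s: "regular v" "regular w" and n: "(\<integral>x. dens v x \<partial>leb \<Omega>) = 1" "(\<integral>x. dens w x \<partial>leb \<Omega>) = 1" using assms by (auto simp: unit_mass_def)
  note dv = gpot_facts(6)[OF s(1)] note dw = gpot_facts(6)[OF s(2)]
  have gen: "(\<integral>x. dens y x * w x \<partial>leb \<Omega>) = lam * ip u y - c" if y: "unit_mass y" for y
  proof -
    have sy: "regular y" and ny: "(\<integral>x. dens y x \<partial>leb \<Omega>) = 1" using y by (auto simp: unit_mass_def)
    have "(\<integral>x. dens y x * w x \<partial>leb \<Omega>) = (\<integral>x. lam * (gpot u x * dens y x) - c * dens y x \<partial>leb \<Omega>)"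
      by (rule Bochner_Integration.integral_cong) (auto simp: w space_restrict_space algebra_simps)
    also have "\<dots> = lam * ip u y - c"
      unfolding ip_def using ip_integrable[OF u sy] bmeas_integrable[OF gpot_facts(6)[OF sy]] ny by simp
    finally show ?thesis .
  qed
  show "Ent w = lam * ip u w - c" unfolding Ent_def by (rule gen[OF assms(2)])
  have "integrable (leb \<Omega>) (\<lambda>x. dens v x * (v x - w x))" "integrable (leb \<Omega>) (\<lambda>x. dens v x * w x)"
    by (intro bmeas_integrable bmeas_mult bmeas_diff dv regular_bmeas s)+
  then have "KL v w + (\<integral>x. dens v x * w x \<partial>leb \<Omega>) = (\<integral>x. dens v x * (v x - w x) + dens v x * w x \<partial>leb \<Omega>)"
    unfolding KL_def by simp
  also have "\<dots> = Ent v" unfolding Ent_def by (simp add: algebra_simps)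
  finally show "Ent v = KL v w + lam * ip u v - c" using gen[OF assms(1)] by simp
qed

text \<open>Here \<open>w\<close> is the image of \<open>v\<close> under the descent map. The
  quadratic term has the sign of \<open>lam\<close>, so the identity serves positive
  parameters.\<close>

lemma F_step:
  assumes "unit_mass v" "unit_mass w" "\<And>x. x \<in> \<Omega> \<Longrightarrow> w x = lam * gpot v x - c"
  shows "F lam v - F lam w = KL v w + lam / 2 * (ip v v - 2 * ip v w + ip w w)"
  using Ent_split[OF assms(1,2,3)] assms(1) unfolding F_def unit_mass_def by (simp add: algebra_simps)

text \<open>Here \<open>w\<close> is a fixed point of the descent map. The quadratic term now has
  the opposite sign, so for \<open>lam \<le> 0\<close> both terms are nonnegative and the fixed
  point minimises.\<close>

lemma F_fixed:
  assumes "unit_mass v" "unit_mass w" "\<And>x. x \<in> \<Omega> \<Longrightarrow> w x = lam * gpot w x - c"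
  shows "F lam v - F lam w = KL v w - lam / 2 * (ip v v - 2 * ip v w + ip w w)"
  using Ent_split[OF assms(1,2,3)] assms(1,2) ip_sym[of v w] unfolding F_def unit_mass_def by (simp add: algebra_simps)

lemma gibbs_unit_mass: "regular \<phi> \<Longrightarrow> unit_mass (gibbs lam \<phi>)"
  unfolding unit_mass_def using gibbs_regular dens_gibbs(2) by (simp add: regular_def)

text \<open>Young's inequality \<open>a s \<le> a ln a - a + e\<^sup>s\<close> with \<open>s = \<theta> ln (D / \<bar>x - q\<bar>)\<close>: as \<open>e\<^sup>s\<close> is integrable
  for \<open>\<theta> < 2\<close>, the entropy bounds the potential uniformly. The range of \<open>\<theta>\<close> is what makes the free energy
  coercive up to \<open>8\<pi>\<close>.\<close>

lemma entropy_bounds_potential: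
  assumes "0 < \<theta>" "\<theta> < 2"
  shows "\<exists>C. \<forall>v x. unit_mass v \<longrightarrow> x \<in> closure \<Omega> \<longrightarrow> 2 * pi * \<theta> * gpot v x \<le> Ent v + C"
proof -
  obtain C where C: "C \<ge> 0" "\<forall>A x r. A \<in> sets borel \<longrightarrow> 0 < r \<longrightarrow> A \<subseteq> ball x r \<longrightarrow>
     integrable (leb A) (\<lambda>q. norm (x - q) powr - \<theta>) \<and> (\<integral>q. norm (x - q) powr - \<theta> \<partial>leb A) \<le> C * r powr (2 - \<theta>)"
    using riesz_potential_bound[of \<theta>] assms by auto
  obtain hM0 where hM0: "\<And>x. x \<in> closure \<Omega> \<Longrightarrow> \<bar>h x\<bar> \<le> hM0" using continuous_closure_bounded[OF h_cont] by blast
  define hM where "hM = max 1 hM0"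
  have hM: "hM \<ge> 1" "\<And>x. x \<in> \<Omega> \<Longrightarrow> h x \<le> hM" using hM0 in_closure by (force simp: hM_def)+
  \<comment> \<open>The first term pays for the entropy relative to \<open>h\<close> instead of
    Lebesgue measure, the second is the integral of e^S over the domain.\<close>
  define C' where "C' = ln hM + D powr \<theta> * (C * (D + 1) powr (2 - \<theta>))"
  have "2 * pi * \<theta> * gpot v x \<le> Ent v + C'" if v: "unit_mass v" and x: "x \<in> closure \<Omega>" for v x
  proof -
    have s: "regular v" and n: "(\<integral>x. dens v x \<partial>leb \<Omega>) = 1" using v by (auto simp: unit_mass_def)
    note dv = gpot_facts(6)[OF s]
    obtain B where B: "bdd (dens v) B" using dv bmeas_def by blast
    define W where "W q = norm (x - q) powr - \<theta>" for q
    have R: "integrable (leb \<Omega>) W" "(\<integral>q. W q \<partial>leb \<Omega>) \<le> C * (D + 1) powr (2 - \<theta>)"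
      using C(2)[rule_format, OF om_borel _ om_ball[OF x]] D_ge1 by (auto simp: W_def[abs_def])
    let ?r = "\<lambda>q. (dens v q * v q + ln hM * dens v q) + D powr \<theta> * W q"
    have i1: "integrable (leb \<Omega>) (\<lambda>q. dens v q * v q)" "integrable (leb \<Omega>) (dens v)"
      by (intro bmeas_integrable bmeas_mult dv regular_bmeas s)+
    have ir: "integrable (leb \<Omega>) ?r" using i1 R(1) by simp
    have iK: "integrable (leb \<Omega>) (\<lambda>q. 2 * pi * \<theta> * (K q x * dens v q))"
      using K_rho_integrable[OF B K_integrable[OF x]] by simp
    have ae: "AE q in leb \<Omega>. 2 * pi * \<theta> * (K q x * dens v q) \<le> ?r q"
      using AE_leb_neq[OF om(1), of x] AE_space
    proof eventually_elim
      case (elim q)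
      then have q: "q \<in> \<Omega>" "x \<noteq> q" by (auto simp: space_restrict_space)
      define S where "S = \<theta> * ln (D / norm (x - q))"
      have expS: "exp S = D powr \<theta> * W q"
      proof -
        have "exp S = (D / norm (x - q)) powr \<theta>" using q D_ge1 by (simp add: S_def powr_def)
        then show ?thesis by (simp add: W_def powr_divide powr_minus_divide)
      qed
      have "2 * pi * \<theta> * (K q x * dens v q) \<le> S * dens v q"
      proof -
        have "2 * pi * K q x \<le> ln (D / norm (x - q))" using K_upper[OF q(1) x q(2)] by (simp add: LD_def field_simps)
        then have "\<theta> * (2 * pi * K q x) \<le> S" using assms by (simp add: S_def)
        from mult_right_mono[OF this dens_nonneg[OF q(1), of v]] show ?thesis by (simp add: mult_ac)
      qed
      also have "\<dots> \<le> ?r q"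
      proof (cases "dens v q = 0")
        case True
        then show ?thesis using expS exp_ge_zero[of S] by simp
      next
        case False
        then have a: "dens v q > 0" using dens_nonneg[OF q(1), of v] by simp
        then have hq: "h q > 0" using h_nonneg[OF q(1)] by (simp add: dens_def zero_less_mult_iff)
        define l where "l = ln (dens v q)"
        have ea: "exp l = dens v q" using a by (simp add: l_def)
        \<comment> \<open>Multiplied by \<open>exp l = dens v q\<close>, this is Young's inequality
          for the pair \<open>S\<close> and \<open>dens v q\<close>.\<close>
        have "1 + (S - l) \<le> exp (S - l)" by (rule exp_ge_add_one_self)
        from mult_left_mono[OF this less_imp_le[OF a]]
        have "dens v q * (1 + (S - l)) \<le> exp S" using ea a by (simp add: exp_diff)
        moreover have "l \<le> v q + ln hM"
          using hq hM(2)[OF q(1)] hM(1) by (simp add: l_def dens_def ln_mult)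
        then have "dens v q * l \<le> dens v q * (v q + ln hM)" using a by simp
        ultimately show ?thesis using expS a by (simp add: algebra_simps)
      qed
      finally show ?case .
    qed
    have "2 * pi * \<theta> * gpot v x = (\<integral>q. 2 * pi * \<theta> * (K q x * dens v q) \<partial>leb \<Omega>)"
      unfolding gpot_def pot_def by simp
    also have "\<dots> \<le> (\<integral>q. ?r q \<partial>leb \<Omega>)" by (rule integral_mono_AE[OF iK ir ae])
    also have "\<dots> = Ent v + ln hM + D powr \<theta> * (\<integral>q. W q \<partial>leb \<Omega>)"
      unfolding Ent_def using i1 R(1) n by simp
    also have "\<dots> \<le> Ent v + C'" unfolding C'_def using R(2) by (simp add: mult_left_mono)
    finally show ?thesis .
  qed
  then show ?thesis by blast
qed

end

subsection \<open>Compactness\<close>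

context mean_field
begin

text \<open>Bounded pointwise convergence of continuous functions is the weakest mode closed under
  all operations used here, including potentials and normalisation, and it suffices for dominated
  convergence.\<close>

definition bconv :: "(nat \<Rightarrow> pt \<Rightarrow> real) \<Rightarrow> (pt \<Rightarrow> real) \<Rightarrow> bool" where
  "bconv f g \<longleftrightarrow> (\<forall>n. continuous_on (closure \<Omega>) (f n)) \<and> continuous_on (closure \<Omega>) g \<and>
     (\<forall>x\<in>closure \<Omega>. (\<lambda>n. f n x) \<longlonglongrightarrow> g x) \<and> (\<exists>B. \<forall>n. \<forall>x\<in>closure \<Omega>. \<bar>f n x\<bar> \<le> B)"

lemma bconvD:
  assumes "bconv f g"
  shows "continuous_on (closure \<Omega>) (f n)" "continuous_on (closure \<Omega>) g" "x \<in> closure \<Omega> \<Longrightarrow> (\<lambda>n. f n x) \<longlonglongrightarrow> g x"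
  using assms unfolding bconv_def by auto

lemma bconv_bounded:
  assumes "bconv f g" obtains B where "\<And>n x. x \<in> closure \<Omega> \<Longrightarrow> \<bar>f n x\<bar> \<le> B" "\<And>n. bdd (f n) B" "0 \<le> B"
proof -
  obtain B where B: "\<forall>n. \<forall>x\<in>closure \<Omega>. \<bar>f n x\<bar> \<le> B" using assms unfolding bconv_def by blast
  have b: "bdd (f n) B" for n
    unfolding bdd_def using B in_closure bmeas_measurable[OF bmeas_cont[OF bconvD(1)[OF assms, of n]]] by blast
  show ?thesis by (rule that[of B]) (use B b bdd_nonneg[OF b] in auto)
qed

lemma bconvI:
  assumes "\<And>n. continuous_on (closure \<Omega>) (f n)" "continuous_on (closure \<Omega>) g"
    "\<And>x. x \<in> closure \<Omega> \<Longrightarrow> (\<lambda>n. f n x) \<longlonglongrightarrow> g x" "\<And>n x. x \<in> closure \<Omega> \<Longrightarrow> \<bar>f n x\<bar> \<le> B"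
  shows "bconv f g"
  using assms unfolding bconv_def by blast

lemma bconv_cong:
  assumes "bconv f g" "\<And>n x. x \<in> closure \<Omega> \<Longrightarrow> f n x = f' n x" "\<And>n. continuous_on (closure \<Omega>) (f' n)"
  shows "bconv f' g"
proof -
  obtain B where B: "\<And>n x. x \<in> closure \<Omega> \<Longrightarrow> \<bar>f n x\<bar> \<le> B" using bconv_bounded[OF assms(1)] by metis
  show ?thesis by (rule bconvI[OF assms(3) bconvD(2)[OF assms(1)], where B=B])
      (use bconvD(3)[OF assms(1)] assms(2) B in auto)
qed

lemma bconv_mult: assumes "bconv f g" "bconv f' g'" shows "bconv (\<lambda>n x. f n x * f' n x) (\<lambda>x. g x * g' x)"
proof -
  obtain A where A: "\<And>n x. x \<in> closure \<Omega> \<Longrightarrow> \<bar>f n x\<bar> \<le> A" "0 \<le> A" using bconv_bounded[OF assms(1)] by metis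
  obtain B where B: "\<And>n x. x \<in> closure \<Omega> \<Longrightarrow> \<bar>f' n x\<bar> \<le> B" "0 \<le> B" using bconv_bounded[OF assms(2)] by metis
  have b: "\<bar>f n x * f' n x\<bar> \<le> A * B" if "x \<in> closure \<Omega>" for n x
    unfolding abs_mult using A B that by (intro mult_mono) auto
  show ?thesis
    by (rule bconvI[OF _ _ _ b]) (intro continuous_intros tendsto_intros bconvD[OF assms(1)] bconvD[OF assms(2)]; assumption)+
qed

lemma bconv_diff: assumes "bconv f g" "bconv f' g'" shows "bconv (\<lambda>n x. f n x - f' n x) (\<lambda>x. g x - g' x)"
proof -
  obtain A where A: "\<And>n x. x \<in> closure \<Omega> \<Longrightarrow> \<bar>f n x\<bar> \<le> A" using bconv_bounded[OF assms(1)] by metis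
  obtain B where B: "\<And>n x. x \<in> closure \<Omega> \<Longrightarrow> \<bar>f' n x\<bar> \<le> B" using bconv_bounded[OF assms(2)] by metis
  have b: "\<bar>f n x - f' n x\<bar> \<le> A + B" if "x \<in> closure \<Omega>" for n x
    using A[OF that, of n] B[OF that, of n] by linarith
  show ?thesis
    by (rule bconvI[OF _ _ _ b]) (intro continuous_intros tendsto_intros bconvD[OF assms(1)] bconvD[OF assms(2)]; assumption)+
qed

lemma bconv_const: assumes "a \<longlonglongrightarrow> c" shows "bconv (\<lambda>n x. a n) (\<lambda>x. c)"
proof -
  obtain B where "\<And>n. norm (a n) \<le> B" using convergent_imp_Bseq[OF convergentI[OF assms]] unfolding Bseq_def by blast
  then show ?thesis by (intro bconvI[where B=B]) (use assms in auto)
qed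

lemma bconv_same: assumes "continuous_on (closure \<Omega>) f" shows "bconv (\<lambda>n. f) f"
proof -
  obtain B where "\<And>x. x \<in> closure \<Omega> \<Longrightarrow> \<bar>f x\<bar> \<le> B" using continuous_closure_bounded[OF assms] by blast
  then show ?thesis by (rule bconvI[OF assms assms tendsto_const])
qed

lemma bconv_exp: assumes "bconv f g" shows "bconv (\<lambda>n x. exp (f n x)) (\<lambda>x. exp (g x))"
proof -
  obtain A where A: "\<And>n x. x \<in> closure \<Omega> \<Longrightarrow> \<bar>f n x\<bar> \<le> A" using bconv_bounded[OF assms(1)] by metis
  have b: "\<bar>exp (f n x)\<bar> \<le> exp A" if "x \<in> closure \<Omega>" for n x using A[OF that, of n] by simp
  show ?thesis
    by (rule bconvI[OF _ _ _ b]) (intro continuous_intros tendsto_intros bconvD[OF assms(1)]; assumption)+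
qed

lemma bconv_dens: "bconv v w \<Longrightarrow> bconv (\<lambda>n. dens (v n)) (dens w)"
  unfolding dens_def[abs_def] by (intro bconv_mult bconv_exp bconv_same h_cont)

lemma bconv_integral: assumes "bconv f g" shows "(\<lambda>n. \<integral>x. f n x \<partial>leb \<Omega>) \<longlonglongrightarrow> (\<integral>x. g x \<partial>leb \<Omega>)"
proof -
  obtain B where B: "\<And>n x. x \<in> closure \<Omega> \<Longrightarrow> \<bar>f n x\<bar> \<le> B" using bconv_bounded[OF assms(1)] by metis
  show ?thesis
  proof (rule integral_dominated_convergence[where w="\<lambda>x. B"])
    show "integrable (leb \<Omega>) (\<lambda>x. B)" by (rule bmeas_integrable[OF bmeas_const])
    show "g \<in> borel_measurable (leb \<Omega>)" "\<And>n. f n \<in> borel_measurable (leb \<Omega>)"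
      by (intro bmeas_measurable bmeas_cont bconvD[OF assms])+
    show "AE x in leb \<Omega>. (\<lambda>n. f n x) \<longlonglongrightarrow> g x" by (intro AE_I2 bconvD(3)[OF assms] in_closure) (simp add: space_restrict_space)
    show "AE x in leb \<Omega>. norm (f n x) \<le> B" for n
      unfolding real_norm_def by (intro AE_I2 B in_closure) (simp add: space_restrict_space)
  qed
qed

lemma pot_bound: "\<exists>C\<ge>0. \<forall>\<rho> B x. bdd \<rho> B \<longrightarrow> x \<in> closure \<Omega> \<longrightarrow> \<bar>pot \<rho> x\<bar> \<le> B * C"
proof -
  obtain C where C: "C \<ge> 0" "\<forall>x\<in>closure \<Omega>. integrable (leb \<Omega>) (\<lambda>q. (K q x)\<^sup>2) \<and> (\<integral>q. (K q x)\<^sup>2 \<partial>leb \<Omega>) \<le> C"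
    using K_sq_bound by blast
  have "\<bar>pot \<rho> x\<bar> \<le> B * (measure (leb \<Omega>) \<Omega> + C)" if "bdd \<rho> B" "x \<in> closure \<Omega>" for \<rho> B x
  proof -
    have i: "integrable (leb \<Omega>) (\<lambda>q. 1 + (K q x)\<^sup>2)" using C(2) that(2) bmeas_integrable[OF bmeas_const[of 1]] by auto
    have "\<bar>pot \<rho> x\<bar> \<le> (\<integral>q. \<bar>K q x * \<rho> q\<bar> \<partial>leb \<Omega>)" unfolding pot_def by (rule integral_abs_bound)
    also have "\<dots> \<le> (\<integral>q. B * (1 + (K q x)\<^sup>2) \<partial>leb \<Omega>)"
    proof (rule integral_mono)
      show "integrable (leb \<Omega>) (\<lambda>q. \<bar>K q x * \<rho> q\<bar>)" using K_rho_integrable[OF that(1) K_integrable[OF that(2)]] by simp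
      show "integrable (leb \<Omega>) (\<lambda>q. B * (1 + (K q x)\<^sup>2))" using i by simp
      fix q assume "q \<in> space (leb \<Omega>)"
      then have "\<bar>\<rho> q\<bar> \<le> B" using that(1) by (simp add: bdd_def space_restrict_space)
      moreover have "\<bar>K q x\<bar> \<le> 1 + (K q x)\<^sup>2"
        using zero_le_power2[of "\<bar>K q x\<bar> - 1"] unfolding power2_diff by (simp add: power2_abs)
      ultimately have "\<bar>K q x\<bar> * \<bar>\<rho> q\<bar> \<le> (1 + (K q x)\<^sup>2) * B" by (intro mult_mono) auto
      then show "\<bar>K q x * \<rho> q\<bar> \<le> B * (1 + (K q x)\<^sup>2)" by (simp add: abs_mult mult.commute)
    qed
    also have "\<dots> = B * (measure (leb \<Omega>) \<Omega> + (\<integral>q. (K q x)\<^sup>2 \<partial>leb \<Omega>))"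
      using C(2) that(2) bmeas_integrable[OF bmeas_const[of 1]] by (simp add: space_restrict_space)
    also have "\<dots> \<le> B * (measure (leb \<Omega>) \<Omega> + C)" using C(2) that bdd_nonneg[OF that(1)] by (intro mult_left_mono) auto
    finally show ?thesis .
  qed
  moreover have "measure (leb \<Omega>) \<Omega> + C \<ge> 0" using C(1) by simp
  ultimately show ?thesis by blast
qed

lemma bconv_pot: assumes "bconv \<rho> \<sigma>" shows "bconv (\<lambda>n. pot (\<rho> n)) (pot \<sigma>)"
proof -
  obtain B where B: "\<And>n. bdd (\<rho> n) B" "\<And>n x. x \<in> closure \<Omega> \<Longrightarrow> \<bar>\<rho> n x\<bar> \<le> B" using bconv_bounded[OF assms(1)] by metis
  obtain C where C: "\<forall>\<rho> B x. bdd \<rho> B \<longrightarrow> x \<in> closure \<Omega> \<longrightarrow> \<bar>pot \<rho> x\<bar> \<le> B * C" using pot_bound by blast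
  obtain B' where B': "bdd \<sigma> B'" using bmeas_cont[OF bconvD(2)[OF assms]] bmeas_def by blast
  show ?thesis
  proof (rule bconvI)
    show "continuous_on (closure \<Omega>) (pot (\<rho> n))" for n by (rule pot_continuous[OF B(1)])
    show "continuous_on (closure \<Omega>) (pot \<sigma>)" by (rule pot_continuous[OF B'])
    show "\<bar>pot (\<rho> n) x\<bar> \<le> B * C" if "x \<in> closure \<Omega>" for n x using C B(1) that by blast
    show "(\<lambda>n. pot (\<rho> n) x) \<longlonglongrightarrow> pot \<sigma> x" if x: "x \<in> closure \<Omega>" for x
      unfolding pot_def
    proof (rule integral_dominated_convergence[where w="\<lambda>q. B * \<bar>K q x\<bar>"])
      show "(\<lambda>q. K q x * \<sigma> q) \<in> borel_measurable (leb \<Omega>)" "\<And>n. (\<lambda>q. K q x * \<rho> n q) \<in> borel_measurable (leb \<Omega>)"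
        by (intro borel_measurable_times K_measurable x bmeas_measurable bmeas_cont bconvD[OF assms])+
      show "integrable (leb \<Omega>) (\<lambda>q. B * \<bar>K q x\<bar>)" using K_integrable[OF x] by simp
      show "AE q in leb \<Omega>. (\<lambda>n. K q x * \<rho> n q) \<longlonglongrightarrow> K q x * \<sigma> q"
        by (intro AE_I2 tendsto_mult tendsto_const bconvD(3)[OF assms] in_closure) (simp add: space_restrict_space)
      show "AE q in leb \<Omega>. norm (K q x * \<rho> n q) \<le> B * \<bar>K q x\<bar>" for n
      proof (rule AE_I2)
        fix q assume "q \<in> space (leb \<Omega>)"
        then have "\<bar>\<rho> n q\<bar> \<le> B" using B(2) in_closure by (simp add: space_restrict_space)
        from mult_left_mono[OF this abs_ge_zero[of "K q x"]] show "norm (K q x * \<rho> n q) \<le> B * \<bar>K q x\<bar>"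
          by (simp add: abs_mult mult.commute)
      qed
    qed
  qed
qed

lemma bconv_gpot: "bconv v w \<Longrightarrow> bconv (\<lambda>n. gpot (v n)) (gpot w)"
  unfolding gpot_def by (intro bconv_pot bconv_dens)

lemma bconv_gibbs: assumes "bconv \<phi> \<psi>" "lam \<longlonglongrightarrow> l" shows "bconv (\<lambda>n. gibbs (lam n) (\<phi> n)) (gibbs l \<psi>)"
proof -
  have m: "bconv (\<lambda>n x. lam n * \<phi> n x) (\<lambda>x. l * \<psi> x)" by (intro bconv_mult bconv_const assms)
  have "(\<lambda>n. Z (lam n) (\<phi> n)) \<longlonglongrightarrow> Z l \<psi>" unfolding Z_def by (intro bconv_integral bconv_dens m)
  moreover have "Z l \<psi> > 0" by (rule Z_pos[OF bconvD(2)[OF assms(1)]])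
  ultimately have "(\<lambda>n. ln (Z (lam n) (\<phi> n))) \<longlonglongrightarrow> ln (Z l \<psi>)" by (intro tendsto_ln) auto
  then show ?thesis unfolding gibbs_def[abs_def] by (intro bconv_diff m bconv_const)
qed

lemma bconv_functionals:
  assumes "bconv v w"
  shows "(\<lambda>n. ip (v n) (v n)) \<longlonglongrightarrow> ip w w" "(\<lambda>n. F lam (v n)) \<longlonglongrightarrow> F lam w"
    "bconv v' w' \<Longrightarrow> (\<lambda>n. KL (v n) (v' n)) \<longlonglongrightarrow> KL w w'"
proof -
  show i: "(\<lambda>n. ip (v n) (v n)) \<longlonglongrightarrow> ip w w" unfolding ip_def
    by (intro bconv_integral bconv_mult bconv_gpot bconv_dens assms)
  have "(\<lambda>n. Ent (v n)) \<longlonglongrightarrow> Ent w" unfolding Ent_def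
    by (intro bconv_integral bconv_mult bconv_dens assms)
  then show "(\<lambda>n. F lam (v n)) \<longlonglongrightarrow> F lam w" unfolding F_def by (intro tendsto_intros i)
  assume "bconv v' w'"
  then show "(\<lambda>n. KL (v n) (v' n)) \<longlonglongrightarrow> KL w w'" unfolding KL_def
    by (intro bconv_integral bconv_mult bconv_diff bconv_dens assms)
qed

text \<open>Arzela-Ascoli: the modulus of continuity and the sup bound of a potential depend on the
  density only through \<open>B\<close>.\<close>

lemma pot_compact:
  assumes "\<And>n. bdd (\<rho> n) B"
  obtains g k where "strict_mono (k :: nat \<Rightarrow> nat)" "bconv (\<lambda>n. pot (\<rho> (k n))) g"
proof -
  obtain C where C: "\<forall>\<rho> B x. bdd \<rho> B \<longrightarrow> x \<in> closure \<Omega> \<longrightarrow> \<bar>pot \<rho> x\<bar> \<le> B * C" using pot_bound by blast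
  have "\<exists>g k. continuous_on (closure \<Omega>) g \<and> strict_mono (k :: nat \<Rightarrow> nat) \<and>
     (\<forall>e>0. \<exists>N. \<forall>n x. n \<ge> N \<and> x \<in> closure \<Omega> \<longrightarrow> norm (pot (\<rho> (k n)) x - g x) < e)"
  proof (rule Arzela_Ascoli[of "closure \<Omega>" "\<lambda>n. pot (\<rho> n)" "B * C"])
    show "compact (closure \<Omega>)" using om by simp
    show "norm (pot (\<rho> n) x) \<le> B * C" if "x \<in> closure \<Omega>" for n x using C assms that by simp
    show "\<exists>d. 0 < d \<and> (\<forall>n y. y \<in> closure \<Omega> \<and> norm (x - y) < d \<longrightarrow> norm (pot (\<rho> n) x - pot (\<rho> n) y) < e)"
      if xe: "x \<in> closure \<Omega>" "0 < e" for x e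
    proof -
      obtain d where d: "d > 0"
        "\<And>\<rho> y. bdd \<rho> B \<Longrightarrow> y \<in> closure \<Omega> \<Longrightarrow> norm (x - y) < d \<Longrightarrow> \<bar>pot \<rho> x - pot \<rho> y\<bar> < e"
        using pot_equicontinuous[OF xe bdd_nonneg[OF assms]] by blast
      show ?thesis by (intro exI[of _ d] conjI allI impI d(1)) (use d(2)[OF assms] in auto)
    qed
  qed blast
  then obtain g k where g: "continuous_on (closure \<Omega>) g" "strict_mono (k :: nat \<Rightarrow> nat)"
     "\<forall>e>0. \<exists>N. \<forall>n x. n \<ge> N \<and> x \<in> closure \<Omega> \<longrightarrow> norm (pot (\<rho> (k n)) x - g x) < e" by blast
  have "bconv (\<lambda>n. pot (\<rho> (k n))) g"
  proof (rule bconvI)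
    show "continuous_on (closure \<Omega>) (pot (\<rho> (k n)))" for n by (rule pot_continuous[OF assms])
    show "\<bar>pot (\<rho> (k n)) x\<bar> \<le> B * C" if "x \<in> closure \<Omega>" for n x using C assms that by simp
    show "(\<lambda>n. pot (\<rho> (k n)) x) \<longlonglongrightarrow> g x" if "x \<in> closure \<Omega>" for x
      by (rule LIMSEQ_I) (use g(3) that in blast)
  qed (rule g(1))
  then show ?thesis by (rule that[OF g(2)])
qed

text \<open>The fixed-point form of the equation. It fixes the values on the closed domain only,
  since functions are arbitrary outside; the congruence lemmas below bridge this.\<close>

definition critical :: "real \<Rightarrow> (pt \<Rightarrow> real) \<Rightarrow> bool" where
  "critical lam \<psi> \<longleftrightarrow> continuous_on (closure \<Omega>) \<psi> \<and> (\<forall>x\<in>closure \<Omega>. \<psi> x = gpot (gibbs lam \<psi>) x)"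

lemma critical_facts:
  assumes "critical lam \<psi>"
  shows "regular \<psi>" "unit_mass (gibbs lam \<psi>)" "\<And>x. x \<in> closure \<Omega> \<Longrightarrow> gibbs lam \<psi> x = lam * gpot (gibbs lam \<psi>) x - ln (Z lam \<psi>)"
    "\<And>x. x \<in> closure \<Omega> \<Longrightarrow> \<psi> x = gpot (gibbs lam \<psi>) x" "\<And>x. x \<in> \<Omega> \<Longrightarrow> \<psi> x > 0" "\<And>x. x \<in> closure \<Omega> \<Longrightarrow> \<psi> x \<ge> 0"
    "\<And>x. x \<in> frontier \<Omega> \<Longrightarrow> \<psi> x = 0" "continuous_on (closure \<Omega>) \<psi>"
proof -
  show c: "continuous_on (closure \<Omega>) \<psi>" and e: "\<And>x. x \<in> closure \<Omega> \<Longrightarrow> \<psi> x = gpot (gibbs lam \<psi>) x" using assms by (auto simp: critical_def)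
  have "loc_holder \<Omega> (gpot (gibbs lam \<psi>))"
    using pot_regular[OF dens_bmeas[OF gibbs_cont[OF c]]] unfolding gpot_def regular_def by blast
  then have "loc_holder \<Omega> \<psi>" by (rule loc_holder_cong) (use e in_closure in simp)
  then show s: "regular \<psi>" using c by (simp add: regular_def)
  show n: "unit_mass (gibbs lam \<psi>)" by (rule gibbs_unit_mass[OF s])
  show "gibbs lam \<psi> x = lam * gpot (gibbs lam \<psi>) x - ln (Z lam \<psi>)" if "x \<in> closure \<Omega>" for x
    using e[OF that] gibbs_def[of lam \<psi> x] by simp
  note f = gpot_facts[OF gibbs_regular[OF s]]
  show "\<And>x. x \<in> \<Omega> \<Longrightarrow> \<psi> x > 0" using f(3) e in_closure by simp
  show "\<And>x. x \<in> closure \<Omega> \<Longrightarrow> \<psi> x \<ge> 0" using f(8) e by simp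
  show "\<And>x. x \<in> frontier \<Omega> \<Longrightarrow> \<psi> x = 0" using f(9) e frontier_in_closure by simp
qed

lemma gpot_cong: "(\<And>x. x \<in> \<Omega> \<Longrightarrow> v x = w x) \<Longrightarrow> gpot v y = gpot w y"
  unfolding gpot_def pot_def by (rule Bochner_Integration.integral_cong) (auto simp: dens_def space_restrict_space)

lemma functional_cong:
  assumes "\<And>x. x \<in> \<Omega> \<Longrightarrow> v x = w x"
  shows "F lam v = F lam w" "ip v v = ip w w"
proof -
  have p: "gpot v = gpot w" by (rule ext) (rule gpot_cong[OF assms])
  show i: "ip v v = ip w w" unfolding ip_def p
    by (rule Bochner_Integration.integral_cong) (auto simp: dens_def space_restrict_space assms)
  have "Ent v = Ent w" unfolding Ent_def
    by (rule Bochner_Integration.integral_cong) (auto simp: dens_def space_restrict_space assms)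
  then show "F lam v = F lam w" unfolding F_def using i by simp
qed

text \<open>Bounded densities make a subsequence of the potentials, that is of the solutions
  themselves, converge; the fixed-point equation and the energy pass to the limit.\<close>

lemma critical_compact:
  assumes "\<And>n. critical (lam n) (\<psi> n)" "lam \<longlonglongrightarrow> l" "\<And>n. bdd (dens (gibbs (lam n) (\<psi> n))) B"
  obtains \<phi> k where "strict_mono (k :: nat \<Rightarrow> nat)" "critical l \<phi>"
    "(\<lambda>n. ip (gibbs (lam (k n)) (\<psi> (k n))) (gibbs (lam (k n)) (\<psi> (k n)))) \<longlonglongrightarrow> ip (gibbs l \<phi>) (gibbs l \<phi>)"
proof -
  obtain g k where g: "strict_mono (k :: nat \<Rightarrow> nat)" "bconv (\<lambda>n. pot (dens (gibbs (lam (k n)) (\<psi> (k n))))) g"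
    using pot_compact[of "\<lambda>n. dens (gibbs (lam n) (\<psi> n))" B] assms(3) by blast
  have b: "bconv (\<lambda>n. \<psi> (k n)) g"
    by (rule bconv_cong[OF g(2)]) (use critical_facts(4,8)[OF assms(1)] in \<open>auto simp: gpot_def\<close>)
  have bv: "bconv (\<lambda>n. gibbs (lam (k n)) (\<psi> (k n))) (gibbs l g)"
    by (rule bconv_gibbs[OF b]) (use LIMSEQ_subseq_LIMSEQ[OF assms(2) g(1)] in \<open>simp add: o_def\<close>)
  have "critical l g" unfolding critical_def
  proof (intro conjI ballI)
    show "continuous_on (closure \<Omega>) g" by (rule bconvD(2)[OF b])
    fix x assume x: "x \<in> closure \<Omega>"
    have "(\<lambda>n. gpot (gibbs (lam (k n)) (\<psi> (k n))) x) \<longlonglongrightarrow> gpot (gibbs l g) x" by (rule bconvD(3)[OF bconv_gpot[OF bv] x])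
    then show "g x = gpot (gibbs l g) x" using LIMSEQ_unique[OF bconvD(3)[OF g(2) x]] by (simp add: gpot_def)
  qed
  then show ?thesis by (rule that[OF g(1) _ bconv_functionals(1)[OF bv]])
qed

section \<open>Partition function, lower bound of the entropy, coercivity\<close>

definition h_mass :: real where "h_mass = (\<integral>x. h x \<partial>leb \<Omega>)"

lemma h_bound: obtains M where "M \<ge> 1" "\<And>x. x \<in> \<Omega> \<Longrightarrow> h x \<le> M"
proof -
  obtain M where M: "\<And>x. x \<in> closure \<Omega> \<Longrightarrow> \<bar>h x\<bar> \<le> M" using continuous_closure_bounded[OF h_cont] by blast
  show ?thesis by (rule that[of "max 1 M"]) (use M in_closure in force)+
qed

lemma h_mass_pos: "h_mass > 0"
  unfolding h_mass_def by (rule integral_pos[OF bmeas_cont[OF h_cont] h_nonneg h_pos])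

lemma h_integrable: "integrable (leb \<Omega>) h" by (rule bmeas_integrable[OF bmeas_cont[OF h_cont]])

lemma Z_ge: assumes "continuous_on (closure \<Omega>) \<phi>" "\<And>x. x \<in> closure \<Omega> \<Longrightarrow> \<phi> x \<ge> 0" "lam \<ge> 0" shows "Z lam \<phi> \<ge> h_mass"
  unfolding Z_def h_mass_def
proof (rule integral_mono[OF h_integrable bmeas_integrable[OF dens_bmeas]])
  show "continuous_on (closure \<Omega>) (\<lambda>x. lam * \<phi> x)" by (intro continuous_intros assms)
  fix x assume "x \<in> space (leb \<Omega>)"
  then have x: "x \<in> \<Omega>" by (simp add: space_restrict_space)
  have "1 \<le> exp (lam * \<phi> x)" using assms(2)[OF in_closure[OF x]] assms(3) by simp
  from mult_left_mono[OF this h_nonneg[OF x]] show "h x \<le> dens (\<lambda>x. lam * \<phi> x) x" by (simp add: dens_def)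
qed

lemma gibbs_dens_bdd:
  assumes "continuous_on (closure \<Omega>) \<phi>" "\<And>x. x \<in> \<Omega> \<Longrightarrow> lam * \<phi> x \<le> A" "Z lam \<phi> \<ge> z" "z > 0" "M \<ge> 1" "\<And>x. x \<in> \<Omega> \<Longrightarrow> h x \<le> M"
  shows "bdd (dens (gibbs lam \<phi>)) (M * exp A / z)"
  unfolding bdd_def
proof (intro conjI ballI)
  show "dens (gibbs lam \<phi>) \<in> borel_measurable (leb \<Omega>)" by (intro bmeas_measurable dens_bmeas gibbs_cont assms)
  fix x assume x: "x \<in> \<Omega>"
  have "dens (gibbs lam \<phi>) x = h x * exp (lam * \<phi> x) / Z lam \<phi>" unfolding dens_gibbs(1)[OF assms(1)] by (simp add: dens_def)
  also have "\<dots> \<le> (M * exp A) / z"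
    using assms x h_nonneg[OF x] by (intro frac_le mult_mono) auto
  finally show "\<bar>dens (gibbs lam \<phi>) x\<bar> \<le> M * exp A / z" using dens_nonneg[OF x, of "gibbs lam \<phi>"] by simp
qed

text \<open>Pointwise e^v - 1 is at most v e^v; multiply by \<open>h\<close> and integrate.\<close>

lemma Ent_ge: assumes "unit_mass v" shows "Ent v \<ge> 1 - h_mass"
proof -
  have s: "regular v" and n: "(\<integral>x. dens v x \<partial>leb \<Omega>) = 1" using assms by (auto simp: unit_mass_def)
  note d = gpot_facts(6)[OF s]
  have "1 - h_mass = (\<integral>x. dens v x - h x \<partial>leb \<Omega>)" using bmeas_integrable[OF d] h_integrable n by (simp add: h_mass_def)
  also have "\<dots> \<le> Ent v" unfolding Ent_def
  proof (rule integral_mono)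
    show "integrable (leb \<Omega>) (\<lambda>x. dens v x - h x)" using bmeas_integrable[OF d] h_integrable by simp
    show "integrable (leb \<Omega>) (\<lambda>x. dens v x * v x)" by (intro bmeas_integrable bmeas_mult d regular_bmeas s)
    fix x assume "x \<in> space (leb \<Omega>)"
    then have x: "x \<in> \<Omega>" by (simp add: space_restrict_space)
    have "1 + (- v x) \<le> exp (- v x)" by (rule exp_ge_add_one_self)
    from mult_left_mono[OF this, of "exp (v x)"] have "exp (v x) * (1 - v x) \<le> 1" by (simp add: exp_minus)
    from mult_left_mono[OF this h_nonneg[OF x]] show "dens v x - h x \<le> dens v x * v x" by (simp add: dens_def algebra_simps)
  qed
  finally show ?thesis .
qed

lemma ip_le: assumes "regular v" "unit_mass w" "\<And>x. x \<in> closure \<Omega> \<Longrightarrow> gpot v x \<le> M" shows "ip v w \<le> M"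
proof -
  have s: "regular v" "regular w" and n: "(\<integral>x. dens w x \<partial>leb \<Omega>) = 1" using assms by (auto simp: unit_mass_def)
  have "ip v w \<le> (\<integral>x. M * dens w x \<partial>leb \<Omega>)" unfolding ip_def
  proof (rule integral_mono[OF ip_integrable[OF s]])
    show "integrable (leb \<Omega>) (\<lambda>x. M * dens w x)" using bmeas_integrable[OF gpot_facts(6)[OF s(2)]] by simp
    show "gpot v x * dens w x \<le> M * dens w x" if "x \<in> space (leb \<Omega>)" for x
      using that assms(3)[OF in_closure] dens_nonneg by (intro mult_right_mono) (auto simp: space_restrict_space)
  qed
  also have "\<dots> = M" using n by simp
  finally show ?thesis .
qed

text \<open>The doubled energy is at most the supremum of the potential, which the entropy controls
  with factor 1 / (2 \<pi> \<theta>). The energy term thus costs the share \<open>\<kappa>\<close>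
  of the entropy, and \<open>\<kappa> < 1\<close> leaves a bound for the entropy itself.\<close>

lemma coercive:
  assumes "0 < lam" "lam < 8 * pi"
  shows "\<exists>M. \<forall>v. unit_mass v \<longrightarrow> F lam v \<le> A \<longrightarrow> (\<forall>x\<in>closure \<Omega>. gpot v x \<le> M)"
proof -
  \<comment> \<open>The midpoint between \<open>lam / (4 * pi)\<close> and 2; the interval is
    nonempty because \<open>lam < 8 * pi\<close>.\<close>
  define \<theta> where "\<theta> = (lam / (4 * pi) + 2) / 2"
  have th: "0 < \<theta>" "\<theta> < 2" "lam / (4 * pi) < \<theta>" using assms by (auto simp: \<theta>_def field_simps)
  obtain C where C: "\<And>v x. unit_mass v \<Longrightarrow> x \<in> closure \<Omega> \<Longrightarrow> 2 * pi * \<theta> * gpot v x \<le> Ent v + C"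
    using entropy_bounds_potential[OF th(1,2)] by blast
  define \<kappa> where "\<kappa> = lam / (4 * pi * \<theta>)"
  have k: "0 < \<kappa>" "\<kappa> < 1" using th assms by (auto simp: \<kappa>_def field_simps)
  define S where "S = (A + \<kappa> * C) / (1 - \<kappa>)"
  have "gpot v x \<le> (S + C) / (2 * pi * \<theta>)" if v: "unit_mass v" "F lam v \<le> A" and x: "x \<in> closure \<Omega>" for v x
  proof -
    have b: "gpot v y \<le> (Ent v + C) / (2 * pi * \<theta>)" if "y \<in> closure \<Omega>" for y
      using C[OF v(1) that] th(1) by (simp add: field_simps)
    have "ip v v \<le> (Ent v + C) / (2 * pi * \<theta>)" by (rule ip_le[OF _ v(1) b]) (use v(1) in \<open>simp add: unit_mass_def\<close>)
    from mult_left_mono[OF this, of "lam / 2"] have "lam / 2 * ip v v \<le> \<kappa> * (Ent v + C)"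
      using assms th(1) by (simp add: \<kappa>_def field_simps)
    then have "Ent v * (1 - \<kappa>) \<le> A + \<kappa> * C" using v(2) unfolding F_def by (simp add: algebra_simps)
    then have "Ent v \<le> S" using k by (simp add: S_def field_simps)
    then have "(Ent v + C) / (2 * pi * \<theta>) \<le> (S + C) / (2 * pi * \<theta>)" using th(1) by (intro divide_right_mono) auto
    then show ?thesis using b[OF x] by linarith
  qed
  then show ?thesis by blast
qed

text \<open>The map \<open>v \<mapsto> gibbs lam (gpot v)\<close> decreases the free energy by at least a relative entropy, so its
  orbits accumulate at critical points.\<close>

lemma descent:
  assumes "0 < lam" "lam < 8 * pi" "unit_mass v0"
  shows "\<exists>\<phi>. critical lam \<phi> \<and> F lam (gibbs lam \<phi>) \<le> F lam v0"
proof -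
  define v where "v n = ((\<lambda>v. gibbs lam (gpot v)) ^^ n) v0" for n
  have v0: "v 0 = v0" and vS: "v (Suc n) = gibbs lam (gpot (v n))" for n by (simp_all add: v_def)
  have nv: "unit_mass (v n)" for n
    by (induction n) (use assms(3) v0 vS gibbs_unit_mass gpot_facts(4) in \<open>auto simp: unit_mass_def\<close>)
  have sv: "regular (v n)" for n using nv by (simp add: unit_mass_def)
  have step: "F lam (v n) - F lam (v (Suc n)) \<ge> KL (v n) (v (Suc n))" for n
  proof -
    have "F lam (v n) - F lam (v (Suc n)) = KL (v n) (v (Suc n)) + lam / 2 * (ip (v n) (v n) - 2 * ip (v n) (v (Suc n)) + ip (v (Suc n)) (v (Suc n)))"
      by (rule F_step[OF nv nv, where c="ln (Z lam (gpot (v n)))"]) (simp add: vS gibbs_def)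
    then show ?thesis using mult_nonneg_nonneg[OF _ ip_diff_nonneg[OF sv[of n] sv[of "Suc n"]], of "lam / 2"] assms(1) by simp
  qed
  have dec: "F lam (v (Suc n)) \<le> F lam (v n)" for n using step[of n] KL_nonneg(1)[OF nv nv, of n "Suc n"] by linarith
  have Fle: "F lam (v n) \<le> F lam v0" for n by (induction n) (use v0 dec order_trans in \<open>auto\<close>)
  obtain M where M: "\<forall>v. unit_mass v \<longrightarrow> F lam v \<le> F lam v0 \<longrightarrow> (\<forall>x\<in>closure \<Omega>. gpot v x \<le> M)" using coercive[OF assms(1,2)] by blast
  have pM: "gpot (v n) x \<le> M" if "x \<in> closure \<Omega>" for n x using M nv Fle that by blast
  have Fge: "F lam (v n) \<ge> 1 - h_mass - lam / 2 * M" for n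
  proof -
    have "lam / 2 * ip (v n) (v n) \<le> lam / 2 * M" using ip_le[OF sv nv pM] assms(1) by simp
    then show ?thesis using Ent_ge[OF nv, of n] unfolding F_def by linarith
  qed
  have "decseq (\<lambda>n. F lam (v n))" using dec by (simp add: decseq_Suc_iff)
  from decseq_convergent[OF this, of "1 - h_mass - lam / 2 * M"] Fge
  obtain L where L: "(\<lambda>n. F lam (v n)) \<longlonglongrightarrow> L" by metis
  \<comment> \<open>The relative entropy is squeezed between 0 and the decrement of a convergent
    decreasing sequence.\<close>
  have KL0: "(\<lambda>n. KL (v n) (v (Suc n))) \<longlonglongrightarrow> 0"
  proof (rule real_tendsto_sandwich[OF _ _ tendsto_const])
    have "(\<lambda>n. F lam (v n) - F lam (v (Suc n))) \<longlonglongrightarrow> L - L" by (intro tendsto_diff L LIMSEQ_Suc[OF L])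
    then show "(\<lambda>n. F lam (v n) - F lam (v (Suc n))) \<longlonglongrightarrow> 0" by simp
  qed (use KL_nonneg(1)[OF nv nv] step in \<open>auto intro!: always_eventually\<close>)
  obtain hM where hM: "hM \<ge> 1" "\<And>x. x \<in> \<Omega> \<Longrightarrow> h x \<le> hM" using h_bound by blast
  have bd: "bdd (dens (v (Suc n))) (hM * exp (lam * M) / h_mass)" for n
    unfolding vS
  proof (rule gibbs_dens_bdd[OF gpot_facts(7)[OF sv] _ Z_ge[OF gpot_facts(7,8)[OF sv]] h_mass_pos hM])
    show "lam * gpot (v n) x \<le> lam * M" if "x \<in> \<Omega>" for x using pM[OF in_closure[OF that]] assms(1) by simp
  qed (use assms in auto)
  obtain g k where k: "strict_mono (k :: nat \<Rightarrow> nat)" and g: "bconv (\<lambda>n. pot (dens (v (Suc (k n))))) g"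
    using pot_compact[of "\<lambda>n. dens (v (Suc n))", OF bd] by blast
  have nxt: "bconv (\<lambda>n. v (Suc (m n))) (gibbs lam (gpot w))" if "bconv (\<lambda>n. v (m n)) w" for m w
    unfolding vS by (intro bconv_gibbs bconv_gpot that tendsto_const)
  have b2: "bconv (\<lambda>n. v (Suc (Suc (k n)))) (gibbs lam g)"
    unfolding vS[of "Suc _"] by (intro bconv_gibbs tendsto_const) (use g in \<open>simp add: gpot_def\<close>)
  \<comment> \<open>\<open>g\<close> is known only to be a continuous limit, so
    \<open>gibbs lam g\<close> need not be regular. One further step of the map gives a limit of
    unit mass in the required class, and yet another gives its successor \<open>w3\<close>.\<close>
  define w2 where "w2 = gibbs lam (gpot (gibbs lam g))"
  define w3 where "w3 = gibbs lam (gpot w2)"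
  note b3 = nxt[OF b2, folded w2_def] note b4 = nxt[OF b3, folded w3_def]
  have "regular (gpot (gibbs lam g))" unfolding gpot_def by (rule pot_regular[OF dens_bmeas[OF bconvD(2)[OF b2]]])
  then have n2: "unit_mass w2" unfolding w2_def by (rule gibbs_unit_mass)
  have n3: "unit_mass w3" unfolding w3_def by (rule gibbs_unit_mass[OF gpot_facts(4)]) (use n2 in \<open>simp add: unit_mass_def\<close>)
  let ?m = "\<lambda>n. Suc (Suc (Suc (k n)))"
  have sm: "strict_mono ?m" using k by (auto simp: strict_mono_def)
  have "(\<lambda>n. KL (v (?m n)) (v (Suc (?m n)))) \<longlonglongrightarrow> KL w2 w3" by (rule bconv_functionals(3)[OF b3 b4])
  moreover have "(\<lambda>n. KL (v (?m n)) (v (Suc (?m n)))) \<longlonglongrightarrow> 0" using LIMSEQ_subseq_LIMSEQ[OF KL0 sm] by (simp add: o_def)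
  ultimately have "KL w2 w3 = 0" by (rule LIMSEQ_unique)
  then have eq: "w2 x = w3 x" if "x \<in> closure \<Omega>" for x using KL_nonneg(2)[OF n2 n3] that by blast
  define \<phi> where "\<phi> = gpot w2"
  have g3: "gibbs lam \<phi> = w3" by (simp add: w3_def \<phi>_def)
  have "critical lam \<phi>" unfolding critical_def g3
  proof (intro conjI ballI)
    show "continuous_on (closure \<Omega>) \<phi>" unfolding \<phi>_def by (rule gpot_facts(7)) (use n2 in \<open>simp add: unit_mass_def\<close>)
    show "\<phi> x = gpot w3 x" for x unfolding \<phi>_def by (rule gpot_cong) (use eq in_closure in blast)
  qed
  moreover have "F lam w2 \<le> F lam v0"
    by (rule LIMSEQ_le_const2[OF bconv_functionals(2)[OF b3]]) (use Fle in blast)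
  then have "F lam (gibbs lam \<phi>) \<le> F lam v0" unfolding g3 using functional_cong(1)[of w2 w3 lam] eq in_closure by simp
  ultimately show ?thesis by blast
qed

end

subsection \<open>A priori bounds\<close>

context mean_field
begin

lemma zero_regular: "regular (\<lambda>x. 0)" unfolding regular_def using loc_holder_const[OF om(1)] by simp

lemma ip_nonneg: assumes "regular v" shows "ip v v \<ge> 0"
  unfolding ip_def
  by (rule integral_nonneg_AE, rule AE_I2)
    (use gpot_facts(8)[OF assms] in_closure dens_nonneg in \<open>simp add: space_restrict_space\<close>)

lemma bdd_mono: "bdd \<rho> B \<Longrightarrow> B \<le> B' \<Longrightarrow> bdd \<rho> B'"
  unfolding bdd_def by fastforce

text \<open>Bounding Z below amounts to bounding the mean of the solution against \<open>h\<close>.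
  As \<open>h\<close> is the density of the zero exponent, symmetry of the energy form turns this
  mean into one of a fixed potential, bounded by \<open>M0\<close>.\<close>

lemma Z_lower:
  assumes "T \<ge> 0"
  shows "\<exists>z>0. \<forall>lam \<psi>. critical lam \<psi> \<longrightarrow> - T \<le> lam \<longrightarrow> lam \<le> 0 \<longrightarrow> z \<le> Z lam \<psi>"
proof -
  obtain M0 where M0: "\<And>x. x \<in> closure \<Omega> \<Longrightarrow> \<bar>gpot (\<lambda>x. 0) x\<bar> \<le> M0"
    using continuous_closure_bounded[OF gpot_facts(7)[OF zero_regular]] by blast
  obtain x0 where "x0 \<in> \<Omega>" using om(3) by blast
  then have M00: "0 \<le> M0" using M0[OF in_closure] by force
  define c where "c = T * M0 / h_mass"
  have "exp (- c) * h_mass \<le> Z lam \<psi>" if cr: "critical lam \<psi>" and l: "- T \<le> lam" "lam \<le> 0" for lam \<psi>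
  proof -
    note cf = critical_facts[OF cr]
    let ?v = "gibbs lam \<psi>"
    have sv: "regular ?v" using cf(2) by (simp add: unit_mass_def)
    have ii: "integrable (leb \<Omega>) (\<lambda>x. \<psi> x * h x)" by (intro bmeas_integrable bmeas_mult regular_bmeas cf bmeas_cont h_cont)
    have "(\<integral>x. \<psi> x * h x \<partial>leb \<Omega>) = ip ?v (\<lambda>x. 0)" unfolding ip_def
      by (rule Bochner_Integration.integral_cong) (auto simp: dens_def space_restrict_space cf(4)[OF in_closure, symmetric])
    also have "\<dots> = ip (\<lambda>x. 0) ?v" by (rule ip_sym[OF sv zero_regular])
    also have "\<dots> \<le> M0" by (rule ip_le[OF zero_regular cf(2)]) (use M0 abs_le_D1 in blast)
    finally have psi: "(\<integral>x. \<psi> x * h x \<partial>leb \<Omega>) \<le> M0" .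
    \<comment> \<open>The tangent to \<open>exp\<close> at \<open>- c\<close> bounds the exponential
      from below; \<open>c\<close> is chosen so that \<open>c * h_mass\<close> compensates the worst
      linear term \<open>T * M0\<close>.\<close>
    let ?f = "\<lambda>x. exp (- c) * ((1 + c) * h x + lam * (\<psi> x * h x))"
    have "exp (- c) * h_mass \<le> exp (- c) * ((1 + c) * h_mass + lam * (\<integral>x. \<psi> x * h x \<partial>leb \<Omega>))"
    proof (rule mult_left_mono)
      have "lam * (\<integral>x. \<psi> x * h x \<partial>leb \<Omega>) \<ge> lam * M0" using psi l(2) by (rule mult_left_mono_neg)
      moreover have "lam * M0 \<ge> - T * M0" using l(1) M00 by (intro mult_right_mono) auto
      moreover have "c * h_mass = T * M0" using h_mass_pos by (simp add: c_def)
      ultimately show "h_mass \<le> (1 + c) * h_mass + lam * (\<integral>x. \<psi> x * h x \<partial>leb \<Omega>)" by (simp add: algebra_simps)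
    qed simp
    also have "\<dots> = (\<integral>x. ?f x \<partial>leb \<Omega>)" unfolding h_mass_def using ii h_integrable by simp
    also have "\<dots> \<le> Z lam \<psi>" unfolding Z_def
    proof (rule integral_mono)
      show "integrable (leb \<Omega>) ?f" using ii h_integrable by simp
      show "integrable (leb \<Omega>) (dens (\<lambda>x. lam * \<psi> x))" by (intro bmeas_integrable dens_bmeas continuous_intros cf)
      fix x assume "x \<in> space (leb \<Omega>)"
      then have x: "x \<in> \<Omega>" by (simp add: space_restrict_space)
      have "exp (- c) * (1 + (lam * \<psi> x + c)) \<le> exp (- c) * exp (lam * \<psi> x + c)"
        by (intro mult_left_mono exp_ge_add_one_self) simp
      also have "\<dots> = exp (lam * \<psi> x)" by (simp add: exp_add[symmetric])
      finally have "h x * (exp (- c) * (1 + (lam * \<psi> x + c))) \<le> h x * exp (lam * \<psi> x)" using h_nonneg[OF x] by (rule mult_left_mono)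
      then show "?f x \<le> dens (\<lambda>x. lam * \<psi> x) x" by (simp add: dens_def algebra_simps)
    qed
    finally show ?thesis .
  qed
  moreover have "exp (- c) * h_mass > 0" using h_mass_pos by simp
  ultimately show ?thesis by blast
qed

lemma critical_Ent: assumes "critical lam \<psi>" shows "Ent (gibbs lam \<psi>) = lam * ip (gibbs lam \<psi>) (gibbs lam \<psi>) - ln (Z lam \<psi>)"
proof (rule Ent_split(2)[OF critical_facts(2)[OF assms] critical_facts(2)[OF assms]])
  show "gibbs lam \<psi> x = lam * gpot (gibbs lam \<psi>) x - ln (Z lam \<psi>)" if "x \<in> \<Omega>" for x
    by (rule critical_facts(3)[OF assms in_closure[OF that]])
  show "regular (gibbs lam \<psi>)" using critical_facts(2)[OF assms] by (simp add: unit_mass_def)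
qed

text \<open>For \<open>lam \<ge> 0\<close> the energy bounds the entropy, the entropy bounds the
  solution, and the partition function is at least \<open>h_mass\<close>. For \<open>lam < 0\<close>
  the exponent is nonpositive and only the partition function needs care. The parameter
  \<open>8 * pi\<close> is included, as needed for the limit there.\<close>

lemma critical_dens_bdd:
  assumes "T \<ge> 0"
  shows "\<exists>B. \<forall>lam \<psi>. critical lam \<psi> \<longrightarrow> - T \<le> lam \<longrightarrow> lam \<le> 8 * pi \<longrightarrow> ip (gibbs lam \<psi>) (gibbs lam \<psi>) \<le> A \<longrightarrow> bdd (dens (gibbs lam \<psi>)) B"
proof -
  obtain hM where hM: "hM \<ge> 1" "\<And>x. x \<in> \<Omega> \<Longrightarrow> h x \<le> hM" using h_bound by blast
  obtain z where z: "z > 0" "\<forall>lam \<psi>. critical lam \<psi> \<longrightarrow> - T \<le> lam \<longrightarrow> lam \<le> 0 \<longrightarrow> z \<le> Z lam \<psi>" using Z_lower[OF assms] by blast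
  \<comment> \<open>With the energy already bounded nothing has to be absorbed, so any admissible
    exponent works; 1 is taken.\<close>
  obtain C where C: "\<And>v x. unit_mass v \<Longrightarrow> x \<in> closure \<Omega> \<Longrightarrow> 2 * pi * 1 * gpot v x \<le> Ent v + C"
    using entropy_bounds_potential[of 1] by auto
  define M where "M = \<bar>8 * pi * \<bar>A\<bar> - ln h_mass + C\<bar> / (2 * pi)"
  define B1 where "B1 = hM * exp (8 * pi * M) / h_mass"
  define B2 where "B2 = hM * exp 0 / z"
  have "bdd (dens (gibbs lam \<psi>)) (max B1 B2)"
    if cr: "critical lam \<psi>" and l: "- T \<le> lam" "lam \<le> 8 * pi" and ipA: "ip (gibbs lam \<psi>) (gibbs lam \<psi>) \<le> A" for lam \<psi>
  proof (cases "lam \<ge> 0")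
    case True
    note cf = critical_facts[OF cr]
    have Zm: "Z lam \<psi> \<ge> h_mass" by (rule Z_ge[OF cf(8,6) True])
    have "lam * ip (gibbs lam \<psi>) (gibbs lam \<psi>) \<le> 8 * pi * \<bar>A\<bar>"
      using l ipA True by (intro mult_mono) (auto intro: ip_nonneg gibbs_regular cf)
    moreover have "ln h_mass \<le> ln (Z lam \<psi>)" using Zm h_mass_pos by simp
    ultimately have "Ent (gibbs lam \<psi>) \<le> 8 * pi * \<bar>A\<bar> - ln h_mass" using critical_Ent[OF cr] by linarith
    then have "2 * pi * gpot (gibbs lam \<psi>) x \<le> \<bar>8 * pi * \<bar>A\<bar> - ln h_mass + C\<bar>" if "x \<in> closure \<Omega>" for x
      using C[OF cf(2) that] by linarith
    then have pM: "\<psi> x \<le> M" if "x \<in> closure \<Omega>" for x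
      using that cf(4)[OF that] by (simp add: M_def field_simps)
    have "bdd (dens (gibbs lam \<psi>)) B1" unfolding B1_def
    proof (rule gibbs_dens_bdd[OF cf(8) _ Zm h_mass_pos hM])
      show "lam * \<psi> x \<le> 8 * pi * M" if "x \<in> \<Omega>" for x
        using l True pM[OF in_closure[OF that]] cf(5)[OF that] by (intro mult_mono) auto
    qed
    then show ?thesis by (rule bdd_mono) simp
  next
    case False
    note cf = critical_facts[OF cr]
    have zZ: "z \<le> Z lam \<psi>" using z(2) cr l False by simp
    have "bdd (dens (gibbs lam \<psi>)) B2" unfolding B2_def
    proof (rule gibbs_dens_bdd[OF cf(8) _ zZ z(1) hM])
      show "lam * \<psi> x \<le> 0" if "x \<in> \<Omega>" for x using False cf(5)[OF that] by (simp add: mult_nonpos_nonneg)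
    qed
    then show ?thesis by (rule bdd_mono) simp
  qed
  then show ?thesis by blast
qed

lemma gibbs_cong: assumes "\<And>x. x \<in> \<Omega> \<Longrightarrow> \<phi> x = \<psi> x" "x \<in> \<Omega>" shows "gibbs lam \<phi> x = gibbs lam \<psi> x"
proof -
  have "Z lam \<phi> = Z lam \<psi>" unfolding Z_def
    by (rule Bochner_Integration.integral_cong) (auto simp: dens_def space_restrict_space assms(1))
  then show ?thesis unfolding gibbs_def using assms by simp
qed

subsection \<open>The limit at minus infinity\<close>

definition step0 :: "real \<Rightarrow> real" where "step0 t = (if t \<ge> 0 then 3 * t^2 - 2 * t^3 else 0)"
definition step0' :: "real \<Rightarrow> real" where "step0' t = (if t \<ge> 0 then 6 * t - 6 * t^2 else 0)"
text \<open>The cubic transition 3 t^2 - 2 t^3 from 0 to 1 on the unit interval, C1 on the line with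
  slope at most 3/2.\<close>

definition sstep :: "real \<Rightarrow> real" where "sstep t = (if t \<ge> 1 then 1 else step0 t)"
definition sstep' :: "real \<Rightarrow> real" where "sstep' t = (if t \<ge> 1 then 0 else step0' t)"

lemma DERIV_step0: "(step0 has_real_derivative step0' t) (at t)"
  unfolding step0_def[abs_def] step0'_def
  by (rule DERIV_piecewise) (auto intro!: derivative_eq_intros simp: power2_eq_square algebra_simps)

lemma DERIV_sstep: "(sstep has_real_derivative sstep' t) (at t)"
proof -
  have 1: "step0 1 = 1" "step0' 1 = 0" by (simp_all add: step0_def step0'_def)
  show ?thesis unfolding sstep_def[abs_def] sstep'_def
    by (rule DERIV_piecewise[where f'="\<lambda>t. 0" and g'=step0']) (simp_all add: DERIV_step0 1)
qed

lemma sstep'_eq: "sstep' t = max 0 (6 * t * (1 - t))"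
proof -
  consider "t < 0" | "0 \<le> t" "t < 1" | "t \<ge> 1" by linarith
  then show ?thesis
  proof cases
    case 1
    have "6 * t * (1 - t) \<le> 0" by (rule mult_nonpos_nonneg) (use 1 in auto)
    then show ?thesis using 1 by (simp add: sstep'_def step0'_def)
  next
    case 2
    then have "6 * t * (1 - t) \<ge> 0" by simp
    then show ?thesis using 2 by (simp add: sstep'_def step0'_def power2_eq_square algebra_simps)
  next
    case 3
    have "6 * t * (1 - t) \<le> 0" by (rule mult_nonneg_nonpos) (use 3 in auto)
    then show ?thesis using 3 by (simp add: sstep'_def)
  qed
qed

lemma continuous_sstep': "continuous_on UNIV sstep'"
  unfolding sstep'_eq[abs_def] by (intro continuous_intros)

lemma sstep'_bounds: "0 \<le> sstep' t" "sstep' t \<le> 3/2"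
proof -
  show "0 \<le> sstep' t" by (simp add: sstep'_eq)
  have "6 * t * (1 - t) \<le> 3/2" using zero_le_power2[of "t - 1/2"] by (simp add: power2_eq_square algebra_simps)
  then show "sstep' t \<le> 3/2" by (simp add: sstep'_eq)
qed

lemma sstep_bounds: "0 \<le> sstep t" "sstep t \<le> 1" "t \<le> 0 \<Longrightarrow> sstep t = 0" "t \<ge> 1 \<Longrightarrow> sstep t = 1"
proof -
  have "0 \<le> step0 t \<and> step0 t \<le> 1" if "t < 1"
  proof (cases "t \<ge> 0")
    case True
    have "3 * t^2 - 2 * t^3 = t^2 * (3 - 2 * t)" "1 - (3 * t^2 - 2 * t^3) = (1 - t)^2 * (1 + 2 * t)"
      by (simp_all add: power2_eq_square power3_eq_cube algebra_simps)
    moreover have "0 \<le> t^2 * (3 - 2 * t)" "0 \<le> (1 - t)^2 * (1 + 2 * t)" using True that by auto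
    ultimately have "0 \<le> 3 * t^2 - 2 * t^3" "3 * t^2 - 2 * t^3 \<le> 1" by linarith+
    then show ?thesis using True unfolding step0_def by simp
  qed (simp add: step0_def)
  then show "0 \<le> sstep t" "sstep t \<le> 1" by (auto simp: sstep_def)
  show "t \<le> 0 \<Longrightarrow> sstep t = 0" "t \<ge> 1 \<Longrightarrow> sstep t = 1" by (auto simp: sstep_def step0_def)
qed

section \<open>Level sets and the partition function for large negative parameters\<close>

lemma measure_om_pos: "measure (leb \<Omega>) \<Omega> > 0"
proof -
  have "(\<integral>x. (1::real) \<partial>leb \<Omega>) > 0" by (rule integral_pos[OF bmeas_const]) auto
  then show ?thesis by (simp add: space_restrict_space)
qed

lemma level_sets: "bmeas f \<Longrightarrow> {x\<in>\<Omega>. f x < c} \<in> sets (leb \<Omega>)"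
  using borel_measurable_less[OF bmeas_measurable[of f] borel_measurable_const[of c]] by (simp add: space_restrict_space pred_def)

text \<open>A function vanishing on the boundary that exceeds \<open>2 a\<close> outside a small set needs a large Dirichlet
  energy on \<open>{a < \<psi> < 2 a}\<close>, whereas for a critical point this energy is at most \<open>a\<close>. Testing with
  \<open>x\<^sub>1 g(\<psi>)\<close>, where \<open>g\<close> is a smooth step from \<open>a\<close> to \<open>2 a\<close>, makes this quantitative.\<close>

lemma small_level_set:
  assumes "a > 0"
  shows "\<exists>\<delta>>0. \<forall>lam \<psi>. critical lam \<psi> \<longrightarrow> measure (leb \<Omega>) {x\<in>\<Omega>. \<psi> x < 2 * a} \<ge> \<delta>"
proof -
  define m where "m = measure (leb \<Omega>) \<Omega>"
  have m: "m > 0" using measure_om_pos by (simp add: m_def)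
  obtain R where R: "\<And>x. x \<in> \<Omega> \<Longrightarrow> norm x \<le> R" using om(2) unfolding bounded_iff by blast
  \<comment> \<open>The weight in Young's inequality R |b| <= \<tau> + R^2 b^2 / (4 \<tau>), chosen
    so that R^2 / (4 \<tau>) is at most \<open>m / 4\<close>.\<close>
  define \<tau> where "\<tau> = (R\<^sup>2 + 1) / m"
  have tau: "\<tau> > 0" using m by (simp add: \<tau>_def add_nonneg_pos)
  \<comment> \<open>An upper bound for \<open>\<tau> * g'\<close>, since the step from
    \<open>a\<close> to \<open>2 * a\<close> has slope at most 3 / (2 a).\<close>
  define k where "k = 3 * \<tau> / (2 * a)"
  have k: "k > 0" using tau assms by (simp add: k_def)
  have "m / (2 * (1 + k)) \<le> measure (leb \<Omega>) {x\<in>\<Omega>. \<psi> x < 2 * a}" if cr: "critical lam \<psi>" for lam \<psi>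
  proof -
    note cf = critical_facts[OF cr]
    define v where "v = gibbs lam \<psi>"
    define u where "u = gpot v"
    have nv: "unit_mass v" using cf(2) by (simp add: v_def)
    then have sv: "regular v" by (simp add: unit_mass_def)
    have ue: "u x = \<psi> x" if "x \<in> closure \<Omega>" for x using cf(4)[OF that] by (simp add: u_def v_def)
    note pf = gpot_facts[OF sv, folded u_def]
    have C2: "Ck 2 \<Omega> u" using pf(1) by (simp add: admissible_def)
    define g where "g s = sstep (s / a - 1)" for s
    define g' where "g' s = sstep' (s / a - 1) * (1 / a)" for s
    have dg: "(g has_real_derivative g' s) (at s)" for s
      unfolding g_def[abs_def] g'_def
      by (rule DERIV_chain2[OF DERIV_sstep]) (use assms in \<open>auto intro!: derivative_eq_intros\<close>)
    have cg': "continuous_on UNIV g'"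
      unfolding g'_def[abs_def] divide_inverse by (intro continuous_intros continuous_on_compose2[OF continuous_sstep']) auto
    have g0: "g s = 0" if "\<bar>s\<bar> \<le> a" for s unfolding g_def by (rule sstep_bounds(3)) (use that assms in \<open>auto simp: field_simps\<close>)
    have g1: "g s = 1" if "s \<ge> 2 * a" for s unfolding g_def by (rule sstep_bounds(4)) (use that assms in \<open>auto simp: field_simps\<close>)
    have gb: "0 \<le> g s" "g s \<le> 1" for s unfolding g_def by (rule sstep_bounds)+
    have g'b: "0 \<le> g' s" "g' s \<le> 3 / (2 * a)" for s
      unfolding g'_def using sstep'_bounds[of "s / a - 1"] assms by (auto simp: field_simps)
    have g'0: "g' s = 0" if "s \<ge> 2 * a" for s
      unfolding g'_def sstep'_def using that assms by (auto simp: field_simps)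
    note ibp = integration_by_parts_cutoff[OF C2 C2 pf(7,9) dg cg' assms g0]
    \<comment> \<open>The right-hand side is the mass of the density: the Laplacian of the solution
      is tested with a function between 0 and 1.\<close>
    have E: "(\<integral>x. g' (u x) * grad_sq u x \<partial>leb \<Omega>) \<le> 1"
    proof -
      have "(\<integral>x. g' (u x) * grad_sq u x \<partial>leb \<Omega>) = (\<integral>x. g (u x) * - laplacian u x \<partial>leb \<Omega>)"
        using ibp(3) by (simp add: grad_dot_self)
      also have "\<dots> = (\<integral>x. g (u x) * dens v x \<partial>leb \<Omega>)" unfolding u_def by (rule ip_laplacian[OF sv])
      also have "\<dots> \<le> (\<integral>x. dens v x \<partial>leb \<Omega>)"
      proof (rule integral_mono)
        have "integrable (leb \<Omega>) (\<lambda>x. g (u x) * - laplacian u x)" by (rule ibp(1))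
        then show "integrable (leb \<Omega>) (\<lambda>x. g (u x) * dens v x)"
          by (rule Bochner_Integration.integrable_cong[THEN iffD1, rotated 2]) (auto simp: space_restrict_space pf(2)[symmetric])
        show "integrable (leb \<Omega>) (dens v)" by (rule bmeas_integrable[OF pf(6)])
        show "g (u x) * dens v x \<le> dens v x" if "x \<in> space (leb \<Omega>)" for x
          using that gb dens_nonneg[of x v] by (intro mult_left_le_one_le) (auto simp: space_restrict_space)
      qed
      also have "\<dots> = 1" using nv by (simp add: unit_mass_def)
      finally show ?thesis .
    qed
    let ?C = "{x\<in>closure \<Omega>. \<bar>u x\<bar> \<ge> a}"
    note C = compact_superlevel[OF pf(7,9) assms]
    have gz: "g (u x) = 0" if "x \<in> \<Omega> - ?C" for x using that g0[of "u x"] in_closure by force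
    have cgu: "continuous_on \<Omega> (\<lambda>x. g (u x))" "continuous_on \<Omega> (\<lambda>x. g' (u x))"
    proof -
      have "continuous_on UNIV g" by (intro continuous_at_imp_continuous_on ballI DERIV_isCont[OF dg])
      then show "continuous_on \<Omega> (\<lambda>x. g (u x))" by (rule continuous_on_compose2) (use Ck2D(1)[OF C2] in auto)
      show "continuous_on \<Omega> (\<lambda>x. g' (u x))" by (rule continuous_on_compose2[OF cg']) (use Ck2D(1)[OF C2] in auto)
    qed
    \<comment> \<open>The derivative of \<open>x $ 1 * g (u x)\<close> in the first coordinate. Its
      zero integral expresses the integral of g(u) through the gradient on the transition
      layer.\<close>
    define Fd where "Fd x = 1 * g (u x) + x $ 1 * (g' (u x) * pd 1 u x)" for x :: pt
    have Fd: "integrable (leb \<Omega>) Fd" "(\<integral>x. Fd x \<partial>leb \<Omega>) = 0"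
    proof -
      have c: "continuous_on \<Omega> (\<lambda>x. x $ 1 * g (u x))" "continuous_on \<Omega> Fd"
        unfolding Fd_def by (intro continuous_intros cgu Ck2D(3)[OF C2])+
      have d: "has_pd 1 (\<lambda>x. x $ 1 * g (u x)) x (Fd x)" if "x \<in> \<Omega>" for x
        using has_pd_mult[OF has_pd_component[of 1 1 x] has_pd_chain[OF dg Ck2D(2)[OF C2 that, of 1]]] by (simp add: Fd_def)
      have z: "x $ 1 * g (u x) = 0" if "x \<in> \<Omega> - ?C" for x using gz[OF that] by simp
      show "integrable (leb \<Omega>) Fd" "(\<integral>x. Fd x \<partial>leb \<Omega>) = 0"
        by (rule integral_pd_zero[OF om(1) C c d z]; assumption)+
    qed
    have okg: "bmeas (\<lambda>x. g (u x))" unfolding bmeas_def bdd_def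
      by (intro exI[of _ 1] conjI ballI borel_measurable_leb cgu) (use gb in \<open>auto simp: abs_le_iff intro: order_trans[of _ 0]\<close>)
    let ?A = "{x\<in>\<Omega>. \<psi> x < 2 * a}"
    have Am: "?A \<in> sets (leb \<Omega>)" by (rule level_sets[OF regular_bmeas[OF cf(1)]])
    interpret finite_measure "leb \<Omega>" by (rule finite_leb_om)
    have iA: "integrable (leb \<Omega>) (indicator ?A :: pt \<Rightarrow> real)" using Am by (intro integrable_real_indicator) (auto simp: less_top[symmetric])
    have intA: "(\<integral>x. indicator ?A x \<partial>leb \<Omega>) = measure (leb \<Omega>) ?A" using Am by simp
    have ie: "integrable (leb \<Omega>) (\<lambda>x. g' (u x) * grad_sq u x)" using ibp(2) by (simp add: grad_dot_self)
    let ?r = "\<lambda>x. k * indicator ?A x + R\<^sup>2 / (4 * \<tau>) * (g' (u x) * grad_sq u x)"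
    have "(\<integral>x. g (u x) \<partial>leb \<Omega>) = (\<integral>x. g (u x) - Fd x \<partial>leb \<Omega>)" using bmeas_integrable[OF okg] Fd by simp
    also have "\<dots> \<le> (\<integral>x. ?r x \<partial>leb \<Omega>)"
    proof (rule integral_mono)
      show "integrable (leb \<Omega>) (\<lambda>x. g (u x) - Fd x)" using bmeas_integrable[OF okg] Fd by simp
      show "integrable (leb \<Omega>) ?r" using iA ie by simp
      fix x assume "x \<in> space (leb \<Omega>)"
      then have x: "x \<in> \<Omega>" by (simp add: space_restrict_space)
      define b where "b = pd 1 u x"
      have x1: "\<bar>x $ 1\<bar> \<le> R" using component_le_norm_cart[of x 1] R[OF x] by linarith
      have "(pd 1 u x)\<^sup>2 \<le> grad_sq u x" unfolding grad_sq_def by (rule member_le_sum) auto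
      then have b2: "b\<^sup>2 \<le> grad_sq u x" by (simp add: b_def)
      have "- (x $ 1 * b) \<le> R * \<bar>b\<bar>"
      proof -
        have "- (x $ 1 * b) \<le> \<bar>x $ 1\<bar> * \<bar>b\<bar>" by (metis abs_ge_minus_self abs_mult)
        also have "\<dots> \<le> R * \<bar>b\<bar>" using x1 by (rule mult_right_mono) simp
        finally show ?thesis .
      qed
      also have "\<dots> \<le> \<tau> + R\<^sup>2 / (4 * \<tau>) * b\<^sup>2"
      proof -
        have "0 \<le> (2 * \<tau> - R * \<bar>b\<bar>)\<^sup>2" by simp
        then have "4 * \<tau> * (R * \<bar>b\<bar>) \<le> 4 * \<tau> * \<tau> + R\<^sup>2 * b\<^sup>2" by (simp add: power2_diff power_mult_distrib power2_eq_square[of \<tau>])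
        then have "R * \<bar>b\<bar> \<le> (4 * \<tau> * \<tau> + R\<^sup>2 * b\<^sup>2) / (4 * \<tau>)" using tau by (simp add: pos_le_divide_eq mult.commute)
        also have "\<dots> = \<tau> + R\<^sup>2 / (4 * \<tau>) * b\<^sup>2" using tau by (simp add: field_simps)
        finally show ?thesis .
      qed
      also have "\<dots> \<le> \<tau> + R\<^sup>2 / (4 * \<tau>) * grad_sq u x" using b2 tau by (intro add_left_mono mult_left_mono) auto
      finally have "g' (u x) * - (x $ 1 * b) \<le> g' (u x) * (\<tau> + R\<^sup>2 / (4 * \<tau>) * grad_sq u x)" using g'b(1) by (rule mult_left_mono)
      moreover have "g' (u x) * \<tau> \<le> k * indicator ?A x"
      proof (cases "\<psi> x < 2 * a")
        case True
        then show ?thesis using x mult_right_mono[OF g'b(2)[of "u x"], of \<tau>] tau by (simp add: k_def mult.commute)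
      next
        case False
        then show ?thesis using g'0[of "u x"] ue[OF in_closure[OF x]] k by simp
      qed
      moreover have "g (u x) - Fd x = g' (u x) * - (x $ 1 * b)" by (simp add: Fd_def b_def mult_ac)
      ultimately show "g (u x) - Fd x \<le> ?r x" by (simp add: algebra_simps)
    qed
    also have "\<dots> = k * measure (leb \<Omega>) ?A + R\<^sup>2 / (4 * \<tau>) * (\<integral>x. g' (u x) * grad_sq u x \<partial>leb \<Omega>)"
      using iA ie intA by simp
    also have "\<dots> \<le> k * measure (leb \<Omega>) ?A + R\<^sup>2 / (4 * \<tau>) * 1" using E tau by (intro add_left_mono mult_left_mono) auto
    also have "R\<^sup>2 / (4 * \<tau>) * 1 \<le> m / 4"
    proof -
      have "R\<^sup>2 / (R\<^sup>2 + 1) \<le> 1" by (simp add: add_nonneg_pos)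
      then have "(m / 4) * (R\<^sup>2 / (R\<^sup>2 + 1)) \<le> m / 4" using m by (intro mult_left_le) auto
      moreover have "R\<^sup>2 / (4 * \<tau>) * 1 = (m / 4) * (R\<^sup>2 / (R\<^sup>2 + 1))" by (simp add: \<tau>_def mult_ac)
      ultimately show ?thesis by simp
    qed
    finally have up: "(\<integral>x. g (u x) \<partial>leb \<Omega>) \<le> k * measure (leb \<Omega>) ?A + m / 4" by simp
    have "m - measure (leb \<Omega>) ?A = (\<integral>x. 1 - indicator ?A x \<partial>leb \<Omega>)"
      using iA intA by (simp add: m_def space_restrict_space)
    also have "\<dots> \<le> (\<integral>x. g (u x) \<partial>leb \<Omega>)"
    proof (rule integral_mono)
      show "integrable (leb \<Omega>) (\<lambda>x. 1 - indicator ?A x :: real)" using iA by simp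
      show "1 - indicator ?A x \<le> g (u x)" if "x \<in> space (leb \<Omega>)" for x
        using that gb(1)[of "u x"] g1[of "u x"] ue[OF in_closure, of x] by (cases "\<psi> x < 2 * a") (auto simp: space_restrict_space)
    qed (rule bmeas_integrable[OF okg])
    \<comment> \<open>The estimates give 3 m / 4; one half is enough.\<close>
    finally have "m / 2 \<le> (1 + k) * measure (leb \<Omega>) ?A" using up m by (simp add: algebra_simps)
    then show ?thesis using k by (simp add: field_simps)
  qed
  moreover have "m / (2 * (1 + k)) > 0" using m k by simp
  ultimately show ?thesis by blast
qed

text \<open>The sublevel sets decrease to a set contained in \<open>P\<close>, which is null, and
  measures converge along a decreasing sequence.\<close>

lemma h_small_set: assumes "\<delta> > 0" shows "\<exists>\<kappa>>0. measure (leb \<Omega>) {x\<in>\<Omega>. h x < \<kappa>} < \<delta>"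
proof -
  interpret finite_measure "leb \<Omega>" by (rule finite_leb_om)
  define A where "A n = {x\<in>\<Omega>. h x < inverse (real (Suc n))}" for n
  have Am: "A n \<in> sets (leb \<Omega>)" for n unfolding A_def by (rule level_sets[OF bmeas_cont[OF h_cont]])
  have "decseq A" unfolding decseq_def A_def by (force intro: less_le_trans le_imp_inverse_le)
  then have lim: "(\<lambda>n. measure (leb \<Omega>) (A n)) \<longlonglongrightarrow> measure (leb \<Omega>) (\<Inter>n. A n)"
    using Am by (intro finite_Lim_measure_decseq) auto
  have "AE x in leb \<Omega>. x \<notin> (\<Inter>n. A n)"
    using AE_notin_P AE_space
  proof eventually_elim
    case (elim x)
    then have "h x > 0" using h_pos by (simp add: space_restrict_space)
    then obtain n where "inverse (real (Suc n)) < h x" using reals_Archimedean by blast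
    then have "x \<notin> A n" by (simp add: A_def)
    then show ?case by blast
  qed
  then have "(\<Inter>n. A n) \<in> null_sets (leb \<Omega>)" using AE_iff_null_sets[of "\<Inter>n. A n" "leb \<Omega>"] Am by auto
  then have "measure (leb \<Omega>) (\<Inter>n. A n) = 0" by (rule measure_eq_0_null_sets)
  then have "\<forall>\<^sub>F n in sequentially. measure (leb \<Omega>) (A n) < \<delta>" using order_tendstoD(2)[OF lim] assms by simp
  then obtain n where "measure (leb \<Omega>) (A n) < \<delta>" unfolding eventually_sequentially by blast
  then show ?thesis unfolding A_def by (intro exI[of _ "inverse (real (Suc n))"]) simp
qed

text \<open>At a critical point t times the doubled energy is \<open>- Ent - ln Z\<close>, and the
  entropy is bounded below. It remains to bound Z below, by integrating only over points where the
  solution is below \<open>2 * a\<close> and \<open>h\<close> is at least \<open>\<kappa>\<close>, a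
  set of measure at least \<open>\<delta> / 2\<close>.\<close>

lemma energy_upper:
  assumes "a > 0"
  shows "\<exists>C. \<forall>t \<psi>. 0 < t \<longrightarrow> critical (- t) \<psi> \<longrightarrow> t * ip (gibbs (- t) \<psi>) (gibbs (- t) \<psi>) \<le> C + 2 * a * t"
proof -
  interpret finite_measure "leb \<Omega>" by (rule finite_leb_om)
  obtain \<delta> where d: "\<delta> > 0" "\<forall>lam \<psi>. critical lam \<psi> \<longrightarrow> measure (leb \<Omega>) {x\<in>\<Omega>. \<psi> x < 2 * a} \<ge> \<delta>"
    using small_level_set[OF assms] by blast
  obtain \<kappa> where k: "\<kappa> > 0" "measure (leb \<Omega>) {x\<in>\<Omega>. h x < \<kappa>} < \<delta> / 2" using h_small_set[of "\<delta> / 2"] d(1) by auto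
  have "t * ip (gibbs (- t) \<psi>) (gibbs (- t) \<psi>) \<le> (h_mass - 1 - ln (\<kappa> * (\<delta> / 2))) + 2 * a * t" if t: "0 < t" and cr: "critical (- t) \<psi>" for t \<psi>
  proof -
    note cf = critical_facts[OF cr]
    let ?A = "{x\<in>\<Omega>. \<psi> x < 2 * a}" and ?B = "{x\<in>\<Omega>. h x < \<kappa>}"
    have m: "?A \<in> sets (leb \<Omega>)" "?B \<in> sets (leb \<Omega>)" by (intro level_sets regular_bmeas cf bmeas_cont h_cont)+
    have "measure (leb \<Omega>) ?A \<le> measure (leb \<Omega>) (?A - ?B) + measure (leb \<Omega>) ?B"
    proof -
      have "measure (leb \<Omega>) ?A \<le> measure (leb \<Omega>) ((?A - ?B) \<union> ?B)" by (rule finite_measure_mono) (use m in auto)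
      also have "\<dots> \<le> measure (leb \<Omega>) (?A - ?B) + measure (leb \<Omega>) ?B" by (rule measure_Un_le) (use m in auto)
      finally show ?thesis .
    qed
    moreover have "\<delta> \<le> measure (leb \<Omega>) ?A" using d(2) cr by blast
    ultimately have S: "measure (leb \<Omega>) (?A - ?B) \<ge> \<delta> / 2" using k(2) by linarith
    have mS: "?A - ?B \<in> sets (leb \<Omega>)" using m by blast
    let ?c = "\<kappa> * exp (- (2 * a * t))"
    have "?c * (\<delta> / 2) \<le> ?c * measure (leb \<Omega>) (?A - ?B)" using S k(1) by (intro mult_left_mono) auto
    also have "\<dots> = (\<integral>x. ?c * indicator (?A - ?B) x \<partial>leb \<Omega>)" using mS by simp
    also have "\<dots> \<le> Z (- t) \<psi>" unfolding Z_def
    proof (rule integral_mono)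
      show "integrable (leb \<Omega>) (\<lambda>x. ?c * indicator (?A - ?B) x :: real)"
        using mS by (intro integrable_mult_right integrable_real_indicator) (auto simp: less_top[symmetric])
      show "integrable (leb \<Omega>) (dens (\<lambda>x. - t * \<psi> x))" by (intro bmeas_integrable dens_bmeas continuous_intros cf)
      fix x assume "x \<in> space (leb \<Omega>)"
      then have x: "x \<in> \<Omega>" by (simp add: space_restrict_space)
      show "?c * indicator (?A - ?B) x \<le> dens (\<lambda>x. - t * \<psi> x) x"
      proof (cases "x \<in> ?A - ?B")
        case True
        then have "\<kappa> \<le> h x" "t * \<psi> x \<le> t * (2 * a)" using t by auto
        then have "\<kappa> * exp (- (2 * a * t)) \<le> h x * exp (- t * \<psi> x)" using k(1) by (intro mult_mono) (auto simp: mult_ac)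
        then show ?thesis using True by (simp add: dens_def)
      next
        case False
        then have "indicator (?A - ?B) x = (0::real)" by (simp add: indicator_def)
        then show ?thesis using dens_nonneg[OF x] by simp
      qed
    qed
    finally have "ln (?c * (\<delta> / 2)) \<le> ln (Z (- t) \<psi>)" using k(1) d(1) by (intro ln_mono) auto
    moreover have "ln (?c * (\<delta> / 2)) = ln (\<kappa> * (\<delta> / 2)) - 2 * a * t"
    proof -
      have "?c * (\<delta> / 2) = (\<kappa> * (\<delta> / 2)) * exp (- (2 * a * t))" by simp
      then show ?thesis using k(1) d(1) by (simp only: ln_mult_pos[of "\<kappa> * (\<delta> / 2)" "exp (- (2 * a * t))"] mult_pos_pos half_gt_zero exp_gt_zero ln_exp)
    qed
    moreover have "Ent (gibbs (- t) \<psi>) = - t * ip (gibbs (- t) \<psi>) (gibbs (- t) \<psi>) - ln (Z (- t) \<psi>)" by (rule critical_Ent[OF cr])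
    moreover have "Ent (gibbs (- t) \<psi>) \<ge> 1 - h_mass" by (rule Ent_ge[OF cf(2)])
    ultimately show ?thesis by simp
  qed
  then show ?thesis by blast
qed

end

subsection \<open>The energy along the branch of solutions\<close>

text \<open>Existence, uniqueness and the absence of a solution at the end point, all in the
  fixed-point form.\<close>

locale first_kind = mean_field +
  fixes \<psi> :: "real \<Rightarrow> pt \<Rightarrow> real"
  assumes sol: "\<And>lam. lam < 8 * pi \<Longrightarrow> critical lam (\<psi> lam)"
    and uniq: "\<And>lam \<phi> x. lam < 8 * pi \<Longrightarrow> critical lam \<phi> \<Longrightarrow> x \<in> closure \<Omega> \<Longrightarrow> \<phi> x = \<psi> lam x"
    and nosol: "\<And>\<phi>. \<not> critical (8 * pi) \<phi>"
begin

definition V :: "real \<Rightarrow> pt \<Rightarrow> real" where "V lam = gibbs lam (\<psi> lam)"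
definition En :: "real \<Rightarrow> real" where "En lam = 1 / 2 * ip (V lam) (V lam)"

lemma V_unit_mass: "lam < 8 * pi \<Longrightarrow> unit_mass (V lam)" "lam < 8 * pi \<Longrightarrow> regular (V lam)"
  using critical_facts(2)[OF sol] by (auto simp: V_def unit_mass_def)

lemma V_fixed: "lam < 8 * pi \<Longrightarrow> x \<in> closure \<Omega> \<Longrightarrow> V lam x = lam * gpot (V lam) x - ln (Z lam (\<psi> lam))"
  "lam < 8 * pi \<Longrightarrow> x \<in> closure \<Omega> \<Longrightarrow> gpot (V lam) x = \<psi> lam x"
  using critical_facts(3,4)[OF sol] by (auto simp: V_def)

text \<open>For positive parameters descent from any competitor ends at a critical point, which
  uniqueness identifies. For the others the fixed-point identity is a sum of nonnegative
  terms.\<close>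

lemma F_min: assumes "lam < 8 * pi" "unit_mass w" shows "F lam (V lam) \<le> F lam w"
proof (cases "lam > 0")
  case True
  obtain \<phi> where p: "critical lam \<phi>" "F lam (gibbs lam \<phi>) \<le> F lam w" using descent[OF True assms] by blast
  have "F lam (gibbs lam \<phi>) = F lam (V lam)" unfolding V_def
    by (rule functional_cong(1), rule gibbs_cong) (use uniq[OF assms(1) p(1)] in_closure in auto)
  then show ?thesis using p(2) by simp
next
  case False
  have "F lam w - F lam (V lam) = KL w (V lam) - lam / 2 * (ip w w - 2 * ip w (V lam) + ip (V lam) (V lam))"
    by (rule F_fixed[OF assms(2) V_unit_mass(1)[OF assms(1)] V_fixed(1)[OF assms(1) in_closure]])
  moreover have "lam / 2 * (ip w w - 2 * ip w (V lam) + ip (V lam) (V lam)) \<le> 0"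
    using False ip_diff_nonneg[of w "V lam"] V_unit_mass[OF assms(1)] assms(2) by (intro mult_nonpos_nonneg) (auto simp: unit_mass_def)
  ultimately show ?thesis using KL_nonneg(1)[OF assms(2) V_unit_mass(1)[OF assms(1)]] by linarith
qed

lemma frontier_nonempty: "frontier \<Omega> \<noteq> {}"
  using om not_bounded_UNIV by (auto simp: frontier_eq_empty)

text \<open>On the boundary the solution vanishes, so the constants agree; inside it is positive, so
  the factors do.\<close>

lemma multiples_distinct:
  assumes "mu < 8 * pi" "\<And>x. x \<in> closure \<Omega> \<Longrightarrow> a * \<psi> mu x - c = b * \<psi> mu x - d"
  shows "a = b"
proof -
  obtain z where z: "z \<in> frontier \<Omega>" using frontier_nonempty by blast
  have "c = d" using assms(2)[OF frontier_in_closure[OF z]] critical_facts(7)[OF sol[OF assms(1)] z] by simp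
  moreover obtain x where "x \<in> \<Omega>" using om(3) by blast
  ultimately show ?thesis using assms(2)[OF in_closure] critical_facts(5)[OF sol[OF assms(1)]] by force
qed

text \<open>Equality would make a relative entropy vanish, and then one solution would satisfy the
  relation of two parameters at once, against \<open>multiples_distinct\<close>. For positive
  \<open>lam\<close> strictness arises in the first descent step from \<open>V mu\<close>, for the
  others from comparison with the minimiser.\<close>

lemma F_strict: assumes "lam < 8 * pi" "mu < 8 * pi" "lam \<noteq> mu" shows "F lam (V lam) < F lam (V mu)"
proof (cases "lam > 0")
  case True
  define w where "w = gibbs lam (gpot (V mu))"
  have nw: "unit_mass w" unfolding w_def by (intro gibbs_unit_mass gpot_facts(4) V_unit_mass(2) assms)
  then have sw: "regular w" by (simp add: unit_mass_def)
  have "F lam (V mu) - F lam w = KL (V mu) w + lam / 2 * (ip (V mu) (V mu) - 2 * ip (V mu) w + ip w w)"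
    by (rule F_step[OF V_unit_mass(1)[OF assms(2)] nw, where c="ln (Z lam (gpot (V mu)))"]) (simp add: w_def gibbs_def)
  moreover have "lam / 2 * (ip (V mu) (V mu) - 2 * ip (V mu) w + ip w w) \<ge> 0"
    using True ip_diff_nonneg[OF V_unit_mass(2)[OF assms(2)] sw] by simp
  moreover have "KL (V mu) w \<noteq> 0"
  proof
    assume "KL (V mu) w = 0"
    then have "V mu x = w x" if "x \<in> closure \<Omega>" for x using KL_nonneg(2)[OF V_unit_mass(1)[OF assms(2)] nw] that by blast
    then have "mu * \<psi> mu x - ln (Z mu (\<psi> mu)) = lam * \<psi> mu x - ln (Z lam (gpot (V mu)))" if "x \<in> closure \<Omega>" for x
      using V_fixed[OF assms(2) that] that by (simp add: w_def gibbs_def)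
    then show False using multiples_distinct[OF assms(2)] assms(3) by blast
  qed
  ultimately show ?thesis using KL_nonneg(1)[OF V_unit_mass(1)[OF assms(2)] nw] F_min[OF assms(1) nw] by linarith
next
  case False
  have "F lam (V mu) - F lam (V lam) = KL (V mu) (V lam) - lam / 2 * (ip (V mu) (V mu) - 2 * ip (V mu) (V lam) + ip (V lam) (V lam))"
    by (rule F_fixed[OF V_unit_mass(1)[OF assms(2)] V_unit_mass(1)[OF assms(1)] V_fixed(1)[OF assms(1) in_closure]])
  moreover have "lam / 2 * (ip (V mu) (V mu) - 2 * ip (V mu) (V lam) + ip (V lam) (V lam)) \<le> 0"
    using False ip_diff_nonneg[OF V_unit_mass(2)[OF assms(2)] V_unit_mass(2)[OF assms(1)]] by (intro mult_nonpos_nonneg) auto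
  moreover have "KL (V mu) (V lam) \<noteq> 0"
  proof
    assume "KL (V mu) (V lam) = 0"
    then have eq: "V mu x = V lam x" if "x \<in> closure \<Omega>" for x
      using KL_nonneg(2)[OF V_unit_mass(1)[OF assms(2)] V_unit_mass(1)[OF assms(1)]] that by blast
    have pe: "gpot (V mu) x = gpot (V lam) x" for x by (rule gpot_cong) (use eq in_closure in blast)
    have "mu * \<psi> mu x - ln (Z mu (\<psi> mu)) = lam * \<psi> mu x - ln (Z lam (\<psi> lam))" if "x \<in> closure \<Omega>" for x
      using V_fixed[OF assms(2) that] V_fixed[OF assms(1) that] eq[OF that] pe by metis
    then show False using multiples_distinct[OF assms(2)] assms(3) by blast
  qed
  ultimately show ?thesis using KL_nonneg(1)[OF V_unit_mass(1)[OF assms(2)] V_unit_mass(1)[OF assms(1)]] by linarith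
qed

lemma En_strict_mono: assumes "lam < mu" "mu < 8 * pi" shows "En lam < En mu"
proof -
  have l: "lam < 8 * pi" using assms by linarith
  have "F lam (V lam) + F mu (V mu) < F lam (V mu) + F mu (V lam)"
    using F_strict[OF l assms(2)] F_strict[OF assms(2) l] assms(1) by (intro add_strict_mono) auto
  then have "(mu - lam) * (ip (V mu) (V mu) - ip (V lam) (V lam)) > 0" unfolding F_def by (simp add: algebra_simps)
  then have "ip (V lam) (V lam) < ip (V mu) (V mu)" using assms(1) by (simp add: zero_less_mult_iff)
  then show ?thesis by (simp add: En_def)
qed

text \<open>Bounded energy bounds the densities, so a subsequence converges to a critical point at
  \<open>l\<close>. There is none at \<open>8 * pi\<close>, which gives the first claim; for smaller
  \<open>l\<close> uniqueness identifies the limit.\<close>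

lemma En_compact:
  assumes lam: "\<And>n. lam n < 8 * pi" "lam \<longlonglongrightarrow> l" and A: "\<And>n. En (lam n) \<le> A"
  shows "l < 8 * pi" "\<exists>k. strict_mono (k :: nat \<Rightarrow> nat) \<and> (\<lambda>n. En (lam (k n))) \<longlonglongrightarrow> En l"
proof -
  obtain T where T: "\<And>n. norm (lam n) \<le> T" using convergent_imp_Bseq[OF convergentI[OF lam(2)]] unfolding Bseq_def by blast
  have T0: "T \<ge> 0" using order_trans[OF norm_ge_zero T] .
  obtain B where B: "\<forall>lam \<psi>. critical lam \<psi> \<longrightarrow> - T \<le> lam \<longrightarrow> lam \<le> 8 * pi \<longrightarrow> ip (gibbs lam \<psi>) (gibbs lam \<psi>) \<le> 2 * A \<longrightarrow> bdd (dens (gibbs lam \<psi>)) B"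
    using critical_dens_bdd[OF T0] by blast
  have bd: "bdd (dens (gibbs (lam n) (\<psi> (lam n)))) B" for n
  proof -
    have "- T \<le> lam n" using T[of n] by (simp add: abs_le_iff)
    moreover have "ip (gibbs (lam n) (\<psi> (lam n))) (gibbs (lam n) (\<psi> (lam n))) \<le> 2 * A" using A[of n] by (simp add: En_def V_def)
    ultimately show ?thesis using B sol[OF lam(1)] less_imp_le[OF lam(1)] by blast
  qed
  obtain \<phi> k where k: "strict_mono (k :: nat \<Rightarrow> nat)" and cr: "critical l \<phi>"
    and lim: "(\<lambda>n. ip (gibbs (lam (k n)) (\<psi> (lam (k n)))) (gibbs (lam (k n)) (\<psi> (lam (k n))))) \<longlonglongrightarrow> ip (gibbs l \<phi>) (gibbs l \<phi>)"
    by (rule critical_compact[OF sol[OF lam(1)] lam(2) bd])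
  have "l \<le> 8 * pi" by (rule LIMSEQ_le_const2[OF lam(2)]) (use lam(1) less_imp_le in blast)
  moreover have "l \<noteq> 8 * pi" using cr nosol by blast
  ultimately show l: "l < 8 * pi" by simp
  have "ip (gibbs l \<phi>) (gibbs l \<phi>) = ip (V l) (V l)" unfolding V_def
    by (rule functional_cong(2), rule gibbs_cong) (use uniq[OF l cr] in_closure in auto)
  then have "(\<lambda>n. En (lam (k n))) \<longlonglongrightarrow> En l" unfolding En_def V_def using tendsto_mult_left[OF lim, of "1 / 2"] by simp
  then show "\<exists>k. strict_mono (k :: nat \<Rightarrow> nat) \<and> (\<lambda>n. En (lam (k n))) \<longlonglongrightarrow> En l" using k by blast
qed

text \<open>Every subsequence has a further subsequence along which the energies converge to the
  right value.\<close>

lemma En_continuous: "continuous_on {..<8 * pi} En"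
  unfolding continuous_on_sequentially
proof (intro allI ballI impI, elim conjE)
  fix X l assume X: "\<forall>n. X n \<in> {..<8 * pi}" and l: "l \<in> {..<8 * pi}" and lim: "X \<longlonglongrightarrow> l"
  \<comment> \<open>A parameter beyond \<open>l\<close>; by monotonicity its energy bounds the
    energies of all nearby parameters.\<close>
  define b where "b = (l + 8 * pi) / 2"
  have b: "l < b" "b < 8 * pi" using l by (auto simp: b_def)
  obtain N where N: "\<And>n. n \<ge> N \<Longrightarrow> X n < b" using order_tendstoD(2)[OF lim b(1)] unfolding eventually_sequentially by blast
  have "(\<lambda>n. En (X (n + N))) \<longlonglongrightarrow> En l"
  proof (rule ccontr)
    assume "\<not> ?thesis"
    then obtain e where e: "e > 0" "\<forall>M. \<exists>n\<ge>M. \<not> \<bar>En (X (n + N)) - En l\<bar> < e" unfolding LIMSEQ_iff by auto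
    have "infinite {n. \<not> \<bar>En (X (n + N)) - En l\<bar> < e}" unfolding infinite_nat_iff_unbounded_le using e(2) by blast
    from infinite_enumerate[OF this] obtain r :: "nat \<Rightarrow> nat" where r: "strict_mono r" "\<forall>n. \<not> \<bar>En (X (r n + N)) - En l\<bar> < e" by auto
    let ?Y = "\<lambda>n. X (r n + N)"
    have "(\<lambda>n. X (n + N)) \<longlonglongrightarrow> l" by (rule LIMSEQ_ignore_initial_segment[OF lim])
    from LIMSEQ_subseq_LIMSEQ[OF this r(1)] have Y: "?Y \<longlonglongrightarrow> l" by (simp add: o_def)
    have "En (?Y n) \<le> En b" for n using En_strict_mono[OF N b(2), of "r n + N"] by simp
    then obtain k where "strict_mono (k :: nat \<Rightarrow> nat)" "(\<lambda>n. En (?Y (k n))) \<longlonglongrightarrow> En l"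
      using En_compact(2)[of ?Y l "En b"] X Y by auto
    from LIMSEQ_D[OF this(2) e(1)] obtain n where "norm (En (?Y (k n)) - En l) < e" by blast
    then show False using r(2) by simp
  qed
  then show "(En \<circ> X) \<longlonglongrightarrow> En l" unfolding o_def by (rule LIMSEQ_offset)
qed

lemma En_at_top: "filterlim En at_top (at_left (8 * pi))"
  unfolding filterlim_at_top
proof
  fix A
  have "\<exists>l<8 * pi. A \<le> En l"
  proof (rule ccontr)
    assume "\<not> ?thesis"
    then have le: "En l \<le> A" if "l < 8 * pi" for l using that by force
    have "(\<lambda>n. 8 * pi - inverse (real (Suc n))) \<longlonglongrightarrow> 8 * pi - 0" by (intro tendsto_diff tendsto_const LIMSEQ_inverse_real_of_nat)
    then have lim: "(\<lambda>n. 8 * pi - inverse (real (Suc n))) \<longlonglongrightarrow> 8 * pi" by simp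
    have "8 * pi < 8 * pi" by (rule En_compact(1)[OF _ lim, of A]) (use le in auto)
    then show False by simp
  qed
  then obtain l where l: "l < 8 * pi" "A \<le> En l" by blast
  have "\<forall>\<^sub>F x in at_left (8 * pi). x \<in> {l<..<8 * pi}" using l(1) by (intro eventually_at_left_real)
  then show "\<forall>\<^sub>F x in at_left (8 * pi). A \<le> En x"
    by eventually_elim (use l En_strict_mono in \<open>force\<close>)
qed

lemma En_at_bot: "(En \<longlongrightarrow> 0) at_bot"
proof (rule tendstoI)
  fix e :: real assume "e > 0"
  define a where "a = e / 2"
  obtain C where C: "\<forall>t \<psi>. 0 < t \<longrightarrow> critical (- t) \<psi> \<longrightarrow> t * ip (gibbs (- t) \<psi>) (gibbs (- t) \<psi>) \<le> C + 2 * a * t"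
    using energy_upper[of a] \<open>e > 0\<close> by (auto simp: a_def)
  \<comment> \<open>Beyond \<open>t0\<close> the constant satisfies \<open>C < e * t\<close>;
    together with \<open>2 * a * t = e * t\<close> the doubled energy drops below
    \<open>2 * e\<close>.\<close>
  define t0 where "t0 = \<bar>C\<bar> / e + 1"
  have t0: "t0 > 0" using \<open>e > 0\<close> by (simp add: t0_def add_nonneg_pos)
  have "\<forall>\<^sub>F x in at_bot. x \<le> - t0" by (rule eventually_le_at_bot)
  then show "\<forall>\<^sub>F x in at_bot. dist (En x) 0 < e"
  proof eventually_elim
    case (elim x)
    define t where "t = - x"
    have t: "t \<ge> t0" "t > 0" using elim t0 by (auto simp: t_def)
    have x8: "x < 8 * pi" using t pi_gt_zero unfolding t_def by linarith
    have "x = - t" by (simp add: t_def)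
    then have "critical (- t) (\<psi> x)" using sol[OF x8] by simp
    with C t(2) have "t * ip (gibbs (- t) (\<psi> x)) (gibbs (- t) (\<psi> x)) \<le> C + 2 * a * t" by blast
    then have "t * ip (V x) (V x) \<le> C + 2 * a * t" unfolding V_def \<open>x = - t\<close> by simp
    also have "\<dots> < e * t + e * t"
    proof (rule add_less_le_mono)
      have "\<bar>C\<bar> < e * t0" using \<open>e > 0\<close> by (simp add: t0_def field_simps)
      also have "\<dots> \<le> e * t" using t(1) \<open>e > 0\<close> by simp
      finally show "C < e * t" by simp
    qed (simp add: a_def)
    finally have "t * ip (V x) (V x) < t * (2 * e)" by (simp add: algebra_simps)
    then have "ip (V x) (V x) < 2 * e" using t(2) by simp
    then show "dist (En x) 0 < e" using ip_nonneg[OF V_unit_mass(2)[OF x8]] by (simp add: En_def dist_real_def)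
  qed
qed

text \<open>Positivity follows from strict monotonicity over a nonnegative function; surjectivity is
  the intermediate value theorem between the two limits.\<close>

lemma En_bij: "bij_betw En {..<8 * pi} {0<..}"
proof -
  have inj: "inj_on En {..<8 * pi}"
    by (rule inj_onI) (metis En_strict_mono lessThan_iff less_irrefl linorder_neqE_linordered_idom)
  have pos: "En l > 0" if "l < 8 * pi" for l
  proof -
    have "En (l - 1) < En l" using En_strict_mono[of "l - 1" l] that by simp
    moreover have "En (l - 1) \<ge> 0" using ip_nonneg[OF V_unit_mass(2), of "l - 1"] that by (simp add: En_def)
    ultimately show ?thesis by linarith
  qed
  have "y \<in> En ` {..<8 * pi}" if "y > 0" for y
  proof -
    have "\<forall>\<^sub>F x in at_bot. En x < y" using order_tendstoD(2)[OF En_at_bot that] .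
    then obtain N1 where N1: "\<And>x. x \<le> N1 \<Longrightarrow> En x < y" unfolding eventually_at_bot_linorder by blast
    define a where "a = min N1 0"
    have a: "En a < y" "a < 8 * pi" using N1[of a] by (auto simp: a_def min_less_iff_disj)
    have "\<forall>\<^sub>F x in at_left (8 * pi). y \<le> En x" using En_at_top unfolding filterlim_at_top by blast
    then obtain b0 where b0: "b0 < 8 * pi" "\<And>x. b0 < x \<Longrightarrow> x < 8 * pi \<Longrightarrow> y \<le> En x"
      using eventually_at_left[of 0 "8 * pi"] by auto
    define b where "b = (max a b0 + 8 * pi) / 2"
    have b: "a \<le> b" "b0 < b" "b < 8 * pi" using a b0 by (auto simp: b_def max_def)
    have "\<exists>x\<ge>a. x \<le> b \<and> En x = y"
      by (rule IVT'[of En a y b]) (use a b b0 in \<open>auto intro!: continuous_on_subset[OF En_continuous]\<close>)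
    then show ?thesis using b by auto
  qed
  then show ?thesis unfolding bij_betw_def using inj pos by auto
qed

end

subsection \<open>Solutions of the mean field equation as critical points\<close>

lemma leb_integral_eq:
  fixes f :: "pt \<Rightarrow> real"
  assumes "open \<Omega>" "integrable (leb \<Omega>) f"
  shows "f integrable_on \<Omega>" "integral \<Omega> f = (\<integral>x. f x \<partial>leb \<Omega>)"
proof -
  have m: "\<Omega> \<inter> space lborel \<in> sets lborel" using assms(1) by simp
  have s: "set_integrable lborel \<Omega> f"
    using assms(2) unfolding integrable_restrict_space[OF m] set_integrable_def .
  show "f integrable_on \<Omega>" by (rule set_borel_integral_eq_integral(1)[OF s])
  show "integral \<Omega> f = (\<integral>x. f x \<partial>leb \<Omega>)"
    unfolding set_borel_integral_eq_integral(2)[OF s, symmetric] integral_restrict_space[OF m] set_lebesgue_integral_def ..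
qed

context mean_field
begin

lemma Z_integral:
  assumes "continuous_on (closure \<Omega>) \<phi>"
  shows "(\<lambda>x. h x * exp (lam * \<phi> x)) integrable_on \<Omega>" "integral \<Omega> (\<lambda>x. h x * exp (lam * \<phi> x)) = Z lam \<phi>"
proof -
  have "integrable (leb \<Omega>) (dens (\<lambda>x. lam * \<phi> x))" by (intro bmeas_integrable dens_bmeas continuous_intros assms)
  then have i: "integrable (leb \<Omega>) (\<lambda>x. h x * exp (lam * \<phi> x))" by (simp add: dens_def[abs_def])
  show "(\<lambda>x. h x * exp (lam * \<phi> x)) integrable_on \<Omega>" by (rule leb_integral_eq(1)[OF om(1) i])
  show "integral \<Omega> (\<lambda>x. h x * exp (lam * \<phi> x)) = Z lam \<phi>" unfolding leb_integral_eq(2)[OF om(1) i] Z_def dens_def ..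
qed

text \<open>A solution is C2, so its right-hand side is Hoelder continuous, and uniqueness for the
  Poisson problem identifies it with the potential of its density.\<close>

lemma sol_imp_critical: assumes "mean_field_sol \<Omega> h lam u" shows "critical lam u"
proof -
  have u: "Ck 2 \<Omega> u" "continuous_on (closure \<Omega>) u" "\<And>z. z \<in> frontier \<Omega> \<Longrightarrow> u z = 0"
    and eq: "\<And>x. x \<in> \<Omega> \<Longrightarrow> - laplacian u x = h x * exp (lam * u x) / integral \<Omega> (\<lambda>y. h y * exp (lam * u y))"
    using assms by (auto simp: mean_field_sol_def)
  have "loc_holder \<Omega> u" by (rule C1_loc_holder[OF om(1) Ck2D(2,3)[OF u(1)]])
  then have s: "regular u" using u(2) by (simp add: regular_def)
  have e: "- laplacian u x = dens (gibbs lam u) x" if "x \<in> \<Omega>" for x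
    unfolding eq[OF that] Z_integral(2)[OF u(2)] dens_gibbs(1)[OF u(2)] by (simp add: dens_def)
  obtain B where B: "bdd (dens (gibbs lam u)) B" using dens_bmeas[OF gibbs_cont[OF u(2)]] bmeas_def by blast
  show ?thesis unfolding critical_def gpot_def
    using pot_unique[OF B dens_holder[OF gibbs_regular[OF s]] u e] u(2) by blast
qed

text \<open>Stated for the potential, which agrees with \<open>u\<close> on the closed domain and
  whose C2 regularity is already available.\<close>

lemma critical_imp_sol: assumes "critical lam u" shows "mean_field_sol \<Omega> h lam (gpot (gibbs lam u))"
proof -
  note cf = critical_facts[OF assms]
  let ?u = "gpot (gibbs lam u)"
  have sv: "regular (gibbs lam u)" using cf(2) by (simp add: unit_mass_def)
  note pf = gpot_facts[OF sv]
  have eq: "?u x = u x" if "x \<in> \<Omega>" for x using cf(4)[OF in_closure[OF that]] by simp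
  have Z: "Z lam ?u = Z lam u" unfolding Z_def
    by (rule Bochner_Integration.integral_cong) (auto simp: dens_def space_restrict_space eq)
  show ?thesis unfolding mean_field_sol_def Z_integral(2)[OF pf(7)] Z
  proof (intro conjI ballI)
    show "Ck 2 \<Omega> ?u" using pf(1) by (simp add: admissible_def)
    show "continuous_on (closure \<Omega>) ?u" by (rule pf(7))
    show "?u x = 0" if "x \<in> frontier \<Omega>" for x by (rule pf(9)[OF that])
    show "(\<lambda>x. h x * exp (lam * ?u x)) integrable_on \<Omega>" by (rule Z_integral(1)[OF pf(7)])
    show "- laplacian ?u x = h x * exp (lam * ?u x) / Z lam u" if "x \<in> \<Omega>" for x
      unfolding pf(2)[OF that] dens_gibbs(1)[OF cf(8)] by (simp add: dens_def eq[OF that])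
  qed
qed

lemma critical_energy: assumes "mean_field_sol \<Omega> h lam u"
  shows "integral \<Omega> (grad_sq u) = ip (gibbs lam u) (gibbs lam u)"
proof -
  have cr: "critical lam u" by (rule sol_imp_critical[OF assms])
  note cf = critical_facts[OF cr]
  have sv: "regular (gibbs lam u)" using cf(2) by (simp add: unit_mass_def)
  have "grad_sq u x = grad_sq (gpot (gibbs lam u)) x" if "x \<in> \<Omega>" for x
    unfolding grad_sq_def using pd_cong_open[OF om(1) that, of u "gpot (gibbs lam u)"] cf(4)[OF in_closure] by simp
  then have "integral \<Omega> (grad_sq u) = integral \<Omega> (grad_sq (gpot (gibbs lam u)))" by (rule integral_cong)
  also have "\<dots> = ip (gibbs lam u) (gibbs lam u)"
    unfolding leb_integral_eq(2)[OF om(1) grad_energy(1)[OF sv]] by (rule grad_energy(2)[OF sv])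
  finally show ?thesis .
qed

end

text \<open>The factor -4 \<pi> \<alpha> turns the logarithmic singularity into the power 2
  \<alpha>. The product extends this to the poles: there \<open>0 powr\<close> gives 0, the value
  prescribed by \<open>weight\<close>.\<close>

lemma weight_eq:
  assumes H: "\<And>j x. j < n \<Longrightarrow> x \<in> S \<Longrightarrow> x \<noteq> p j \<Longrightarrow> G (p j) x = - (1 / (2 * pi)) * ln (norm (x - p j)) + H (p j) x"
    and "x \<in> S"
  shows "weight G n p \<alpha> x = (\<Prod>j<n. norm (x - p j) powr (2 * \<alpha> j) * exp (- 4 * pi * \<alpha> j * H (p j) x))"
proof (cases "x \<in> p ` {..<n}")
  case True
  then obtain j where "j < n" "x = p j" by auto
  then have "(\<Prod>j<n. norm (x - p j) powr (2 * \<alpha> j) * exp (- 4 * pi * \<alpha> j * H (p j) x)) = 0" by (intro prod_zero) auto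
  then show ?thesis using True by (simp add: weight_def)
next
  case False
  have "- 4 * pi * (\<Sum>j<n. \<alpha> j * G (p j) x) = (\<Sum>j<n. 2 * \<alpha> j * ln (norm (x - p j)) + - 4 * pi * \<alpha> j * H (p j) x)"
    unfolding sum_distrib_left
  proof (rule sum.cong)
    fix j assume j: "j \<in> {..<n}"
    then have "x \<noteq> p j" using False by auto
    then have "G (p j) x = - (1 / (2 * pi)) * ln (norm (x - p j)) + H (p j) x" using H j assms(2) by simp
    from this show "- 4 * pi * (\<alpha> j * G (p j) x) = 2 * \<alpha> j * ln (norm (x - p j)) + - 4 * pi * \<alpha> j * H (p j) x"
      by (simp only:) (simp add: field_simps)
  qed simp
  then have "weight G n p \<alpha> x = exp (\<Sum>j<n. 2 * \<alpha> j * ln (norm (x - p j)) + - 4 * pi * \<alpha> j * H (p j) x)"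
    using False by (simp add: weight_def)
  also have "\<dots> = (\<Prod>j<n. exp (2 * \<alpha> j * ln (norm (x - p j)) + - 4 * pi * \<alpha> j * H (p j) x))" by (rule exp_sum) simp
  also have "\<dots> = (\<Prod>j<n. norm (x - p j) powr (2 * \<alpha> j) * exp (- 4 * pi * \<alpha> j * H (p j) x))"
  proof (rule prod.cong)
    fix j assume "j \<in> {..<n}"
    then have "x \<noteq> p j" using False by auto
    then show "exp (2 * \<alpha> j * ln (norm (x - p j)) + - 4 * pi * \<alpha> j * H (p j) x) = norm (x - p j) powr (2 * \<alpha> j) * exp (- 4 * pi * \<alpha> j * H (p j) x)"
      unfolding exp_add by (simp add: powr_def)
  qed simp
  finally show ?thesis .
qed

theorem theorem1:
  fixes \<Omega> :: "pt set" and n :: nat and p :: "nat \<Rightarrow> pt" and \<alpha> :: "nat \<Rightarrow> real"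
    and G :: "pt \<Rightarrow> pt \<Rightarrow> real" and \<psi> :: "real \<Rightarrow> pt \<Rightarrow> real" and E :: "real \<Rightarrow> real"
  assumes dom: "smooth_bounded_sc_domain \<Omega>"
    and pts: "\<forall>j<n. p j \<in> \<Omega>"
    and alpha_pos: "\<forall>j<n. \<alpha> j > 0"
    and green: "\<forall>q\<in>\<Omega>. green_fun \<Omega> q (G q)"
    and first_kind: "\<not> (\<exists>\<phi>. mean_field_sol \<Omega> (weight G n p \<alpha>) (8 * pi) \<phi>)"
    and sol: "\<forall>lam<8 * pi. mean_field_sol \<Omega> (weight G n p \<alpha>) lam (\<psi> lam)"
    and uniq: "\<forall>lam<8 * pi. \<forall>\<phi>. mean_field_sol \<Omega> (weight G n p \<alpha>) lam \<phi> \<longrightarrow>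
                 (\<forall>x\<in>closure \<Omega>. \<phi> x = \<psi> lam x)"
    and E_def: "\<forall>lam<8 * pi. E lam = (1 / 2) * integral \<Omega> (grad_sq (\<psi> lam))"
  shows "strict_mono_on {..<8 * pi} E \<and> bij_betw E {..<8 * pi} {0<..}
         \<and> (E \<longlongrightarrow> 0) at_bot \<and> filterlim E at_top (at_left (8 * pi))"
proof -
  have om: "open \<Omega>" "bounded \<Omega>" "\<Omega> \<noteq> {}" using dom by (auto simp: smooth_bounded_sc_domain_def)
  have "\<forall>q\<in>\<Omega>. \<exists>Hq. harmonic_on \<Omega> Hq \<and> continuous_on (closure \<Omega>) Hq \<and>
      (\<forall>x\<in>closure \<Omega> - {q}. G q x = - (1 / (2 * pi)) * ln (norm (x - q)) + Hq x) \<and> (\<forall>x\<in>frontier \<Omega>. G q x = 0)"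
    using green unfolding green_fun_def by blast
  \<comment> \<open>\<open>green_fun\<close> provides a regular part for each pole separately; one
    is chosen for every point of the domain.\<close>
  from bchoice[OF this] obtain H where H: "\<forall>q\<in>\<Omega>. harmonic_on \<Omega> (H q) \<and> continuous_on (closure \<Omega>) (H q) \<and>
      (\<forall>x\<in>closure \<Omega> - {q}. G q x = - (1 / (2 * pi)) * ln (norm (x - q)) + H q x) \<and> (\<forall>x\<in>frontier \<Omega>. G q x = 0)" by blast
  interpret green_domain \<Omega> H
  proof
    show "H q z = - newton (z - q)" if "q \<in> \<Omega>" "z \<in> frontier \<Omega>" for q z
    proof -
      have "z \<in> closure \<Omega> - {q}" using that om(1) by (auto simp: frontier_def interior_open)
      then have "G q z = - (1 / (2 * pi)) * ln (norm (z - q)) + H q z" "G q z = 0" using H that by blast+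
      then show ?thesis by (simp add: newton_def)
    qed
  qed (use om H in auto)
  let ?h = "weight G n p \<alpha>"
  let ?P = "p ` {..<n}"
  have heq: "?h x = (\<Prod>j<n. norm (x - p j) powr (2 * \<alpha> j) * exp (- 4 * pi * \<alpha> j * H (p j) x))" if "x \<in> closure \<Omega>" for x
    by (rule weight_eq[OF _ that]) (use H pts in auto)
  interpret mean_field \<Omega> H ?h ?P
  proof
    have Hh: "loc_holder \<Omega> (\<lambda>x. exp (- 4 * pi * \<alpha> j * H (p j) x))" if "j < n" for j
    proof -
      have "loc_holder \<Omega> (H (p j))" using pts that by (intro C1_loc_holder[OF om(1) Ck2D(2,3)[OF H_C2(1)]]) auto
      then show ?thesis
        by (rule loc_holder_compose[where g="\<lambda>s. exp (- 4 * pi * \<alpha> j * s)" and g'="\<lambda>s. exp (- 4 * pi * \<alpha> j * s) * (- 4 * pi * \<alpha> j)"])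
          (auto intro!: derivative_eq_intros continuous_intros)
    qed
    have "loc_holder \<Omega> (\<lambda>x. \<Prod>j<n. norm (x - p j) powr (2 * \<alpha> j) * exp (- 4 * pi * \<alpha> j * H (p j) x))"
      using alpha_pos by (intro loc_holder_prod loc_holder_mult loc_holder_norm_powr om Hh) auto
    then show "loc_holder \<Omega> ?h" by (rule loc_holder_cong) (use heq in_closure in simp)
    have "continuous_on (closure \<Omega>) (\<lambda>x. \<Prod>j<n. norm (x - p j) powr (2 * \<alpha> j) * exp (- 4 * pi * \<alpha> j * H (p j) x))"
      using alpha_pos pts by (intro continuous_on_prod continuous_on_mult continuous_on_powr' continuous_on_exp continuous_intros H_cont) auto
    then show "continuous_on (closure \<Omega>) ?h" by (rule continuous_on_cong[THEN iffD1, OF refl, rotated]) (use heq in simp)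
  qed (auto simp: weight_def)
  \<comment> \<open>Keeps the hypothesis accessible: the interpretation below introduces a fact of
    the same name.\<close>
  note solution = sol
  interpret first_kind \<Omega> H ?h ?P \<psi>
  proof
    show "critical lam (\<psi> lam)" if "lam < 8 * pi" for lam using sol_imp_critical sol that by blast
    show "\<phi> x = \<psi> lam x" if "lam < 8 * pi" "critical lam \<phi>" "x \<in> closure \<Omega>" for lam \<phi> x
      using critical_imp_sol[OF that(2)] uniq that critical_facts(4)[OF that(2,3)] by metis
    show "\<not> critical (8 * pi) \<phi>" for \<phi> using critical_imp_sol first_kind by blast
  qed
  have EE: "E lam = En lam" if "lam < 8 * pi" for lam
    using E_def critical_energy[OF solution[rule_format, OF that]] that by (simp add: En_def V_def)
  have "strict_mono_on {..<8 * pi} E"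
    by (rule strict_mono_onI) (use EE En_strict_mono in auto)
  moreover have "bij_betw E {..<8 * pi} {0<..}"
    using En_bij by (rule bij_betw_cong[THEN iffD1, rotated]) (use EE in simp)
  moreover have "(E \<longlongrightarrow> 0) at_bot"
  proof (rule Lim_transform_eventually[OF En_at_bot])
    have "\<forall>\<^sub>F x in at_bot. x \<le> (0::real)" by (rule eventually_le_at_bot)
    then show "\<forall>\<^sub>F x in at_bot. En x = E x"
      by eventually_elim (use EE pi_gt_zero in \<open>simp add: order.strict_trans1\<close>)
  qed
  moreover have "filterlim E at_top (at_left (8 * pi))"
  proof (rule filterlim_cong[THEN iffD1, OF refl refl _ En_at_top])
    show "\<forall>\<^sub>F x in at_left (8 * pi). En x = E x" unfolding eventually_at_filter by (auto simp: EE)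
  qed
  ultimately show ?thesis by blast
qed

end
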